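(* Let $K$ be a number field with ring of integers $\mathcal{O}_K$, and let $f\in K^*$ be non-exceptional, i.e. $|f|\neq 1$ for every archimedean absolute value $|\cdot|$ on $K$. Then there exists a morphism of monoidal spaces $\psi:\overline{\mathrm{Spec}\,\mathcal{O}_K}\to\mathbb{P}^1_{\mathbb{F}_1}$ whose restriction to $(\overline{\mathrm{Spec}\,\mathcal{O}_K})_{\mathrm{nA}}\cong(\mathrm{Spec}\,\mathcal{O}_K)^\bullet$ is $p\circ\varphi_f^\bullet$, and a continuous map $\check f:\overline{\mathrm{Spec}\,\mathcal{O}_K}\to\mathrm{SCong}\,\mathbb{P}^1_{\mathbb{F}_1}$ with $\pi_{\mathbb{P}^1_{\mathbb{F}_1}}\circ\check f=\psi$ (as maps of underlying sets) and $\check f([P])=\widetilde f(P)$ for all $P\in\mathrm{Spec}\,\mathcal{O}_K$. Moreover, $\check f$ comes with an injective morphism of pointed monoids $\check f_{\mathfrak a}:\kappa(\check f(\mathfrak a))\hookrightarrow\kappa(\mathfrak a)$ for each $\mathfrak a\in\overline{\mathrm{Spec}\,\mathcal{O}_K}$, such that $\check f_{[P]}=\widetilde f_P$ for all $P\in\mathrm{Spec}\,\mathcal{O}_K$.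
   Context: Pointed monoids are commutative monoids with absorbing $0$; $\mathbb{F}_1=\{0,1\}$; $R^\bullet$ is the multiplicative pointed monoid of a ring $R$. A monoidal space is a topological space with a sheaf of pointed monoids; a morphism is a continuous map $\varphi$ with a morphism of sheaves $\varphi^\#:\mathcal{O}_Y\to\varphi_*\mathcal{O}_X$ whose stalk maps are local ($\varphi_x^{\#-1}$ of units equals units). For a scheme $Y$, $Y^\bullet$ is the monoidal space obtained by forgetting addition in $\mathcal{O}_Y$. Compactification: places of $K$ are equivalence classes of absolute values, including the trivial place $[0]$; for a prime $P\in\mathrm{Spec}\,\mathcal{O}_K$ ($P\ne0$), $[P]$ is the $P$-adic place, and $[0]$ corresponds to $P=0$. For a place $\mathfrak a$: $\mathcal{O}_{\mathfrak a}=\{a\in K:|a|\le1\}$, $m_{\mathfrak a}=\{a\in K:|a|<1\}$, $\kappa(\mathfrak a)=\mathcal{O}_{\mathfrak a}/m_{\mathfrak a}$ (quotient pointed monoid, collapsing $m_{\mathfrak a}$ to $0$). $\overline{\mathrm{Spec}\,\mathcal{O}_K}$ is the set of all places, with $[0]$ generic and the cofinite topology on the remaining places (open sets: $\emptyset$ and complements of finite sets of non-trivial places), with structure sheaf $U\mapsto\{\lambda\in K:\lambda\in\mathcal{O}_{\mathfrak a}\ \forall\mathfrak a\in U\}$. The non-archimedean places form an open subspace $(\overline{\mathrm{Spec}\,\mathcal{O}_K})_{\mathrm{nA}}$, identified with $(\mathrm{Spec}\,\mathcal{O}_K)^\bullet$ via $P\mapsto[P]$; for $P\neq 0$, $\kappa([P])$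 is the residue field of $P$ (as pointed monoid), and $\kappa([0])=K^\bullet$. Projective lines: $\mathbb{P}^1_{\mathbb{F}_1}$ is the monoid scheme glued from $D_+(Y)=\mathrm{MSpec}\,\mathbb{F}_1[X/Y]$ and $D_+(X)=\mathrm{MSpec}\,\mathbb{F}_1[Y/X]$ along $\mathrm{MSpec}\,\mathbb{F}_1[(X/Y)^\pm]$; $\mathbb{P}^1_{\mathbb{Z}}$ is the analogous scheme glued from $\mathrm{Spec}\,\mathbb{Z}[X/Y]$, $\mathrm{Spec}\,\mathbb{Z}[Y/X]$. Here $\mathrm{MSpec}\,A$ is the set of prime ideals of $A$ with basic opens $U_h=\{I: h\notin I\}$ and sheaf $U_h\mapsto A[h^{-1}]$. $\varphi_f:\mathrm{Spec}\,\mathcal{O}_K\to\mathbb{P}^1_{\mathbb{Z}}$ is the morphism given by $X/Y\mapsto f$ in $\mathcal{O}_K[f]$ and $Y/X\mapsto 1/f$ in $\mathcal{O}_K[1/f]$. $p:(\mathbb{P}^1_{\mathbb{Z}})^\bullet\to\mathbb{P}^1_{\mathbb{F}_1}$ is the morphism of monoidal spaces which on each chart $\mathrm{Spec}\,A_{\mathbb{Z}}$ (with $A=\mathbb{F}_1[X/Y]$ or $\mathbb{F}_1[Y/X]$, $A_\mathbb{Z}$ the corresponding polynomial ring over $\mathbb{Z}$) sends $Q\mapsto Q\cap A$, with $p^\#$ induced by $A\hookrightarrow A_{\mathbb{Z}}$. Strong congruence space: a domain is a pointed monoid isomorphic to a pointed submonoid of $L^\bullet$ for some field $L$; $\mathrm{SCong}\,A$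 is the set of congruences $\mathfrak c$ on $A$ with $A/\mathfrak c$ a domain, topologized by basic opens $U_{a,b}=\{\mathfrak c:(a,b)\notin\mathfrak c\}$; $\mathrm{SCong}\,\mathbb{P}^1_{\mathbb{F}_1}$ is glued from $\mathrm{SCong}\,\mathbb{F}_1[X/Y]$ and $\mathrm{SCong}\,\mathbb{F}_1[Y/X]$ along $\mathrm{SCong}\,\mathbb{F}_1[(X/Y)^\pm]$. Its points: the generic point (trivial congruence), $[0]=\langle X/Y\sim0\rangle$, $[\infty]=\langle0\sim Y/X\rangle$, and $[n]=\langle (X/Y)^n\sim 1\rangle$, $n\ge1$. $\pi_{\mathbb{P}^1_{\mathbb{F}_1}}$ sends a congruence $\mathfrak c$ on a chart $A$ to its null ideal $\{a\in A:(a,0)\in\mathfrak c\}\in\mathrm{MSpec}\,A$. For a point $\mathfrak c$ on chart $A$, $\kappa(\mathfrak c)$ is the group of fractions of $A/\mathfrak c$; thus $\kappa(\text{generic})=\mathbb{F}_1[T^{\pm}]$, $\kappa([0])=\kappa([\infty])=\mathbb{F}_1$, $\kappa([n])=\mathbb{F}_1[T]/\langle T^n\sim1\rangle$, with $T=X/Y$. The map $\widetilde f:\mathrm{Spec}\,\mathcal{O}_K\to\mathrm{SCong}\,\mathbb{P}^1_{\mathbb{F}_1}$: $\widetilde f(0)$ is the generic point; for $P\ne0$, $\widetilde f(P)=[0]$ if $v_P(f)>0$, $[\infty]$ if $v_P(f)<0$, and $[n]$ if $v_P(f)=0$, where $n$ is the multiplicative order of $f$ modulo $P$ in the residue field. $\widetilde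 f_P:\kappa(\widetilde f(P))\to\kappa([P])$ is: the inclusion $\mathbb{F}_1\hookrightarrow\kappa([P])$ if $\widetilde f(P)\in\{[0],[\infty]\}$; $\overline T\mapsto \overline f$ if $\widetilde f(P)=[n]$; and $\mathbb{F}_1[T^\pm]\to K^\bullet$, $T\mapsto f$, if $P=0$. *)

theory Defs
  imports
    "HOL-Algebra.Ideal_Product"
    "HOL-Algebra.Multiplicative_Group"
    "HOL-Algebra.Chinese_Remainder"
    "HOL-Analysis.Function_Topology"
    "HOL-Computational_Algebra.Polynomial"
    "HOL-Computational_Algebra.Fraction_Field"
begin

section \<open>Pointed monoids\<close>

record 'a pmonoid = "'a monoid" +
  pzero :: 'a

locale pointed_monoid = comm_monoid A for A :: "('a, 'e) pmonoid_scheme" (structure) +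
  assumes pzero_closed: "pzero A \<in> carrier A"
    and pzero_absorbing: "x \<in> carrier A \<Longrightarrow> pzero A \<otimes> x = pzero A"

definition pm_hom :: "'a pmonoid \<Rightarrow> 'b pmonoid \<Rightarrow> ('a \<Rightarrow> 'b) set" where
  "pm_hom A B = {h \<in> hom A B. h \<one>\<^bsub>A\<^esub> = \<one>\<^bsub>B\<^esub> \<and> h (pzero A) = pzero B}"

text \<open>The multiplicative pointed monoid \<open>R\<^sup>\<bullet>\<close> of a ring.\<close>

definition mult_pm :: "'a ring \<Rightarrow> 'a pmonoid" where
  "mult_pm R = \<lparr>carrier = carrier R, monoid.mult = monoid.mult R, one = \<one>\<^bsub>R\<^esub>, pzero = \<zero>\<^bsub>R\<^esub>\<rparr>"

text \<open>Subsets of type-class rings as structures: subrings, and pointed submonoids of the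
  multiplicative monoid.\<close>

definition sub_ring :: "'a::comm_ring_1 set \<Rightarrow> 'a ring" where
  "sub_ring S = \<lparr>carrier = S, monoid.mult = (*), one = 1, ring.zero = 0, add = (+)\<rparr>"

definition sub_pm :: "'a::comm_ring_1 set \<Rightarrow> 'a pmonoid" where
  "sub_pm S = mult_pm (sub_ring S)"

definition prime_pideal :: "'a pmonoid \<Rightarrow> 'a set \<Rightarrow> bool" where
  "prime_pideal A I \<longleftrightarrow>
     I \<subseteq> carrier A \<and> pzero A \<in> I \<and> \<one>\<^bsub>A\<^esub> \<notin> I \<and>
     (\<forall>a\<in>carrier A. \<forall>x\<in>I. a \<otimes>\<^bsub>A\<^esub> x \<in> I) \<and>
     (\<forall>a\<in>carrier A. \<forall>b\<in>carrier A. a \<otimes>\<^bsub>A\<^esub> b \<in> I \<longrightarrow> a \<in> I \<or> b \<in> I)"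


subsection \<open>Localization\<close>

text \<open>Fractions \<open>a/s\<close> with \<open>s\<close> in a multiplicative set \<open>S\<close> only involve the multiplication, so
  for a ring \<open>R\<close> the underlying set of its localization is that of \<open>R\<^sup>\<bullet>\<close>.\<close>

definition frac_rel :: "('a, 'e) monoid_scheme \<Rightarrow> 'a set \<Rightarrow> (('a \<times> 'a) \<times> ('a \<times> 'a)) set" where
  "frac_rel A S = {((a, s), (b, t)). a \<in> carrier A \<and> b \<in> carrier A \<and> s \<in> S \<and> t \<in> S \<and>
     (\<exists>u\<in>S. u \<otimes>\<^bsub>A\<^esub> (a \<otimes>\<^bsub>A\<^esub> t) = u \<otimes>\<^bsub>A\<^esub> (b \<otimes>\<^bsub>A\<^esub> s))}"

definition fraction :: "('a, 'e) monoid_scheme \<Rightarrow> 'a set \<Rightarrow> 'a \<Rightarrow> 'a \<Rightarrow> ('a \<times> 'a) set" where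
  "fraction A S a s = frac_rel A S `` {(a, s)}"

definition frac_mult ::
    "('a, 'e) monoid_scheme \<Rightarrow> 'a set \<Rightarrow> ('a \<times> 'a) set \<Rightarrow> ('a \<times> 'a) set \<Rightarrow> ('a \<times> 'a) set" where
  "frac_mult A S x y = (\<Union>(a, s)\<in>x. \<Union>(b, t)\<in>y. fraction A S (a \<otimes>\<^bsub>A\<^esub> b) (s \<otimes>\<^bsub>A\<^esub> t))"

definition loc_pm :: "'a pmonoid \<Rightarrow> 'a set \<Rightarrow> ('a \<times> 'a) set pmonoid" where
  "loc_pm A S =
     \<lparr>carrier = (carrier A \<times> S) // frac_rel A S, monoid.mult = frac_mult A S,
      one = fraction A S \<one>\<^bsub>A\<^esub> \<one>\<^bsub>A\<^esub>, pzero = fraction A S (pzero A) \<one>\<^bsub>A\<^esub>\<rparr>"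

definition loc_ring :: "'a ring \<Rightarrow> 'a set \<Rightarrow> ('a \<times> 'a) set ring" where
  "loc_ring R S =
     \<lparr>carrier = (carrier R \<times> S) // frac_rel R S, monoid.mult = frac_mult R S,
      one = fraction R S \<one>\<^bsub>R\<^esub> \<one>\<^bsub>R\<^esub>, ring.zero = fraction R S \<zero>\<^bsub>R\<^esub> \<one>\<^bsub>R\<^esub>,
      add = (\<lambda>x y. \<Union>(a, s)\<in>x. \<Union>(b, t)\<in>y.
               fraction R S ((a \<otimes>\<^bsub>R\<^esub> t) \<oplus>\<^bsub>R\<^esub> (b \<otimes>\<^bsub>R\<^esub> s)) (s \<otimes>\<^bsub>R\<^esub> t))\<rparr>"

text \<open>For \<open>h : A \<rightarrow> B\<close> and a prime \<open>Q\<close> of \<open>B\<close>: the map from \<open>A\<close> localized at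
  \<open>h\<^sup>-\<^sup>1(Q)\<close> to \<open>B\<close> localized at \<open>Q\<close>.\<close>

definition loc_map ::
    "('b, 'e) monoid_scheme \<Rightarrow> ('a \<Rightarrow> 'b) \<Rightarrow> 'b set \<Rightarrow> ('a \<times> 'a) set \<Rightarrow> ('b \<times> 'b) set" where
  "loc_map B h Q z = (\<Union>(a, t)\<in>z. fraction B (carrier B - Q) (h a) (h t))"


subsection \<open>Congruences\<close>

definition congruence :: "'a pmonoid \<Rightarrow> ('a \<times> 'a) set \<Rightarrow> bool" where
  "congruence A c \<longleftrightarrow> equiv (carrier A) c \<and>
     (\<forall>(a, b)\<in>c. \<forall>(a', b')\<in>c. (a \<otimes>\<^bsub>A\<^esub> a', b \<otimes>\<^bsub>A\<^esub> b') \<in> c)"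

definition gen_congruence :: "'a pmonoid \<Rightarrow> 'a \<Rightarrow> 'a \<Rightarrow> ('a \<times> 'a) set" where
  "gen_congruence A a b = \<Inter>{c. congruence A c \<and> (a, b) \<in> c}"

definition quot_pm :: "'a pmonoid \<Rightarrow> ('a \<times> 'a) set \<Rightarrow> 'a set pmonoid" where
  "quot_pm A c =
     \<lparr>carrier = carrier A // c, monoid.mult = (\<lambda>X Y. \<Union>x\<in>X. \<Union>y\<in>Y. c `` {x \<otimes>\<^bsub>A\<^esub> y}),
      one = c `` {\<one>\<^bsub>A\<^esub>}, pzero = c `` {pzero A}\<rparr>"

definition null_ideal :: "'a pmonoid \<Rightarrow> ('a \<times> 'a) set \<Rightarrow> 'a set" where
  "null_ideal A c = {a \<in> carrier A. (a, pzero A) \<in> c}"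

text \<open>The field \<open>L\<close> may be taken on the type \<open>'a list\<close> without loss of generality: an injective
  image of \<open>A\<close> in any field generates a subfield of cardinality at most that of this (infinite)
  type.\<close>

definition pm_domain :: "'a pmonoid \<Rightarrow> bool" where
  "pm_domain A \<longleftrightarrow>
     (\<exists>L :: 'a list ring. field L \<and> (\<exists>h \<in> pm_hom A (mult_pm L). inj_on h (carrier A)))"

definition SCong :: "'a pmonoid \<Rightarrow> ('a \<times> 'a) set set" where
  "SCong A = {c. congruence A c \<and> pm_domain (quot_pm A c)}"

definition SCong_top :: "'a pmonoid \<Rightarrow> ('a \<times> 'a) set topology" where
  "SCong_top A =
     topology_generated_by {{c \<in> SCong A. (a, b) \<notin> c} |a b. a \<in> carrier A \<and> b \<in> carrier A}"

definition pullback_cong ::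
    "'a pmonoid \<Rightarrow> ('a \<Rightarrow> 'b) \<Rightarrow> ('b \<times> 'b) set \<Rightarrow> ('a \<times> 'a) set" where
  "pullback_cong A h c = {(a, b) \<in> carrier A \<times> carrier A. (h a, h b) \<in> c}"

text \<open>\<open>A/c\<close> with all nonzero elements inverted, for \<open>A/c\<close> a domain.\<close>

definition cong_residue :: "'a pmonoid \<Rightarrow> ('a \<times> 'a) set \<Rightarrow> ('a set \<times> 'a set) set pmonoid" where
  "cong_residue A c = (let B = quot_pm A c in loc_pm B (carrier B - {pzero B}))"


section \<open>Spaces with a sheaf\<close>

text \<open>\<open>'p\<close> is the type of points, \<open>'s\<close> the type of sections. The structure type \<open>'m\<close> is
  \<open>'s pmonoid\<close> or \<open>'s ring\<close>; in this way ringed spaces and monoidal spaces share their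
  point-set constructions.\<close>

record ('p, 's, 'm) sheaf_space =
  space_top :: "'p topology"
  sections :: "'p set \<Rightarrow> 'm"
  res :: "'p set \<Rightarrow> 'p set \<Rightarrow> 's \<Rightarrow> 's"

type_synonym ('p, 's) mspace = "('p, 's, 's pmonoid) sheaf_space"
type_synonym ('p, 's) rspace = "('p, 's, 's ring) sheaf_space"

text \<open>The data of a morphism \<open>h : X \<rightarrow> Y\<close>: the map on points and, for each open \<open>V\<close> of \<open>Y\<close>, the map
  from sections of \<open>Y\<close> over \<open>V\<close> to sections of \<open>X\<close> over the preimage of \<open>V\<close>. The latter is
  meaningful only on the carrier of the sections over \<open>V\<close>.\<close>

record ('p, 's, 'q, 't) space_map =
  pt :: "'p \<Rightarrow> 'q"
  pull :: "'q set \<Rightarrow> 't \<Rightarrow> 's"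

definition pre ::
    "('p, 's, 'm) sheaf_space \<Rightarrow> ('p, 's, 'q, 't) space_map \<Rightarrow> 'q set \<Rightarrow> 'p set" where
  "pre X h V = {x \<in> topspace (space_top X). pt h x \<in> V}"

text \<open>\<open>comp_map Y g h\<close> is \<open>g \<circ> h\<close> for \<open>h : X \<rightarrow> Y\<close> and \<open>g : Y \<rightarrow> Z\<close>.\<close>

definition comp_map ::
    "('q, 't, 'm) sheaf_space \<Rightarrow> ('q, 't, 'r, 'u) space_map \<Rightarrow> ('p, 's, 'q, 't) space_map
      \<Rightarrow> ('p, 's, 'r, 'u) space_map" where
  "comp_map Y g h = \<lparr>pt = pt g \<circ> pt h, pull = (\<lambda>W. pull h (pre Y g W) \<circ> pull g W)\<rparr>"

definition map_eq ::
    "('p, 's, 'm) sheaf_space \<Rightarrow> ('q, 't, ('t, 'e) monoid_scheme) sheaf_space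
      \<Rightarrow> ('p, 's, 'q, 't) space_map \<Rightarrow> ('p, 's, 'q, 't) space_map \<Rightarrow> bool" where
  "map_eq X Y g h \<longleftrightarrow>
     (\<forall>x\<in>topspace (space_top X). pt g x = pt h x) \<and>
     (\<forall>V. openin (space_top Y) V \<longrightarrow> (\<forall>t\<in>carrier (sections Y V). pull g V t = pull h V t))"

text \<open>The functor \<open>Y \<mapsto> Y\<^sup>\<bullet>\<close> forgetting addition; it does not change the data of morphisms.\<close>

definition forget_add :: "('p, 's) rspace \<Rightarrow> ('p, 's) mspace" where
  "forget_add X =
     \<lparr>space_top = space_top X, sections = (\<lambda>U. mult_pm (sections X U)), res = res X\<rparr>"

definition open_subspace :: "('p, 's, 'm) sheaf_space \<Rightarrow> 'p set \<Rightarrow> ('p, 's, 'm) sheaf_space" where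
  "open_subspace X U = X\<lparr>space_top := subtopology (space_top X) U\<rparr>"

definition open_incl ::
    "('p, 's, 'm) sheaf_space \<Rightarrow> 'p set \<Rightarrow> ('p, 's, 'p, 's) space_map" where
  "open_incl X U = \<lparr>pt = id, pull = (\<lambda>V. res X V (V \<inter> U))\<rparr>"


subsection \<open>Monoidal spaces and their morphisms\<close>

locale monoidal_space =
  fixes X :: "('p, 's) mspace"
  assumes sections_pointed: "openin (space_top X) U \<Longrightarrow> pointed_monoid (sections X U)"
    and res_hom: "openin (space_top X) U \<Longrightarrow> openin (space_top X) V \<Longrightarrow> V \<subseteq> U \<Longrightarrow>
          res X U V \<in> pm_hom (sections X U) (sections X V)"
    and res_id: "openin (space_top X) U \<Longrightarrow> s \<in> carrier (sections X U) \<Longrightarrow> res X U U s = s"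
    and res_res: "openin (space_top X) U \<Longrightarrow> openin (space_top X) V \<Longrightarrow> openin (space_top X) W \<Longrightarrow>
          W \<subseteq> V \<Longrightarrow> V \<subseteq> U \<Longrightarrow> s \<in> carrier (sections X U) \<Longrightarrow>
          res X V W (res X U V s) = res X U W s"
    and sheaf: "(\<And>V. V \<in> \<V> \<Longrightarrow> openin (space_top X) V) \<Longrightarrow>
          (\<And>V. V \<in> \<V> \<Longrightarrow> \<sigma> V \<in> carrier (sections X V)) \<Longrightarrow>
          (\<And>V W. V \<in> \<V> \<Longrightarrow> W \<in> \<V> \<Longrightarrow> res X V (V \<inter> W) (\<sigma> V) = res X W (V \<inter> W) (\<sigma> W)) \<Longrightarrow>
          \<exists>!t. t \<in> carrier (sections X (\<Union>\<V>)) \<and> (\<forall>V\<in>\<V>. res X (\<Union>\<V>) V t = \<sigma> V)"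

definition germ_rel :: "('p, 's) mspace \<Rightarrow> 'p \<Rightarrow> (('p set \<times> 's) \<times> ('p set \<times> 's)) set" where
  "germ_rel X x = {((U, s), (V, t)).
     openin (space_top X) U \<and> x \<in> U \<and> s \<in> carrier (sections X U) \<and>
     openin (space_top X) V \<and> x \<in> V \<and> t \<in> carrier (sections X V) \<and>
     (\<exists>W. openin (space_top X) W \<and> x \<in> W \<and> W \<subseteq> U \<inter> V \<and> res X U W s = res X V W t)}"

definition germ :: "('p, 's) mspace \<Rightarrow> 'p \<Rightarrow> 'p set \<Rightarrow> 's \<Rightarrow> ('p set \<times> 's) set" where
  "germ X x U s = germ_rel X x `` {(U, s)}"

definition stalk :: "('p, 's) mspace \<Rightarrow> 'p \<Rightarrow> ('p set \<times> 's) set pmonoid" where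
  "stalk X x =
     \<lparr>carrier = {germ X x U s |U s.
        openin (space_top X) U \<and> x \<in> U \<and> s \<in> carrier (sections X U)},
      monoid.mult = (\<lambda>C D. \<Union>(U, s)\<in>C. \<Union>(V, t)\<in>D. germ X x (U \<inter> V)
        (res X U (U \<inter> V) s \<otimes>\<^bsub>sections X (U \<inter> V)\<^esub> res X V (U \<inter> V) t)),
      one = germ X x (topspace (space_top X)) \<one>\<^bsub>sections X (topspace (space_top X))\<^esub>,
      pzero = germ X x (topspace (space_top X)) (pzero (sections X (topspace (space_top X))))\<rparr>"

definition stalk_map ::
    "('p, 's) mspace \<Rightarrow> ('p, 's, 'q, 't) space_map \<Rightarrow> 'p
      \<Rightarrow> ('q set \<times> 't) set \<Rightarrow> ('p set \<times> 's) set" where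
  "stalk_map X h x C = (\<Union>(V, t)\<in>C. germ X x (pre X h V) (pull h V t))"

locale monoidal_morphism = X: monoidal_space X + Y: monoidal_space Y
  for X :: "('p, 's) mspace" and Y :: "('q, 't) mspace" +
  fixes h :: "('p, 's, 'q, 't) space_map"
  assumes continuous: "continuous_map (space_top X) (space_top Y) (pt h)"
    and pull_hom: "openin (space_top Y) V \<Longrightarrow>
          pull h V \<in> pm_hom (sections Y V) (sections X (pre X h V))"
    and pull_res: "openin (space_top Y) V \<Longrightarrow> openin (space_top Y) W \<Longrightarrow> W \<subseteq> V \<Longrightarrow>
          t \<in> carrier (sections Y V) \<Longrightarrow>
          pull h W (res Y V W t) = res X (pre X h V) (pre X h W) (pull h V t)"
    and local_stalks: "x \<in> topspace (space_top X) \<Longrightarrow>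
          {C \<in> carrier (stalk Y (pt h x)). stalk_map X h x C \<in> Units (stalk X x)}
            = Units (stalk Y (pt h x))"


subsection \<open>Spectra\<close>

definition spec_top :: "('a, 'e) monoid_scheme \<Rightarrow> 'a set set \<Rightarrow> 'a set topology" where
  "spec_top A pts = topology_generated_by ((\<lambda>h. {P \<in> pts. h \<notin> P}) ` carrier A)"

text \<open>The sections over \<open>U\<close> are the families of elements of the localizations at the points of
  \<open>U\<close> that are locally given by one fraction; on a basic open \<open>U\<^sub>h\<close> these are the elements of
  \<open>A[h\<^sup>-\<^sup>1]\<close>.\<close>

definition frac_sections ::
    "('a, 'e) monoid_scheme \<Rightarrow> 'a set set \<Rightarrow> 'a set set \<Rightarrow> ('a set \<Rightarrow> ('a \<times> 'a) set) set" where
  "frac_sections A pts U =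
     {s \<in> (\<Pi>\<^sub>E P\<in>U. (carrier A \<times> (carrier A - P)) // frac_rel A (carrier A - P)).
       \<forall>P\<in>U. \<exists>V. openin (spec_top A pts) V \<and> P \<in> V \<and> V \<subseteq> U \<and>
         (\<exists>a\<in>carrier A. \<exists>h\<in>carrier A.
           \<forall>Q\<in>V. h \<notin> Q \<and> s Q = fraction A (carrier A - Q) a h)}"

definition MSpec :: "'a pmonoid \<Rightarrow> ('a set, 'a set \<Rightarrow> ('a \<times> 'a) set) mspace" where
  "MSpec A =
     \<lparr>space_top = spec_top A {P. prime_pideal A P},
      sections = (\<lambda>U. \<lparr>carrier = frac_sections A {P. prime_pideal A P} U,
        monoid.mult = (\<lambda>s t. \<lambda>P\<in>U. s P \<otimes>\<^bsub>loc_pm A (carrier A - P)\<^esub> t P),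
        one = (\<lambda>P\<in>U. \<one>\<^bsub>loc_pm A (carrier A - P)\<^esub>),
        pzero = (\<lambda>P\<in>U. pzero (loc_pm A (carrier A - P)))\<rparr>),
      res = (\<lambda>U V s. restrict s V)\<rparr>"

definition Spec :: "'a ring \<Rightarrow> ('a set, 'a set \<Rightarrow> ('a \<times> 'a) set) rspace" where
  "Spec R =
     \<lparr>space_top = spec_top R {P. primeideal P R},
      sections = (\<lambda>U. \<lparr>carrier = frac_sections R {P. primeideal P R} U,
        monoid.mult = (\<lambda>s t. \<lambda>P\<in>U. s P \<otimes>\<^bsub>loc_ring R (carrier R - P)\<^esub> t P),
        one = (\<lambda>P\<in>U. \<one>\<^bsub>loc_ring R (carrier R - P)\<^esub>),
        ring.zero = (\<lambda>P\<in>U. \<zero>\<^bsub>loc_ring R (carrier R - P)\<^esub>),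
        add = (\<lambda>s t. \<lambda>P\<in>U. s P \<oplus>\<^bsub>loc_ring R (carrier R - P)\<^esub> t P)\<rparr>),
      res = (\<lambda>U V s. restrict s V)\<rparr>"

text \<open>The map of spectra induced by \<open>h : A \<rightarrow> B\<close>, where \<open>T\<close> is the topology of the spectrum of
  \<open>B\<close>. With \<open>B\<close> a ring, \<open>T\<close> its prime spectrum and \<open>A\<close> a multiplicative submonoid this is the map
  \<open>(Spec B)\<^sup>\<bullet> \<rightarrow> MSpec A\<close> given by \<open>Q \<mapsto> Q \<inter> A\<close>.\<close>

definition spec_map ::
    "('a, 'e) monoid_scheme \<Rightarrow> ('b, 'e2) monoid_scheme \<Rightarrow> 'b set topology \<Rightarrow> ('a \<Rightarrow> 'b)
      \<Rightarrow> ('b set, 'b set \<Rightarrow> ('b \<times> 'b) set, 'a set, 'a set \<Rightarrow> ('a \<times> 'a) set) space_map" where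
  "spec_map A B T h = (let contr = (\<lambda>Q. {a \<in> carrier A. h a \<in> Q}) in
     \<lparr>pt = contr,
      pull = (\<lambda>V s. \<lambda>Q\<in>{Q \<in> topspace T. contr Q \<in> V}. loc_map B h Q (s (contr Q)))\<rparr>)"


subsection \<open>Gluing\<close>

text \<open>Gluing of \<open>X\<^sub>1\<close> and \<open>X\<^sub>2\<close> along open embeddings \<open>j\<^sub>1 : X\<^sub>1\<^sub>2 \<rightarrow> X\<^sub>1\<close>, \<open>j\<^sub>2 : X\<^sub>1\<^sub>2 \<rightarrow> X\<^sub>2\<close>: a
  point is a class of points of the disjoint union, a set is open if its preimages in \<open>X\<^sub>1\<close>, \<open>X\<^sub>2\<close>
  are, and a section is a pair of sections with equal pullbacks to \<open>X\<^sub>1\<^sub>2\<close>.\<close>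

definition glue_class ::
    "'x topology \<Rightarrow> ('x \<Rightarrow> 'p) \<Rightarrow> ('x \<Rightarrow> 'q) \<Rightarrow> 'p + 'q \<Rightarrow> ('p + 'q) set" where
  "glue_class T j1 j2 w =
     (let R = {(Inl (j1 x), Inr (j2 x)) |x. x \<in> topspace T} in (R \<union> R\<inverse>)\<^sup>* `` {w})"

definition glue_top ::
    "'p topology \<Rightarrow> 'q topology \<Rightarrow> 'x topology \<Rightarrow> ('x \<Rightarrow> 'p) \<Rightarrow> ('x \<Rightarrow> 'q)
      \<Rightarrow> ('p + 'q) set topology" where
  "glue_top T1 T2 T j1 j2 = topology (\<lambda>W.
     W \<subseteq> glue_class T j1 j2 ` (Inl ` topspace T1 \<union> Inr ` topspace T2) \<and>
     openin T1 {x \<in> topspace T1. glue_class T j1 j2 (Inl x) \<in> W} \<and>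
     openin T2 {y \<in> topspace T2. glue_class T j1 j2 (Inr y) \<in> W})"

lemma istopology_glue:
  "istopology (\<lambda>W.
     W \<subseteq> C ` (Inl ` topspace T1 \<union> Inr ` topspace T2) \<and>
     openin T1 {x \<in> topspace T1. C (Inl x) \<in> W} \<and>
     openin T2 {y \<in> topspace T2. C (Inr y) \<in> W})"
proof -
  have int: "{x \<in> A. p x \<in> S \<inter> S'} = {x \<in> A. p x \<in> S} \<inter> {x \<in> A. p x \<in> S'}"
    for A :: "'u set" and p :: "'u \<Rightarrow> 'v" and S S'
    by blast
  have un: "{x \<in> A. p x \<in> \<Union>\<K>} = (\<Union>S\<in>\<K>. {x \<in> A. p x \<in> S})"
    for A :: "'u set" and p :: "'u \<Rightarrow> 'v" and \<K>
    by blast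
  show ?thesis
    unfolding istopology_def int un
    by (blast intro: openin_Int openin_Union)
qed

text \<open>The map out of a glued space given by compatible maps on the two pieces.\<close>

definition glue_desc_pt :: "('p \<Rightarrow> 'r) \<Rightarrow> ('q \<Rightarrow> 'r) \<Rightarrow> ('p + 'q) set \<Rightarrow> 'r" where
  "glue_desc_pt g1 g2 z = case_sum g1 g2 (SOME w. w \<in> z)"

definition glue_desc ::
    "('p, 's, 'r, 'u) space_map \<Rightarrow> ('q, 't, 'r, 'u) space_map
      \<Rightarrow> (('p + 'q) set, 's \<times> 't, 'r, 'u) space_map" where
  "glue_desc g1 g2 =
     \<lparr>pt = glue_desc_pt (pt g1) (pt g2), pull = (\<lambda>V u. (pull g1 V u, pull g2 V u))\<rparr>"

definition glue_in1 ::
    "'x topology \<Rightarrow> ('x, 'w, 'p, 's) space_map \<Rightarrow> ('x, 'w, 'q, 't) space_map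
      \<Rightarrow> ('p, 's, ('p + 'q) set, 's \<times> 't) space_map" where
  "glue_in1 T j1 j2 = \<lparr>pt = (\<lambda>x. glue_class T (pt j1) (pt j2) (Inl x)), pull = (\<lambda>W. fst)\<rparr>"

definition glue_in2 ::
    "'x topology \<Rightarrow> ('x, 'w, 'p, 's) space_map \<Rightarrow> ('x, 'w, 'q, 't) space_map
      \<Rightarrow> ('q, 't, ('p + 'q) set, 's \<times> 't) space_map" where
  "glue_in2 T j1 j2 = \<lparr>pt = (\<lambda>y. glue_class T (pt j1) (pt j2) (Inr y)), pull = (\<lambda>W. snd)\<rparr>"

definition glue_sections ::
    "('p, 's, ('s, 'e) monoid_scheme) sheaf_space \<Rightarrow> ('q, 't, ('t, 'e2) monoid_scheme) sheaf_space
      \<Rightarrow> 'x topology \<Rightarrow> ('x, 'w, 'p, 's) space_map \<Rightarrow> ('x, 'w, 'q, 't) space_map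
      \<Rightarrow> ('p + 'q) set set \<Rightarrow> ('s \<times> 't) set" where
  "glue_sections X1 X2 T j1 j2 W =
     (let W1 = pre X1 (glue_in1 T j1 j2) W; W2 = pre X2 (glue_in2 T j1 j2) W in
      {(s, t). s \<in> carrier (sections X1 W1) \<and> t \<in> carrier (sections X2 W2) \<and>
        pull j1 W1 s = pull j2 W2 t})"

definition glue_res ::
    "('p, 's, 'm) sheaf_space \<Rightarrow> ('q, 't, 'n) sheaf_space
      \<Rightarrow> 'x topology \<Rightarrow> ('x, 'w, 'p, 's) space_map \<Rightarrow> ('x, 'w, 'q, 't) space_map
      \<Rightarrow> ('p + 'q) set set \<Rightarrow> ('p + 'q) set set \<Rightarrow> 's \<times> 't \<Rightarrow> 's \<times> 't" where
  "glue_res X1 X2 T j1 j2 W W' =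
     map_prod
       (res X1 (pre X1 (glue_in1 T j1 j2) W) (pre X1 (glue_in1 T j1 j2) W'))
       (res X2 (pre X2 (glue_in2 T j1 j2) W) (pre X2 (glue_in2 T j1 j2) W'))"

definition glue_mspace ::
    "('p, 's) mspace \<Rightarrow> ('q, 't) mspace \<Rightarrow> 'x topology \<Rightarrow> ('x, 'w, 'p, 's) space_map
      \<Rightarrow> ('x, 'w, 'q, 't) space_map \<Rightarrow> (('p + 'q) set, 's \<times> 't) mspace" where
  "glue_mspace X1 X2 T j1 j2 =
     \<lparr>space_top = glue_top (space_top X1) (space_top X2) T (pt j1) (pt j2),
      sections = (\<lambda>W.
        let A1 = sections X1 (pre X1 (glue_in1 T j1 j2) W);
            A2 = sections X2 (pre X2 (glue_in2 T j1 j2) W)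
        in \<lparr>carrier = glue_sections X1 X2 T j1 j2 W, monoid.mult = monoid.mult (A1 \<times>\<times> A2),
            one = \<one>\<^bsub>A1 \<times>\<times> A2\<^esub>, pzero = (pzero A1, pzero A2)\<rparr>),
      res = glue_res X1 X2 T j1 j2\<rparr>"

definition glue_rspace ::
    "('p, 's) rspace \<Rightarrow> ('q, 't) rspace \<Rightarrow> 'x topology \<Rightarrow> ('x, 'w, 'p, 's) space_map
      \<Rightarrow> ('x, 'w, 'q, 't) space_map \<Rightarrow> (('p + 'q) set, 's \<times> 't) rspace" where
  "glue_rspace X1 X2 T j1 j2 =
     \<lparr>space_top = glue_top (space_top X1) (space_top X2) T (pt j1) (pt j2),
      sections = (\<lambda>W.
        (RDirProd (sections X1 (pre X1 (glue_in1 T j1 j2) W))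
                  (sections X2 (pre X2 (glue_in2 T j1 j2) W)))
        \<lparr>carrier := glue_sections X1 X2 T j1 j2 W\<rparr>),
      res = glue_res X1 X2 T j1 j2\<rparr>"

text \<open>For open embeddings \<open>c\<^sub>1 : X\<^sub>1 \<rightarrow> X\<close>, \<open>c\<^sub>2 : X\<^sub>2 \<rightarrow> X\<close> whose images cover \<open>X\<close>, and maps
  \<open>g\<^sub>i : X\<^sub>i \<rightarrow> Y\<close> that agree on the overlap: the map \<open>g : X \<rightarrow> Y\<close> with \<open>g \<circ> c\<^sub>i = g\<^sub>i\<close>.\<close>

definition cover_desc ::
    "('p, 's, ('s, 'e) monoid_scheme) sheaf_space
      \<Rightarrow> ('p1, 's1, 'm1) sheaf_space \<Rightarrow> ('p1, 's1, 'p, 's) space_map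
      \<Rightarrow> ('p2, 's2, 'm2) sheaf_space \<Rightarrow> ('p2, 's2, 'p, 's) space_map
      \<Rightarrow> ('p1, 's1, 'q, 't) space_map \<Rightarrow> ('p2, 's2, 'q, 't) space_map
      \<Rightarrow> ('p, 's, 'q, 't) space_map" where
  "cover_desc X X1 c1 X2 c2 g1 g2 =
     (let g = (\<lambda>x. if x \<in> pt c1 ` topspace (space_top X1)
                   then pt g1 (inv_into (topspace (space_top X1)) (pt c1) x)
                   else pt g2 (inv_into (topspace (space_top X2)) (pt c2) x))
      in \<lparr>pt = g,
          pull = (\<lambda>W t. let U = {x \<in> topspace (space_top X). g x \<in> W} in
            THE s. s \<in> carrier (sections X U) \<and>
              pull c1 U s = pull g1 W t \<and> pull c2 U s = pull g2 W t)\<rparr>)"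


section \<open>Projective lines\<close>

text \<open>The chart rings \<open>\<int>[X/Y]\<close> and \<open>\<int>[Y/X]\<close> are both represented by \<open>int poly\<close>, the
  variable standing for \<open>X/Y\<close> in the first chart and for \<open>Y/X\<close> in the second. The overlap ring
  \<open>\<int>[T\<^sup>\<plusminus>]\<close>, \<open>T = X/Y\<close>, is taken inside the field of fractions of \<open>int poly\<close>; the two
  chart rings map to it by evaluation at \<open>T\<close> and at \<open>T\<^sup>-\<^sup>1\<close>. The pointed monoids over \<open>\<bbbF>\<^sub>1\<close> are the
  submonoids of \<open>0\<close> and the powers of the variable.\<close>

definition eval_at :: "'a::comm_ring_1 \<Rightarrow> int poly \<Rightarrow> 'a" where
  "eval_at x p = Polynomial.poly (map_poly of_int p) x"

definition Tvar :: "int poly fract" where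
  "Tvar = Fract [:0, 1:] 1"

definition Z_X :: "int poly ring" where
  "Z_X = sub_ring UNIV"

definition Z_T :: "int poly fract ring" where
  "Z_T = sub_ring {eval_at Tvar p / Tvar ^ n |p n. True}"

definition F1_X :: "int poly pmonoid" where
  "F1_X = sub_pm (insert 0 (range (\<lambda>n. [:0, 1:] ^ n)))"

definition F1_T :: "int poly fract pmonoid" where
  "F1_T = sub_pm (insert 0 (range (\<lambda>k::int. Tvar powi k)))"

abbreviation F1_overlap :: "int poly fract set topology" where
  "F1_overlap \<equiv> space_top (MSpec F1_T)"

abbreviation F1_emb where
  "F1_emb x \<equiv> spec_map F1_X F1_T F1_overlap (eval_at x)"

abbreviation Z_overlap :: "int poly fract set topology" where
  "Z_overlap \<equiv> space_top (Spec Z_T)"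

abbreviation Z_emb where
  "Z_emb x \<equiv> spec_map Z_X Z_T Z_overlap (eval_at x)"

type_synonym p1_point = "(int poly set + int poly set) set"
type_synonym p1_section =
  "(int poly set \<Rightarrow> (int poly \<times> int poly) set) \<times> (int poly set \<Rightarrow> (int poly \<times> int poly) set)"

definition P1_F1 :: "(p1_point, p1_section) mspace" where
  "P1_F1 =
     glue_mspace (MSpec F1_X) (MSpec F1_X) F1_overlap (F1_emb Tvar) (F1_emb (inverse Tvar))"

definition P1_Z :: "(p1_point, p1_section) rspace" where
  "P1_Z = glue_rspace (Spec Z_X) (Spec Z_X) Z_overlap (Z_emb Tvar) (Z_emb (inverse Tvar))"

text \<open>The morphism \<open>p : (\<bbbP>\<^sup>1 over \<int>)\<^sup>\<bullet> \<rightarrow> \<bbbP>\<^sup>1 over \<bbbF>\<^sub>1\<close>.\<close>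

definition p_map :: "(p1_point, p1_section, p1_point, p1_section) space_map" where
  "p_map = (let q = spec_map F1_X Z_X (space_top (Spec Z_X)) id in
     glue_desc
       (comp_map (MSpec F1_X) (glue_in1 F1_overlap (F1_emb Tvar) (F1_emb (inverse Tvar))) q)
       (comp_map (MSpec F1_X) (glue_in2 F1_overlap (F1_emb Tvar) (F1_emb (inverse Tvar))) q))"


subsection \<open>The strong congruence space\<close>

type_synonym sc_point =
  "((int poly \<times> int poly) set + (int poly \<times> int poly) set) set"

abbreviation sc_class :: "(int poly \<times> int poly) set + (int poly \<times> int poly) set \<Rightarrow> sc_point" where
  "sc_class \<equiv> glue_class (SCong_top F1_T)
     (pullback_cong F1_X (eval_at Tvar)) (pullback_cong F1_X (eval_at (inverse Tvar)))"

definition SCong_P1 :: "sc_point topology" where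
  "SCong_P1 = glue_top (SCong_top F1_X) (SCong_top F1_X) (SCong_top F1_T)
     (pullback_cong F1_X (eval_at Tvar)) (pullback_cong F1_X (eval_at (inverse Tvar)))"

definition sc_generic :: sc_point where
  "sc_generic = sc_class (Inl (Id_on (carrier F1_X)))"

definition sc_zero :: sc_point where
  "sc_zero = sc_class (Inl (gen_congruence F1_X [:0, 1:] 0))"

definition sc_infinity :: sc_point where
  "sc_infinity = sc_class (Inr (gen_congruence F1_X 0 [:0, 1:]))"

definition sc_root :: "nat \<Rightarrow> sc_point" where
  "sc_root n = sc_class (Inl (gen_congruence F1_X ([:0, 1:] ^ n) 1))"

definition sc_pi :: "sc_point \<Rightarrow> p1_point" where
  "sc_pi = glue_desc_pt
     (\<lambda>c. pt (glue_in1 F1_overlap (F1_emb Tvar) (F1_emb (inverse Tvar))) (null_ideal F1_X c))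
     (\<lambda>c. pt (glue_in2 F1_overlap (F1_emb Tvar) (F1_emb (inverse Tvar))) (null_ideal F1_X c))"

text \<open>\<open>\<kappa>(z)\<close>, computed on the first chart whenever \<open>z\<close> lies on it, that is for all \<open>z\<close> except
  \<open>[\<infinity>]\<close>; \<open>sc_T z\<close> is the class of \<open>T = X/Y\<close> in \<open>\<kappa>(z)\<close> for \<open>z\<close> on the first chart.\<close>

definition sc_kappa :: "sc_point \<Rightarrow> (int poly set \<times> int poly set) set pmonoid" where
  "sc_kappa z =
     (if \<exists>c. Inl c \<in> z then cong_residue F1_X (THE c. Inl c \<in> z)
      else cong_residue F1_X (THE c. Inr c \<in> z))"

definition sc_T :: "sc_point \<Rightarrow> (int poly set \<times> int poly set) set" where
  "sc_T z = (let c = (THE c. Inl c \<in> z); B = quot_pm F1_X c in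
     fraction B (carrier B - {pzero B}) (c `` {[:0, 1:]}) \<one>\<^bsub>B\<^esub>)"


section \<open>Number fields and places\<close>

definition number_field :: "'k::field_char_0 itself \<Rightarrow> bool" where
  "number_field _ \<longleftrightarrow>
     (\<exists>B::'k set. finite B \<and> module.span (\<lambda>(q::rat) x. of_rat q * x) B = UNIV)"

definition ring_of_integers :: "'k::field_char_0 ring" where
  "ring_of_integers = sub_ring {x. algebraic_int x}"

text \<open>The ring \<open>\<O>\<^sub>K[t]\<close>.\<close>

definition integers_adjoin :: "'k::field_char_0 \<Rightarrow> 'k ring" where
  "integers_adjoin t =
     sub_ring {Polynomial.poly q t |q. \<forall>i. algebraic_int (Polynomial.coeff q i)}"

definition phi ::
    "'k::field_char_0
      \<Rightarrow> ('k set, 'k set \<Rightarrow> ('k \<times> 'k) set, p1_point, p1_section) space_map" where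
  "phi f =
     (let X1 = Spec (integers_adjoin f); X2 = Spec (integers_adjoin (inverse f)) in
      cover_desc (Spec ring_of_integers)
        X1 (spec_map ring_of_integers (integers_adjoin f) (space_top X1) id)
        X2 (spec_map ring_of_integers (integers_adjoin (inverse f)) (space_top X2) id)
        (comp_map (Spec Z_X) (glue_in1 Z_overlap (Z_emb Tvar) (Z_emb (inverse Tvar)))
          (spec_map Z_X (integers_adjoin f) (space_top X1) (eval_at f)))
        (comp_map (Spec Z_X) (glue_in2 Z_overlap (Z_emb Tvar) (Z_emb (inverse Tvar)))
          (spec_map Z_X (integers_adjoin (inverse f)) (space_top X2) (eval_at (inverse f)))))"

definition absolute_value :: "('k::field \<Rightarrow> real) \<Rightarrow> bool" where
  "absolute_value v \<longleftrightarrow>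
     (\<forall>x. v x \<ge> 0) \<and> (\<forall>x. v x = 0 \<longleftrightarrow> x = 0) \<and>
     (\<forall>x y. v (x * y) = v x * v y) \<and> (\<forall>x y. v (x + y) \<le> v x + v y)"

definition nonarchimedean :: "('k::field \<Rightarrow> real) \<Rightarrow> bool" where
  "nonarchimedean v \<longleftrightarrow> (\<forall>x y. v (x + y) \<le> max (v x) (v y))"

definition av_equiv :: "(('k::field \<Rightarrow> real) \<times> ('k \<Rightarrow> real)) set" where
  "av_equiv = {(v, w). absolute_value v \<and> absolute_value w \<and>
     (\<exists>r>0. \<forall>x. w x = v x powr r)}"

type_synonym 'k place = "('k \<Rightarrow> real) set"

definition places :: "'k::field place set" where
  "places = {v. absolute_value v} // av_equiv"

definition trivial_place :: "'k::field place" where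
  "trivial_place = av_equiv `` {\<lambda>x. if x = 0 then 0 else 1}"

definition na_places :: "'k::field place set" where
  "na_places = {\<aa> \<in> places. \<forall>v\<in>\<aa>. nonarchimedean v}"

definition place_ring :: "'k::field place \<Rightarrow> 'k set" where
  "place_ring \<aa> = {x. \<forall>v\<in>\<aa>. v x \<le> 1}"

definition place_ideal :: "'k::field place \<Rightarrow> 'k set" where
  "place_ideal \<aa> = {x. \<forall>v\<in>\<aa>. v x < 1}"

text \<open>\<open>\<kappa>(\<aa>) = \<O>\<^sub>\<aa>/m\<^sub>\<aa>\<close>. For non-archimedean \<open>\<aa>\<close> this is the quotient of the ring \<open>\<O>\<^sub>\<aa>\<close> by its
  maximal ideal, the residue field; for archimedean \<open>\<aa>\<close>, where \<open>\<O>\<^sub>\<aa>\<close> is only a pointed monoid, it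
  is the quotient that collapses \<open>m\<^sub>\<aa>\<close> to \<open>0\<close>.\<close>

definition place_cong :: "'k::field place \<Rightarrow> ('k \<times> 'k) set" where
  "place_cong \<aa> = {(x, y) \<in> place_ring \<aa> \<times> place_ring \<aa>.
     if \<aa> \<in> na_places then x - y \<in> place_ideal \<aa>
     else x = y \<or> x \<in> place_ideal \<aa> \<and> y \<in> place_ideal \<aa>}"

definition place_kappa :: "'k::field place \<Rightarrow> 'k set pmonoid" where
  "place_kappa \<aa> = quot_pm (sub_pm (place_ring \<aa>)) (place_cong \<aa>)"

text \<open>Over the empty set the formula \<open>{\<lambda>. \<forall>\<aa>\<in>U. \<lambda> \<in> \<O>\<^sub>\<aa>}\<close> is replaced by the terminal pointed
  monoid, as the sheaf condition requires.\<close>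

definition compact_spec :: "('k::field place, 'k) mspace" where
  "compact_spec =
     \<lparr>space_top = topology (\<lambda>U. U = {} \<or>
        U \<subseteq> places \<and> trivial_place \<in> U \<and> finite (places - U)),
      sections = (\<lambda>U. if U = {}
        then \<lparr>carrier = {0}, monoid.mult = (*), one = 0, pzero = 0\<rparr>
        else sub_pm {x. \<forall>\<aa>\<in>U. x \<in> place_ring \<aa>}),
      res = (\<lambda>U V x. if V = {} then 0 else x)\<rparr>"

lemma istopology_compact:
  "istopology (\<lambda>U. U = {} \<or> U \<subseteq> A \<and> a \<in> U \<and> finite (A - U))"
  unfolding istopology_def
proof (intro conjI allI impI)
  fix S T
  assume "S = {} \<or> S \<subseteq> A \<and> a \<in> S \<and> finite (A - S)"
    and "T = {} \<or> T \<subseteq> A \<and> a \<in> T \<and> finite (A - T)"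
  then show "S \<inter> T = {} \<or> S \<inter> T \<subseteq> A \<and> a \<in> S \<inter> T \<and> finite (A - S \<inter> T)"
    by (auto simp: Diff_Int)
next
  fix \<K>
  assume K: "\<forall>K\<in>\<K>. K = {} \<or> K \<subseteq> A \<and> a \<in> K \<and> finite (A - K)"
  show "\<Union>\<K> = {} \<or> \<Union>\<K> \<subseteq> A \<and> a \<in> \<Union>\<K> \<and> finite (A - \<Union>\<K>)"
  proof (cases "\<Union>\<K> = {}")
    case False
    then obtain K0 where K0: "K0 \<in> \<K>" "K0 \<noteq> {}" by blast
    with K have "a \<in> K0" "finite (A - K0)" by auto
    moreover have "A - \<Union>\<K> \<subseteq> A - K0" using K0 by blast
    ultimately have "a \<in> \<Union>\<K>" "finite (A - \<Union>\<K>)"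
      using K0 by (auto intro: finite_subset)
    moreover have "\<Union>\<K> \<subseteq> A" using K by fastforce
    ultimately show ?thesis by blast
  qed simp
qed


subsection \<open>Primes as places\<close>

text \<open>The \<open>P\<close>-adic valuation: the largest \<open>n\<close> with \<open>x \<in> P\<^sup>n\<close> for integral \<open>x \<noteq> 0\<close>, extended
  to fractions. It is used for nonzero \<open>P\<close> and \<open>x\<close> only.\<close>

definition val_int :: "'k::field_char_0 set \<Rightarrow> 'k \<Rightarrow> nat" where
  "val_int P x = (GREATEST n. x \<in> P [^]\<^bsub>ideals_set ring_of_integers\<^esub> n)"

definition val :: "'k::field_char_0 set \<Rightarrow> 'k \<Rightarrow> int" where
  "val P x = (THE n. \<exists>a b. algebraic_int a \<and> algebraic_int b \<and> a \<noteq> 0 \<and> b \<noteq> 0 \<and> x = a / b \<and>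
     n = int (val_int P a) - int (val_int P b))"

text \<open>The place \<open>[P]\<close>; the choice of the base \<open>1/2\<close> does not affect it.\<close>

definition prime_place :: "'k::field_char_0 set \<Rightarrow> 'k place" where
  "prime_place P =
     (if P = {0} then trivial_place
      else av_equiv `` {\<lambda>x. if x = 0 then 0 else (1 / 2) powi val P x})"

text \<open>The isomorphism from \<open>(Spec \<O>\<^sub>K)\<^sup>\<bullet>\<close> to the subspace of non-archimedean places: a section
  \<open>x \<in> K\<close> is sent to the family of fractions \<open>a/b = x\<close> in the localizations of \<open>\<O>\<^sub>K\<close>.\<close>

definition na_iso ::
    "('k::field_char_0 set, 'k set \<Rightarrow> ('k \<times> 'k) set, 'k place, 'k) space_map" where
  "na_iso =
     \<lparr>pt = prime_place,
      pull = (\<lambda>U x. \<lambda>P\<in>{P. primeideal P ring_of_integers \<and> prime_place P \<in> U}.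
        {(a, b). algebraic_int a \<and> algebraic_int b \<and> b \<notin> P \<and> a = x * b})\<rparr>"


subsection \<open>The map to the strong congruence space\<close>

definition residue :: "'k::field place \<Rightarrow> 'k \<Rightarrow> 'k set" where
  "residue \<aa> x = place_cong \<aa> `` {x}"

definition f_tilde :: "'k::field_char_0 \<Rightarrow> 'k set \<Rightarrow> sc_point" where
  "f_tilde f P =
     (if P = {0} then sc_generic
      else if val P f > 0 then sc_zero
      else if val P f < 0 then sc_infinity
      else sc_root (group.ord (units_of (place_kappa (prime_place P))) (residue (prime_place P) f)))"

text \<open>A morphism from \<open>\<kappa>(generic) = \<bbbF>\<^sub>1[T\<^sup>\<plusminus>]\<close> or \<open>\<kappa>([n])\<close> is determined by the image of \<open>T\<close>. For
  \<open>P = 0\<close> the residue of \<open>f\<close> is \<open>f\<close> itself, under \<open>\<kappa>([0]) = K\<^sup>\<bullet>\<close>.\<close>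

definition f_tilde_map ::
    "'k::field_char_0 \<Rightarrow> 'k set \<Rightarrow> (int poly set \<times> int poly set) set \<Rightarrow> 'k set" where
  "f_tilde_map f P =
     (let A = sc_kappa (f_tilde f P); B = place_kappa (prime_place P) in
      if f_tilde f P \<in> {sc_zero, sc_infinity}
      then (\<lambda>z\<in>carrier A. if z = pzero A then pzero B else \<one>\<^bsub>B\<^esub>)
      else (THE h. h \<in> pm_hom A B \<and> h \<in> extensional (carrier A) \<and>
              h (sc_T (f_tilde f P)) = residue (prime_place P) f))"

end

theory Submission
  imports
    Defs
    "HOL-Computational_Algebra.Fundamental_Theorem_Algebra"
    "HOL-Real_Asymp.Real_Asymp"
    "HOL-Algebra.Weak_Morphisms"
begin

text \<open>Only finitely many places \<open>\<aa>\<close> satisfy \<open>|f|\<^sub>\<aa> \<noteq> 1\<close>. Hence the map sending \<open>\<aa>\<close> to the point \<open>[0]\<close>, to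
  \<open>[\<infinity>]\<close> or to the generic point according to whether \<open>|f|\<^sub>\<aa>\<close> is less than, greater than or equal to \<open>1\<close> is
  continuous. Sections over nonempty open sets are elements of \<open>\<bbbF>\<^sub>1[T\<^sup>\<plusminus>]\<close> and of \<open>K\<close>, and on sections \<open>\<psi>\<close> is
  \<open>T \<mapsto> f\<close>. At \<open>\<aa>\<close> the map to the strong congruence space takes the kernel congruence of \<open>T \<mapsto> f\<close> (or of
  \<open>T\<^sup>-\<^sup>1 \<mapsto> f\<^sup>-\<^sup>1\<close>) with values in \<open>\<kappa>(\<aa>)\<close>, so that the map of residue monoids exists and is injective. At an
  archimedean place \<open>\<kappa>(\<aa>)\<close> is not a field; there \<open>|f|\<^sub>\<aa> \<noteq> 1\<close> makes the quotient equal to \<open>\<bbbF>\<^sub>1\<close>, which is a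
  domain.\<close>

section \<open>Algebraic integers\<close>

text \<open>All arithmetic of \<open>K\<close> comes from one source: \<open>n + 1\<close> elements
  always satisfy an integral linear relation with coprime coefficients. Coprimality keeps the
  relation nontrivial modulo every prime, so the residue rings of the integers are finite, and
  pigeonhole on the powers of an element yields complete integral closedness and inverses modulo a
  prime. The valuation is prescribed as a \<open>GREATEST\<close> over powers of the ideal
  \<open>P\<close>, so local principality must be known before \<open>val\<close> can be computed;
  an element \<open>q\<close> of \<open>P\<close> and a field element \<open>g\<close> with
  \<open>q * g\<close> integral and outside \<open>P\<close> provide it. The hypothesis on
  \<open>f\<close> acts twice. An archimedean absolute value exists because \<open>K\<close> embeds
  in the complex numbers, so \<open>f\<close> is no root of unity and \<open>T \<mapsto> f\<close>
  is injective at the trivial place; and a place where \<open>f\<close> has value \<open>1\<close>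
  is non-archimedean, so its residue monoid is a field. The comparison with \<open>phi f\<close> has
  to unfold gluing, localization and \<open>THE\<close>. Since nonempty open sets contain the
  generic point, it reduces to equations between elements of \<open>K\<close>.\<close>

interpretation zmod: Modules.module "\<lambda>(q::int) (x::'k::field_char_0). of_int q * x"
  by unfold_locales (auto simp: algebra_simps)

text \<open>The integers are Noetherian, by induction on generators. The possible coefficients of
  \<open>s\<close> in elements of \<open>N\<close> form an ideal, generated by some
  \<open>d\<close>; an element \<open>n0\<close> of \<open>N\<close> with coefficient
  \<open>d\<close>, joined to generators of \<open>N \<inter> zmod.span S\<close>, generates
  \<open>N\<close>.\<close>

lemma zspan_submodule_finite:
  fixes S N :: "'k::field_char_0 set"
  assumes "finite S" "zmod.subspace N" "N \<subseteq> zmod.span S"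
  shows "\<exists>G. finite G \<and> N = zmod.span G"
  using assms
proof (induction S arbitrary: N rule: finite_induct)
  case empty
  then have "N = {0}" using zmod.subspace_0 by auto
  then show ?case by (intro exI[of _ "{}"]) auto
next
  case (insert s S)
  define I where "I = {m::int. \<exists>y\<in>zmod.span S. of_int m * s + y \<in> N}"
  have I0: "0 \<in> I" unfolding I_def
    using insert.prems(1) zmod.span_zero[of S] by (auto intro!: bexI[of _ 0] simp: zmod.subspace_0)
  have Isub: "a - q * b \<in> I" if ab: "a \<in> I" "b \<in> I" for a b q
  proof -
    obtain x y where x: "x \<in> zmod.span S" "of_int a * s + x \<in> N"
      and y: "y \<in> zmod.span S" "of_int b * s + y \<in> N"
      using ab unfolding I_def by blast
    have "(of_int a * s + x) - of_int q * (of_int b * s + y) \<in> N"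
      using x y insert.prems(1) by (intro zmod.subspace_diff zmod.subspace_scale)
    moreover have "(of_int a * s + x) - of_int q * (of_int b * s + y)
        = of_int (a - q * b) * s + (x - of_int q * y)"
      by (simp add: algebra_simps)
    moreover have "x - of_int q * y \<in> zmod.span S"
      using x y by (intro zmod.span_diff zmod.span_scale)
    ultimately show ?thesis unfolding I_def by auto
  qed
  obtain d where d: "d \<in> I" "\<And>m. m \<in> I \<Longrightarrow> d dvd m"
  proof (cases "\<exists>m\<in>I. m \<noteq> 0")
    case False
    then show ?thesis using that[of 0] I0 by auto
  next
    case True
    then obtain m where m: "m \<in> I" "m \<noteq> 0" by blast
    have "\<exists>n>0. int n \<in> I"
    proof (cases "m > 0")
      case True then show ?thesis using m by (intro exI[of _ "nat m"]) auto
    next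
      case False
      have "0 - 1 * m \<in> I" using Isub[of 0 m 1] I0 m by simp
      then show ?thesis using False m by (intro exI[of _ "nat (-m)"]) auto
    qed
    define n where "n = (LEAST n. n > 0 \<and> int n \<in> I)"
    have n: "n > 0" "int n \<in> I"
      using LeastI_ex[OF \<open>\<exists>n>0. int n \<in> I\<close>] unfolding n_def by auto
    have "int n dvd m" if "m \<in> I" for m
    proof (rule ccontr)
      assume "\<not> int n dvd m"
      then have "m mod int n \<noteq> 0" by (simp add: dvd_eq_mod_eq_0)
      then have "m mod int n > 0" using n pos_mod_sign[of "int n" m] by linarith
      moreover have "m mod int n \<in> I" using Isub[OF that n(2), of "m div int n"]
        by (simp add: minus_div_mult_eq_mod)
      moreover have "m mod int n < int n" using n by simp
      ultimately have "nat (m mod int n) > 0 \<and> int (nat (m mod int n)) \<in> I" "nat (m mod int n) < n"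
        by auto
      then show False using not_less_Least[of "nat (m mod int n)"] unfolding n_def by blast
    qed
    then show ?thesis using that n by blast
  qed
  obtain y0 where y0: "y0 \<in> zmod.span S" "of_int d * s + y0 \<in> N"
    using d(1) unfolding I_def by blast
  define n0 where "n0 = of_int d * s + y0"
  have "zmod.subspace (N \<inter> zmod.span S)"
    using insert.prems(1) by (intro zmod.subspace_inter zmod.subspace_span)
  then obtain G where G: "finite G" "N \<inter> zmod.span S = zmod.span G"
    using insert.IH[of "N \<inter> zmod.span S"] by blast
  have "N = zmod.span (insert n0 G)"
  proof
    show "zmod.span (insert n0 G) \<subseteq> N"
      using y0 G insert.prems(1) zmod.span_superset[of G]
      by (intro zmod.span_minimal) (auto simp: n0_def)
    show "N \<subseteq> zmod.span (insert n0 G)"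
    proof
      fix n assume n: "n \<in> N"
      then have "n \<in> zmod.span (insert s S)" using insert.prems by blast
      then obtain m where m: "n - of_int m * s \<in> zmod.span S"
        unfolding zmod.span_insert by blast
      then have "m \<in> I" using n unfolding I_def by (auto intro!: bexI[of _ "n - of_int m * s"])
      then obtain q where q: "m = d * q" using d by blast
      have "n - of_int q * n0 = (n - of_int m * s) - of_int q * y0"
        by (simp add: n0_def q algebra_simps)
      moreover have "\<dots> \<in> zmod.span S" by (rule zmod.span_diff[OF m zmod.span_scale[OF y0(1)]])
      moreover have "n - of_int q * n0 \<in> N"
        using n y0 insert.prems(1) unfolding n0_def by (intro zmod.subspace_diff zmod.subspace_scale)
      ultimately have "n - of_int q * n0 \<in> N \<inter> zmod.span S" by (metis IntI)
      then have "n - of_int q * n0 \<in> zmod.span G" unfolding G(2) .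
      then show "n \<in> zmod.span (insert n0 G)" unfolding zmod.span_insert by blast
    qed
  qed
  then show ?case using G by blast
qed

text \<open>Coefficients are indexed by exponents and not by elements, so that a relation can be
  read off even when some powers of \<open>z\<close> coincide.\<close>

lemma zspan_powers:
  "zmod.span ((\<lambda>i. (z::'k::field_char_0) ^ i) ` {..<m}) = {\<Sum>i<m. of_int (c i) * z ^ i | c. True}"
proof
  show "zmod.span ((\<lambda>i. z ^ i) ` {..<m}) \<subseteq> {\<Sum>i<m. of_int (c i) * z ^ i | c. True}"
  proof (rule zmod.span_minimal)
    show "(\<lambda>i. z ^ i) ` {..<m} \<subseteq> {\<Sum>i<m. of_int (c i) * z ^ i |c. True}"
    proof clarify
      fix j assume "j < m"
      then have "z ^ j = (\<Sum>i<m. of_int (if i = j then 1 else 0) * z ^ i)"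
        by (simp add: if_distrib[of of_int] if_distrib[of "\<lambda>x. x * _"] cong: if_cong)
      then show "\<exists>c. z ^ j = (\<Sum>i<m. of_int (c i) * z ^ i) \<and> True"
        by (intro exI[of _ "\<lambda>i. if i = j then 1 else 0"]) simp
    qed
    have "\<exists>e. (\<Sum>i<m. of_int (c i) * z ^ i) + (\<Sum>i<m. of_int (d i) * z ^ i)
        = (\<Sum>i<m. of_int (e i) * z ^ i)" for c d
      by (rule exI[of _ "\<lambda>i. c i + d i"]) (simp add: sum.distrib algebra_simps)
    moreover have "\<exists>e. of_int q * (\<Sum>i<m. of_int (c i) * z ^ i)
        = (\<Sum>i<m. of_int (e i) * z ^ i)" for c q
      by (rule exI[of _ "\<lambda>i. q * c i"]) (simp only: sum_distrib_left of_int_mult mult.assoc)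
    moreover have "\<exists>e. 0 = (\<Sum>i<m. of_int (e i) * z ^ i)"
      by (rule exI[of _ "\<lambda>i. 0"]) simp
    ultimately show "zmod.subspace {\<Sum>i<m. of_int (c i) * z ^ i |c. True}"
      unfolding zmod.subspace_def by auto
  qed
  show "{\<Sum>i<m. of_int (c i) * z ^ i | c. True} \<subseteq> zmod.span ((\<lambda>i. z ^ i) ` {..<m})"
    by (auto intro!: zmod.span_sum zmod.span_scale intro: zmod.span_base)
qed

lemma coeff_sum_monom: "coeff (\<Sum>i<m. monom (g i) i) j = (if j < m then g j else 0)"
  by (auto simp: coeff_sum if_distrib cong: if_cong)

text \<open>A monic equation solved for its leading term. In this form integrality becomes a
  statement about finitely generated modules.\<close>

lemma algebraic_int_iff_power_in_span:
  "algebraic_int (z::'k::field_char_0) \<longleftrightarrow>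
    (\<exists>m. z ^ m \<in> zmod.span ((\<lambda>i. z ^ i) ` {..<m}))"
proof
  assume "algebraic_int z"
  then obtain p where p: "Polynomial.poly (map_poly of_int p) z = 0" "lead_coeff p = 1"
    unfolding algebraic_int_altdef_ipoly by blast
  have "0 = (\<Sum>i\<le>degree p. of_int (coeff p i) * z ^ i)"
    using p(1) by (simp add: poly_altdef degree_map_poly coeff_map_poly)
  also have "\<dots> = (\<Sum>i<degree p. of_int (coeff p i) * z ^ i) + z ^ degree p"
    using p(2) by (simp flip: lessThan_Suc_atMost)
  finally have "z ^ degree p = (\<Sum>i<degree p. of_int (- coeff p i) * z ^ i)"
    by (simp add: sum_negf add_eq_0_iff)
  then show "\<exists>m. z ^ m \<in> zmod.span ((\<lambda>i. z ^ i) ` {..<m})"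
    unfolding zspan_powers by (intro exI[of _ "degree p"] CollectI exI[of _ "\<lambda>i. - coeff p i"]) simp
next
  assume "\<exists>m. z ^ m \<in> zmod.span ((\<lambda>i. z ^ i) ` {..<m})"
  then obtain m c where c: "z ^ m = (\<Sum>i<m. of_int (c i) * z ^ i)"
    unfolding zspan_powers by blast
  define r where "r = (\<Sum>i<m. monom (c i) i)"
  define p where "p = monom 1 m - r"
  have cr: "coeff r j = (if j < m then c j else 0)" for j
    unfolding r_def by (rule coeff_sum_monom)
  have "coeff p m = 1" "degree p \<le> m"
    by (auto simp: p_def cr intro!: degree_le)
  then have "degree p = m" by (metis le_antisym le_degree zero_neq_one)
  then have lc: "lead_coeff p = 1" using \<open>coeff p m = 1\<close> by simp
  have "Polynomial.poly (map_poly of_int p) z = (\<Sum>i\<le>m. of_int (coeff p i) * z ^ i)"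
    using \<open>degree p = m\<close> by (simp add: poly_altdef degree_map_poly coeff_map_poly)
  also have "\<dots> = (\<Sum>i<m. of_int (coeff p i) * z ^ i) + z ^ m"
    using \<open>coeff p m = 1\<close> by (simp flip: lessThan_Suc_atMost)
  also have "(\<Sum>i<m. of_int (coeff p i) * z ^ i) = (\<Sum>i<m. - (of_int (c i) * z ^ i))"
    by (intro sum.cong) (auto simp: p_def cr)
  finally have "Polynomial.poly (map_poly of_int p) z = 0" using c by (simp add: sum_negf)
  then show "algebraic_int z" unfolding algebraic_int_altdef_ipoly using lc by blast
qed

text \<open>The module criterion for integrality, by the Noetherian property in place of a
  determinant: all powers of \<open>z\<close> lie in the span of \<open>S\<close>, so their span has
  finitely many generators; these involve only powers below some \<open>k\<close>, hence
  \<open>z ^ k\<close> is a combination of lower powers.\<close>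

lemma algebraic_int_if_stable:
  fixes z :: "'k::field_char_0"
  assumes "finite S" "1 \<in> zmod.span S" and stable: "\<And>s. s \<in> S \<Longrightarrow> z * s \<in> zmod.span S"
  shows "algebraic_int z"
proof -
  have st: "z * x \<in> zmod.span S" if "x \<in> zmod.span S" for x
    using that
  proof (induction rule: zmod.span_induct_alt)
    case (step c x y)
    have "z * (of_int c * x + y) = of_int c * (z * x) + z * y" by (simp add: algebra_simps)
    then show ?case using step stable by (auto intro!: zmod.span_add zmod.span_scale)
  qed (simp add: zmod.span_zero)
  have pw: "z ^ i \<in> zmod.span S" for i
    by (induction i) (use assms st in auto)
  obtain G where G: "finite G" "zmod.span (range (\<lambda>i. z ^ i)) = zmod.span G"
    using zspan_submodule_finite[OF assms(1) zmod.subspace_span, of "range (\<lambda>i. z ^ i)"]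
      zmod.span_minimal[of "range (\<lambda>i. z ^ i)" "zmod.span S"] pw by auto
  have mono: "zmod.span ((\<lambda>i. z ^ i) ` {..<k}) \<subseteq> zmod.span ((\<lambda>i. z ^ i) ` {..<k'})" if "k \<le> k'" for k k'
    using that by (intro zmod.span_mono image_mono) auto
  have "\<exists>k. G' \<subseteq> zmod.span ((\<lambda>i. z ^ i) ` {..<k})" if "finite G'" "G' \<subseteq> G" for G'
    using that
  proof (induction rule: finite_induct)
    case (insert g G')
    have "g \<in> zmod.span (range (\<lambda>i. z ^ i))" using insert.prems G zmod.span_superset by blast
    then obtain t r where t: "finite t" "t \<subseteq> range (\<lambda>i. z ^ i)" "g = (\<Sum>a\<in>t. of_int (r a) * a)"
      unfolding zmod.span_explicit by auto
    obtain J where J: "finite J" "t = (\<lambda>i. z ^ i) ` J" using finite_subset_image[OF t(1,2)] by blast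
    then have "t \<subseteq> (\<lambda>i. z ^ i) ` {..<Suc (Max J)}"
      by (auto simp: less_Suc_eq_le)
    then have g: "g \<in> zmod.span ((\<lambda>i. z ^ i) ` {..<Suc (Max J)})"
      unfolding t(3) by (auto intro!: zmod.span_sum zmod.span_scale intro: zmod.span_base)
    obtain k where k: "G' \<subseteq> zmod.span ((\<lambda>i. z ^ i) ` {..<k})" using insert by blast
    show ?case
      using g k mono[of k "max k (Suc (Max J))"] mono[of "Suc (Max J)" "max k (Suc (Max J))"]
      by (intro exI[of _ "max k (Suc (Max J))"]) (simp add: subset_iff)
  qed auto
  then obtain k where "G \<subseteq> zmod.span ((\<lambda>i. z ^ i) ` {..<k})" using G by blast
  then have "zmod.span G \<subseteq> zmod.span ((\<lambda>i. z ^ i) ` {..<k})"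
    by (intro zmod.span_minimal) auto
  moreover have "z ^ k \<in> zmod.span G" unfolding G(2)[symmetric] by (auto intro: zmod.span_base)
  ultimately show ?thesis unfolding algebraic_int_iff_power_in_span by blast
qed

text \<open>Multiplication by \<open>x\<close> raises the exponent, and at the top exponent the
  relation for \<open>x ^ m\<close> brings it back into range. The set \<open>W\<close> is arbitrary
  so that either factor of a product basis can play the role of \<open>x\<close>.\<close>

lemma zspan_power_products_stable:
  fixes x :: "'k::field_char_0"
  assumes x: "x ^ m \<in> zmod.span ((\<lambda>i. x ^ i) ` {..<m})" and "s \<in> zmod.span {x ^ i * w |i w. i < m \<and> w \<in> W}"
  shows "x * s \<in> zmod.span {x ^ i * w |i w. i < m \<and> w \<in> W}"
  using assms(2)
proof (induction rule: zmod.span_induct_alt)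
  case base
  then show ?case by (simp add: zmod.span_zero)
next
  case (step c s y)
  then obtain i w where s: "s = x ^ i * w" "i < m" "w \<in> W" by blast
  have "x * s \<in> zmod.span {x ^ i * w |i w. i < m \<and> w \<in> W}"
  proof (cases "Suc i < m")
    case True
    then show ?thesis unfolding s
      by (intro zmod.span_base CollectI exI[of _ "Suc i"] exI[of _ w]) (use s in auto)
  next
    case False
    then have m: "m = Suc i" using s by auto
    obtain e where e: "x ^ m = (\<Sum>j<m. of_int (e j) * x ^ j)"
      using x unfolding zspan_powers by blast
    have "x * s = x ^ m * w" by (simp add: s m)
    also have "\<dots> = (\<Sum>j<m. of_int (e j) * (x ^ j * w))"
      unfolding e by (simp add: sum_distrib_right mult.assoc)
    also have "\<dots> \<in> zmod.span {x ^ i * w |i w. i < m \<and> w \<in> W}"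
      using s by (intro zmod.span_sum zmod.span_scale zmod.span_base) auto
    finally show ?thesis .
  qed
  moreover have "x * (of_int c * s + y) = of_int c * (x * s) + x * y" by (simp add: algebra_simps)
  ultimately show ?case using step by (auto intro!: zmod.span_add zmod.span_scale)
qed

text \<open>Both \<open>x\<close> and \<open>y\<close> act on the finitely generated module spanned
  by the products \<open>x ^ i * y ^ j\<close>, hence so do their sum and product.\<close>

lemma
  fixes x y :: "'k::field_char_0"
  assumes "algebraic_int x" "algebraic_int y"
  shows algebraic_int_plus [intro]: "algebraic_int (x + y)"
    and algebraic_int_times [intro]: "algebraic_int (x * y)"
proof -
  obtain m n where mn: "x ^ m \<in> zmod.span ((\<lambda>i. x ^ i) ` {..<m})"
    "y ^ n \<in> zmod.span ((\<lambda>i. y ^ i) ` {..<n})"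
    using assms unfolding algebraic_int_iff_power_in_span by blast
  have pos: "m > 0" "n > 0" using mn by (auto intro!: Nat.gr0I)
  define S where "S = {x ^ i * w |i w. i < m \<and> w \<in> (\<lambda>j. y ^ j) ` {..<n}}"
  have S': "S = {y ^ j * w |j w. j < n \<and> w \<in> (\<lambda>i. x ^ i) ` {..<m}}"
    unfolding S_def by (auto simp: image_iff) (metis lessThan_iff mult.commute)+
  have "S = (\<lambda>(i, j). x ^ i * y ^ j) ` ({..<m} \<times> {..<n})" unfolding S_def by auto
  then have fin: "finite S" by simp
  have "1 \<in> S" unfolding S_def using pos
    by (intro CollectI exI[of _ 0] exI[of _ 1]) (auto intro: image_eqI[of _ _ 0])
  then have one: "1 \<in> zmod.span S" by (rule zmod.span_base)
  have xs: "x * s \<in> zmod.span S" if "s \<in> zmod.span S" for s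
    using zspan_power_products_stable[OF mn(1)] that unfolding S_def by blast
  have ys: "y * s \<in> zmod.span S" if "s \<in> zmod.span S" for s
    using zspan_power_products_stable[OF mn(2)] that unfolding S' by blast
  show "algebraic_int (x + y)"
    using xs ys by (intro algebraic_int_if_stable[OF fin one])
      (auto simp: distrib_right intro: zmod.span_add zmod.span_base)
  show "algebraic_int (x * y)"
    using xs ys by (intro algebraic_int_if_stable[OF fin one])
      (auto simp: mult.assoc intro: zmod.span_base)
qed

lemma algebraic_int_diff [intro]:
  "algebraic_int x \<Longrightarrow> algebraic_int y \<Longrightarrow> algebraic_int (x - (y::'k::field_char_0))"
  using algebraic_int_plus[of x "-y"] by auto

lemma algebraic_int_power [intro]: "algebraic_int (x::'k::field_char_0) \<Longrightarrow> algebraic_int (x ^ n)"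
  by (induction n) auto

text \<open>By \<open>j < i\<close>, \<open>z\<close> is a root of a monic polynomial whose only
  non-integer coefficient is the integral element \<open>c\<close>. Transitivity of integrality is
  carried out on the module spanned by the \<open>c ^ b * z ^ a\<close>.\<close>

lemma algebraic_int_if_power_diff:
  fixes z :: "'k::field_char_0"
  assumes "j < i" "algebraic_int (z ^ i - z ^ j)"
  shows "algebraic_int z"
proof -
  define c where "c = z ^ i - z ^ j"
  obtain d where d: "c ^ d \<in> zmod.span ((\<lambda>i. c ^ i) ` {..<d})"
    using assms(2) unfolding algebraic_int_iff_power_in_span c_def by blast
  have pos: "d > 0" using d by (auto intro!: Nat.gr0I)
  define S where "S = {c ^ b * w |b w. b < d \<and> w \<in> (\<lambda>a. z ^ a) ` {..<i}}"
  have "S = (\<lambda>(b, a). c ^ b * z ^ a) ` ({..<d} \<times> {..<i})" unfolding S_def by auto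
  then have fin: "finite S" by simp
  have "1 \<in> S" unfolding S_def using pos assms(1)
    by (intro CollectI exI[of _ 0] exI[of _ 1]) (auto intro: image_eqI[of _ _ 0])
  then have one: "1 \<in> zmod.span S" by (rule zmod.span_base)
  have cs: "c * s \<in> zmod.span S" if "s \<in> zmod.span S" for s
    using zspan_power_products_stable[OF d] that unfolding S_def by blast
  have "z * s \<in> zmod.span S" if sS: "s \<in> S" for s
  proof -
    obtain b w where w: "s = c ^ b * w" "b < d" "w \<in> (\<lambda>a. z ^ a) ` {..<i}"
      using sS unfolding S_def by blast
    then obtain a where s: "s = c ^ b * z ^ a" "b < d" "a < i" by blast
    show ?thesis
    proof (cases "Suc a < i")
      case True
      then have "c ^ b * z ^ Suc a \<in> S" unfolding S_def using s by blast
      then show ?thesis unfolding s by (auto simp: mult.left_commute intro: zmod.span_base)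
    next
      case False
      then have "i = Suc a" using s by auto
      then have "z * s = c ^ b * z ^ i" by (simp add: s)
      also have "z ^ i = z ^ j + c" by (simp add: c_def)
      finally have "z * s = c ^ b * z ^ j + c * (c ^ b * z ^ 0)" by (simp add: algebra_simps)
      moreover have "z ^ j \<in> (\<lambda>a. z ^ a) ` {..<i}" "z ^ 0 \<in> (\<lambda>a. z ^ a) ` {..<i}"
        using assms(1) by (intro imageI, simp)+
      then have "c ^ b * z ^ j \<in> S" "c ^ b * z ^ 0 \<in> S" unfolding S_def using s by blast+
      ultimately show ?thesis using cs by (auto intro!: zmod.span_add intro: zmod.span_base)
    qed
  qed
  then show ?thesis by (rule algebraic_int_if_stable[OF fin one])
qed

section \<open>Rational linear relations and finite residue rings\<close>

interpretation qvs: vector_space "\<lambda>(q::rat) (x::'k::field_char_0). of_rat q * x"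
  by unfold_locales (auto simp: algebra_simps of_rat_add of_rat_mult)

lemma common_denominator: "\<exists>D::int. D > 0 \<and> (\<forall>i\<le>n::nat. \<exists>m::int. of_int D * c i = (of_int m :: rat))"
proof (induction n)
  case 0
  obtain a b where "quotient_of (c 0) = (a, b)" by fastforce
  then have "b > 0" "c 0 = of_int a / of_int b"
    by (auto simp: quotient_of_denom_pos quotient_of_div)
  then show ?case by (intro exI[of _ b]) auto
next
  case (Suc n)
  then obtain D where D: "D > 0" "\<forall>i\<le>n. \<exists>m::int. of_int D * c i = (of_int m :: rat)" by blast
  obtain a b where "quotient_of (c (Suc n)) = (a, b)" by fastforce
  then have b: "b > 0" "c (Suc n) = of_int a / of_int b"
    by (auto simp: quotient_of_denom_pos quotient_of_div)
  have "\<exists>m::int. of_int (b * D) * c i = (of_int m :: rat)" if i: "i \<le> Suc n" for i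
  proof (cases "i = Suc n")
    case True
    then show ?thesis using b by (intro exI[of _ "D * a"]) auto
  next
    case False
    then obtain m :: int where "of_int D * c i = (of_int m :: rat)" using D i by (metis le_SucE)
    then show ?thesis by (intro exI[of _ "b * m"]) (simp add: mult.assoc)
  qed
  then show ?case using b D by (intro exI[of _ "b * D"]) auto
qed

text \<open>A rational dependence with denominators cleared and the gcd divided out. The bound
  \<open>n\<close> depends on \<open>K\<close> alone, and the form of the coprimality condition also
  covers \<open>p = 0\<close>, so the coefficients are not all zero.\<close>

lemma number_field_primitive_relation:
  assumes "number_field (K :: 'k::field_char_0 itself)"
  obtains n where "\<And>x::nat \<Rightarrow> 'k. \<exists>c::nat \<Rightarrow> int. (\<forall>p. (\<forall>i\<le>n. p dvd c i) \<longrightarrow> is_unit p) \<and>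
    (\<Sum>i\<le>n. of_int (c i) * x i) = 0"
proof -
  obtain B :: "'k set" where B: "finite B" "qvs.span B = UNIV"
    using assms unfolding number_field_def by blast
  have "\<exists>c::nat \<Rightarrow> int. (\<forall>p. (\<forall>i\<le>card B. p dvd c i) \<longrightarrow> is_unit p) \<and>
    (\<Sum>i\<le>card B. of_int (c i) * x i) = 0" for x :: "nat \<Rightarrow> 'k"
  proof -
    define n where "n = card B"
    have "\<exists>q::nat \<Rightarrow> rat. (\<exists>i\<le>n. q i \<noteq> 0) \<and> (\<Sum>i\<le>n. of_rat (q i) * x i) = 0"
    proof (cases "inj_on x {..n}")
      case True
      then have "card (x ` {..n}) > card B" by (simp add: card_image n_def)
      then have "qvs.dependent (x ` {..n})"
        using qvs.independent_span_bound[OF B(1), of "x ` {..n}"] B(2) by auto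
      then obtain u where u: "\<exists>v\<in>x ` {..n}. u v \<noteq> 0" "(\<Sum>v\<in>x ` {..n}. of_rat (u v) * v) = 0"
        using qvs.dependent_finite[of "x ` {..n}"] by auto
      then show ?thesis
        using True by (intro exI[of _ "u \<circ> x"]) (auto simp: sum.reindex)
    next
      \<comment> \<open>Repeated entries disappear in the image set, so here the relation
        \<open>x i - x j = 0\<close> is written down directly.\<close>
      case False
      then obtain i j where ij: "i \<le> n" "j \<le> n" "i \<noteq> j" "x i = x j" unfolding inj_on_def by auto
      have "(\<Sum>k\<le>n. of_rat (if k = i then 1 else if k = j then - 1 else 0) * x k)
          = (\<Sum>k\<le>n. (if k = i then x i else 0) - (if k = j then x j else 0))"
        using ij(3) by (intro sum.cong) auto
      also have "\<dots> = 0" using ij by (simp add: sum_subtractf)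
      finally show ?thesis using ij
        by (intro exI[of _ "\<lambda>k. if k = i then 1 else if k = j then - 1 else 0"]) auto
    qed
    then obtain q :: "nat \<Rightarrow> rat" where q: "\<exists>i\<le>n. q i \<noteq> 0" "(\<Sum>i\<le>n. of_rat (q i) * x i) = 0" by blast
    obtain D where D: "D > 0" "\<forall>i\<le>n. \<exists>m::int. of_int D * q i = of_int m"
      using common_denominator by blast
    then obtain m :: "nat \<Rightarrow> int" where m: "\<And>i. i \<le> n \<Longrightarrow> of_int D * q i = of_int (m i)" by metis
    have "(\<Sum>i\<le>n. of_int (m i) * x i) = (\<Sum>i\<le>n. of_int D * (of_rat (q i) * x i))"
    proof (intro sum.cong refl)
      fix i assume "i \<in> {..n}"
      then have "(of_rat (of_int D * q i) :: 'k) = of_rat (of_int (m i))" using m by simp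
      then show "of_int (m i) * x i = of_int D * (of_rat (q i) * x i)"
        by (simp add: of_rat_mult mult.assoc)
    qed
    also have "\<dots> = 0" using q(2) by (simp flip: sum_distrib_left)
    finally have m0: "(\<Sum>i\<le>n. of_int (m i) * x i) = 0" .
    define g where "g = Gcd (m ` {..n})"
    obtain i0 where "i0 \<le> n" "m i0 \<noteq> 0" using q(1) m D(1)
      by (metis mult_eq_0_iff of_int_0 of_int_0_eq_iff order_less_irrefl)
    then have g0: "g \<noteq> 0" unfolding g_def by auto
    have gd: "g dvd m i" if "i \<le> n" for i unfolding g_def using that by (intro Gcd_dvd) auto
    have "is_unit p" if p: "\<forall>i\<le>n. p dvd m i div g" for p
    proof -
      have "p * g dvd m i" if "i \<le> n" for i
        using p gd[OF that] that g0 by (metis dvd_div_iff_mult mult.commute)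
      then have "p * g dvd g" unfolding g_def by (intro Gcd_greatest) auto
      then show ?thesis using g0 by auto
    qed
    moreover have "of_int g * (\<Sum>i\<le>n. of_int (m i div g) * x i) = (\<Sum>i\<le>n. of_int (m i) * x i)"
      unfolding sum_distrib_left
    proof (intro sum.cong refl)
      fix i assume "i \<in> {..n}"
      then have "g * (m i div g) = m i" using gd by auto
      then have "of_int g * of_int (m i div g) = (of_int (m i) :: 'k)" by (metis of_int_mult)
      then show "of_int g * (of_int (m i div g) * x i) = of_int (m i) * x i"
        by (simp flip: mult.assoc)
    qed
    ultimately show ?thesis using m0 g0 unfolding n_def by (intro exI[of _ "\<lambda>i. m i div g"]) auto
  qed
  then show ?thesis using that by blast
qed

locale number_field_context =
  fixes K :: "'k::field_char_0 itself"
  assumes number_field: "number_field K"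
begin

text \<open>A relation between the powers of \<open>x\<close> with leading coefficient
  \<open>c m\<close> becomes monic in \<open>c m * x\<close> after multiplication by
  \<open>c m ^ (m - 1)\<close>.\<close>

lemma integral_multiple: "\<exists>N::nat. N > 0 \<and> algebraic_int (of_nat N * (x::'k))"
proof -
  obtain n where "\<exists>c::nat \<Rightarrow> int. (\<forall>p. (\<forall>i\<le>n. p dvd c i) \<longrightarrow> is_unit p) \<and>
    (\<Sum>i\<le>n. of_int (c i) * x ^ i) = 0"
    using number_field_primitive_relation[OF number_field] by metis
  then obtain c :: "nat \<Rightarrow> int" where c: "\<And>p. (\<forall>i\<le>n. p dvd c i) \<Longrightarrow> is_unit p"
    "(\<Sum>i\<le>n. of_int (c i) * x ^ i) = 0" by blast
  define M where "M = {i. i \<le> n \<and> c i \<noteq> 0}"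
  \<comment> \<open>Coprimality with \<open>p = 0\<close> excludes the zero relation.\<close>
  have "M \<noteq> {}" using c(1)[of 0] unfolding M_def by auto
  moreover have finM: "finite M" unfolding M_def by auto
  ultimately have "Max M \<in> M" by simp
  define m where "m = Max M"
  have m: "m \<le> n" "c m \<noteq> 0" using \<open>Max M \<in> M\<close> unfolding m_def M_def by auto
  have above: "c i = 0" if "i \<le> n" "i > m" for i
  proof (rule ccontr)
    assume "c i \<noteq> 0"
    then have "i \<in> M" using that unfolding M_def by auto
    then show False using Max_ge[OF finM] that unfolding m_def by fastforce
  qed
  have "(\<Sum>i\<le>n. of_int (c i) * x ^ i) = (\<Sum>i\<le>m. of_int (c i) * x ^ i)"
    using m above by (intro sum.mono_neutral_right) auto
  then have s: "of_int (c m) * x ^ m = - (\<Sum>i<m. of_int (c i) * x ^ i)"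
    using c(2) by (simp add: eq_neg_iff_add_eq_0 add.commute flip: lessThan_Suc_atMost)
  define y where "y = of_int (c m) * x"
  have "m > 0"
  proof (rule Nat.gr0I)
    assume "m = 0"
    then have "of_int (c m) = (0::'k)" using s by simp
    then show False using m by simp
  qed
  then obtain l where l: "m = Suc l" by (cases m) auto
  have "y ^ m = of_int (c m) ^ l * (of_int (c m) * x ^ m)"
    unfolding y_def power_mult_distrib by (simp add: l)
  also have "\<dots> = (\<Sum>i<m. - (of_int (c m) ^ l * (of_int (c i) * x ^ i)))"
    unfolding s by (simp add: sum_distrib_left sum_negf)
  also have "\<dots> = (\<Sum>i<m. of_int (- (c i * c m ^ (l - i))) * y ^ i)"
  proof (intro sum.cong refl)
    fix i assume "i \<in> {..<m}"
    then have "l = (l - i) + i" using l by auto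
    then have "of_int (c m) ^ l = (of_int (c m) ^ (l - i) * of_int (c m) ^ i :: 'k)" by (metis power_add)
    then show "- (of_int (c m) ^ l * (of_int (c i) * x ^ i)) = of_int (- (c i * c m ^ (l - i))) * y ^ i"
      unfolding y_def power_mult_distrib by (simp add: mult_ac)
  qed
  finally have "algebraic_int y"
    unfolding algebraic_int_iff_power_in_span zspan_powers
    by (intro exI[of _ m] CollectI exI[of _ "\<lambda>i. - (c i * c m ^ (l - i))"]) simp
  then have "algebraic_int (of_int (\<bar>c m\<bar>) * x)"
    unfolding y_def by (cases "c m \<ge> 0") (auto simp: abs_if)
  moreover have "of_int \<bar>c m\<bar> = (of_nat (nat \<bar>c m\<bar>) :: 'k)" by simp
  ultimately have "algebraic_int (of_nat (nat \<bar>c m\<bar>) * x)" by (simp only:)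
  then show ?thesis using m(2) by (intro exI[of _ "nat \<bar>c m\<bar>"] conjI) simp_all
qed

lemma as_fraction: "\<exists>a b. algebraic_int a \<and> algebraic_int b \<and> b \<noteq> 0 \<and> (x::'k) = a / b"
proof -
  obtain N :: nat where "N > 0" "algebraic_int (of_nat N * x)" using integral_multiple by blast
  then show ?thesis
    by (intro exI[of _ "of_nat N * x"] exI[of _ "of_nat N"]) auto
qed

text \<open>Plays the role of the norm: the cofactor \<open>y\<close> is an integral multiple of
  \<open>1 / x\<close>.\<close>

lemma divides_integer:
  assumes "(x::'k) \<noteq> 0"
  obtains N y where "N > 0" "algebraic_int y" "x * y = of_nat N"
proof -
  obtain N :: nat where "N > 0" "algebraic_int (of_nat N * (1 / x))" using integral_multiple by blast
  then show ?thesis using assms by (intro that[of N "of_nat N * (1 / x)"]) auto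
qed

text \<open>The integers modulo \<open>p\<close> form a vector space over the field with
  \<open>p\<close> elements, and \<open>indep m e\<close> is linear independence there. A primitive
  relation stays nontrivial modulo \<open>p\<close>, so independent families have at most
  \<open>n\<close> members; a maximal one spans, and \<open>F\<close> collects its combinations with
  coefficients below \<open>p\<close>.\<close>

lemma finite_residues_prime:
  assumes "prime (p::nat)"
  shows "\<exists>F. finite F \<and> F \<subseteq> {x. algebraic_int x} \<and>
    (\<forall>x::'k. algebraic_int x \<longrightarrow> (\<exists>y\<in>F. algebraic_int ((x - y) / of_nat p)))"
proof -
  obtain n where n: "\<And>x::nat \<Rightarrow> 'k. \<exists>c::nat \<Rightarrow> int. (\<forall>p. (\<forall>i\<le>n. p dvd c i) \<longrightarrow> is_unit p) \<and>
    (\<Sum>i\<le>n. of_int (c i) * x i) = 0"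
    using number_field_primitive_relation[OF number_field] by metis
  have p: "p > 0" "p > 1" using assms prime_gt_1_nat prime_gt_0_nat by auto
  define indep where "indep = (\<lambda>m (e::nat \<Rightarrow> 'k). (\<forall>i<m. algebraic_int (e i)) \<and>
    (\<forall>c::nat \<Rightarrow> int. algebraic_int ((\<Sum>i<m. of_int (c i) * e i) / of_nat p) \<longrightarrow> (\<forall>i<m. int p dvd c i)))"
  have bound: "m \<le> n" if ex: "\<exists>e. indep m e" for m
  proof (rule ccontr)
    assume "\<not> m \<le> n"
    obtain e where e: "indep m e" using ex by blast
    obtain c :: "nat \<Rightarrow> int" where c: "\<And>p. (\<forall>i\<le>n. p dvd c i) \<Longrightarrow> is_unit p" "(\<Sum>i\<le>n. of_int (c i) * e i) = 0"
      using n by blast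
    have "(\<Sum>i<m. of_int (if i \<le> n then c i else 0) * e i) = (\<Sum>i\<le>n. of_int (c i) * e i)"
      using \<open>\<not> m \<le> n\<close> by (intro sum.mono_neutral_cong_right) auto
    then have "algebraic_int ((\<Sum>i<m. of_int (if i \<le> n then c i else 0) * e i) / of_nat p)"
      using c(2) by simp
    then have "\<forall>i<m. int p dvd (if i \<le> n then c i else 0)"
      using e[unfolded indep_def, THEN conjunct2, rule_format, of "\<lambda>i. if i \<le> n then c i else 0"] by blast
    then have "int p dvd c i" if i: "i \<le> n" for i
      using i \<open>\<not> m \<le> n\<close> by (auto elim!: allE[of _ i])
    then have "is_unit (int p)" using c(1) by blast
    then show False using p by simp
  qed
  have "indep 0 e" for e unfolding indep_def by simp
  then obtain m where m: "\<exists>e. indep m e" "\<And>m'. \<exists>e. indep m' e \<Longrightarrow> m' \<le> m"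
    using GreatestI_ex_nat[of "\<lambda>m. \<exists>e. indep m e" n] Greatest_le_nat[of "\<lambda>m. \<exists>e. indep m e" _ n] bound
    by blast
  then obtain e where e: "indep m e" by blast
  have ei: "algebraic_int (e i)" if "i < m" for i using e that unfolding indep_def by blast
  define F where "F = (\<lambda>d. \<Sum>i<m. of_int (d i) * e i) ` (PiE {..<m} (\<lambda>_. {0..<int p}))"
  have sumI: "algebraic_int (\<Sum>i<m. of_int (d i) * e i)" for d :: "nat \<Rightarrow> int"
  proof -
    have "algebraic_int (\<Sum>i<k. of_int (d i) * e i)" if "k \<le> m" for k
      using that
    proof (induction k)
      case (Suc k)
      then have "algebraic_int (\<Sum>i<k. of_int (d i) * e i)" "algebraic_int (of_int (d k) * e k)"
        using algebraic_int_times[OF algebraic_int_of_int ei[of k]] by simp_all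
      then show ?case by (simp add: algebraic_int_plus)
    qed simp
    then show ?thesis by blast
  qed
  have "finite F" unfolding F_def by (intro finite_imageI finite_PiE) auto
  moreover have "F \<subseteq> {x. algebraic_int x}" unfolding F_def using sumI by auto
  moreover have "\<exists>y\<in>F. algebraic_int ((x - y) / of_nat p)" if x: "algebraic_int x" for x
  proof -
    have "\<not> indep (Suc m) (e(m := x))" using m(2)[of "Suc m"] by auto
    moreover have "\<forall>i<Suc m. algebraic_int ((e(m := x)) i)" using x ei by auto
    ultimately obtain c :: "nat \<Rightarrow> int" where
      "algebraic_int ((\<Sum>i<Suc m. of_int (c i) * (e(m := x)) i) / of_nat p)"
      and nd: "\<exists>i<Suc m. \<not> int p dvd c i"
      unfolding indep_def by blast
    then have c: "algebraic_int (((\<Sum>i<m. of_int (c i) * e i) + of_int (c m) * x) / of_nat p)" by simp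
    \<comment> \<open>Otherwise the term with \<open>x\<close> could be dropped modulo
      \<open>p\<close>, leaving a nontrivial relation between the independent
      \<open>e i\<close>.\<close>
    have "\<not> int p dvd c m"
    proof
      assume "int p dvd c m"
      then obtain q where q: "c m = int p * q" by blast
      have "(\<Sum>i<m. of_int (c i) * e i) / of_nat p
          = ((\<Sum>i<m. of_int (c i) * e i) + of_int (c m) * x) / of_nat p - of_int q * x"
        using p by (simp add: q field_simps)
      also have "algebraic_int \<dots>" using c x by blast
      finally have "\<forall>i<m. int p dvd c i" using e unfolding indep_def by blast
      then show False using nd \<open>int p dvd c m\<close> by (auto simp: less_Suc_eq)
    qed
    then have "coprime (int p) (c m)" using assms by (simp add: prime_imp_coprime)
    \<comment> \<open>\<open>u\<close> inverts the coefficient of \<open>x\<close> modulo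
      \<open>p\<close>, so \<open>x\<close> is congruent to \<open>- u\<close> times the rest of the
      relation. Reducing those coefficients modulo \<open>p\<close> gives the element
      \<open>y\<close> of \<open>F\<close>.\<close>
    then obtain u w where uw: "u * c m + w * int p = 1"
      using coprime_iff_gcd_eq_1 bezout_int by (metis gcd.commute mult.commute)
    define d where "d = (\<lambda>i\<in>{..<m}. (- u * c i) mod int p)"
    define y where "y = (\<Sum>i<m. of_int (d i) * e i)"
    have "d \<in> PiE {..<m} (\<lambda>_. {0..<int p})" 
    proof (rule PiE_I)
      show "d i \<in> {0..<int p}" if "i \<in> {..<m}" for i
        using that p pos_mod_sign[of "int p"] pos_mod_bound[of "int p"] by (simp add: d_def)
      show "d i = undefined" if "i \<notin> {..<m}" for i using that by (simp add: d_def)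
    qed
    then have "y \<in> F" unfolding F_def y_def by (rule imageI)
    have di: "of_int (d i) * e i = - of_int u * (of_int (c i) * e i) - of_nat p * (of_int ((- u * c i) div int p) * e i)"
      if "i < m" for i
    proof -
      have "d i = - u * c i - int p * ((- u * c i) div int p)"
        using that unfolding d_def by (simp add: minus_mult_div_eq_mod)
      then have "of_int (d i) = (of_int (- u * c i - int p * ((- u * c i) div int p)) :: 'k)" by simp
      then have eq: "of_int (d i) = (- of_int u * of_int (c i) - of_nat p * of_int ((- u * c i) div int p) :: 'k)"
        by simp
      show ?thesis unfolding eq by (simp only: left_diff_distrib mult.assoc)
    qed
    define z where "z = (\<Sum>i<m. of_int ((- u * c i) div int p) * e i)"
    define s where "s = (\<Sum>i<m. of_int (c i) * e i)"
    have y: "y = - of_int u * s - of_nat p * z"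
      unfolding y_def z_def s_def using di by (simp add: sum_subtractf sum_distrib_left sum_negf)
    have "(x - y) / of_nat p = of_int u * ((s + of_int (c m) * x) / of_nat p)
        + (1 - of_int u * of_int (c m)) * x / of_nat p + z"
      unfolding y using p by (simp add: field_simps)
    also have "1 - of_int u * of_int (c m) = (of_int w * of_nat p :: 'k)"
      using arg_cong[OF uw, of "of_int :: int \<Rightarrow> 'k"] by (simp add: algebra_simps)
    finally have "(x - y) / of_nat p = of_int u * ((s + of_int (c m) * x) / of_nat p) + of_int w * x + z"
      using p by simp
    moreover have "algebraic_int z" unfolding z_def by (rule sumI)
    moreover have "algebraic_int (of_int u * ((s + of_int (c m) * x) / of_nat p))" "algebraic_int (of_int w * x)"
      using c x unfolding s_def by (auto simp del: times_divide_eq_right)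
    ultimately have "algebraic_int ((x - y) / of_nat p)" by (simp only: algebraic_int_plus)
    then show ?thesis using \<open>y \<in> F\<close> by blast
  qed
  ultimately show ?thesis by blast
qed

text \<open>Induction on prime factors by digit expansion: a residue modulo \<open>p * N\<close> is
  a residue modulo \<open>p\<close> plus \<open>p\<close> times a residue modulo
  \<open>N\<close>.\<close>

lemma finite_residues:
  assumes "(N::nat) > 0"
  shows "\<exists>F. finite F \<and> F \<subseteq> {x. algebraic_int x} \<and>
    (\<forall>x::'k. algebraic_int x \<longrightarrow> (\<exists>y\<in>F. algebraic_int ((x - y) / of_nat N)))"
  using assms
proof (induction N rule: prime_divisors_induct)
  case zero
  then show ?case by simp
next
  case (unit x)
  then have "x = 1" by simp
  then show ?case by (intro exI[of _ "{0}"]) auto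
next
  case (factor p N)
  then have N: "N > 0" by simp
  obtain F where F: "finite F" "F \<subseteq> {x. algebraic_int x}"
    "\<And>x::'k. algebraic_int x \<Longrightarrow> \<exists>y\<in>F. algebraic_int ((x - y) / of_nat p)"
    using finite_residues_prime[OF factor.hyps(1)] by blast
  obtain G where G: "finite G" "G \<subseteq> {x. algebraic_int x}"
    "\<And>x::'k. algebraic_int x \<Longrightarrow> \<exists>y\<in>G. algebraic_int ((x - y) / of_nat N)"
    using factor.IH[OF N] by blast
  have p: "p > 0" using factor.hyps prime_gt_0_nat by blast
  define H where "H = (\<lambda>(y, z). y + of_nat p * z) ` (F \<times> G)"
  have "\<exists>h\<in>H. algebraic_int ((x - h) / of_nat (p * N))" if x: "algebraic_int x" for x
  proof -
    obtain y where y: "y \<in> F" "algebraic_int ((x - y) / of_nat p)" using F(3)[OF x] by blast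
    obtain z where z: "z \<in> G" "algebraic_int (((x - y) / of_nat p - z) / of_nat N)" using G(3)[OF y(2)] by blast
    have "((x - y) / of_nat p - z) / of_nat N = (x - (y + of_nat p * z)) / of_nat (p * N)"
      using p N by (simp add: field_simps)
    then show ?thesis using y z unfolding H_def by (intro bexI[of _ "y + of_nat p * z"]) auto
  qed
  moreover have "algebraic_int (y + of_nat p * z)" if "y \<in> F" "z \<in> G" for y z
    using F(2) G(2) that by (intro algebraic_int_plus algebraic_int_times) auto
  then have "H \<subseteq> {x. algebraic_int x}" unfolding H_def by auto
  moreover have "finite H" using F(1) G(1) unfolding H_def by simp
  ultimately show ?case by (intro exI[of _ H]) simp
qed

text \<open>Pigeonhole on residues. Applied to sequences of powers it gives complete integral
  closedness, an annihilator argument in \<open>inverse_element\<close>, and inverses modulo a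
  prime.\<close>

lemma residues_repeat:
  assumes "(N::nat) > 0" "\<And>k. algebraic_int (s k :: 'k)"
  obtains i j :: nat where "j < i" "algebraic_int ((s i - s j) / of_nat N)"
proof -
  obtain F where F: "finite F" "F \<subseteq> {x. algebraic_int x}"
    "\<And>x::'k. algebraic_int x \<Longrightarrow> \<exists>y\<in>F. algebraic_int ((x - y) / of_nat N)"
    using finite_residues[OF assms(1)] by blast
  then have "\<forall>k. \<exists>y\<in>F. algebraic_int ((s k - y) / of_nat N)"
    using assms(2) by blast
  then obtain r where r: "\<And>k. r k \<in> F" "\<And>k. algebraic_int ((s k - r k) / of_nat N)"
    by metis
  have "\<not> inj r"
    using F(1) r(1) finite_subset[of "range r" F] finite_imageD[of r UNIV] by auto
  then obtain i j where ij: "i \<noteq> j" "r i = r j" unfolding inj_def by blast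
  have *: "algebraic_int ((s i - s j) / of_nat N)" if "r i = r j" for i j
  proof -
    have "(s i - s j) / of_nat N = (s i - r i) / of_nat N - (s j - r j) / of_nat N"
      using that by (simp add: diff_divide_distrib)
    then show ?thesis using r(2) by (auto intro: algebraic_int_diff)
  qed
  show ?thesis
  proof (cases "j < i")
    case True then show ?thesis using that * ij by blast
  next
    case False
    then have "i < j" using ij by simp
    then show ?thesis using that * ij(2)[symmetric] by blast
  qed
qed

text \<open>As \<open>d\<close> divides some integer \<open>N\<close>, all \<open>N * g ^ k\<close>
  are integral. Two of them agree modulo \<open>N\<close>, and then \<open>g ^ i - g ^ j\<close> is
  integral.\<close>

lemma completely_integrally_closed:
  assumes "(d::'k) \<noteq> 0" "\<And>k. algebraic_int (d * g ^ k)"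
  shows "algebraic_int g"
proof -
  obtain N y where N: "N > 0" "algebraic_int y" "d * y = of_nat N" by (rule divides_integer[OF assms(1)])
  have "algebraic_int (y * (d * g ^ k))" for k using N assms(2) by blast
  moreover have "y * (d * g ^ k) = of_nat N * g ^ k" for k using N(3) by (simp flip: mult.assoc add: mult.commute)
  ultimately have "\<And>k. algebraic_int (of_nat N * g ^ k)" by metis
  then obtain i j :: nat where "j < i" "algebraic_int ((of_nat N * g ^ i - of_nat N * g ^ j) / of_nat N)"
    using residues_repeat[OF N(1), of "\<lambda>k. of_nat N * g ^ k"] by blast
  moreover have "(of_nat N * g ^ i - of_nat N * g ^ j) / of_nat N = g ^ i - g ^ j"
    using N(1) by (simp flip: right_diff_distrib)
  ultimately show ?thesis using algebraic_int_if_power_diff by metis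
qed

end

section \<open>Primes of the ring of integers\<close>

lemma sub_ring_simps [simp]:
  "carrier (sub_ring S) = S" "x \<otimes>\<^bsub>sub_ring S\<^esub> y = x * y" "\<one>\<^bsub>sub_ring S\<^esub> = 1"
  "\<zero>\<^bsub>sub_ring S\<^esub> = 0" "x \<oplus>\<^bsub>sub_ring S\<^esub> y = x + y"
  by (auto simp: sub_ring_def)

locale subring_set =
  fixes S :: "'a::comm_ring_1 set"
  assumes one_mem: "1 \<in> S"
    and diff_mem: "a \<in> S \<Longrightarrow> b \<in> S \<Longrightarrow> a - b \<in> S"
    and mult_mem: "a \<in> S \<Longrightarrow> b \<in> S \<Longrightarrow> a * b \<in> S"
begin

lemma zero_mem: "0 \<in> S" using diff_mem[OF one_mem one_mem] by simp
lemma uminus_mem: "a \<in> S \<Longrightarrow> - a \<in> S" using diff_mem[OF zero_mem, of a] by simp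
lemma add_mem: "a \<in> S \<Longrightarrow> b \<in> S \<Longrightarrow> a + b \<in> S" using diff_mem[of a "-b"] uminus_mem by simp

lemma cring_sub_ring: "cring (sub_ring S)"
proof (rule cringI)
  show "abelian_group (sub_ring S)"
  proof (rule abelian_groupI)
    show "\<exists>y\<in>carrier (sub_ring S). y \<oplus>\<^bsub>sub_ring S\<^esub> x = \<zero>\<^bsub>sub_ring S\<^esub>"
      if "x \<in> carrier (sub_ring S)" for x
      using that uminus_mem by (intro bexI[of _ "- x"]) auto
  qed (auto simp: zero_mem add_mem algebra_simps)
  show "comm_monoid (sub_ring S)"
    by unfold_locales (auto simp: one_mem mult_mem algebra_simps)
qed (auto simp: algebra_simps)

lemma primeideal_sub_ring_iff:
  "primeideal P (sub_ring S) \<longleftrightarrow> P \<subseteq> S \<and> 0 \<in> P \<and> (\<forall>a\<in>P. \<forall>b\<in>P. a + b \<in> P) \<and>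
     (\<forall>a\<in>S. \<forall>b\<in>P. a * b \<in> P) \<and> 1 \<notin> P \<and>
     (\<forall>a\<in>S. \<forall>b\<in>S. a * b \<in> P \<longrightarrow> a \<in> P \<or> b \<in> P)"
  (is "_ \<longleftrightarrow> ?r")
proof
  interpret cring "sub_ring S" by (rule cring_sub_ring)
  assume "primeideal P (sub_ring S)"
  then interpret primeideal P "sub_ring S" .
  have "1 \<notin> P" using one_imp_carrier I_notcarr by auto
  moreover have "P \<subseteq> S" using a_subset by auto
  moreover have "0 \<in> P" using zero_closed by simp
  ultimately show ?r
    using I_prime I_l_closed a_closed by auto
next
  assume r: ?r
  interpret cring "sub_ring S" by (rule cring_sub_ring)
  have neg: "- a \<in> P" if "a \<in> P" for a
  proof -
    have "(- 1) * a \<in> P" using r that uminus_mem[OF one_mem] by blast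
    then show ?thesis by simp
  qed
  have "subgroup P (add_monoid (sub_ring S))"
  proof (rule group.subgroupI)
    show "Group.group (add_monoid (sub_ring S))" by (rule add.is_group)
    show "P \<subseteq> carrier (add_monoid (sub_ring S))" using r by auto
    show "P \<noteq> {}" using r by auto
    show "inv\<^bsub>add_monoid (sub_ring S)\<^esub> a \<in> P" if "a \<in> P" for a
    proof -
      have "inv\<^bsub>add_monoid (sub_ring S)\<^esub> a = - a"
        using r that neg[OF that] by (intro group.inv_equality[OF add.is_group]) auto
      then show ?thesis using neg[OF that] by simp
    qed
    show "a \<otimes>\<^bsub>add_monoid (sub_ring S)\<^esub> b \<in> P" if "a \<in> P" "b \<in> P" for a b
      using r that by auto
  qed
  moreover have "\<forall>a\<in>P. \<forall>b\<in>S. a * b \<in> P" using r by (metis mult.commute)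
  ultimately have "ideal P (sub_ring S)"
    using r by (intro idealI) (auto simp: ring_axioms)
  then show "primeideal P (sub_ring S)"
    using r is_cring one_mem by (intro primeidealI) auto
qed

end

abbreviation integers :: "'k::field_char_0 set" where "integers \<equiv> {x. algebraic_int x}"

interpretation integers: subring_set "integers :: 'k::field_char_0 set"
  by unfold_locales (auto intro: algebraic_int_diff algebraic_int_times)

locale integer_prime = number_field_context K for K :: "'k::field_char_0 itself" +
  fixes P :: "'k set"
  assumes prime: "primeideal P ring_of_integers"
begin

lemmas prime_conds = prime[unfolded ring_of_integers_def integers.primeideal_sub_ring_iff]

lemma integral: "x \<in> P \<Longrightarrow> algebraic_int x" using prime_conds by blast
lemma zero_in: "0 \<in> P" using prime_conds by blast
lemma one_notin: "1 \<notin> P" using prime_conds by blast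
lemma add_in: "x \<in> P \<Longrightarrow> y \<in> P \<Longrightarrow> x + y \<in> P" using prime_conds by blast
lemma mult_in: "algebraic_int x \<Longrightarrow> y \<in> P \<Longrightarrow> x * y \<in> P" using prime_conds by blast
lemma mult_in': "algebraic_int x \<Longrightarrow> y \<in> P \<Longrightarrow> y * x \<in> P" using mult_in by (metis mult.commute)
lemma prime_in: "algebraic_int x \<Longrightarrow> algebraic_int y \<Longrightarrow> x * y \<in> P \<Longrightarrow> x \<in> P \<or> y \<in> P"
  using prime_conds by blast
lemma uminus_in: "x \<in> P \<Longrightarrow> - x \<in> P" using mult_in[of "-1" x] by simp
lemma diff_in: "x \<in> P \<Longrightarrow> y \<in> P \<Longrightarrow> x - y \<in> P" using add_in[of x "-y"] uminus_in by simp
lemma power_in: "algebraic_int x \<Longrightarrow> x ^ n \<in> P \<Longrightarrow> x \<in> P"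
proof (induction n)
  case (Suc n)
  then show ?case using prime_in[of x "x ^ n"] algebraic_int_power by auto
qed (use one_notin in auto)
lemma mult_notin: "algebraic_int x \<Longrightarrow> algebraic_int y \<Longrightarrow> x \<notin> P \<Longrightarrow> y \<notin> P \<Longrightarrow> x * y \<notin> P"
  using prime_in by blast
lemma notin_nonzero: "x \<notin> P \<Longrightarrow> x \<noteq> 0" using zero_in by blast

end

locale nonzero_integer_prime = integer_prime K P
  for K :: "'k::field_char_0 itself" and P :: "'k set" +
  assumes nonzero: "P \<noteq> {0}"
begin

text \<open>A nonzero element of \<open>P\<close> divides a positive integer, which therefore lies
  in \<open>P\<close>; primality of \<open>P\<close> then selects a prime factor.\<close>

lemma rational_prime_in: "\<exists>p::nat. Factorial_Ring.prime p \<and> of_nat p \<in> P"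
proof -
  obtain x where x: "x \<in> P" "x \<noteq> 0" using nonzero zero_in by blast
  obtain N y where N: "N > 0" "algebraic_int y" "x * y = of_nat N" by (rule divides_integer[OF x(2)])
  have "of_nat N \<in> P" using mult_in'[OF N(2) x(1)] N(3) by simp
  with N(1) show ?thesis
  proof (induction N rule: prime_divisors_induct)
    case (unit x)
    then show ?case using one_notin by simp
  next
    case (factor p N)
    then have "of_nat p * of_nat N \<in> P" by simp
    then have "of_nat p \<in> P \<or> of_nat N \<in> P" using prime_in algebraic_int_of_nat by blast
    then show ?case using factor by auto
  qed simp
qed

text \<open>The element \<open>g\<close> stands in for the inverse fractional ideal of \<open>P\<close>. It is \<open>b / p\<close>, with \<open>b\<close> chosen to make
  \<open>{x. p dvd x b}\<close> maximal among the subsets of \<open>P\<close> of this form.\<close>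

lemma inverse_element:
  obtains p :: nat and g where "p > 0" "of_nat p \<in> P" "\<not> algebraic_int g" "\<And>x. x \<in> P \<Longrightarrow> algebraic_int (x * g)"
    "algebraic_int (of_nat p * g)"
proof -
  obtain p :: nat where p: "Factorial_Ring.prime p" "of_nat p \<in> P" using rational_prime_in by blast
  then have p0: "p > 0" by (simp add: prime_gt_0_nat)
  obtain F where F: "finite F" "F \<subseteq> {x. algebraic_int x}"
    "\<And>x::'k. algebraic_int x \<Longrightarrow> \<exists>y\<in>F. algebraic_int ((x - y) / of_nat p)"
    using finite_residues[OF p0] by blast
  \<comment> \<open>\<open>A b\<close> is the annihilator of the class of \<open>b\<close> modulo
    \<open>p\<close>. It depends on that class only, so there are finitely many such sets and a
    maximal one inside \<open>P\<close> exists.\<close>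
  define A where "A = (\<lambda>b::'k. {x. algebraic_int x \<and> algebraic_int (x * b / of_nat p)})"
  have Acong: "A b \<subseteq> A b'" if bb: "algebraic_int ((b - b') / of_nat p)" for b b'
  proof
    fix x assume "x \<in> A b"
    then have x: "algebraic_int x" "algebraic_int (x * b / of_nat p)" unfolding A_def by auto
    have "x * b' / of_nat p = x * b / of_nat p - x * ((b - b') / of_nat p)"
      by (simp add: right_diff_distrib diff_divide_distrib)
    moreover have "algebraic_int \<dots>"
      by (rule algebraic_int_diff[OF x(2) algebraic_int_times[OF x(1) bb]])
    ultimately show "x \<in> A b'" using x(1) unfolding A_def by simp
  qed
  have "\<exists>y\<in>F. A b = A y" if b: "algebraic_int b" for b
  proof -
    obtain y where y: "y \<in> F" "algebraic_int ((b - y) / of_nat p)" using F(3)[OF b] by blast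
    have "(y - b) / of_nat p = - ((b - y) / of_nat p)" by (simp add: minus_divide_left)
    then have "algebraic_int ((y - b) / of_nat p)" using y(2) by (metis algebraic_int_minus)
    then show ?thesis using Acong y by blast
  qed
  then have "A ` {b. algebraic_int b \<and> A b \<subseteq> P} \<subseteq> A ` F" by blast
  then have fin: "finite (A ` {b. algebraic_int b \<and> A b \<subseteq> P})" using F(1) finite_subset by blast
  have "A 1 \<subseteq> P"
  proof
    fix x assume "x \<in> A 1"
    then have "algebraic_int (x / of_nat p)" unfolding A_def by auto
    then have "x / of_nat p * of_nat p \<in> P" using p(2) mult_in by blast
    then show "x \<in> P" using p0 by simp
  qed
  then have "A ` {b. algebraic_int b \<and> A b \<subseteq> P} \<noteq> {}" using algebraic_int_1 by blast
  from finite_has_maximal[OF fin this]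
  obtain M where M: "M \<in> A ` {b. algebraic_int b \<and> A b \<subseteq> P}"
    "\<And>M'. M' \<in> A ` {b. algebraic_int b \<and> A b \<subseteq> P} \<Longrightarrow> M \<subseteq> M' \<Longrightarrow> M = M'"
    unfolding Ball_def by blast
  then obtain b where b: "algebraic_int b" "A b \<subseteq> P" "M = A b" by blast
  have bmax: "A b' = A b" if "algebraic_int b'" "A b' \<subseteq> P" "A b \<subseteq> A b'" for b'
    using M(2)[of "A b'"] b(3) that by blast
  have "x \<in> A b" if x: "x \<in> P" for x
  proof (rule ccontr)
    assume xA: "x \<notin> A b"
    have xi: "algebraic_int x" using integral x by blast
    obtain i j :: nat where ij: "j < i" "algebraic_int ((x ^ i - x ^ j) / of_nat p)"
      by (rule residues_repeat[OF p0, of "\<lambda>k. x ^ k", OF algebraic_int_power[OF xi]])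
    \<comment> \<open>\<open>Q j\<close> says that \<open>b * x ^ j\<close> is killed modulo
      \<open>p\<close> by an element outside \<open>P\<close>. It holds for some \<open>j\<close>:
      powers of \<open>x\<close> repeat modulo \<open>p\<close>, and the killing factor
      \<open>x ^ (i - j) - 1\<close> is outside \<open>P\<close> because \<open>x\<close> is
      inside.\<close>
    define Q where "Q = (\<lambda>j. \<exists>u::'k. algebraic_int u \<and> u \<notin> P \<and> algebraic_int (u * b * x ^ j / of_nat p))"
    have "x * x ^ (i - j - 1) \<in> P" using mult_in'[OF algebraic_int_power[OF xi] x] .
    then have xin: "x ^ (i - j) \<in> P" using ij(1) by (cases "i - j") auto
    have "Q j" unfolding Q_def
    proof (intro exI conjI)
      show "algebraic_int (x ^ (i - j) - 1)"
        by (intro algebraic_int_diff algebraic_int_power xi algebraic_int_1)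
      show "x ^ (i - j) - 1 \<notin> P"
      proof
        assume "x ^ (i - j) - 1 \<in> P"
        from diff_in[OF xin this] show False using one_notin by simp
      qed
      have "x ^ i = x ^ (i - j) * x ^ j" using ij(1) by (simp flip: power_add)
      then have "(x ^ (i - j) - 1) * b * x ^ j / of_nat p = b * ((x ^ i - x ^ j) / of_nat p)"
        by (simp add: algebra_simps)
      then show "algebraic_int ((x ^ (i - j) - 1) * b * x ^ j / of_nat p)"
        using algebraic_int_times[OF b(1) ij(2)] by (simp only:)
    qed
    define l where "l = (LEAST j. Q j)"
    have "Q l" unfolding l_def using \<open>Q j\<close> by (rule LeastI)
    then obtain u where u: "algebraic_int u" "u \<notin> P" "algebraic_int (u * b * x ^ l / of_nat p)"
      unfolding Q_def by blast
    have "l \<noteq> 0"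
    proof
      assume "l = 0"
      then have "u \<in> A b" using u unfolding A_def by simp
      then show False using b(2) u by blast
    qed
    then obtain m where m: "l = Suc m" by (cases l) auto
    then have nQ: "\<not> Q m" using not_less_Least[of m Q] unfolding l_def by simp
    \<comment> \<open>With \<open>l = Suc m\<close> least, an element outside \<open>P\<close>
      killing \<open>b'\<close> would yield \<open>Q m\<close>; so the annihilator of
      \<open>b'\<close> stays in \<open>P\<close>. It contains \<open>A b\<close> and also
      \<open>x\<close>, against maximality.\<close>
    define b' where "b' = u * b * x ^ m"
    have "A b' \<subseteq> P"
    proof
      fix w assume w: "w \<in> A b'"
      show "w \<in> P"
      proof (rule ccontr)
        assume "w \<notin> P"
        have wi: "algebraic_int w" using w unfolding A_def by auto
        have "algebraic_int (w * u)" "w * u \<notin> P"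
          using mult_notin[OF wi u(1) \<open>w \<notin> P\<close> u(2)] algebraic_int_times[OF wi u(1)] by auto
        moreover have "algebraic_int (w * u * b * x ^ m / of_nat p)"
          using w unfolding A_def b'_def by (simp add: mult.assoc)
        ultimately show False using nQ unfolding Q_def by blast
      qed
    qed
    moreover have "A b \<subseteq> A b'"
    proof
      fix w assume "w \<in> A b"
      then have w: "algebraic_int w" "algebraic_int (w * b / of_nat p)" unfolding A_def by auto
      have "w * b' / of_nat p = u * x ^ m * (w * b / of_nat p)" unfolding b'_def by (simp add: mult_ac)
      then show "w \<in> A b'" unfolding A_def
        using w algebraic_int_times[OF algebraic_int_times[OF u(1) algebraic_int_power[OF xi]] w(2)] by (simp only: mem_Collect_eq simp_thms)
    qed
    moreover have "x \<in> A b'" unfolding A_def b'_def using xi u(3) m by (simp add: mult_ac)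
    moreover have "algebraic_int b'" unfolding b'_def by (intro algebraic_int_times algebraic_int_power u b xi)
    ultimately show False using bmax xA by blast
  qed
  then have "\<And>x. x \<in> P \<Longrightarrow> algebraic_int (x * (b / of_nat p))" unfolding A_def by simp
  moreover have "1 \<notin> A b" using b(2) one_notin by blast
  then have "\<not> algebraic_int (b / of_nat p)" unfolding A_def by simp
  moreover have "algebraic_int (of_nat p * (b / of_nat p))" using p0 b by simp
  ultimately show ?thesis using that p0 p(2) by blast
qed

text \<open>If \<open>g\<close> mapped \<open>P\<close> into \<open>P\<close>, all
  \<open>p * g ^ k\<close> would be integral and so would \<open>g\<close>; this gives
  \<open>q\<close> with \<open>q * g\<close> outside \<open>P\<close>. For \<open>x\<close>,
  multiply by \<open>g\<close> as long as the result is integral: the last integral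
  \<open>x * g ^ n\<close> is outside \<open>P\<close>, since \<open>g\<close> maps \<open>P\<close>
  into the integers, and \<open>x * (q * g) ^ n = q ^ n * (x * g ^ n)\<close> is the
  factorization.\<close>

lemma uniformizer_factorization_integral:
  obtains q g where "q \<in> P" "algebraic_int (q * g)" "q * g \<notin> P" "\<And>x. x \<in> P \<Longrightarrow> algebraic_int (x * g)"
    "\<And>x. algebraic_int x \<Longrightarrow> x \<noteq> 0 \<Longrightarrow> \<exists>n a b. algebraic_int a \<and> a \<notin> P \<and> algebraic_int b \<and> b \<notin> P \<and> x * b = q ^ n * a"
proof -
  obtain p :: nat and g where p: "p > 0" "of_nat p \<in> P" and g: "\<not> algebraic_int g"
    "\<And>x. x \<in> P \<Longrightarrow> algebraic_int (x * g)" by (rule inverse_element) blast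
  have "\<exists>q\<in>P. q * g \<notin> P"
  proof (rule ccontr)
    assume "\<not> ?thesis"
    then have step: "q * g \<in> P" if "q \<in> P" for q using that by blast
    have "of_nat p * g ^ k \<in> P" for k
    proof (induction k)
      case (Suc k)
      have "of_nat p * g ^ Suc k = of_nat p * g ^ k * g" by (simp add: mult_ac)
      then show ?case using step[OF Suc] by (simp only:)
    qed (use p in simp)
    then have "algebraic_int (of_nat p * g ^ k)" for k by (rule integral)
    moreover have "(of_nat p :: 'k) \<noteq> 0" using p(1) by simp
    ultimately have "algebraic_int g" using completely_integrally_closed[of "of_nat p" g] by blast
    then show False using g by blast
  qed
  then obtain q where q: "q \<in> P" "q * g \<notin> P" by blast
  have "\<exists>n a b. algebraic_int a \<and> a \<notin> P \<and> algebraic_int b \<and> b \<notin> P \<and> x * b = q ^ n * a"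
    if x: "algebraic_int x" "x \<noteq> 0" for x
  proof -
    have "\<exists>k. \<not> algebraic_int (x * g ^ k)"
      using completely_integrally_closed[OF x(2)] g(1) by blast
    define l where "l = (LEAST k. \<not> algebraic_int (x * g ^ k))"
    have l: "\<not> algebraic_int (x * g ^ l)" unfolding l_def using \<open>\<exists>k. _\<close> by (rule LeastI_ex)
    then have "l \<noteq> 0" using x by (cases l) auto
    then obtain n where n: "l = Suc n" by (cases l) auto
    then have a: "algebraic_int (x * g ^ n)"
      using not_less_Least[of n "\<lambda>k. \<not> algebraic_int (x * g ^ k)"] unfolding l_def by auto
    have "x * g ^ n \<notin> P" using g(2)[of "x * g ^ n"] l n by (auto simp: mult_ac)
    moreover have "x * (q * g) ^ n = q ^ n * (x * g ^ n)" by (simp add: power_mult_distrib mult_ac)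
    moreover have "(q * g) ^ n \<notin> P" using q g power_in by blast
    ultimately show ?thesis using a g(2)[OF q(1)] algebraic_int_power by blast
  qed
  then show ?thesis using that q g by blast
qed

end

section \<open>Localization at a prime, uniformizers and valuations\<close>

definition loc_integers :: "'k::field_char_0 set \<Rightarrow> 'k set" where
  "loc_integers P = {a / b | a b. algebraic_int a \<and> algebraic_int b \<and> b \<notin> P}"

definition loc_ideal :: "'k::field_char_0 set \<Rightarrow> 'k set" where
  "loc_ideal P = {a / b | a b. a \<in> P \<and> algebraic_int b \<and> b \<notin> P}"

context integer_prime
begin

lemma loc_integersI: "algebraic_int a \<Longrightarrow> algebraic_int b \<Longrightarrow> b \<notin> P \<Longrightarrow> a / b \<in> loc_integers P"
  unfolding loc_integers_def by blast

lemma loc_integers_integral: "algebraic_int x \<Longrightarrow> x \<in> loc_integers P"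
  using loc_integersI[of x 1] one_notin by simp

lemma loc_integers_add: "x \<in> loc_integers P \<Longrightarrow> y \<in> loc_integers P \<Longrightarrow> x + y \<in> loc_integers P"
proof -
  assume "x \<in> loc_integers P" "y \<in> loc_integers P"
  then obtain a b c d where *: "x = a / b" "y = c / d" "algebraic_int a" "algebraic_int b" "b \<notin> P"
    "algebraic_int c" "algebraic_int d" "d \<notin> P" unfolding loc_integers_def by blast
  have "x + y = (a * d + c * b) / (b * d)"
    using * notin_nonzero[of b] notin_nonzero[of d] by (simp add: add_frac_eq)
  then show ?thesis using * mult_notin[of b d] by (auto intro!: loc_integersI algebraic_int_plus algebraic_int_times)
qed

lemma loc_integers_mult: "x \<in> loc_integers P \<Longrightarrow> y \<in> loc_integers P \<Longrightarrow> x * y \<in> loc_integers P"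
proof -
  assume "x \<in> loc_integers P" "y \<in> loc_integers P"
  then obtain a b c d where *: "x = a / b" "y = c / d" "algebraic_int a" "algebraic_int b" "b \<notin> P"
    "algebraic_int c" "algebraic_int d" "d \<notin> P" unfolding loc_integers_def by blast
  have "x * y = (a * c) / (b * d)" using * by simp
  then show ?thesis using * mult_notin[of b d] loc_integersI algebraic_int_times by metis
qed

lemma loc_ideal_integral: "algebraic_int x \<Longrightarrow> x \<in> loc_ideal P \<longleftrightarrow> x \<in> P"
proof
  assume x: "algebraic_int x" "x \<in> loc_ideal P"
  then obtain a b where *: "x = a / b" "a \<in> P" "algebraic_int b" "b \<notin> P" unfolding loc_ideal_def by blast
  then have "x * b \<in> P" using notin_nonzero by auto
  then show "x \<in> P" using prime_in x * by blast
qed (use one_notin in \<open>force simp: loc_ideal_def\<close>)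

lemma loc_ideal_subset: "loc_ideal P \<subseteq> loc_integers P"
  unfolding loc_ideal_def loc_integers_def using integral by blast

end

context nonzero_integer_prime
begin

text \<open>The powers of \<open>b\<close> repeat modulo a rational prime in \<open>P\<close>.
  Cancelling \<open>b ^ j\<close>, which is outside \<open>P\<close>, exhibits a power of
  \<open>b\<close> as an inverse.\<close>

lemma inverse_mod:
  assumes "algebraic_int b" "b \<notin> P"
  obtains c where "algebraic_int c" "1 - b * c \<in> P"
proof -
  obtain p :: nat where p: "Factorial_Ring.prime p" "of_nat p \<in> P" using rational_prime_in by blast
  then have p0: "p > 0" by (simp add: prime_gt_0_nat)
  obtain i j :: nat where ij: "j < i" "algebraic_int ((b ^ i - b ^ j) / of_nat p)"
    by (rule residues_repeat[OF p0, of "\<lambda>k. b ^ k", OF algebraic_int_power[OF assms(1)]])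
  have "(b ^ i - b ^ j) / of_nat p * of_nat p \<in> P" by (rule mult_in[OF ij(2) p(2)])
  then have "b ^ i - b ^ j \<in> P" using p0 by simp
  moreover obtain k where k: "i = j + Suc k" using less_imp_Suc_add[OF ij(1)] by auto
  ultimately have "b ^ j * (b * b ^ k - 1) \<in> P" by (simp add: algebra_simps power_add)
  moreover have "algebraic_int (b * b ^ k - 1)" "algebraic_int (b ^ j)"
    using assms(1) by (intro algebraic_int_diff algebraic_int_times algebraic_int_power algebraic_int_1; simp)+
  ultimately have "b * b ^ k - 1 \<in> P" using power_in[OF assms(1), of j] prime_in assms(2) by blast
  then have "1 - b * b ^ k \<in> P" using uminus_in[of "b * b ^ k - 1"] by simp
  then show ?thesis using that algebraic_int_power[OF assms(1)] by blast
qed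

end

text \<open>\<open>q\<close> generates the maximal ideal of the localization at \<open>P\<close>;
  both conditions are stated with denominators cleared, so that they speak of integral
  elements.\<close>

locale integer_prime_uniformizer = nonzero_integer_prime K P
  for K :: "'k::field_char_0 itself" and P :: "'k set" +
  fixes q :: 'k
  assumes q_in: "q \<in> P"
    and uniformizer_dvd: "x \<in> P \<Longrightarrow> \<exists>a b. algebraic_int a \<and> algebraic_int b \<and> b \<notin> P \<and> x * b = q * a"
    and uniformizer_factor: "algebraic_int x \<Longrightarrow> x \<noteq> 0 \<Longrightarrow>
      \<exists>n a b. algebraic_int a \<and> a \<notin> P \<and> algebraic_int b \<and> b \<notin> P \<and> x * b = q ^ n * a"
begin

lemma q_nonzero: "q \<noteq> 0"
proof
  assume "q = 0"
  obtain x where "x \<in> P" "x \<noteq> 0" using nonzero zero_in by blast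
  then show False using uniformizer_dvd[of x] \<open>q = 0\<close> notin_nonzero by auto
qed

text \<open>The order at \<open>P\<close> relative to \<open>q\<close>. As a relation it is visibly
  multiplicative before uniqueness is known; \<open>val_eq\<close> identifies it with
  \<open>val\<close>.\<close>

definition has_ord :: "'k \<Rightarrow> int \<Rightarrow> bool" where
  "has_ord x n \<longleftrightarrow> (\<exists>a b. algebraic_int a \<and> a \<notin> P \<and> algebraic_int b \<and> b \<notin> P \<and> x = q powi n * (a / b))"

lemma has_ordI: "algebraic_int a \<Longrightarrow> a \<notin> P \<Longrightarrow> algebraic_int b \<Longrightarrow> b \<notin> P \<Longrightarrow> x = q powi n * (a / b) \<Longrightarrow> has_ord x n"
  unfolding has_ord_def by blast

lemma has_ord_nonzero: "has_ord x n \<Longrightarrow> x \<noteq> 0"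
  unfolding has_ord_def using notin_nonzero q_nonzero by auto

lemma has_ord_mult: "has_ord x m \<Longrightarrow> has_ord y n \<Longrightarrow> has_ord (x * y) (m + n)"
proof -
  assume "has_ord x m" "has_ord y n"
  then obtain a b c d where *: "x = q powi m * (a / b)" "y = q powi n * (c / d)" "algebraic_int a" "algebraic_int b" "b \<notin> P"
    "algebraic_int c" "algebraic_int d" "d \<notin> P" "a \<notin> P" "c \<notin> P" unfolding has_ord_def by blast
  then have "x * y = q powi (m + n) * ((a * c) / (b * d))" using q_nonzero by (simp add: power_int_add)
  then show ?thesis
    by (rule has_ordI[of "a * c" "b * d", rotated 4]) (use * in \<open>auto intro!: algebraic_int_times simp: mult_notin\<close>)
qed

lemma has_ord_inverse: "has_ord x m \<Longrightarrow> has_ord (inverse x) (- m)"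
proof -
  assume "has_ord x m"
  then obtain a b where *: "x = q powi m * (a / b)" "algebraic_int a" "algebraic_int b" "b \<notin> P" "a \<notin> P"
    unfolding has_ord_def by blast
  then have "inverse x = q powi (- m) * (b / a)" by (simp add: power_int_minus field_simps)
  then show ?thesis using * has_ordI by blast
qed

lemma has_ord_divide: "has_ord x m \<Longrightarrow> has_ord y n \<Longrightarrow> has_ord (x / y) (m - n)"
  using has_ord_mult[OF _ has_ord_inverse, of x m y n] by (simp add: field_simps)

lemma has_ord_nonneg_integral:
  assumes "algebraic_int x" "x \<noteq> 0"
  obtains n :: nat where "has_ord x (int n)" "n > 0 \<longleftrightarrow> x \<in> P"
proof -
  obtain n a b where *: "algebraic_int a" "a \<notin> P" "algebraic_int b" "b \<notin> P" "x * b = q ^ n * a"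
    using uniformizer_factor[OF assms] by blast
  have "x = q powi (int n) * (a / b)" using *(5) notin_nonzero[OF *(4)] by (simp add: field_simps)
  then have "has_ord x (int n)" using * has_ordI by blast
  moreover have "n > 0 \<longleftrightarrow> x \<in> P"
  proof
    assume "n > 0"
    then obtain k where "n = Suc k" by (cases n) auto
    then have "x * b = (q ^ k * a) * q" using * by (simp add: mult_ac)
    also have "\<dots> \<in> P" by (intro mult_in algebraic_int_times algebraic_int_power integral q_in *)
    finally show "x \<in> P" using prime_in assms * by blast
  next
    assume "x \<in> P"
    then have "x * b \<in> P" using mult_in' * by blast
    then show "n > 0" using * by (cases n) auto
  qed
  ultimately show ?thesis using that by blast
qed

text \<open>A unit of the localization cannot have positive order: clearing denominators would put
  the product \<open>a * d\<close> of two elements outside \<open>P\<close> into \<open>P\<close>.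
  This is the core of uniqueness of the order.\<close>

lemma has_ord_pos_diff: 
  assumes "has_ord x (int k)" "x = a / b" "algebraic_int a" "algebraic_int b" "b \<notin> P" "a \<notin> P"
  shows "k = 0"
proof (rule ccontr)
  assume "k \<noteq> 0"
  then obtain l where l: "k = Suc l" by (cases k) auto
  obtain c d where *: "algebraic_int c" "c \<notin> P" "algebraic_int d" "d \<notin> P" "x = q powi (int k) * (c / d)"
    using assms(1) unfolding has_ord_def by blast
  have "a * d = (q ^ l * c * b) * q"
    using *(5) assms(2) notin_nonzero[OF *(4)] notin_nonzero[OF assms(5)] unfolding l
    by (simp only: power_int_of_nat power_Suc) (simp add: field_simps)
  also have "\<dots> \<in> P" by (intro mult_in algebraic_int_times algebraic_int_power integral[OF q_in] q_in * assms)
  finally show False using mult_notin assms * by blast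
qed

lemma has_ord_unique: "has_ord x m \<Longrightarrow> has_ord x n \<Longrightarrow> m = n"
proof -
  have *: "m = n" if "has_ord x m" "has_ord x n" "m \<le> n" for m n
  proof -
    have "has_ord (x / x) (n - m)" using has_ord_divide that by blast
    then have "has_ord 1 (int (nat (n - m)))" using has_ord_nonzero[OF that(1)] that(3) by simp
    then have "nat (n - m) = 0" by (rule has_ord_pos_diff[of 1 _ 1 1]) (use one_notin in auto)
    then show ?thesis using that by simp
  qed
  assume "has_ord x m" "has_ord x n"
  then show ?thesis using *[of m n] *[of n m] by linarith
qed

lemma has_ord_exists: "x \<noteq> 0 \<Longrightarrow> \<exists>n. has_ord x n"
proof -
  assume x: "x \<noteq> 0"
  obtain a b where ab: "algebraic_int a" "algebraic_int b" "b \<noteq> 0" "x = a / b" using as_fraction by blast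
  then have "a \<noteq> 0" using x by auto
  then show ?thesis using ab has_ord_divide has_ord_nonneg_integral by metis
qed

text \<open>Powers of \<open>P\<close> are detected in the localization, where they are generated by
  powers of \<open>q\<close>. This turns the \<open>GREATEST\<close> in \<open>val_int\<close> into
  the order with respect to \<open>q\<close>.\<close>

lemma ideal_power:
  "P [^]\<^bsub>ideals_set ring_of_integers\<^esub> n =
    {x. algebraic_int x \<and> (\<exists>a b. algebraic_int a \<and> algebraic_int b \<and> b \<notin> P \<and> x * b = q ^ n * a)}"
proof -
  define I where "I = (\<lambda>n::nat. P [^]\<^bsub>ideals_set ring_of_integers\<^esub> n)"
  have I0: "I 0 = integers" unfolding I_def by (simp add: nat_pow_def ideals_set_def ring_of_integers_def)
  have IS: "I (Suc n) = ideal_prod ring_of_integers (I n) P" for n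
    unfolding I_def by (simp add: nat_pow_def ideals_set_def)
  interpret R: cring "ring_of_integers :: 'k ring"
    unfolding ring_of_integers_def by (rule integers.cring_sub_ring)
  have Pid: "ideal P ring_of_integers" using prime primeideal.axioms by blast
  have id: "ideal (I n) ring_of_integers" for n
  proof (induction n)
    case 0
    then show ?case using R.oneideal unfolding I0 by (simp add: ring_of_integers_def)
  next
    case (Suc n)
    then show ?case unfolding IS by (rule R.ideal_prod_is_ideal[OF _ Pid])
  qed
  have Iint: "x \<in> I n \<Longrightarrow> algebraic_int x" for x n
    using ideal.Icarr[OF id] by (simp add: ring_of_integers_def)
  have Imult: "a * x \<in> I n" if "x \<in> I n" "algebraic_int a" for a x n
    using ideal.I_l_closed[OF id that(1), of a] that(2) by (simp add: ring_of_integers_def)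
  have Iadd: "x + y \<in> I n" if "x \<in> I n" "y \<in> I n" for x y n
    using additive_subgroup.a_closed[OF ideal.axioms(1)[OF id] that] by (simp add: ring_of_integers_def)
  have Ipow: "x ^ n \<in> I n" if "x \<in> P" for x n
  proof (induction n)
    case 0
    then show ?case unfolding I0 by simp
  next
    case (Suc n)
    then have "x ^ n \<otimes>\<^bsub>ring_of_integers\<^esub> x \<in> I (Suc n)" unfolding IS using that by (rule ideal_prod.prod)
    then show ?case by (simp add: ring_of_integers_def mult.commute)
  qed
  define J where "J = (\<lambda>n x. \<exists>a b. algebraic_int a \<and> algebraic_int b \<and> b \<notin> P \<and> x * b = q ^ n * a)"
  have sub: "J n x" if "x \<in> I n" for n x
    using that
  proof (induction n arbitrary: x)
    case 0
    then show ?case unfolding I0 J_def using one_notin by (intro exI[of _ x] exI[of _ 1]) auto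
  next
    case (Suc n)
    from Suc.prems show ?case unfolding IS
    proof (induction rule: ideal_prod.induct)
      case (prod i j)
      obtain a b where ab: "algebraic_int a" "algebraic_int b" "b \<notin> P" "i * b = q ^ n * a"
        using Suc.IH[OF prod(1)] unfolding J_def by blast
      obtain c d where cd: "algebraic_int c" "algebraic_int d" "d \<notin> P" "j * d = q * c"
        using uniformizer_dvd[OF prod(2)] by blast
      have "i * j * (b * d) = (i * b) * (j * d)" by (simp add: mult_ac)
      also have "\<dots> = q ^ Suc n * (a * c)" unfolding ab cd by (simp add: mult_ac)
      finally have "i \<otimes>\<^bsub>ring_of_integers\<^esub> j * (b * d) = q ^ Suc n * (a * c)"
        by (simp add: ring_of_integers_def)
      then show ?case unfolding J_def
        using ab cd algebraic_int_times mult_notin by metis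
    next
      case (sum s1 s2)
      obtain a b where ab: "algebraic_int a" "algebraic_int b" "b \<notin> P" "s1 * b = q ^ Suc n * a"
        using sum unfolding J_def by blast
      obtain c d where cd: "algebraic_int c" "algebraic_int d" "d \<notin> P" "s2 * d = q ^ Suc n * c"
        using sum unfolding J_def by blast
      have "(s1 + s2) * (b * d) = (s1 * b) * d + (s2 * d) * b" by (simp add: algebra_simps)
      also have "\<dots> = q ^ Suc n * (a * d + c * b)" unfolding ab cd by (simp add: algebra_simps)
      finally have "(s1 \<oplus>\<^bsub>ring_of_integers\<^esub> s2) * (b * d) = q ^ Suc n * (a * d + c * b)"
        by (simp add: ring_of_integers_def)
      moreover have "algebraic_int (a * d + c * b)" "algebraic_int (b * d)" "b * d \<notin> P"
        using ab cd by (auto intro!: algebraic_int_times algebraic_int_plus simp: mult_notin)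
      ultimately show ?case unfolding J_def by blast
    qed
  qed
  have "x \<in> I n" if x: "algebraic_int x" "J n x" for n x
  proof -
    obtain a b where ab: "algebraic_int a" "algebraic_int b" "b \<notin> P" "x * b = q ^ n * a"
      using x(2) unfolding J_def by blast
    obtain c where c: "algebraic_int c" "1 - b * c \<in> P" using inverse_mod[OF ab(2,3)] by blast
    \<comment> \<open>To return from the localization to the integers, \<open>x\<close> is split as
      \<open>x * (1 - r ^ n) + x * r ^ n\<close>. The first term is a multiple of
      \<open>x * b\<close>, hence of \<open>q ^ n\<close>; the second lies in the power of the ideal
      because \<open>r\<close> is in \<open>P\<close>.\<close>
    define r where "r = 1 - b * c"
    have ri: "algebraic_int r" using c integral unfolding r_def by blast
    have si: "algebraic_int (\<Sum>i<m. r ^ i)" for m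
      by (induction m) (simp_all add: algebraic_int_plus algebraic_int_power ri)
    have "1 - r ^ n = b * c * (\<Sum>i<n. r ^ i)" unfolding one_diff_power_eq by (simp add: r_def)
    then have "x * (1 - r ^ n) = (a * c * (\<Sum>i<n. r ^ i)) * q ^ n"
      using ab(4) by (simp add: mult_ac)
    also have "\<dots> \<in> I n"
      by (intro Imult Ipow q_in algebraic_int_times ab c si)
    finally have "x * (1 - r ^ n) + x * r ^ n \<in> I n"
      using Imult[OF Ipow x(1), of r] c(2) Iadd unfolding r_def by blast
    then show ?thesis by (simp add: algebra_simps)
  qed
  then show ?thesis using sub Iint unfolding J_def I_def by blast
qed

lemma val_int_eq:
  assumes "has_ord x (int n)" "algebraic_int x"
  shows "val_int P x = n"
  unfolding val_int_def ideal_power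
proof (rule Greatest_equality)
  obtain a b where *: "algebraic_int a" "a \<notin> P" "algebraic_int b" "b \<notin> P" "x = q powi (int n) * (a / b)"
    using assms(1) unfolding has_ord_def by blast
  have xb: "x * b = q ^ n * a" using *(5) notin_nonzero[OF *(4)] by simp
  show "x \<in> {x. algebraic_int x \<and> (\<exists>a b. algebraic_int a \<and> algebraic_int b \<and> b \<notin> P \<and> x * b = q ^ n * a)}"
    using assms * xb by blast
  fix m
  assume "x \<in> {x. algebraic_int x \<and> (\<exists>a b. algebraic_int a \<and> algebraic_int b \<and> b \<notin> P \<and> x * b = q ^ m * a)}"
  then obtain c d where cd: "algebraic_int c" "algebraic_int d" "d \<notin> P" "x * d = q ^ m * c" by blast
  have "c \<noteq> 0" using cd(4) has_ord_nonzero[OF assms(1)] notin_nonzero[OF cd(3)] by auto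
  then obtain l where l: "has_ord c (int l)" using has_ord_nonneg_integral[OF cd(1)] by metis
  have "has_ord d 0" using cd one_notin by (intro has_ordI[of d 1]) auto
  moreover have "has_ord (q ^ m) (int m)" using one_notin by (intro has_ordI[of 1 1]) auto
  ultimately have "has_ord (q ^ m * c / d) (int m + int l - 0)" using l has_ord_mult has_ord_divide by blast
  moreover have "q ^ m * c / d = x" using cd(4) notin_nonzero[OF cd(3)] by (simp add: field_simps)
  ultimately have "int m + int l = int n" using has_ord_unique assms(1) by auto
  then show "m \<le> n" by linarith
qed

lemma val_eq:
  assumes "has_ord x n"
  shows "val P x = n"
  unfolding val_def
proof (rule the_equality)
  \<comment> \<open>Every representation as a fraction computes the order of the same element, so
    uniqueness of orders makes the \<open>THE\<close> in \<open>val\<close> well defined.\<close>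
  have all: "has_ord (a / b) (int (val_int P a) - int (val_int P b))"
    if "algebraic_int a" "algebraic_int b" "a \<noteq> 0" "b \<noteq> 0" for a b
    using that val_int_eq has_ord_nonneg_integral[of a] has_ord_nonneg_integral[of b] has_ord_divide by metis
  obtain a b where ab: "algebraic_int a" "algebraic_int b" "b \<noteq> 0" "x = a / b" using as_fraction by blast
  moreover have "a \<noteq> 0" using ab has_ord_nonzero[OF assms] by auto
  ultimately have "has_ord x (int (val_int P a) - int (val_int P b))" using all[of a b] by simp
  then have "n = int (val_int P a) - int (val_int P b)" using has_ord_unique assms by blast
  then show "\<exists>a b. algebraic_int a \<and> algebraic_int b \<and> a \<noteq> 0 \<and> b \<noteq> 0 \<and> x = a / b \<and>
      n = int (val_int P a) - int (val_int P b)"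
    using ab \<open>a \<noteq> 0\<close> by blast
  fix m assume "\<exists>a b. algebraic_int a \<and> algebraic_int b \<and> a \<noteq> 0 \<and> b \<noteq> 0 \<and> x = a / b \<and>
      m = int (val_int P a) - int (val_int P b)"
  then obtain a b where "algebraic_int a" "algebraic_int b" "a \<noteq> 0" "b \<noteq> 0" "x = a / b"
      "m = int (val_int P a) - int (val_int P b)" by blast
  then have "has_ord x m" using all[of a b] by simp
  then show "m = n" using has_ord_unique assms by blast
qed

end

context nonzero_integer_prime
begin

lemma uniformizer_exists: "\<exists>q. integer_prime_uniformizer K P q"
proof -
  obtain q g where qg: "q \<in> P" "algebraic_int (q * g)" "q * g \<notin> P" "\<And>x. x \<in> P \<Longrightarrow> algebraic_int (x * g)"
    "\<And>x. algebraic_int x \<Longrightarrow> x \<noteq> 0 \<Longrightarrow> \<exists>n a b. algebraic_int a \<and> a \<notin> P \<and> algebraic_int b \<and> b \<notin> P \<and> x * b = q ^ n * a"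
    by (rule uniformizer_factorization_integral) blast
  have "integer_prime_uniformizer K P q"
  proof
    show "\<exists>a b. algebraic_int a \<and> algebraic_int b \<and> b \<notin> P \<and> x * b = q * a" if "x \<in> P" for x
      using qg(2,3) qg(4)[OF that] by (intro exI[of _ "x * g"] exI[of _ "q * g"]) (auto simp: mult_ac)
  qed (use qg in auto)
  then show ?thesis ..
qed

lemma val_mult: "x \<noteq> 0 \<Longrightarrow> y \<noteq> 0 \<Longrightarrow> val P (x * y) = val P x + val P y"
proof -
  obtain q where "integer_prime_uniformizer K P q" using uniformizer_exists by blast
  then interpret integer_prime_uniformizer K P q .
  assume "x \<noteq> 0" "y \<noteq> 0"
  then show ?thesis using has_ord_exists val_eq has_ord_mult by metis
qed

lemma val_nonneg_iff: "x \<noteq> 0 \<Longrightarrow> val P x \<ge> 0 \<longleftrightarrow> x \<in> loc_integers P"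
  and val_pos_iff: "x \<noteq> 0 \<Longrightarrow> val P x > 0 \<longleftrightarrow> x \<in> loc_ideal P"
proof -
  obtain q where "integer_prime_uniformizer K P q" using uniformizer_exists by blast
  then interpret integer_prime_uniformizer K P q .
  have ord0: "has_ord b 0" if "algebraic_int b" "b \<notin> P" for b
    using that one_notin by (intro has_ordI[of b 1]) auto
  assume x: "x \<noteq> 0"
  obtain n where n: "has_ord x n" using has_ord_exists[OF x] by blast
  then obtain a b where ab: "algebraic_int a" "a \<notin> P" "algebraic_int b" "b \<notin> P" "x = q powi n * (a / b)"
    unfolding has_ord_def by blast
  have qi: "algebraic_int q" using integral q_in by blast
  have x': "x = q ^ nat n * a / b" if "n \<ge> 0" using ab that by (simp add: power_int_def)
  have n1: "n \<ge> 0 \<Longrightarrow> x \<in> loc_integers P"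
    using x' ab qi by (auto intro!: loc_integersI algebraic_int_times algebraic_int_power simp del: times_divide_eq_right)
  have n2: "x \<in> loc_ideal P" if "n > 0"
  proof -
    have "q ^ nat n * a = (q ^ (nat n - 1) * a) * q" using that by (cases "nat n") auto
    also have "\<dots> \<in> P" by (intro mult_in algebraic_int_times algebraic_int_power qi ab q_in)
    finally show ?thesis unfolding loc_ideal_def using x' that ab by (intro CollectI exI[of _ "q ^ nat n * a"] exI[of _ b]) simp
  qed
  have n3: "n \<ge> 0 \<and> (c \<in> P \<longrightarrow> n > 0)" if cd: "x = c / d" "algebraic_int c" "algebraic_int d" "d \<notin> P" for c d
  proof -
    have "c \<noteq> 0" using x cd by auto
    then obtain m :: nat where m: "has_ord c (int m)" "m > 0 \<longleftrightarrow> c \<in> P" using has_ord_nonneg_integral cd by metis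
    then have "has_ord x (int m - 0)" unfolding cd(1) using has_ord_divide ord0 cd by blast
    then show ?thesis using has_ord_unique[OF n] m by fastforce
  qed
  show "val P x \<ge> 0 \<longleftrightarrow> x \<in> loc_integers P" unfolding val_eq[OF n]
    using n1 n3 unfolding loc_integers_def by blast
  show "val P x > 0 \<longleftrightarrow> x \<in> loc_ideal P" unfolding val_eq[OF n]
    using n2 n3 integral unfolding loc_ideal_def by blast
qed

section \<open>The absolute value of a nonzero prime\<close>

definition prime_abs :: "'k \<Rightarrow> real" where
  "prime_abs = (\<lambda>x. if x = 0 then 0 else (1 / 2) powi val P x)"

lemma half_powi_le_1: "((1/2)::real) powi n \<le> 1 \<longleftrightarrow> n \<ge> 0" "((1/2)::real) powi n < 1 \<longleftrightarrow> n > 0"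
proof -
  have "((1/2)::real) powi n < 1" if "n > 0"
  proof -
    obtain m where "n = int (Suc m)" using \<open>n > 0\<close> by (metis gr0_conv_Suc zero_less_imp_eq_int)
    then show ?thesis using power_Suc_less_one[of "1/2::real" m] by (simp only: power_int_of_nat)
  qed
  moreover have "((1/2)::real) powi n > 1" if "n < 0"
  proof -
    obtain m where "- n = int (Suc m)" using \<open>n < 0\<close> by (metis gr0_conv_Suc zero_less_imp_eq_int neg_0_less_iff_less)
    then have n: "n = - int (Suc m)" by simp
    have "((1/2)::real) powi n = 2 ^ Suc m" unfolding n by (simp only: power_int_minus power_int_of_nat) (simp add: power_divide)
    then show ?thesis using one_less_power[of "2::real" "Suc m"] by simp
  qed
  moreover have "((1/2)::real) powi n = 1" if "n = 0" using that by simp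
  ultimately show "((1/2)::real) powi n \<le> 1 \<longleftrightarrow> n \<ge> 0" "((1/2)::real) powi n < 1 \<longleftrightarrow> n > 0"
    by (smt (verit))+
qed

lemma prime_abs_le_1: "prime_abs x \<le> 1 \<longleftrightarrow> x \<in> loc_integers P"
  unfolding prime_abs_def using val_nonneg_iff[of x] half_powi_le_1 loc_integers_integral[of 0] by auto

lemma prime_abs_less_1: "prime_abs x < 1 \<longleftrightarrow> x \<in> loc_ideal P"
  unfolding prime_abs_def using val_pos_iff[of x] half_powi_le_1 loc_ideal_integral[of 0] zero_in by auto

lemma prime_abs_mult: "prime_abs (x * y) = prime_abs x * prime_abs y"
  unfolding prime_abs_def using val_mult by (auto simp: power_int_add)

lemma prime_abs_eq_0: "prime_abs x = 0 \<longleftrightarrow> x = 0"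
  unfolding prime_abs_def by auto

lemma prime_abs_nonneg: "prime_abs x \<ge> 0"
  unfolding prime_abs_def by auto

text \<open>Division by the larger element reduces the ultrametric inequality to closure of
  \<open>loc_integers P\<close> under adding \<open>1\<close>.\<close>

lemma prime_abs_max: "prime_abs (x + y) \<le> max (prime_abs x) (prime_abs y)"
proof -
  have *: "prime_abs (x + y) \<le> prime_abs y" if "prime_abs x \<le> prime_abs y" for x y
  proof (cases "y = 0")
    case True
    then show ?thesis using that prime_abs_eq_0[of x] prime_abs_nonneg[of x] prime_abs_eq_0[of 0] by auto
  next
    case False
    then have py: "prime_abs y > 0" using prime_abs_eq_0[of y] prime_abs_nonneg[of y] by linarith
    have "prime_abs x = prime_abs (x / y) * prime_abs y" using False by (simp flip: prime_abs_mult)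
    then have "prime_abs (x / y) * prime_abs y \<le> 1 * prime_abs y" using that by simp
    then have "prime_abs (x / y) \<le> 1" using py by (rule mult_right_le_imp_le)
    then have "x / y \<in> loc_integers P" using prime_abs_le_1 by blast
    then have "x / y + 1 \<in> loc_integers P" using loc_integers_add loc_integers_integral[of 1] by simp
    then have "prime_abs (x / y + 1) \<le> 1" using prime_abs_le_1 by blast
    moreover have "prime_abs (x + y) = prime_abs (x / y + 1) * prime_abs y"
      using False by (simp add: distrib_right flip: prime_abs_mult)
    ultimately show ?thesis using py by (simp add: mult_left_le_one_le prime_abs_nonneg)
  qed
  show ?thesis using *[of x y] *[of y x] by (cases "prime_abs x \<le> prime_abs y") (auto simp: add.commute)
qed

lemma prime_abs_absolute_value: "absolute_value prime_abs"
  unfolding absolute_value_def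
  using prime_abs_nonneg prime_abs_eq_0 prime_abs_mult prime_abs_max
  by (smt (verit, best))

lemma prime_abs_nonarchimedean: "nonarchimedean prime_abs"
  unfolding nonarchimedean_def using prime_abs_max by blast

lemma prime_place_eq: "prime_place P = av_equiv `` {prime_abs}"
  unfolding prime_place_def prime_abs_def using nonzero by simp

end

section \<open>Absolute values and weak approximation\<close>

locale abs_value =
  fixes v :: "'k::field_char_0 \<Rightarrow> real"
  assumes absolute_value: "absolute_value v"
begin

lemma nonneg [simp]: "v x \<ge> 0"
  and eq_0 [simp]: "v x = 0 \<longleftrightarrow> x = 0"
  and mult: "v (x * y) = v x * v y"
  and triangle: "v (x + y) \<le> v x + v y"
  using absolute_value unfolding absolute_value_def by auto

lemma zero [simp]: "v 0 = 0" by simp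

lemma pos: "x \<noteq> 0 \<Longrightarrow> v x > 0" using eq_0[of x] nonneg[of x] by linarith

lemma one [simp]: "v 1 = 1"
proof -
  have "v 1 * v 1 = v 1 * 1" by (simp flip: mult)
  then show ?thesis by simp
qed

lemma uminus [simp]: "v (- x) = v x"
proof -
  have "v (- 1) * v (- 1) = 1" by (simp flip: mult)
  then have "(v (- 1))\<^sup>2 = 1" by (simp add: power2_eq_square)
  then have "v (- 1) = 1" using nonneg[of "- 1"] by (simp add: power2_eq_1_iff)
  then show ?thesis using mult[of "- 1" x] by simp
qed

lemma power: "v (x ^ n) = v x ^ n" by (induction n) (auto simp: mult)

lemma inverse: "v (inverse x) = inverse (v x)"
proof (cases "x = 0")
  case False
  then have "v (inverse x) * v x = 1" by (simp flip: mult)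
  then show ?thesis by (metis inverse_unique mult.commute)
qed auto

lemma divide: "v (x / y) = v x / v y" by (simp add: divide_inverse mult inverse)

lemma powi: "v (x powi n) = v x powi n"
  by (simp add: power_int_def power inverse)

lemma diff_ge: "v x - v y \<le> v (x + y)" using triangle[of "x + y" "- y"] by simp

lemma sum_le: "v (\<Sum>i\<in>A. g i) \<le> (\<Sum>i\<in>A. v (g i))"
proof (induction A rule: infinite_finite_induct)
  case (insert x A)
  then show ?case using triangle[of "g x" "sum g A"] by simp
qed auto

lemma of_nat_le: "v (of_nat n) \<le> real n"
proof (induction n)
  case (Suc n)
  then show ?case using triangle[of 1 "of_nat n"] by simp
qed simp

end

text \<open>Exponential growth beats linear growth. Applied to \<open>k\<close>-th powers it removes
  the linear factors that the following estimates accumulate.\<close>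

lemma power_le_linear_imp_le_1:
  fixes t C D :: real
  assumes "t \<ge> 0" "\<And>k::nat. t ^ k \<le> C * real k + D"
  shows "t \<le> 1"
proof (rule ccontr)
  assume "\<not> t \<le> 1"
  then have t: "t > 1" by simp
  have "(\<lambda>k. (C * real k + D) / t ^ k) \<longlonglongrightarrow> 0"
    using t by real_asymp
  then have "eventually (\<lambda>k. (C * real k + D) / t ^ k < 1) sequentially"
    by (rule order_tendstoD) simp
  then obtain k where "(C * real k + D) / t ^ k < 1" by (auto simp: eventually_sequentially)
  then have "C * real k + D < t ^ k" using t by (simp add: divide_less_eq)
  then show False using assms(2)[of k] by linarith
qed

lemma power_le_linear_imp_le:
  fixes t s C D :: real
  assumes "t \<ge> 0" "s > 0" "\<And>k::nat. t ^ k \<le> (C * real k + D) * s ^ k"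
  shows "t \<le> s"
proof -
  have "(t / s) ^ k \<le> C * real k + D" for k
    using assms(2) assms(3)[of k] by (simp add: power_divide divide_le_eq)
  then have "t / s \<le> 1" using assms by (intro power_le_linear_imp_le_1[of "t / s" C D]) auto
  then show ?thesis using assms by simp
qed

context abs_value
begin

text \<open>In the binomial expansion of the \<open>k\<close>-th power of \<open>x + y\<close> the
  coefficients have value at most \<open>1\<close>, leaving the factor \<open>k + 1\<close>, which
  disappears on passing to \<open>k\<close>-th roots.\<close>

lemma nonarchimedean_if_bounded:
  assumes "\<And>n. v (of_nat n) \<le> 1"
  shows "nonarchimedean v"
  unfolding nonarchimedean_def
proof (intro allI)
  fix x y
  define M where "M = max (v x) (v y)"
  have M: "v x \<le> M" "v y \<le> M" "M \<ge> 0" unfolding M_def using nonneg[of x] by (auto simp del: nonneg)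
  show "v (x + y) \<le> M"
  proof (cases "M = 0")
    case True
    then show ?thesis using M triangle[of x y] by simp
  next
    case False
    have "v (x + y) ^ k \<le> (1 * real k + 1) * M ^ k" for k
    proof -
      have "v (x + y) ^ k = v (\<Sum>i\<le>k. of_nat (k choose i) * x ^ i * y ^ (k - i))"
        by (simp flip: power add: binomial_ring)
      also have "\<dots> \<le> (\<Sum>i\<le>k. v (of_nat (k choose i) * x ^ i * y ^ (k - i)))" by (rule sum_le)
      also have "\<dots> \<le> (\<Sum>i\<le>k. M ^ k)"
      proof (rule sum_mono)
        fix i assume i: "i \<in> {..k}"
        have "v (of_nat (k choose i) * x ^ i * y ^ (k - i)) \<le> 1 * M ^ i * M ^ (k - i)"
          unfolding mult power using M assms by (intro mult_mono power_mono) auto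
        also have "\<dots> = M ^ k" using i by (simp flip: power_add)
        finally show "v (of_nat (k choose i) * x ^ i * y ^ (k - i)) \<le> M ^ k" .
      qed
      finally show ?thesis by (simp add: add.commute)
    qed
    moreover have "M > 0" using M False by linarith
    ultimately show ?thesis using power_le_linear_imp_le[OF nonneg, of M _ 1 1] by blast
  qed
qed

text \<open>Ostrowski's estimate: \<open>x\<close> has at most \<open>L\<close> digits in base
  \<open>n\<close>, and each digit has value at most \<open>n\<close>.\<close>

lemma of_nat_digits_le:
  fixes n :: nat
  assumes "n \<ge> 2" "x < n ^ L"
  shows "v (of_nat x) \<le> real L * real n * max 1 (v (of_nat n)) ^ L"
  using assms(2)
proof (induction L arbitrary: x)
  case (Suc L)
  define M where "M = max 1 (v (of_nat n))"
  have M: "M \<ge> 1" "v (of_nat n) \<le> M" unfolding M_def by auto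
  have "x div n < n ^ L" using Suc.prems assms(1) by (simp add: less_mult_imp_div_less mult.commute)
  then have IH: "v (of_nat (x div n)) \<le> real L * real n * M ^ L" using Suc.IH unfolding M_def by blast
  have "x = n * (x div n) + x mod n" by simp
  then have "v (of_nat x) = v (of_nat n * of_nat (x div n) + of_nat (x mod n))"
    by (metis of_nat_add of_nat_mult)
  also have "\<dots> \<le> v (of_nat n) * v (of_nat (x div n)) + v (of_nat (x mod n))"
    using triangle mult by metis
  also have "\<dots> \<le> M * (real L * real n * M ^ L) + real n * M ^ Suc L"
  proof (intro add_mono mult_mono M IH)
    have "v (of_nat (x mod n)) \<le> real (x mod n)" by (rule of_nat_le)
    also have "\<dots> \<le> real n * 1" using assms(1) by (simp add: less_imp_le)
    also have "\<dots> \<le> real n * M ^ Suc L" using M(1) by (intro mult_left_mono one_le_power) auto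
    finally show "v (of_nat (x mod n)) \<le> real n * M ^ Suc L" .
  qed (use M in auto)
  also have "\<dots> = real (Suc L) * real n * M ^ Suc L" by (simp add: algebra_simps)
  finally show ?case unfolding M_def .
qed simp

text \<open>\<open>m ^ k\<close> has at most \<open>k + 1\<close> digits in base \<open>n\<close>,
  so the digit estimate holds up to a factor linear in \<open>k\<close>.\<close>

lemma of_nat_le_max:
  assumes "(n::nat) \<ge> 2" "m \<le> n"
  shows "v (of_nat m) \<le> max 1 (v (of_nat n))"
proof -
  define M where "M = max 1 (v (of_nat n))"
  have "v (of_nat m) ^ k \<le> (real n * M * real k + real n * M) * M ^ k" for k
  proof -
    have "m ^ k \<le> n ^ k" using assms by (intro power_mono) auto
    also have "\<dots> < n ^ Suc k" using assms by simp
    finally have "v (of_nat (m ^ k)) \<le> real (Suc k) * real n * M ^ Suc k"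
      unfolding M_def using of_nat_digits_le[OF assms(1)] by blast
    then show ?thesis by (simp add: power algebra_simps)
  qed
  moreover have "M > 0" unfolding M_def by linarith
  ultimately show ?thesis unfolding M_def[symmetric]
    using power_le_linear_imp_le[OF nonneg, of M _ "real n * M" "real n * M"] by blast
qed

text \<open>If some \<open>n \<ge> 2\<close> had value at most \<open>1\<close>, writing
  \<open>m ^ k\<close> in base \<open>n\<close> would bound its value linearly in \<open>k\<close>.
  Then every natural number has value at most \<open>1\<close>, which makes \<open>v\<close>
  non-archimedean.\<close>

lemma archimedean_gt_1:
  assumes "\<not> nonarchimedean v" "(n::nat) \<ge> 2"
  shows "v (of_nat n) > 1"
proof (rule ccontr)
  assume n: "\<not> v (of_nat n) > 1"
  have "v (of_nat m) \<le> 1" for m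
  proof (rule power_le_linear_imp_le_1[of _ "real m * real n" "real n"])
    fix k
    \<comment> \<open>A crude bound on the number of digits: \<open>m ^ k\<close> has at most
      \<open>m * k + 1\<close> of them.\<close>
    have "m < n ^ m" using assms(2)
      by (meson less_exp less_le_trans power_mono zero_le)
    then have "m ^ k \<le> (n ^ m) ^ k" by (intro power_mono) auto
    also have "\<dots> < n ^ (m * k + 1)" using assms(2) by (simp add: power_mult)
    finally have "v (of_nat (m ^ k)) \<le> real (m * k + 1) * real n * max 1 (v (of_nat n)) ^ (m * k + 1)"
      using of_nat_digits_le[OF assms(2)] by blast
    also have "max 1 (v (of_nat n)) = 1" using n by simp
    finally show "v (of_nat m) ^ k \<le> real m * real n * real k + real n"
      by (simp add: power algebra_simps)
  qed simp
  then show False using nonarchimedean_if_bounded assms(1) by blast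
qed

text \<open>Lets the integer of largest ordinary absolute value dominate at all archimedean places
  simultaneously.\<close>

lemma archimedean_mono:
  assumes "\<not> nonarchimedean v" "(m::nat) \<le> n"
  shows "v (of_nat m) \<le> v (of_nat n)"
proof (cases "n \<ge> 2")
  case True
  then show ?thesis using of_nat_le_max[OF True assms(2)] archimedean_gt_1[OF assms(1) True] by simp
next
  case False
  then have "n = 0 \<or> n = 1" by linarith
  then show ?thesis using assms(2) by (auto simp: le_Suc_eq)
qed

lemma of_int_abs: "v (of_int c) = v (of_nat (nat \<bar>c\<bar>))"
  by (cases "c \<ge> 0") (auto simp: abs_if)

lemma nonarchimedean_of_nat: "nonarchimedean v \<Longrightarrow> v (of_nat n) \<le> 1"
proof (induction n)
  case (Suc n)
  then have "v (1 + of_nat n) \<le> max (v 1) (v (of_nat n))" unfolding nonarchimedean_def by blast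
  then show ?case using Suc by simp
qed simp

lemma nonarchimedean_of_int: "nonarchimedean v \<Longrightarrow> v (of_int n) \<le> 1"
  using nonarchimedean_of_nat of_int_abs[of n] by presburger

lemma nonarchimedean_sum:
  assumes "nonarchimedean v" "C \<ge> 0" "\<And>i. i \<in> A \<Longrightarrow> v (g i) \<le> C"
  shows "v (\<Sum>i\<in>A. g i) \<le> C"
  using assms(3)
proof (induction A rule: infinite_finite_induct)
  case (insert x A)
  have "v (g x + sum g A) \<le> max (v (g x)) (v (sum g A))" using assms(1) unfolding nonarchimedean_def by blast
  then show ?case using insert by fastforce
qed (use assms(2) in auto)

text \<open>If the value exceeded \<open>1\<close>, the leading term of an integral equation would
  be strictly larger than all the others.\<close>

lemma nonarchimedean_integral:
  assumes "nonarchimedean v" "algebraic_int x"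
  shows "v x \<le> 1"
proof (rule ccontr)
  assume "\<not> v x \<le> 1"
  then have x: "v x > 1" by simp
  obtain m c where c: "x ^ m = (\<Sum>i<m. of_int (c i) * x ^ i)"
    using assms(2) unfolding algebraic_int_iff_power_in_span zspan_powers by blast
  then have "m > 0" by (cases m) auto
  have "v x ^ m \<le> v x ^ (m - 1)"
    unfolding power[symmetric] c
  proof (rule nonarchimedean_sum[OF assms(1)])
    fix i assume "i \<in> {..<m}"
    then have "v (of_int (c i) * x ^ i) \<le> 1 * v x ^ (m - 1)"
      unfolding mult power using nonarchimedean_of_int[OF assms(1)] x by (intro mult_mono power_increasing) auto
    then show "v (of_int (c i) * x ^ i) \<le> v (x ^ (m - 1))" by (simp add: power)
  qed simp
  moreover have "v x ^ (m - 1) < v x ^ m" using x \<open>m > 0\<close> by (intro power_strict_increasing) auto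
  ultimately show False by simp
qed

end

section \<open>Places as equivalence classes of absolute values\<close>

lemma equiv_av_equiv: "equiv {v. absolute_value v} av_equiv"
proof (rule equivI)
  show "av_equiv \<subseteq> {v. absolute_value v} \<times> {v. absolute_value v}" unfolding av_equiv_def by auto
  show "refl_on {v. absolute_value v} av_equiv"
  proof (rule refl_onI)
    fix v assume "v \<in> {v. absolute_value v}"
    then have v: "absolute_value v" by simp
    then have "\<forall>x. v x = v x powr 1" unfolding absolute_value_def by (auto simp: powr_one_gt_zero_iff)
    then show "(v, v) \<in> av_equiv" unfolding av_equiv_def using v by (auto intro!: exI[of _ "1::real"])
  qed
  show "sym av_equiv"
  proof (rule symI)
    fix v w assume "(v, w) \<in> av_equiv"
    then obtain r where vw: "absolute_value v" "absolute_value w" "r > 0" "\<And>x. w x = v x powr r"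
      unfolding av_equiv_def by blast
    have "\<forall>x. v x = w x powr (1 / r)"
      using vw(1,3) unfolding vw(4) absolute_value_def by (auto simp: powr_powr powr_one_gt_zero_iff)
    then show "(w, v) \<in> av_equiv" unfolding av_equiv_def using vw by (auto intro!: exI[of _ "1 / r"])
  qed
  show "trans av_equiv"
  proof (rule transI)
    fix u v w assume "(u, v) \<in> av_equiv" "(v, w) \<in> av_equiv"
    then obtain r s where *: "absolute_value u" "absolute_value w" "r > 0" "s > 0"
      "\<And>x. v x = u x powr r" "\<And>x. w x = v x powr s"
      unfolding av_equiv_def by blast
    then have "\<forall>x. w x = u x powr (r * s)" by (simp add: powr_powr)
    then show "(u, w) \<in> av_equiv" unfolding av_equiv_def using * by (auto intro!: exI[of _ "r * s"])
  qed
qed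

lemma av_equiv_sym: "(v, w) \<in> av_equiv \<Longrightarrow> (w, v) \<in> av_equiv"
  using equiv_av_equiv by (meson equivE symE)

lemma av_equiv_le_1: "(v, w) \<in> av_equiv \<Longrightarrow> v x \<le> 1 \<longleftrightarrow> w x \<le> 1"
  and av_equiv_less_1: "(v, w) \<in> av_equiv \<Longrightarrow> v x < 1 \<longleftrightarrow> w x < 1"
proof -
  have *: "v x \<le> 1 \<Longrightarrow> w x \<le> 1" "v x < 1 \<Longrightarrow> w x < 1" if vw: "(v, w) \<in> av_equiv" for v w x
  proof -
    obtain r where r: "absolute_value v" "r > 0" "w x = v x powr r" using vw unfolding av_equiv_def by blast
    have v: "v x \<ge> 0" using r(1) unfolding absolute_value_def by blast
    show "v x \<le> 1 \<Longrightarrow> w x \<le> 1" using v r powr_mono2[of r "v x" 1] by simp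
    show "v x < 1 \<Longrightarrow> w x < 1" using v r powr_less_mono2[of r "v x" 1] by simp
  qed
  assume "(v, w) \<in> av_equiv"
  then show "v x \<le> 1 \<longleftrightarrow> w x \<le> 1" "v x < 1 \<longleftrightarrow> w x < 1" using * av_equiv_sym by blast+
qed

lemma places_eq: "\<aa> \<in> places \<Longrightarrow> v \<in> \<aa> \<Longrightarrow> \<aa> = av_equiv `` {v}"
proof -
  assume "\<aa> \<in> places" "v \<in> \<aa>"
  then obtain w where w: "\<aa> = av_equiv `` {w}" "(w, v) \<in> av_equiv"
    unfolding places_def by (auto elim!: quotientE)
  then show ?thesis using equiv_class_eq[OF equiv_av_equiv w(2)] by simp
qed

lemma places_absolute_value: "\<aa> \<in> places \<Longrightarrow> v \<in> \<aa> \<Longrightarrow> absolute_value v"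
  unfolding places_def using equiv_av_equiv by (metis in_quotient_imp_subset mem_Collect_eq subsetD)

lemma places_nonempty: "\<aa> \<in> places \<Longrightarrow> \<exists>v. v \<in> \<aa>"
  unfolding places_def using in_quotient_imp_non_empty[OF equiv_av_equiv] by blast

lemma places_equiv: "\<aa> \<in> places \<Longrightarrow> v \<in> \<aa> \<Longrightarrow> w \<in> \<aa> \<Longrightarrow> (v, w) \<in> av_equiv"
  using places_eq by blast

lemma places_same: "\<aa> \<in> places \<Longrightarrow> \<bb> \<in> places \<Longrightarrow> v \<in> \<aa> \<Longrightarrow> w \<in> \<bb> \<Longrightarrow> (v, w) \<in> av_equiv \<Longrightarrow> \<aa> = \<bb>"
  using places_eq[of \<aa> v] places_eq[of \<bb> w] equiv_class_eq[OF equiv_av_equiv, of v w] by simp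

lemma places_class: "absolute_value v \<Longrightarrow> av_equiv `` {v} \<in> places"
  unfolding places_def by (simp add: quotientI)

lemma in_class: "absolute_value v \<Longrightarrow> v \<in> av_equiv `` {v}"
  by (rule equiv_class_self[OF equiv_av_equiv]) simp

lemma place_ring_iff: "\<aa> \<in> places \<Longrightarrow> v \<in> \<aa> \<Longrightarrow> x \<in> place_ring \<aa> \<longleftrightarrow> v x \<le> 1"
  and place_ideal_iff: "\<aa> \<in> places \<Longrightarrow> v \<in> \<aa> \<Longrightarrow> x \<in> place_ideal \<aa> \<longleftrightarrow> v x < 1"
  unfolding place_ring_def place_ideal_def
  using places_equiv av_equiv_le_1 av_equiv_less_1 by blast+

lemma na_places_iff: "\<aa> \<in> places \<Longrightarrow> v \<in> \<aa> \<Longrightarrow> \<aa> \<in> na_places \<longleftrightarrow> nonarchimedean v"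
proof -
  assume a: "\<aa> \<in> places" "v \<in> \<aa>"
  have "nonarchimedean w" if na: "nonarchimedean v" "w \<in> \<aa>" for w
  proof -
    obtain r where r: "absolute_value v" "r > 0" "\<And>x. w x = v x powr r"
      using places_equiv[OF a na(2)] unfolding av_equiv_def by blast
    have "w (x + y) \<le> max (w x) (w y)" for x y
    proof -
      have "v (x + y) powr r \<le> max (v x) (v y) powr r"
        using r(1,2) na(1) unfolding nonarchimedean_def absolute_value_def by (intro powr_mono2) auto
      then show ?thesis unfolding r(3) by (cases "v x \<le> v y") (auto simp: max_def split: if_splits)
    qed
    then show ?thesis unfolding nonarchimedean_def by blast
  qed
  then show ?thesis using a unfolding na_places_def by blast
qed

text \<open>The exponent is \<open>r = ln (w y) / ln (v y)\<close>. For other \<open>x\<close>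
  compare \<open>a = ln (v x) / ln (v y)\<close> with the same ratio \<open>b\<close> for
  \<open>w\<close>. Domination applied to the elements \<open>x powi n * y powi m\<close> transfers
  \<open>n * a + m < 0\<close> to \<open>n * b + m < 0\<close>, which a rational number strictly
  between \<open>a\<close> and \<open>b\<close> would contradict.\<close>

lemma dominated_imp_equiv:
  assumes "absolute_value v" "absolute_value w" "v y > 1" and dom: "\<And>x. v x < 1 \<Longrightarrow> w x < 1"
  shows "(v, w :: 'k::field_char_0 \<Rightarrow> real) \<in> av_equiv"
proof -
  interpret v: abs_value v by unfold_locales fact
  interpret w: abs_value w by unfold_locales fact
  have y0: "y \<noteq> 0" using assms(3) by auto
  have "v (inverse y) < 1" unfolding v.inverse using assms(3) by (simp add: inverse_less_1_iff)
  then have "inverse (w y) < 1" using dom w.inverse by metis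
  then have wy: "w y > 1" using w.pos[OF y0] by (simp add: inverse_less_1_iff)
  define r where "r = ln (w y) / ln (v y)"
  have lv: "ln (v y) > 0" and lw: "ln (w y) > 0" using assms(3) wy by auto
  then have r: "r > 0" unfolding r_def by simp
  have "w x = v x powr r" for x
  proof (cases "x = 0")
    case False
    define a b where "a = ln (v x) / ln (v y)" and "b = ln (w x) / ln (w y)"
    have ln_z: "ln (u (x powi n * y powi m)) = of_int n * ln (u x) + of_int m * ln (u y)"
      if "abs_value u" for u n m
    proof -
      interpret u: abs_value u by fact
      have "u (x powi n * y powi m) = u x powr of_int n * u y powr of_int m"
        using u.pos[OF False] u.pos[OF y0] False y0 by (simp add: u.mult u.powi powr_real_of_int')
      also have "ln \<dots> = of_int n * ln (u x) + of_int m * ln (u y)"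
        using u.pos[OF False] u.pos[OF y0] False y0 by (simp add: ln_mult ln_powr)
      finally show ?thesis .
    qed
    have key: "of_int n * ln (w x) + of_int m * ln (w y) < 0" if "of_int n * ln (v x) + of_int m * ln (v y) < 0" for n m :: int
    proof -
      define z where "z = x powi n * y powi m"
      have z0: "z \<noteq> 0" unfolding z_def using False y0 by simp
      have "ln (v z) < 0" using that unfolding z_def by (simp add: ln_z v.abs_value_axioms)
      then have "w z < 1" using dom v.pos[OF z0] by simp
      then have "ln (w z) < 0" using w.pos[OF z0] by simp
      then show ?thesis unfolding z_def by (simp add: ln_z w.abs_value_axioms)
    qed
    have av: "ln (v x) = a * ln (v y)" and bw: "ln (w x) = b * ln (w y)"
      unfolding a_def b_def using lv lw by auto
    have key': "of_int n * b + of_int m < 0" if "of_int n * a + of_int m < 0" for n m :: int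
    proof -
      have "(of_int n * a + of_int m) * ln (v y) < 0" using that lv by (simp add: mult_neg_pos)
      then have "of_int n * ln (v x) + of_int m * ln (v y) < 0" unfolding av by (simp add: algebra_simps)
      then have "(of_int n * b + of_int m) * ln (w y) < 0" using key[of n m] unfolding bw by (simp add: algebra_simps)
      then show ?thesis using lw by (simp add: mult_less_0_iff)
    qed
    have "a = b"
    proof (rule ccontr)
      assume "a \<noteq> b"
      obtain s where s: "s \<in> \<rat>" "(a < s \<and> s < b) \<or> (b < s \<and> s < a)"
        using \<open>a \<noteq> b\<close> Rats_dense_in_real[of a b] Rats_dense_in_real[of b a] by (meson linorder_neqE_linordered_idom)
      obtain m n :: int where mn: "n > 0" "s = of_int m / of_int n" using Rats_cases'[OF s(1)] by metis
      have 1: "of_int n * c + of_int (- m) < 0 \<longleftrightarrow> c < s" "of_int (- n) * c + of_int m < 0 \<longleftrightarrow> s < c" for c :: real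
        unfolding mn(2) using mn(1) by (auto simp: field_simps)
      show False using s(2) key'[of n "- m"] key'[of "- n" m] unfolding 1 by linarith
    qed
    then have "ln (w x) = r * ln (v x)" using av bw lv unfolding r_def by simp
    then have "exp (ln (w x)) = v x powr r" using False by (simp add: powr_def)
    then show ?thesis using w.pos[OF False] by simp
  qed (use r in simp)
  then show ?thesis unfolding av_equiv_def using assms r by blast
qed

section \<open>Separation of inequivalent absolute values\<close>

definition nontrivial :: "('k::field_char_0 \<Rightarrow> real) \<Rightarrow> bool" where
  "nontrivial v \<longleftrightarrow> (\<exists>x. x \<noteq> 0 \<and> v x \<noteq> 1)"

lemma nontrivial_gt_1: "absolute_value v \<Longrightarrow> nontrivial v \<Longrightarrow> \<exists>x. v x > 1"
proof -
  assume "absolute_value v" "nontrivial v"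
  then interpret abs_value v by unfold_locales
  obtain x where x: "x \<noteq> 0" "v x \<noteq> 1" using \<open>nontrivial v\<close> unfolding nontrivial_def by blast
  show ?thesis
  proof (cases "v x > 1")
    case False
    then have "v (inverse x) > 1" unfolding inverse using x pos[OF x(1)] by (simp add: one_less_inverse_iff)
    then show ?thesis ..
  qed auto
qed

text \<open>Domination fails in both directions; a witness of one failure divided by a witness of
  the other separates.\<close>

lemma separate_two:
  assumes "absolute_value v" "absolute_value w" "nontrivial v" "nontrivial w" "(v, w) \<notin> av_equiv"
  shows "\<exists>z. v z > 1 \<and> w z < 1"
proof -
  interpret v: abs_value v by unfold_locales fact
  interpret w: abs_value w by unfold_locales fact
  obtain x where x: "v x < 1" "w x \<ge> 1"
    using dominated_imp_equiv[OF assms(1,2)] nontrivial_gt_1 assms by (metis not_le)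
  obtain y where y: "w y < 1" "v y \<ge> 1"
    using dominated_imp_equiv[OF assms(2,1)] nontrivial_gt_1 assms av_equiv_sym by (metis not_le)
  have "x \<noteq> 0" "y \<noteq> 0" using x y by auto
  then have "v (y / x) > 1" "w (y / x) < 1"
    unfolding v.divide w.divide using x y v.pos[of x] w.pos[of x] by (auto simp: field_simps)
  then show ?thesis by blast
qed

lemma eventually_mult_power_less:
  fixes a b c :: real
  assumes "0 \<le> a" "a < 1" "c > 0"
  shows "eventually (\<lambda>m. a ^ m * b < c) sequentially"
proof -
  have "(\<lambda>m. a ^ m * b) \<longlonglongrightarrow> 0 * b" using assms by (intro tendsto_mult LIMSEQ_realpow_zero) auto
  then show ?thesis using assms(3) by (intro order_tendstoD) auto
qed

context abs_value
begin

text \<open>The element \<open>y\<^sup>m / (1 + y\<^sup>m)\<close> tends to \<open>1\<close> where \<open>y\<close> is large and to \<open>0\<close> where it is small.\<close>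

lemma eventually_quotient_small:
  assumes "v y < 1" "c > 0"
  shows "eventually (\<lambda>m. v (y ^ m / (1 + y ^ m)) * b < c) sequentially"
proof -
  define d where "d = c / (2 * \<bar>b\<bar> + 2)"
  have d: "d > 0" using assms(2) unfolding d_def by simp
  have "eventually (\<lambda>m. v y ^ m * 1 < min (1/2) d \<and> m > 0) sequentially"
    using eventually_mult_power_less[of "v y" "min (1/2) d" 1] assms d
    by (intro eventually_conj eventually_gt_at_top) auto
  then show ?thesis
  proof eventually_elim
    case (elim m)
    have "v (1 + y ^ m) \<ge> v 1 - v (y ^ m)" using diff_ge by blast
    then have 1: "v (1 + y ^ m) \<ge> 1 / 2" using elim by (simp add: power)
    have "v (y ^ m / (1 + y ^ m)) \<le> d / (1 / 2)"
      unfolding divide power using elim 1 d by (intro frac_le) auto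
    then have "v (y ^ m / (1 + y ^ m)) * \<bar>b\<bar> \<le> 2 * d * \<bar>b\<bar>" by (intro mult_right_mono) auto
    also have "\<dots> < c" unfolding d_def using assms(2) by (simp add: field_simps)
    finally have "v (y ^ m / (1 + y ^ m)) * \<bar>b\<bar> < c" .
    moreover have "v (y ^ m / (1 + y ^ m)) * b \<le> v (y ^ m / (1 + y ^ m)) * \<bar>b\<bar>" by (intro mult_left_mono) auto
    ultimately show ?case by linarith
  qed
qed

lemma eventually_quotient_near_1:
  assumes "v y > 1" "c > 0"
  shows "eventually (\<lambda>m. v (y ^ m / (1 + y ^ m) - 1) < c) sequentially"
proof -
  have "(\<lambda>m. 1 / (v y ^ m - 1)) \<longlonglongrightarrow> 0" using assms(1) by real_asymp
  then have "eventually (\<lambda>m. 1 / (v y ^ m - 1) < c \<and> m > 0) sequentially"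
    using assms by (intro eventually_conj eventually_gt_at_top order_tendstoD) auto
  then show ?thesis
  proof eventually_elim
    case (elim m)
    have "v y ^ m > 1" using elim assms by (intro one_less_power) auto
    moreover have "v (1 + y ^ m) \<ge> v (y ^ m) - v 1" using diff_ge[of "y ^ m" 1] by (simp add: add.commute)
    ultimately have 1: "v (1 + y ^ m) \<ge> v y ^ m - 1" "v y ^ m - 1 > 0" by (auto simp: power)
    then have nz: "1 + y ^ m \<noteq> 0" using eq_0[of "1 + y ^ m"] by linarith
    then have "y ^ m / (1 + y ^ m) - 1 = - (1 / (1 + y ^ m))" by (simp add: field_simps)
    then have "v (y ^ m / (1 + y ^ m) - 1) = 1 / v (1 + y ^ m)" by (simp only: uminus divide one)
    also have "\<dots> \<le> 1 / (v y ^ m - 1)" using 1 by (intro divide_left_mono) auto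
    finally show ?case using elim by linarith
  qed
qed

end

text \<open>Induction, with \<open>y\<close> good for \<open>F\<close> and \<open>z\<close>
  separating \<open>v\<close> from the new \<open>w\<close>. If \<open>w y \<le> 1\<close>, a high
  power of \<open>y\<close> times \<open>z\<close> works. If \<open>w y > 1\<close>, powers of
  \<open>y\<close> would spoil \<open>w\<close>, and the factor \<open>y ^ m / (1 + y ^ m)\<close>
  is used: it is near \<open>1\<close> at \<open>v\<close> and \<open>w\<close> and near
  \<open>0\<close> on \<open>F\<close>.\<close>

lemma separate_many:
  assumes "finite F" "absolute_value v" "nontrivial v"
    "\<And>w. w \<in> F \<Longrightarrow> absolute_value w \<and> nontrivial w \<and> (v, w) \<notin> av_equiv"
  shows "\<exists>x. v x > 1 \<and> (\<forall>w\<in>F. w x < 1)"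
  using assms(1,4)
proof (induction F rule: finite_induct)
  case empty
  then show ?case using nontrivial_gt_1 assms by auto
next
  case (insert w F)
  interpret v: abs_value v by unfold_locales fact
  interpret w: abs_value w using insert by unfold_locales auto
  have av: "abs_value u" if "u \<in> F" for u using insert.prems that by unfold_locales auto
  obtain y where y: "v y > 1" "\<forall>w\<in>F. w y < 1" using insert by auto
  obtain z where z: "v z > 1" "w z < 1" using separate_two[of v w] assms insert.prems by blast
  show ?case
  proof (cases "w y \<le> 1")
    case True
    have "\<forall>u\<in>F. eventually (\<lambda>m. u y ^ m * u z < 1) sequentially"
      using y(2) av abs_value.nonneg by (intro ballI eventually_mult_power_less) auto
    then have "eventually (\<lambda>m. \<forall>u\<in>F. u y ^ m * u z < 1) sequentially"
      using insert.hyps(1) by (simp add: eventually_ball_finite)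
    then obtain m where m: "\<forall>u\<in>F. u y ^ m * u z < 1" by (auto simp: eventually_sequentially)
    have "v (y ^ m * z) > 1"
    proof -
      have "1 * v z \<le> v y ^ m * v z" using y(1) by (intro mult_right_mono one_le_power) auto
      then show ?thesis using z(1) unfolding v.mult v.power by linarith
    qed
    moreover have "w (y ^ m * z) < 1"
    proof -
      have "w y ^ m * w z \<le> 1 * w z" using True by (intro mult_right_mono power_le_one) auto
      then show ?thesis using z(2) by (simp add: w.mult w.power)
    qed
    moreover have "u (y ^ m * z) < 1" if "u \<in> F" for u
    proof -
      interpret u: abs_value u using av that .
      show ?thesis using m that by (simp add: u.mult u.power)
    qed
    ultimately show ?thesis by blast
  next
    case False
    then have wy: "w y > 1" by simp
    have 1: "eventually (\<lambda>m. \<forall>u\<in>F. u (y ^ m / (1 + y ^ m)) * u z < 1) sequentially"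
      using insert.hyps(1) y(2) av
      by (intro eventually_ball_finite ballI abs_value.eventually_quotient_small) auto
    \<comment> \<open>The margins are chosen so that \<open>v t > 1 - (v z - 1) / (2 * v z)\<close>
      gives \<open>v t * v z > (v z + 1) / 2\<close>, which exceeds \<open>1\<close>, while
      \<open>w t \<le> 1 + (1 - w z) / 2\<close> still gives \<open>w t * w z < 1\<close>.\<close>
    have 2: "eventually (\<lambda>m. w (y ^ m / (1 + y ^ m) - 1) < (1 - w z) / 2) sequentially"
      using z(2) by (intro w.eventually_quotient_near_1 wy) auto
    have 3: "eventually (\<lambda>m. v (y ^ m / (1 + y ^ m) - 1) < (v z - 1) / (2 * v z)) sequentially"
      using z(1) by (intro v.eventually_quotient_near_1 y) auto
    from eventually_conj[OF 1 eventually_conj[OF 2 3]] obtain m where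
      m: "\<forall>u\<in>F. u (y ^ m / (1 + y ^ m)) * u z < 1" "w (y ^ m / (1 + y ^ m) - 1) < (1 - w z) / 2"
       "v (y ^ m / (1 + y ^ m) - 1) < (v z - 1) / (2 * v z)" by (auto simp: eventually_sequentially)
    define t where "t = y ^ m / (1 + y ^ m)"
    have "v t \<ge> 1 - v (t - 1)" using v.diff_ge[of 1 "t - 1"] by simp
    then have "v t > 1 - (v z - 1) / (2 * v z)" using m(3) unfolding t_def by linarith
    then have "v t * v z > (1 - (v z - 1) / (2 * v z)) * v z" using z(1) by simp
    also have "(1 - (v z - 1) / (2 * v z)) * v z = (v z + 1) / 2"
    proof -
      have "v z \<noteq> 0" using z(1) by linarith
      then have "(v z - 1) / (2 * v z) * v z = (v z - 1) / 2" by (simp del: v.eq_0)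
      then show ?thesis unfolding left_diff_distrib by (simp add: field_simps)
    qed
    finally have "v (t * z) > 1" using z(1) by (simp add: v.mult)
    moreover have "w (t * z) < 1"
    proof -
      have "w t \<le> 1 + w (t - 1)" using w.triangle[of 1 "t - 1"] by simp
      then have "w t \<le> 1 + (1 - w z) / 2" using m(2) unfolding t_def by linarith
      then have "w t * w z \<le> (1 + (1 - w z) / 2) * w z" by (intro mult_right_mono) auto
      also have "\<dots> < 1"
      proof -
        have "(w z - 1) * (w z - 2) > 0" using z(2) by (intro mult_neg_neg) auto
        then have "w z * 3 - w z * w z < 2" by (simp add: algebra_simps)
        then have "(w z * 3 - w z * w z) / 2 < 1" by simp
        moreover have "(1 + (1 - w z) / 2) * w z = (w z * 3 - w z * w z) / 2"
          by (simp add: field_simps)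
        ultimately show ?thesis by (simp only:)
      qed
      finally show ?thesis by (simp add: w.mult)
    qed
    moreover have "u (t * z) < 1" if "u \<in> F" for u
    proof -
      interpret u: abs_value u using av that .
      show ?thesis using m that unfolding t_def u.mult by blast
    qed
    ultimately show ?thesis by blast
  qed
qed

lemma weak_approximation:
  assumes "finite F" "absolute_value v" "nontrivial v"
    "\<And>w. w \<in> F \<Longrightarrow> absolute_value w \<and> nontrivial w \<and> (v, w) \<notin> av_equiv" "e > 0"
  shows "\<exists>x. v (x - 1) < e \<and> (\<forall>w\<in>F. w x < e)"
proof -
  obtain y where y: "v y > 1" "\<forall>w\<in>F. w y < 1" using separate_many[OF assms(1-4)] by blast
  interpret v: abs_value v by unfold_locales fact
  have av: "abs_value u" if "u \<in> F" for u using assms(4) that by unfold_locales auto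
  have 1: "eventually (\<lambda>m. \<forall>u\<in>F. u (y ^ m / (1 + y ^ m)) * 1 < e) sequentially"
    using assms(1,5) y(2) av abs_value.eventually_quotient_small by (intro eventually_ball_finite) blast+
  have 2: "eventually (\<lambda>m. v (y ^ m / (1 + y ^ m) - 1) < e) sequentially"
    by (intro v.eventually_quotient_near_1 y assms)
  from eventually_conj[OF 1 2] show ?thesis by (auto simp: eventually_sequentially)
qed

section \<open>Finiteness of the set of places where an element is not a unit\<close>

context number_field_context
begin

text \<open>By weak approximation, inequivalent places admit elements \<open>x\<^sub>i\<close> close to \<open>1\<close> at the \<open>i\<close>-th place and
  to \<open>0\<close> at the others. A primitive integral relation between them is contradicted at the place whose own
  coefficient dominates.\<close>

lemma finite_places_if_dominated:
  assumes A: "\<A> \<subseteq> places" "\<And>\<aa> v. \<aa> \<in> \<A> \<Longrightarrow> v \<in> \<aa> \<Longrightarrow> nontrivial v"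
    and dom: "\<And>n (c::nat \<Rightarrow> int). (\<And>p. (\<forall>i\<le>n. p dvd c i) \<Longrightarrow> is_unit p) \<Longrightarrow>
      \<exists>j\<le>n. c j \<noteq> 0 \<and> (\<forall>\<aa>\<in>\<A>. \<forall>v\<in>\<aa>. \<forall>i\<le>n. v (of_int (c i) :: 'k) \<le> v (of_int (c j)))"
  shows "finite \<A>"
proof (rule ccontr)
  assume "infinite \<A>"
  obtain n where n: "\<And>x::nat \<Rightarrow> 'k. \<exists>c::nat \<Rightarrow> int. (\<forall>p. (\<forall>i\<le>n. p dvd c i) \<longrightarrow> is_unit p) \<and>
    (\<Sum>i\<le>n. of_int (c i) * x i) = 0"
    using number_field_primitive_relation[OF number_field] by metis
  obtain a :: "nat \<Rightarrow> 'k place" where a: "inj a" "range a \<subseteq> \<A>"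
    using infinite_countable_subset[OF \<open>infinite \<A>\<close>] by blast
  then have aA: "a i \<in> \<A>" "a i \<in> places" for i using A by auto
  define w where "w = (\<lambda>i. SOME v. v \<in> a i)"
  have w: "w i \<in> a i" for i unfolding w_def using places_nonempty[OF aA(2)] by (rule someI_ex)
  have wav: "absolute_value (w i)" for i using places_absolute_value[OF aA(2) w] .
  then have wab: "abs_value (w i)" for i by unfold_locales
  have wne: "(w i, w j) \<notin> av_equiv" if "i \<noteq> j" for i j
    using places_same[OF aA(2) aA(2) w w, of i j] a(1) that by (auto dest: injD)
  \<comment> \<open>The relation will give \<open>w j (x j) \<le> n * e\<close>, the approximation
    \<open>w j (x j) > 1 - e\<close>; together these need \<open>(n + 1) * e > 1\<close>.\<close>
  define e where "e = 1 / (real n + 2)"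
  have e: "e > 0" unfolding e_def by simp
  have "\<exists>x. w i (x - 1) < e \<and> (\<forall>u\<in>w ` ({..n} - {i}). u x < e)" for i
    using wav A(2)[OF aA(1) w] wne e by (intro weak_approximation) auto
  then obtain x where x: "\<And>i. w i (x i - 1) < e" "\<And>i j. j \<le> n \<Longrightarrow> j \<noteq> i \<Longrightarrow> w j (x i) < e"
    by (metis (no_types, lifting) Diff_iff atMost_iff image_eqI singletonD)
  obtain c :: "nat \<Rightarrow> int" where c: "\<And>p. (\<forall>i\<le>n. p dvd c i) \<Longrightarrow> is_unit p"
    "(\<Sum>i\<le>n. of_int (c i) * x i) = 0" using n by blast
  from dom[OF c(1)] obtain j where j': "j \<le> n" "c j \<noteq> 0"
      "\<forall>\<aa>\<in>\<A>. \<forall>v\<in>\<aa>. \<forall>i\<le>n. v (of_int (c i) :: 'k) \<le> v (of_int (c j))" by blast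
  have j: "j \<le> n" "c j \<noteq> 0" "\<And>v i. v \<in> a j \<Longrightarrow> i \<le> n \<Longrightarrow> v (of_int (c i)) \<le> v (of_int (c j))"
    using j'(1,2) j'(3)[rule_format, OF aA(1)] by auto
  interpret v: abs_value "w j" by (rule wab)
  define M where "M = w j (of_int (c j))"
  have M: "M > 0" unfolding M_def using j(2) by (intro v.pos) simp
  have "(\<Sum>i\<le>n. of_int (c i) * x i) = of_int (c j) * x j + (\<Sum>i\<in>{..n} - {j}. of_int (c i) * x i)"
    using j(1) by (intro sum.remove) auto
  then have "of_int (c j) * x j = - (\<Sum>i\<in>{..n} - {j}. of_int (c i) * x i)"
    using c(2) by (simp add: eq_neg_iff_add_eq_0)
  then have "M * w j (x j) = w j (\<Sum>i\<in>{..n} - {j}. of_int (c i) * x i)"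
    unfolding M_def by (metis v.mult v.uminus)
  also have "\<dots> \<le> (\<Sum>i\<in>{..n} - {j}. w j (of_int (c i) * x i))" by (rule v.sum_le)
  also have "\<dots> \<le> (\<Sum>i\<in>{..n} - {j}. M * e)"
  proof (rule sum_mono)
    fix i assume i: "i \<in> {..n} - {j}"
    then show "w j (of_int (c i) * x i) \<le> M * e"
      unfolding v.mult M_def using j(3)[OF w, of i] x(2)[of j i] j(1) by (intro mult_mono) auto
  qed
  also have "\<dots> = M * (real n * e)" using j(1) by simp
  finally have "w j (x j) \<le> real n * e" using M by simp
  moreover have "w j (x j) > 1 - e"
    using v.diff_ge[of 1 "x j - 1"] x(1)[of j] by simp
  ultimately have "1 < (real n + 1) * e" by (simp add: algebra_simps)
  then show False unfolding e_def by (simp add: field_simps)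
qed

text \<open>The dominating coefficient is the one of largest ordinary absolute value; by
  \<open>archimedean_mono\<close> it serves all archimedean places.\<close>

lemma finite_archimedean_places: "finite (places - na_places :: 'k place set)"
proof (rule finite_places_if_dominated)
  have arch: "abs_value v" "\<not> nonarchimedean v" if "\<aa> \<in> places - na_places" "v \<in> \<aa>" for \<aa> :: "'k place" and v
    using that na_places_iff places_absolute_value by (auto simp: abs_value_def)
  show "nontrivial v" if "\<aa> \<in> places - na_places" "v \<in> \<aa>" for \<aa> :: "'k place" and v
    using abs_value.archimedean_gt_1[OF arch[OF that], of 2] unfolding nontrivial_def
    by (intro exI[of _ 2]) auto
  fix n and c :: "nat \<Rightarrow> int"
  assume c: "\<And>p. (\<forall>i\<le>n. p dvd c i) \<Longrightarrow> is_unit p"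
  define m where "m = Max ((\<lambda>i. \<bar>c i\<bar>) ` {..n})"
  have "m \<in> (\<lambda>i. \<bar>c i\<bar>) ` {..n}" unfolding m_def by (intro Max_in) auto
  then obtain j where j: "j \<le> n" "m = \<bar>c j\<bar>" by auto
  have le: "\<bar>c i\<bar> \<le> \<bar>c j\<bar>" if "i \<le> n" for i unfolding j(2)[symmetric] m_def using that by (intro Max_ge) auto
  have "c j \<noteq> 0"
  proof
    assume "c j = 0"
    then have "\<forall>i\<le>n. 0 dvd c i" using le by auto
    then show False using c[of 0] by simp
  qed
  moreover have "v (of_int (c i)) \<le> v (of_int (c j))"
    if "\<aa> \<in> places - na_places" "v \<in> \<aa>" "i \<le> n" for \<aa> and v :: "'k \<Rightarrow> real" and i
    using abs_value.archimedean_mono[OF arch[OF that(1,2)], of "nat \<bar>c i\<bar>" "nat \<bar>c j\<bar>"] le[OF that(3)]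
    unfolding abs_value.of_int_abs[OF arch(1)[OF that(1,2)]] by simp
  ultimately show "\<exists>j\<le>n. c j \<noteq> 0 \<and> (\<forall>\<aa>\<in>places - na_places. \<forall>v\<in>\<aa>. \<forall>i\<le>n.
      v (of_int (c i) :: 'k) \<le> v (of_int (c j)))"
    using j(1) by blast
qed auto

text \<open>Some coefficient \<open>c j\<close> is prime to \<open>p\<close>. In a Bezout relation
  \<open>u * p + t * c j = 1\<close> the first term has value below \<open>1\<close>, so
  \<open>c j\<close> has value \<open>1\<close>, the largest an integer can have at a
  non-archimedean place.\<close>

lemma finite_places_above:
  assumes p: "Factorial_Ring.prime (p::nat)"
  shows "finite {\<aa> \<in> na_places. (of_nat p :: 'k) \<in> place_ideal \<aa>}"
    (is "finite ?A")
proof (rule finite_places_if_dominated)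
  have na: "abs_value v" "nonarchimedean v" "v (of_nat p) < 1" if "\<aa> \<in> ?A" "v \<in> \<aa>" for \<aa> :: "'k place" and v
    using that places_absolute_value unfolding na_places_def place_ideal_def by (auto simp: abs_value_def)
  show "?A \<subseteq> places" unfolding na_places_def by auto
  show "nontrivial v" if "\<aa> \<in> ?A" "v \<in> \<aa>" for \<aa> v
    using na[OF that] prime_gt_0_nat[OF p] unfolding nontrivial_def by (intro exI[of _ "of_nat p"]) auto
  fix n and c :: "nat \<Rightarrow> int"
  assume c: "\<And>p. (\<forall>i\<le>n. p dvd c i) \<Longrightarrow> is_unit p"
  have "\<not> is_unit (int p)" using p prime_gt_1_nat[OF p] by simp
  then obtain j where j: "j \<le> n" "\<not> int p dvd c j" using c by blast
  then have "coprime (int p) (c j)" using p by (simp add: prime_imp_coprime)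
  then obtain u t where ut: "u * int p + t * c j = 1"
    using coprime_iff_gcd_eq_1 bezout_int by metis
  have "v (of_int (c i)) \<le> v (of_int (c j))" if "\<aa> \<in> ?A" "v \<in> \<aa>" for \<aa> v i
  proof -
    interpret abs_value v using na[OF that] by blast
    note nonarch = na(2)[OF that]
    have "1 = v (of_int (u * int p + t * c j))" unfolding ut by simp
    also have "\<dots> = v (of_int u * of_nat p + of_int t * of_int (c j))" by simp
    also have "\<dots> \<le> max (v (of_int u * of_nat p)) (v (of_int t * of_int (c j)))"
      using nonarch unfolding nonarchimedean_def by blast
    finally have *: "1 \<le> max (v (of_int u * of_nat p)) (v (of_int t * of_int (c j)))" .
    have "v (of_int u * of_nat p) \<le> 1 * v (of_nat p)"
      unfolding mult using nonarchimedean_of_int[OF nonarch] by (intro mult_right_mono) auto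
    then have "1 \<le> v (of_int t * of_int (c j))" using * na(3)[OF that] by (auto simp: max_def split: if_splits)
    also have "\<dots> \<le> 1 * v (of_int (c j))"
      unfolding mult using nonarchimedean_of_int[OF nonarch] by (intro mult_right_mono) auto
    finally show ?thesis using nonarchimedean_of_int[OF nonarch, of "c i"] by linarith
  qed
  moreover have "c j \<noteq> 0" using j by auto
  ultimately show "\<exists>j\<le>n. c j \<noteq> 0 \<and> (\<forall>\<aa>\<in>?A. \<forall>v\<in>\<aa>. \<forall>i\<le>n. v (of_int (c i) :: 'k) \<le> v (of_int (c j)))"
    using j(1) by blast
qed

text \<open>Write \<open>x = a / b\<close> with \<open>a\<close> and \<open>b\<close> dividing
  positive integers \<open>N\<close> and \<open>M\<close>. At a non-archimedean place above no prime
  factor of \<open>N * M\<close>, this product has value \<open>1\<close> while all integral factors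
  have value at most \<open>1\<close>; hence \<open>a\<close> and \<open>b\<close> have value
  \<open>1\<close>. Archimedean places are finite in number, and so are those above each prime
  factor.\<close>

lemma finite_places_nonunit:
  assumes x: "(x::'k) \<noteq> 0"
  shows "finite {\<aa> \<in> places. \<not> (x \<in> place_ring \<aa> \<and> x \<notin> place_ideal \<aa>)}" (is "finite ?A")
proof -
  obtain a b where ab: "algebraic_int a" "algebraic_int b" "b \<noteq> 0" "x = a / b" using as_fraction by blast
  then have a0: "a \<noteq> 0" using x by auto
  obtain N y where N: "N > 0" "algebraic_int y" "a * y = of_nat N" by (rule divides_integer[OF a0])
  obtain M z where M: "M > 0" "algebraic_int z" "b * z = of_nat M" by (rule divides_integer[OF ab(3)])
  have "\<aa> \<in> (places - na_places) \<union> (\<Union>p\<in>prime_factors (N * M). {\<aa> \<in> na_places. (of_nat p :: 'k) \<in> place_ideal \<aa>})"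
    if \<aa>: "\<aa> \<in> ?A" for \<aa>
  proof (cases "\<aa> \<in> na_places")
    case True
    have pl: "\<aa> \<in> places" using \<aa> by simp
    obtain v where v: "v \<in> \<aa>" using places_nonempty[OF pl] by blast
    then have nv: "nonarchimedean v" using True unfolding na_places_def by blast
    interpret abs_value v using places_absolute_value[OF pl v] by unfold_locales
    note int = nonarchimedean_integral[OF nv]
    have vx: "v x \<noteq> 1" using \<aa> place_ring_iff[OF pl v] place_ideal_iff[OF pl v] by auto
    have "\<exists>p\<in>prime_factors (N * M). v (of_nat p) < 1"
    proof (rule ccontr)
      assume "\<not> ?thesis"
      then have 1: "v (of_nat p) = 1" if "p \<in># prime_factorization (N * M)" for p
        using that nonarchimedean_of_nat[OF nv, of p] by force
      have pm: "v (of_nat (prod_mset A)) = 1" if "\<And>p. p \<in># A \<Longrightarrow> v (of_nat p) = 1" for A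
        using that by (induction A) (auto simp: mult)
      have "v (of_nat (N * M)) = 1"
        using pm[of "prime_factorization (N * M)", OF 1] N(1) M(1) by (simp add: prod_mset_prime_factorization_nat)
      then have "v a * v y * (v b * v z) = 1"
        by (simp add: mult flip: N(3) M(3))
      moreover have "v a * v y * (v b * v z) \<le> v a" "v a * v y * (v b * v z) \<le> v b"
      proof -
        have le: "v a \<le> 1" "v b \<le> 1" "v y \<le> 1" "v z \<le> 1" using int ab N M by auto
        have "v a * v y * (v b * v z) \<le> v a * 1 * (1 * 1)" using le by (intro mult_mono) auto
        then show "v a * v y * (v b * v z) \<le> v a" by simp
        have "v a * v y * (v b * v z) \<le> 1 * 1 * (v b * 1)" using le by (intro mult_mono) (auto intro: mult_le_one)
        then show "v a * v y * (v b * v z) \<le> v b" by simp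
      qed
      ultimately have "v a = 1" "v b = 1" using int[OF ab(1)] int[OF ab(2)] by linarith+
      then show False using vx ab(4) by (simp add: divide)
    qed
    then obtain p where p: "p \<in> prime_factors (N * M)" "v (of_nat p) < 1" by blast
    then show ?thesis using True p place_ideal_iff[OF pl v] by blast
  qed (use \<aa> in blast)
  then have "?A \<subseteq> (places - na_places) \<union> (\<Union>p\<in>prime_factors (N * M). {\<aa> \<in> na_places. (of_nat p :: 'k) \<in> place_ideal \<aa>})"
    by blast
  moreover have "finite \<dots>"
    using finite_archimedean_places finite_places_above by (auto simp: in_prime_factors_iff)
  ultimately show ?thesis by (rule finite_subset)
qed

end

section \<open>An embedding into the complex numbers\<close>

definition partial_embedding :: "'k::field_char_0 set \<Rightarrow> ('k \<Rightarrow> complex) \<Rightarrow> bool" where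
  "partial_embedding F s \<longleftrightarrow> (\<forall>q::rat. of_rat q \<in> F) \<and> (\<forall>a\<in>F. \<forall>b\<in>F. a + b \<in> F \<and> a * b \<in> F) \<and>
     s 1 = 1 \<and> (\<forall>a\<in>F. \<forall>b\<in>F. s (a + b) = s a + s b \<and> s (a * b) = s a * s b)"

lemma partial_embedding_Rats: "\<exists>s. partial_embedding (range of_rat :: 'k::field_char_0 set) s"
proof (intro exI[of _ "\<lambda>x. of_rat (inv_into UNIV of_rat x)"])
  have "inj (of_rat :: rat \<Rightarrow> 'k)" by (simp add: inj_def)
  then have s: "inv_into UNIV of_rat (of_rat q :: 'k) = q" for q by (rule inv_f_f)
  have "inv_into UNIV of_rat (1 :: 'k) = 1" using s[of 1] by simp
  moreover have "inv_into UNIV of_rat (of_rat a + of_rat b :: 'k) = a + b" "inv_into UNIV of_rat (of_rat a * of_rat b :: 'k) = a * b" for a b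
    using s by (simp_all flip: of_rat_add of_rat_mult)
  ultimately show "partial_embedding (range of_rat :: 'k set) (\<lambda>x. of_rat (inv_into UNIV of_rat x))"
    unfolding partial_embedding_def using s
    by (auto simp: of_rat_add of_rat_mult) (auto simp flip: of_rat_add of_rat_mult)
qed

context number_field_context
begin

text \<open>For \<open>z = N / y\<close> integral, with \<open>m = Suc l\<close>, multiply the
  equation for \<open>z ^ m\<close> by \<open>y ^ l\<close>. As \<open>z * y = N\<close>, the left
  side becomes \<open>z * N ^ l\<close> and the right side a polynomial in \<open>y\<close>, so
  \<open>1 / y\<close> is obtained within \<open>F\<close>.\<close>

lemma subalgebra_inverse_closed:
  fixes F :: "'k set"
  assumes F: "\<And>q. of_rat q \<in> F" "\<And>a b. a \<in> F \<Longrightarrow> b \<in> F \<Longrightarrow> a + b \<in> F" "\<And>a b. a \<in> F \<Longrightarrow> b \<in> F \<Longrightarrow> a * b \<in> F"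
    and y: "y \<in> F" "y \<noteq> 0"
  shows "inverse y \<in> F"
proof -
  obtain N :: nat where N: "N > 0" "algebraic_int (of_nat N * inverse y)" using integral_multiple by blast
  define z where "z = of_nat N * inverse y"
  obtain m c where c: "z ^ m = (\<Sum>i<m. of_int (c i) * z ^ i)"
    using N(2) unfolding z_def algebraic_int_iff_power_in_span zspan_powers by blast
  then have "m > 0" by (cases m) auto
  then obtain l where l: "m = Suc l" by (cases m) auto
  have pow: "a ^ i \<in> F" if "a \<in> F" for a i using that F(3) F(1)[of 1] by (induction i) auto
  have rat: "of_int a \<in> F" "of_nat b \<in> F" for a b using F(1)[of "of_int a"] F(1)[of "of_nat b"] by auto
  have zy: "z * y = of_nat N" unfolding z_def using y by simp
  have "z * of_nat N ^ l = z ^ m * y ^ l" unfolding l zy[symmetric] by (simp add: power_mult_distrib)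
  also have "\<dots> = (\<Sum>i<m. of_int (c i) * (of_nat N ^ i * y ^ (l - i)))"
    unfolding c sum_distrib_right
  proof (intro sum.cong refl)
    fix i assume "i \<in> {..<m}"
    then have "y ^ l = y ^ i * y ^ (l - i)" using l by (simp flip: power_add)
    then show "of_int (c i) * z ^ i * y ^ l = of_int (c i) * (of_nat N ^ i * y ^ (l - i))"
      unfolding zy[symmetric] by (simp add: power_mult_distrib mult_ac)
  qed
  finally have e: "z * of_nat N ^ l = \<dots>" .
  have "(\<Sum>i\<in>A. of_int (c i) * (of_nat N ^ i * y ^ (l - i))) \<in> F" for A
    by (induction A rule: infinite_finite_induct) (use F(1)[of 0] in \<open>auto intro!: F(2,3) pow rat y\<close>)
  then have "z * of_nat N ^ l \<in> F" unfolding e .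
  then have "z * of_nat N ^ l * of_rat (1 / of_nat N ^ Suc l) \<in> F" by (rule F(3)[OF _ F(1)])
  moreover have "z * of_nat N ^ l * of_rat (1 / of_nat N ^ Suc l) = inverse y"
    using N(1) by (simp add: z_def of_rat_divide of_rat_mult of_rat_power)
  ultimately show ?thesis by simp
qed

text \<open>The usual extension step: \<open>\<mu>\<close> is a polynomial of least degree over
  \<open>F\<close> vanishing at \<open>x\<close>, \<open>r\<close> a complex root of its image under
  \<open>s\<close>, and \<open>x\<close> is sent to \<open>r\<close>.\<close>

lemma partial_embedding_extend:
  assumes "partial_embedding F s"
  shows "\<exists>F' s'. partial_embedding F' s' \<and> F \<subseteq> F' \<and> (x::'k) \<in> F'"
proof -
  have F: "\<And>q. of_rat q \<in> F" "\<And>a b. a \<in> F \<Longrightarrow> b \<in> F \<Longrightarrow> a + b \<in> F" "\<And>a b. a \<in> F \<Longrightarrow> b \<in> F \<Longrightarrow> a * b \<in> F"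
    and s: "s 1 = 1" "\<And>a b. a \<in> F \<Longrightarrow> b \<in> F \<Longrightarrow> s (a + b) = s a + s b" "\<And>a b. a \<in> F \<Longrightarrow> b \<in> F \<Longrightarrow> s (a * b) = s a * s b"
    using assms unfolding partial_embedding_def by auto
  have F01: "0 \<in> F" "1 \<in> F" "-1 \<in> F" using F(1)[of 0] F(1)[of 1] F(1)[of "-1"] by auto
  have s0: "s 0 = 0" using s(2)[OF F01(1) F01(1)] by simp
  have sneg: "s (- a) = - s a" if "a \<in> F" for a
  proof -
    have "- a \<in> F" using F(3)[OF F01(3) that] by simp
    then have "s (a + - a) = s a + s (- a)" using s(2) that by blast
    then show ?thesis using s0 by (simp add: eq_neg_iff_add_eq_0 add.commute)
  qed
  have snz: "s a \<noteq> 0" if "a \<in> F" "a \<noteq> 0" for a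
  proof -
    have "inverse a \<in> F" using subalgebra_inverse_closed[OF F that] by blast
    then have "s a * s (inverse a) = 1" using s(3)[OF that(1), of "inverse a"] that s(1) by simp
    then show ?thesis by auto
  qed
  define PF where "PF = {p::'k poly. \<forall>i. coeff p i \<in> F}"
  have sumF: "(\<Sum>i\<in>A. g i) \<in> F" "s (\<Sum>i\<in>A. g i) = (\<Sum>i\<in>A. s (g i))" if "\<And>i. i \<in> A \<Longrightarrow> g i \<in> F" for g and A :: "nat set"
  proof -
    have "(\<Sum>i\<in>A. g i) \<in> F \<and> s (\<Sum>i\<in>A. g i) = (\<Sum>i\<in>A. s (g i))"
      using that by (induction A rule: infinite_finite_induct) (auto simp: F01 s0 F s)
    then show "(\<Sum>i\<in>A. g i) \<in> F" "s (\<Sum>i\<in>A. g i) = (\<Sum>i\<in>A. s (g i))" by auto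
  qed
  have PF_add: "p + q \<in> PF" and PF_mult: "p * q \<in> PF" and PF_uminus: "- p \<in> PF"
    and map_add: "map_poly s (p + q) = map_poly s p + map_poly s q"
    and map_mult: "map_poly s (p * q) = map_poly s p * map_poly s q"
    and map_uminus: "map_poly s (- p) = - map_poly s p"
    if "p \<in> PF" "q \<in> PF" for p q
    using that F(3)[OF F01(3)] unfolding PF_def
    by (auto simp: poly_eq_iff coeff_map_poly s0 F s coeff_mult sumF sneg)
  have PF_monom: "monom a n \<in> PF" if "a \<in> F" for a n using that F01 unfolding PF_def by auto
  obtain N :: nat where N: "N > 0" "algebraic_int (of_nat N * x)" using integral_multiple by blast
  obtain m c where c: "(of_nat N * x) ^ m = (\<Sum>i<m. of_int (c i) * (of_nat N * x) ^ i)"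
    using N(2) unfolding algebraic_int_iff_power_in_span zspan_powers by blast
  \<comment> \<open>The integral equation of \<open>N * x\<close>, expanded as an equation for
    \<open>x\<close>; it shows that some nonzero polynomial over \<open>F\<close> vanishes at
    \<open>x\<close>.\<close>
  define p0 where "p0 = monom (of_nat N ^ m) m - (\<Sum>i<m. monom (of_int (c i) * of_nat N ^ i) i :: 'k poly)"
  have cp0: "coeff p0 i = (if i = m then of_nat N ^ m else if i < m then - (of_int (c i) * of_nat N ^ i) else 0)" for i
    unfolding p0_def coeff_diff coeff_sum_monom by simp
  have "p0 \<in> PF" unfolding PF_def
  proof (intro CollectI allI)
    fix i
    show "coeff p0 i \<in> F"
      using F(1)[of "of_nat N ^ m"] F(1)[of "- (of_int (c i) * of_nat N ^ i)"] F01
      unfolding cp0 by (auto simp: of_rat_power of_rat_mult of_rat_minus)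
  qed
  moreover have "p0 \<noteq> 0" using cp0[of m] N(1) by auto
  moreover have "Polynomial.poly p0 x = 0"
    unfolding p0_def using c by (simp add: poly_monom poly_sum power_mult_distrib mult_ac)
  ultimately have ex: "\<exists>d p. p \<in> PF \<and> p \<noteq> 0 \<and> Polynomial.poly p x = 0 \<and> degree p = d" by blast
  define d where "d = (LEAST d. \<exists>p. p \<in> PF \<and> p \<noteq> 0 \<and> Polynomial.poly p x = 0 \<and> degree p = d)"
  obtain \<mu> where \<mu>: "\<mu> \<in> PF" "\<mu> \<noteq> 0" "Polynomial.poly \<mu> x = 0" "degree \<mu> = d"
    using LeastI_ex[OF ex] unfolding d_def by blast
  have min: "d \<le> degree p" if "p \<in> PF" "p \<noteq> 0" "Polynomial.poly p x = 0" for p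
    unfolding d_def using that by (intro Least_le) blast
  have "d > 0"
  proof (rule Nat.gr0I)
    assume "d = 0"
    then obtain a where "\<mu> = [:a:]" using \<mu>(4) degree_eq_zeroE by blast
    then show False using \<mu> by simp
  qed
  define lc where "lc = lead_coeff \<mu>"
  have lc: "lc \<in> F" "lc \<noteq> 0" using \<mu> unfolding lc_def PF_def by auto
  have "coeff (map_poly s \<mu>) d \<noteq> 0" using snz[OF lc] unfolding lc_def by (simp add: coeff_map_poly s0 \<mu>(4))
  then have "degree (map_poly s \<mu>) > 0" using \<open>d > 0\<close> le_degree by fastforce
  then have "\<not> constant (Polynomial.poly (map_poly s \<mu>))" by (simp add: constant_degree)
  then obtain r where r: "Polynomial.poly (map_poly s \<mu>) r = 0" using fundamental_theorem_of_algebra by blast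
  define E where "E = (\<lambda>p. Polynomial.poly (map_poly s p) r)"
  \<comment> \<open>Well-definedness of the extension. One step of division by \<open>\<mu>\<close>
    cancels the leading term of \<open>p\<close>, and \<open>E\<close> vanishes on multiples of
    \<open>\<mu>\<close> because \<open>r\<close> is a root.\<close>
  have E0: "E p = 0" if "p \<in> PF" "Polynomial.poly p x = 0" for p
    using that
  proof (induction "degree p" arbitrary: p rule: less_induct)
    case less
    show ?case
    proof (cases "p = 0")
      case True
      then show ?thesis unfolding E_def by simp
    next
      case False
      define k where "k = degree p - d"
      have dk: "degree p = k + d" using min[OF less.prems(1) False less.prems(2)] unfolding k_def by simp
      define a where "a = lead_coeff p * inverse lc"
      have aF: "a \<in> F" unfolding a_def
        using less.prems(1) subalgebra_inverse_closed[OF F lc] unfolding PF_def by (auto intro: F)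
      define t where "t = monom a k * \<mu>"
      have tPF: "t \<in> PF" unfolding t_def by (intro PF_mult PF_monom aF \<mu>)
      define p' where "p' = p + - t"
      have p'PF: "p' \<in> PF" unfolding p'_def using less.prems(1) tPF PF_uminus[OF tPF tPF] by (intro PF_add)
      have "coeff t (degree p) = lead_coeff p"
        unfolding t_def dk using \<mu>(4) lc unfolding a_def lc_def by (simp add: coeff_monom_mult dk)
      moreover have "degree t \<le> degree p"
        unfolding t_def dk using degree_mult_le[of "monom a k" \<mu>] degree_monom_le[of a k] \<mu>(4) by linarith
      ultimately have "coeff p' (degree p) = 0" "degree p' \<le> degree p"
        unfolding p'_def by (auto intro!: degree_diff_le)
      then have "degree p' < degree p \<or> p' = 0" using eq_zero_or_degree_less by blast
      moreover have "Polynomial.poly p' x = 0" unfolding p'_def t_def using less.prems(2) \<mu>(3) by simp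
      ultimately have "E p' = 0" using less.hyps p'PF unfolding E_def by auto
      moreover have "E p' = E p - E t" unfolding E_def p'_def
        using map_add[OF less.prems(1) PF_uminus[OF tPF tPF]] map_uminus[OF tPF tPF] by simp
      moreover have "E t = 0" unfolding E_def t_def
        using map_mult[OF PF_monom[OF aF] \<mu>(1)] r by simp
      ultimately show ?thesis by simp
    qed
  qed
  define F' where "F' = (\<lambda>p. Polynomial.poly p x) ` PF"
  define s' where "s' = (\<lambda>y. E (SOME p. p \<in> PF \<and> Polynomial.poly p x = y))"
  have s': "s' (Polynomial.poly p x) = E p" if p: "p \<in> PF" for p
  proof -
    define p' where "p' = (SOME p'. p' \<in> PF \<and> Polynomial.poly p' x = Polynomial.poly p x)"
    have p': "p' \<in> PF \<and> Polynomial.poly p' x = Polynomial.poly p x"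
      unfolding p'_def by (rule someI[of _ p]) (use p in simp)
    then have "p' + - p \<in> PF" "Polynomial.poly (p' + - p) x = 0"
      using PF_add[OF _ PF_uminus[OF p p], of p'] p by (blast, simp)
    then have "E (p' + - p) = 0" by (rule E0)
    then have "E p' - E p = 0" unfolding E_def using map_add[of p' "- p"] map_uminus[OF p p] PF_uminus[OF p p] p' by simp
    then show ?thesis unfolding s'_def p'_def[symmetric] by simp
  qed
  have const: "[:a:] \<in> PF" if "a \<in> F" for a using that PF_monom[of a 0] by (simp add: monom_0)
  have "partial_embedding F' s'"
    unfolding partial_embedding_def
  proof (intro conjI allI ballI)
    show "of_rat q \<in> F'" for q unfolding F'_def using const[OF F(1)[of q]] by (intro image_eqI[of _ _ "[:of_rat q:]"]) auto
    show "s' 1 = 1" using s'[OF const[OF F01(2)]] unfolding E_def by (simp add: map_poly_pCons s(1) s0)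
    fix a b assume "a \<in> F'" "b \<in> F'"
    then obtain p q where pq: "p \<in> PF" "q \<in> PF" "a = Polynomial.poly p x" "b = Polynomial.poly q x" unfolding F'_def by blast
    show "a + b \<in> F'" unfolding F'_def using pq PF_add by (intro image_eqI[of _ _ "p + q"]) auto
    show "a * b \<in> F'" unfolding F'_def using pq PF_mult by (intro image_eqI[of _ _ "p * q"]) auto
    show "s' (a + b) = s' a + s' b"
      using s'[OF PF_add[OF pq(1,2)]] s'[OF pq(1)] s'[OF pq(2)] map_add[OF pq(1,2)] unfolding E_def pq by simp
    show "s' (a * b) = s' a * s' b"
      using s'[OF PF_mult[OF pq(1,2)]] s'[OF pq(1)] s'[OF pq(2)] map_mult[OF pq(1,2)] unfolding E_def pq by simp
  qed
  moreover have "F \<subseteq> F'" unfolding F'_def using const by force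
  moreover have "x \<in> F'" unfolding F'_def using PF_monom[OF F01(2), of 1]
    by (intro image_eqI[of _ _ "monom 1 1"]) (auto simp: poly_monom)
  ultimately show ?thesis by blast
qed

lemma embedding_exists: "\<exists>s. partial_embedding (UNIV :: 'k set) s"
proof -
  obtain B :: "'k set" where B: "finite B" "qvs.span B = UNIV"
    using number_field unfolding number_field_def by blast
  have "\<exists>F s. partial_embedding F s \<and> B' \<subseteq> F" if "finite B'" for B' :: "'k set"
    using that
  proof (induction B' rule: finite_induct)
    case empty
    then show ?case using partial_embedding_Rats by blast
  next
    case (insert x B')
    then obtain F s where "partial_embedding F s" "B' \<subseteq> F" by blast
    then show ?case using partial_embedding_extend[of F s x] by blast
  qed
  then obtain F s where Fs: "partial_embedding F s" "B \<subseteq> F" using B by blast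
  have "qvs.subspace F" unfolding qvs.subspace_def
    using Fs(1) unfolding partial_embedding_def by (metis of_rat_0)
  then have "UNIV \<subseteq> F" using qvs.span_minimal[OF Fs(2)] B(2) by simp
  then show ?thesis using Fs(1) by (metis top.extremum_uniqueI)
qed

text \<open>Ensures that the condition imposed on \<open>f\<close> at archimedean absolute values is
  not vacuous; \<open>not_root_of_unity\<close> depends on it.\<close>

lemma archimedean_exists: "\<exists>v::'k \<Rightarrow> real. absolute_value v \<and> \<not> nonarchimedean v"
proof -
  obtain s :: "'k \<Rightarrow> complex" where "partial_embedding UNIV s" using embedding_exists by blast
  then have s: "s 1 = 1" "\<And>a b. s (a + b) = s a + s b" "\<And>a b. s (a * b) = s a * s b"
    unfolding partial_embedding_def by auto
  have s0: "s 0 = 0" using s(2)[of 0 0] by simp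
  have "s a \<noteq> 0" if "a \<noteq> 0" for a
    using s(3)[of a "inverse a"] that s(1) by auto
  then have "s a = 0 \<longleftrightarrow> a = 0" for a using s0 by auto
  then have "absolute_value (\<lambda>x. cmod (s x))"
    unfolding absolute_value_def by (auto simp: s norm_mult norm_triangle_ineq)
  moreover have "cmod (s (1 + 1)) = 2" unfolding s by simp
  then have "\<not> nonarchimedean (\<lambda>x. cmod (s x))"
    unfolding nonarchimedean_def by (auto simp: s(1) intro!: exI[of _ 1])
  ultimately show ?thesis by blast
qed

end

section \<open>Spectra embedded in a field\<close>

text \<open>Equality of fractions can be tested in \<open>N\<close>, where denominators are units.
  \<open>N\<close> is a general monoid because it will be both the multiplicative monoid of a field
  and the residue monoid of a place.\<close>

lemma fraction_eq:
  assumes A: "comm_monoid A" and N: "comm_monoid N" and e: "e \<in> hom A N" "inj_on e (carrier A)"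
    and S: "S \<subseteq> carrier A" "e ` S \<subseteq> Units N" and as: "a \<in> carrier A" "s \<in> S"
  shows "fraction A S a s = {(b, t). b \<in> carrier A \<and> t \<in> S \<and> e a \<otimes>\<^bsub>N\<^esub> e t = e b \<otimes>\<^bsub>N\<^esub> e s}"
proof -
  interpret A: comm_monoid A by fact
  interpret N: comm_monoid N by fact
  have em: "e (x \<otimes>\<^bsub>A\<^esub> y) = e x \<otimes>\<^bsub>N\<^esub> e y" if "x \<in> carrier A" "y \<in> carrier A" for x y
    using e(1) that by (auto simp: hom_def)
  have ec: "e x \<in> carrier N" if "x \<in> carrier A" for x using e(1) that by (auto simp: hom_def)
  have "(\<exists>u\<in>S. u \<otimes>\<^bsub>A\<^esub> (a \<otimes>\<^bsub>A\<^esub> t) = u \<otimes>\<^bsub>A\<^esub> (b \<otimes>\<^bsub>A\<^esub> s)) \<longleftrightarrow> e a \<otimes>\<^bsub>N\<^esub> e t = e b \<otimes>\<^bsub>N\<^esub> e s"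
    if bt: "b \<in> carrier A" "t \<in> S" for b t
  proof
    assume "\<exists>u\<in>S. u \<otimes>\<^bsub>A\<^esub> (a \<otimes>\<^bsub>A\<^esub> t) = u \<otimes>\<^bsub>A\<^esub> (b \<otimes>\<^bsub>A\<^esub> s)"
    then obtain u where u: "u \<in> S" "u \<otimes>\<^bsub>A\<^esub> (a \<otimes>\<^bsub>A\<^esub> t) = u \<otimes>\<^bsub>A\<^esub> (b \<otimes>\<^bsub>A\<^esub> s)" by blast
    have car: "u \<in> carrier A" "t \<in> carrier A" "s \<in> carrier A" using u bt as S by auto
    have "e u \<otimes>\<^bsub>N\<^esub> (e a \<otimes>\<^bsub>N\<^esub> e t) = e u \<otimes>\<^bsub>N\<^esub> (e b \<otimes>\<^bsub>N\<^esub> e s)"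
      using arg_cong[OF u(2), of e] car as bt by (simp add: em)
    moreover have "e u \<in> Units N" using u S by blast
    ultimately show "e a \<otimes>\<^bsub>N\<^esub> e t = e b \<otimes>\<^bsub>N\<^esub> e s" using car as bt ec by simp
  next
    assume *: "e a \<otimes>\<^bsub>N\<^esub> e t = e b \<otimes>\<^bsub>N\<^esub> e s"
    have car: "t \<in> carrier A" "s \<in> carrier A" using bt as S by auto
    then have "e (a \<otimes>\<^bsub>A\<^esub> t) = e (b \<otimes>\<^bsub>A\<^esub> s)" using * em as bt by simp
    then have "a \<otimes>\<^bsub>A\<^esub> t = b \<otimes>\<^bsub>A\<^esub> s" using e(2) car as bt by (auto dest: inj_onD)
    then show "\<exists>u\<in>S. u \<otimes>\<^bsub>A\<^esub> (a \<otimes>\<^bsub>A\<^esub> t) = u \<otimes>\<^bsub>A\<^esub> (b \<otimes>\<^bsub>A\<^esub> s)" using as by auto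
  qed
  then show ?thesis unfolding fraction_def frac_rel_def using as by auto
qed

text \<open>The element of the localization at \<open>P\<close> whose value in the field is \<open>m\<close>; it is empty if \<open>m\<close> is not in the
  localization.\<close>

definition fsec :: "('a, 'e) monoid_scheme \<Rightarrow> ('a \<Rightarrow> 'l::field) \<Rightarrow> 'a set \<Rightarrow> 'l \<Rightarrow> ('a \<times> 'a) set" where
  "fsec A e P m = {(b, t). b \<in> carrier A \<and> t \<in> carrier A - P \<and> e b = m * e t}"

locale field_embedding =
  fixes A :: "('a, 'e) monoid_scheme" and e :: "'a \<Rightarrow> 'l::field"
  assumes comm_monoid_A: "comm_monoid A"
    and e_mult: "a \<in> carrier A \<Longrightarrow> b \<in> carrier A \<Longrightarrow> e (a \<otimes>\<^bsub>A\<^esub> b) = e a * e b"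
    and e_one: "e \<one>\<^bsub>A\<^esub> = 1"
    and e_inj: "inj_on e (carrier A)"
begin

interpretation A: comm_monoid A by (rule comm_monoid_A)

text \<open>The properties shared by primes of pointed monoids and primes of rings that suffice to
  compute with fractions in the field; both kinds of spectrum are treated together.\<close>

definition eprime :: "'a set \<Rightarrow> bool" where
  "eprime P \<longleftrightarrow> \<one>\<^bsub>A\<^esub> \<notin> P \<and> (\<forall>a\<in>carrier A. \<forall>b\<in>carrier A. a \<otimes>\<^bsub>A\<^esub> b \<in> P \<longrightarrow> a \<in> P \<or> b \<in> P) \<and>
     (\<forall>a\<in>carrier A. e a = 0 \<longrightarrow> a \<in> P)"

lemma eprime_nonzero: "eprime P \<Longrightarrow> t \<in> carrier A \<Longrightarrow> t \<notin> P \<Longrightarrow> e t \<noteq> 0"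
  unfolding eprime_def by blast

lemma fraction_fsec:
  assumes "eprime P" "a \<in> carrier A" "s \<in> carrier A" "s \<notin> P"
  shows "fraction A (carrier A - P) a s = fsec A e P (e a / e s)"
proof -
  define N where "N = (sub_pm UNIV :: 'l pmonoid)"
  have N: "comm_monoid N" unfolding N_def sub_pm_def mult_pm_def sub_ring_def
    by unfold_locales (auto simp: mult_ac)
  have U: "Units N = {x. x \<noteq> 0}"
  proof -
    have "x \<in> Units N" if "x \<noteq> 0" for x
      using that unfolding Units_def N_def sub_pm_def mult_pm_def sub_ring_def
      by (auto intro!: exI[of _ "inverse x"])
    moreover have "x \<noteq> 0" if "x \<in> Units N" for x
      using that unfolding Units_def N_def sub_pm_def mult_pm_def sub_ring_def by auto
    ultimately show ?thesis by blast
  qed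
  have "e \<in> hom A N" unfolding hom_def N_def sub_pm_def mult_pm_def sub_ring_def using e_mult by auto
  then have "fraction A (carrier A - P) a s = {(b, t). b \<in> carrier A \<and> t \<in> carrier A - P \<and> e a \<otimes>\<^bsub>N\<^esub> e t = e b \<otimes>\<^bsub>N\<^esub> e s}"
    using assms eprime_nonzero U by (intro fraction_eq[OF comm_monoid_A N]) (auto simp: e_inj)
  also have "\<dots> = fsec A e P (e a / e s)"
    unfolding fsec_def using eprime_nonzero[OF assms(1,3,4)]
    by (auto simp: N_def sub_pm_def mult_pm_def sub_ring_def field_simps)
  finally show ?thesis .
qed

lemma fsec_value: "eprime P \<Longrightarrow> (b, t) \<in> fsec A e P m \<Longrightarrow> m = e b / e t"
  unfolding fsec_def using eprime_nonzero by auto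

lemma fsec_inj: "eprime P \<Longrightarrow> fsec A e P m = fsec A e P m' \<Longrightarrow> fsec A e P m \<noteq> {} \<Longrightarrow> m = m'"
  using fsec_value by (metis ex_in_conv surj_pair)

lemma fsec_nonempty_iff: "eprime P \<Longrightarrow> fsec A e P m \<noteq> {} \<longleftrightarrow> (\<exists>a\<in>carrier A. \<exists>s\<in>carrier A - P. m = e a / e s)"
proof
  assume P: "eprime P" and "fsec A e P m \<noteq> {}"
  then obtain a s where "(a, s) \<in> fsec A e P m" by auto
  then show "\<exists>a\<in>carrier A. \<exists>s\<in>carrier A - P. m = e a / e s"
    using fsec_value[OF P] unfolding fsec_def by blast
next
  assume P: "eprime P" and "\<exists>a\<in>carrier A. \<exists>s\<in>carrier A - P. m = e a / e s"
  then obtain a s where "a \<in> carrier A" "s \<in> carrier A - P" "m = e a / e s" by blast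
  then have "(a, s) \<in> fsec A e P m" using eprime_nonzero[OF P, of s] unfolding fsec_def by auto
  then show "fsec A e P m \<noteq> {}" by blast
qed

lemma quotient_frac_rel:
  assumes "eprime P"
  shows "(carrier A \<times> (carrier A - P)) // frac_rel A (carrier A - P) = {fsec A e P m | m. fsec A e P m \<noteq> {}}"
proof -
  have "(carrier A \<times> (carrier A - P)) // frac_rel A (carrier A - P)
      = {fraction A (carrier A - P) a s | a s. a \<in> carrier A \<and> s \<in> carrier A - P}"
    unfolding quotient_def fraction_def by auto
  also have "\<dots> = {fsec A e P (e a / e s) | a s. a \<in> carrier A \<and> s \<in> carrier A - P}"
    using fraction_fsec[OF assms] by (metis (no_types, lifting) DiffE)
  also have "\<dots> = {fsec A e P m | m. fsec A e P m \<noteq> {}}"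
    using fsec_nonempty_iff[OF assms] by (smt (verit, ccfv_threshold) Collect_cong)
  finally show ?thesis .
qed

lemma fsec_mult_nonempty:
  assumes P: "eprime P" and "fsec A e P m \<noteq> {}" "fsec A e P m' \<noteq> {}"
  shows "fsec A e P (m * m') \<noteq> {}"
proof -
  obtain a s b t where "(a, s) \<in> fsec A e P m" "(b, t) \<in> fsec A e P m'" using assms(2,3) by auto
  then have "(a \<otimes>\<^bsub>A\<^esub> b, s \<otimes>\<^bsub>A\<^esub> t) \<in> fsec A e P (m * m')"
    using P unfolding fsec_def eprime_def by (auto simp: e_mult)
  then show ?thesis by blast
qed

lemma frac_mult_fsec:
  assumes P: "eprime P" and ne: "fsec A e P m \<noteq> {}" "fsec A e P m' \<noteq> {}"
  shows "frac_mult A (carrier A - P) (fsec A e P m) (fsec A e P m') = fsec A e P (m * m')"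
proof -
  have "fraction A (carrier A - P) (a \<otimes>\<^bsub>A\<^esub> b) (s \<otimes>\<^bsub>A\<^esub> t) = fsec A e P (m * m')"
    if "(a, s) \<in> fsec A e P m" "(b, t) \<in> fsec A e P m'" for a s b t
  proof -
    have "a \<in> carrier A" "s \<in> carrier A" "s \<notin> P" "b \<in> carrier A" "t \<in> carrier A" "t \<notin> P"
      using that unfolding fsec_def by auto
    moreover from this have "s \<otimes>\<^bsub>A\<^esub> t \<notin> P" using P unfolding eprime_def by blast
    moreover have "m = e a / e s" "m' = e b / e t" using fsec_value[OF P] that by auto
    ultimately show ?thesis using fraction_fsec[OF P, of "a \<otimes>\<^bsub>A\<^esub> b" "s \<otimes>\<^bsub>A\<^esub> t"] by (simp add: e_mult)
  qed
  then show ?thesis unfolding frac_mult_def using ne by fastforce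
qed

lemma fraction_one: "eprime P \<Longrightarrow> a \<in> carrier A \<Longrightarrow> fraction A (carrier A - P) a \<one>\<^bsub>A\<^esub> = fsec A e P (e a)"
  using fraction_fsec[of P a "\<one>\<^bsub>A\<^esub>"] unfolding eprime_def by (simp add: e_one)

end

lemma openin_spec_top_basic: "h \<in> carrier A \<Longrightarrow> openin (spec_top A pts) {P \<in> pts. h \<notin> P}"
  unfolding spec_top_def openin_topology_generated_by_iff by (auto intro: generate_topology_on.Basis)

lemma topspace_spec_top: "h \<in> carrier A \<Longrightarrow> (\<And>P. P \<in> pts \<Longrightarrow> h \<notin> P) \<Longrightarrow> topspace (spec_top A pts) = pts"
  unfolding spec_top_def topology_generated_by_topspace by auto

lemma openin_spec_top_generic:
  assumes "openin (spec_top A pts) U" "U \<noteq> {}" and g: "g \<in> pts" "\<And>P. P \<in> pts \<Longrightarrow> g \<inter> carrier A \<subseteq> P"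
  shows "g \<in> U"
proof -
  have "generate_topology_on ((\<lambda>h. {P \<in> pts. h \<notin> P}) ` carrier A) U"
    using assms(1) unfolding spec_top_def openin_topology_generated_by_iff .
  then show ?thesis using assms(2)
  proof (induction rule: generate_topology_on.induct)
    case (UN K)
    then show ?case by blast
  next
    case (Basis s)
    then show ?case using g by auto
  qed auto
qed

text \<open>A map of localizations is computed by following values: it is enough that every
  representative of \<open>z\<close> is sent to a fraction of value \<open>x\<close>.\<close>

lemma loc_map_fsec:
  assumes B: "field_embedding B e" and P: "field_embedding.eprime B e Q"
    and z: "z \<noteq> {}" "\<And>a t. (a, t) \<in> z \<Longrightarrow> h a \<in> carrier B \<and> h t \<in> carrier B - Q \<and> e (h a) = x * e (h t)"
  shows "loc_map B h Q z = fsec B e Q x"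
proof -
  interpret field_embedding B e by fact
  have "fraction B (carrier B - Q) (h a) (h t) = fsec B e Q x" if "(a, t) \<in> z" for a t
    using fraction_fsec[OF P, of "h a" "h t"] z(2)[OF that] eprime_nonzero[OF P, of "h t"] by auto
  then show ?thesis unfolding loc_map_def using z(1) by fastforce
qed

locale embedded_spectrum = field_embedding A e
  for A :: "('a, 'x) monoid_scheme" and e :: "'a \<Rightarrow> 'l::field" +
  fixes pts :: "'a set set" and g :: "'a set"
  assumes pts_eprime: "P \<in> pts \<Longrightarrow> eprime P"
    and generic: "g \<in> pts" "P \<in> pts \<Longrightarrow> g \<inter> carrier A \<subseteq> P"
begin

interpretation A: comm_monoid A by (rule comm_monoid_A)

lemma topspace_eq: "topspace (spec_top A pts) = pts"
  using topspace_spec_top[of "\<one>\<^bsub>A\<^esub>" A pts] pts_eprime A.one_closed unfolding eprime_def by blast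

lemma generic_in: "openin (spec_top A pts) U \<Longrightarrow> U \<noteq> {} \<Longrightarrow> g \<in> U"
  using openin_spec_top_generic generic by metis

text \<open>A section has a constant value near each point. Any two of these neighbourhoods contain
  the generic point \<open>g\<close>, where the value is determined, so one value serves all of
  \<open>U\<close>.\<close>

lemma frac_sections_eq:
  assumes U: "openin (spec_top A pts) U"
  shows "frac_sections A pts U = {(\<lambda>P\<in>U. fsec A e P m) | m. \<forall>P\<in>U. fsec A e P m \<noteq> {}}"
proof -
  have Upts: "U \<subseteq> pts" using openin_subset[OF U] topspace_eq by simp
  show ?thesis
  proof (intro equalityI subsetI)
    fix s assume s: "s \<in> frac_sections A pts U"
    then have sE: "s \<in> extensional U" unfolding frac_sections_def by (auto simp: PiE_def)
    have loc: "\<exists>V m. openin (spec_top A pts) V \<and> P \<in> V \<and> V \<subseteq> U \<and> (\<forall>Q\<in>V. s Q = fsec A e Q m \<and> fsec A e Q m \<noteq> {})"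
      if P: "P \<in> U" for P
    proof -
      obtain V a h where V: "openin (spec_top A pts) V" "P \<in> V" "V \<subseteq> U" "a \<in> carrier A" "h \<in> carrier A"
        "\<And>Q. Q \<in> V \<Longrightarrow> h \<notin> Q \<and> s Q = fraction A (carrier A - Q) a h"
      proof -
        have "\<exists>V. openin (spec_top A pts) V \<and> P \<in> V \<and> V \<subseteq> U \<and>
          (\<exists>a\<in>carrier A. \<exists>h\<in>carrier A. \<forall>Q\<in>V. h \<notin> Q \<and> s Q = fraction A (carrier A - Q) a h)"
          using s P unfolding frac_sections_def by simp
        then show ?thesis using that by blast
      qed
      have "s Q = fsec A e Q (e a / e h) \<and> fsec A e Q (e a / e h) \<noteq> {}" if "Q \<in> V" for Q
        using V that Upts pts_eprime fraction_fsec[of Q a h] fsec_nonempty_iff[of Q] by blast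
      then show ?thesis using V by blast
    qed
    show "s \<in> {(\<lambda>P\<in>U. fsec A e P m) | m. \<forall>P\<in>U. fsec A e P m \<noteq> {}}"
    proof (cases "U = {}")
      case True
      then show ?thesis using sE by (auto simp: restrict_def)
    next
      case False
      then obtain P0 where "P0 \<in> U" by blast
      then obtain V0 m0 where V0: "openin (spec_top A pts) V0" "P0 \<in> V0" "V0 \<subseteq> U"
        "\<And>Q. Q \<in> V0 \<Longrightarrow> s Q = fsec A e Q m0 \<and> fsec A e Q m0 \<noteq> {}" using loc[OF \<open>P0 \<in> U\<close>] by blast
      have g0: "g \<in> V0" using generic_in[OF V0(1)] V0(2) by blast
      have "s P = fsec A e P m0 \<and> fsec A e P m0 \<noteq> {}" if P: "P \<in> U" for P
      proof -
        obtain V m where V: "openin (spec_top A pts) V" "P \<in> V" "V \<subseteq> U"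
          "\<And>Q. Q \<in> V \<Longrightarrow> s Q = fsec A e Q m \<and> fsec A e Q m \<noteq> {}" using loc[OF P] by blast
        have gV: "g \<in> V" using generic_in[OF V(1)] V(2) by blast
        have "m = m0" using V(4)[OF gV] V0(4)[OF g0] fsec_inj[OF pts_eprime[OF generic(1)]] by metis
        then show ?thesis using V by blast
      qed
      then have "s = (\<lambda>P\<in>U. fsec A e P m0)" "\<forall>P\<in>U. fsec A e P m0 \<noteq> {}"
        using sE by (auto simp: fun_eq_iff extensional_def)
      then show ?thesis by blast
    qed
  next
    fix s assume "s \<in> {(\<lambda>P\<in>U. fsec A e P m) | m. \<forall>P\<in>U. fsec A e P m \<noteq> {}}"
    then obtain m where s: "s = (\<lambda>P\<in>U. fsec A e P m)" and ne: "\<And>P. P \<in> U \<Longrightarrow> fsec A e P m \<noteq> {}" by blast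
    have "s \<in> (\<Pi>\<^sub>E P\<in>U. (carrier A \<times> (carrier A - P)) // frac_rel A (carrier A - P))"
    proof -
      have "fsec A e P m \<in> (carrier A \<times> (carrier A - P)) // frac_rel A (carrier A - P)" if "P \<in> U" for P
        using quotient_frac_rel[OF pts_eprime, of P] ne[OF that] that Upts by blast
      then show ?thesis unfolding s by auto
    qed
    moreover have "\<exists>V. openin (spec_top A pts) V \<and> P \<in> V \<and> V \<subseteq> U \<and>
         (\<exists>a\<in>carrier A. \<exists>h\<in>carrier A. \<forall>Q\<in>V. h \<notin> Q \<and> s Q = fraction A (carrier A - Q) a h)" if P: "P \<in> U" for P
    proof -
      obtain a h where ah: "(a, h) \<in> fsec A e P m" using ne[OF P] by auto
      then have ah': "a \<in> carrier A" "h \<in> carrier A" "h \<notin> P" unfolding fsec_def by auto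
      have m: "m = e a / e h" using fsec_value[OF _ ah] pts_eprime P Upts by blast
      define V where "V = U \<inter> {Q \<in> pts. h \<notin> Q}"
      have "openin (spec_top A pts) V" unfolding V_def using U openin_spec_top_basic[OF ah'(2)] by (rule openin_Int)
      moreover have "P \<in> V" using P Upts ah' unfolding V_def by blast
      moreover have "h \<notin> Q \<and> s Q = fraction A (carrier A - Q) a h" if "Q \<in> V" for Q
        using that fraction_fsec[of Q a h] pts_eprime ah' unfolding V_def s m by auto
      ultimately show ?thesis using ah' unfolding V_def by blast
    qed
    ultimately show "s \<in> frac_sections A pts U" unfolding frac_sections_def by blast
  qed
qed

end

section \<open>Monoidal spaces with constant sections\<close>

text \<open>Every nonempty open set contains the generic point \<open>g\<close>, so a section over it is an element of one field;
  \<open>sec U m\<close> is the section over \<open>U\<close> with value \<open>m\<close>, and \<open>M U\<close> is the set of values.\<close>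

locale constant_sections =
  fixes X :: "('p, 's) mspace" and M :: "'p set \<Rightarrow> 'l::field set" and sec :: "'p set \<Rightarrow> 'l \<Rightarrow> 's" and g :: 'p
  assumes generic: "openin (space_top X) U \<Longrightarrow> U \<noteq> {} \<Longrightarrow> g \<in> U"
    and M_one: "openin (space_top X) U \<Longrightarrow> 1 \<in> M U"
    and M_zero: "openin (space_top X) U \<Longrightarrow> 0 \<in> M U"
    and M_mult: "openin (space_top X) U \<Longrightarrow> m \<in> M U \<Longrightarrow> m' \<in> M U \<Longrightarrow> m * m' \<in> M U"
    and M_mono: "openin (space_top X) U \<Longrightarrow> openin (space_top X) V \<Longrightarrow> V \<subseteq> U \<Longrightarrow> m \<in> M U \<Longrightarrow> m \<in> M V"
    and M_Union: "(\<And>V. V \<in> \<V> \<Longrightarrow> openin (space_top X) V) \<Longrightarrow>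
      (\<And>V. V \<in> \<V> \<Longrightarrow> V \<noteq> {} \<Longrightarrow> m \<in> M V) \<Longrightarrow> \<Union>\<V> \<noteq> {} \<Longrightarrow> m \<in> M (\<Union>\<V>)"
    and carrier_sections: "openin (space_top X) U \<Longrightarrow> carrier (sections X U) = sec U ` M U"
    and mult_sections: "openin (space_top X) U \<Longrightarrow> m \<in> M U \<Longrightarrow> m' \<in> M U \<Longrightarrow>
      sec U m \<otimes>\<^bsub>sections X U\<^esub> sec U m' = sec U (m * m')"
    and one_sections: "openin (space_top X) U \<Longrightarrow> \<one>\<^bsub>sections X U\<^esub> = sec U 1"
    and zero_sections: "openin (space_top X) U \<Longrightarrow> pzero (sections X U) = sec U 0"
    and sec_inj: "openin (space_top X) U \<Longrightarrow> U \<noteq> {} \<Longrightarrow> inj_on (sec U) (M U)"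
    and sec_empty: "sec {} m = sec {} m'"
    and res_sec: "openin (space_top X) U \<Longrightarrow> openin (space_top X) V \<Longrightarrow> V \<subseteq> U \<Longrightarrow> m \<in> M U \<Longrightarrow>
      res X U V (sec U m) = sec V m"
begin

lemma monoidal_space: "monoidal_space X"
proof (rule monoidal_space.intro)
  fix U assume U: "openin (space_top X) U"
  show "pointed_monoid (sections X U)"
    using M_one M_zero M_mult
    by unfold_locales
      (auto simp: carrier_sections[OF U] mult_sections[OF U] one_sections[OF U] zero_sections[OF U]
        M_one[OF U] M_zero[OF U] M_mult[OF U] mult_ac)
  show "res X U U s = s" if "s \<in> carrier (sections X U)" for s
    using that by (auto simp: carrier_sections[OF U] res_sec[OF U U])
  fix V assume V: "openin (space_top X) V" "V \<subseteq> U"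
  note Ms = M_one[OF U] M_zero[OF U] M_mult[OF U] M_mono[OF U V]
  show "res X U V \<in> pm_hom (sections X U) (sections X V)"
    unfolding pm_hom_def hom_def
    by (auto simp: carrier_sections[OF U] carrier_sections[OF V(1)] mult_sections[OF U] mult_sections[OF V(1)]
        one_sections[OF U] one_sections[OF V(1)] zero_sections[OF U] zero_sections[OF V(1)] res_sec[OF U V] Ms)
  fix W assume W: "openin (space_top X) W" "W \<subseteq> V"
  have WU: "W \<subseteq> U" using V W by blast
  show "res X V W (res X U V s) = res X U W s" if "s \<in> carrier (sections X U)" for s
    using that Ms by (auto simp: carrier_sections[OF U] res_sec[OF U V] res_sec[OF V(1) W] res_sec[OF U W(1) WU])
next
  fix \<V> \<sigma>
  assume op: "\<And>V. V \<in> \<V> \<Longrightarrow> openin (space_top X) V"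
    and car: "\<And>V. V \<in> \<V> \<Longrightarrow> \<sigma> V \<in> carrier (sections X V)"
    and comp: "\<And>V W. V \<in> \<V> \<Longrightarrow> W \<in> \<V> \<Longrightarrow> res X V (V \<inter> W) (\<sigma> V) = res X W (V \<inter> W) (\<sigma> W)"
  have opU: "openin (space_top X) (\<Union>\<V>)" using op by blast
  have "\<forall>V\<in>\<V>. \<exists>m. m \<in> M V \<and> \<sigma> V = sec V m" using car carrier_sections op by blast
  then obtain \<mu> where \<mu>: "\<And>V. V \<in> \<V> \<Longrightarrow> \<mu> V \<in> M V" "\<And>V. V \<in> \<V> \<Longrightarrow> \<sigma> V = sec V (\<mu> V)" by metis
  show "\<exists>!t. t \<in> carrier (sections X (\<Union>\<V>)) \<and> (\<forall>V\<in>\<V>. res X (\<Union>\<V>) V t = \<sigma> V)"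
  proof (cases "\<Union>\<V> = {}")
    case True
    have e: "sec (\<Union>\<V>) m = sec {} 1" for m unfolding True by (rule sec_empty)
    have "res X (\<Union>\<V>) V (sec {} 1) = \<sigma> V" if "V \<in> \<V>" for V
    proof -
      have "V = {}" using True that by blast
      have o: "openin (space_top X) {}" by simp
      show ?thesis using res_sec[OF o o _ M_one[OF o]] \<mu>(2)[OF that] sec_empty[of "\<mu> V" 1]
        unfolding True \<open>V = {}\<close> by simp
    qed
    moreover have "sec {} 1 \<in> carrier (sections X (\<Union>\<V>))"
      unfolding e[of 1, symmetric] carrier_sections[OF opU] using M_one[OF opU] by (rule imageI)
    moreover have "t = sec {} 1" if "t \<in> carrier (sections X (\<Union>\<V>))" for t
      using that e unfolding carrier_sections[OF opU] by auto
    ultimately show ?thesis by blast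
  next
    case False
    then obtain V0 where V0: "V0 \<in> \<V>" "V0 \<noteq> {}" by blast
    have same: "\<mu> V = \<mu> V0" if V: "V \<in> \<V>" "V \<noteq> {}" for V
    proof -
      have "g \<in> V \<inter> V0" using generic op V V0 by blast
      moreover have o: "openin (space_top X) (V \<inter> V0)" using op V V0 by blast
      moreover have "sec (V \<inter> V0) (\<mu> V) = sec (V \<inter> V0) (\<mu> V0)"
        using comp[OF V(1) V0(1)] \<mu> V V0 res_sec[OF op o] by simp
      moreover have "\<mu> V \<in> M (V \<inter> V0)" "\<mu> V0 \<in> M (V \<inter> V0)"
        using M_mono[OF op o] \<mu>(1) V V0 by auto
      ultimately show ?thesis using sec_inj[OF o] by (auto dest: inj_onD)
    qed
    have mU: "\<mu> V0 \<in> M (\<Union>\<V>)" using M_Union[OF op _ False] same \<mu>(1) by metis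
    have "res X (\<Union>\<V>) V (sec (\<Union>\<V>) (\<mu> V0)) = \<sigma> V" if "V \<in> \<V>" for V
    proof (cases "V = {}")
      case True
      then show ?thesis using res_sec[OF opU op[OF that] _ mU] \<mu>(2)[OF that] sec_empty by simp
    next
      case False
      then show ?thesis using res_sec[OF opU op[OF that] _ mU] \<mu>(2)[OF that] same[OF that] that by auto
    qed
    moreover have "t = sec (\<Union>\<V>) (\<mu> V0)" if t: "t \<in> carrier (sections X (\<Union>\<V>))" "\<forall>V\<in>\<V>. res X (\<Union>\<V>) V t = \<sigma> V" for t
    proof -
      obtain m where m: "m \<in> M (\<Union>\<V>)" "t = sec (\<Union>\<V>) m" using t(1) carrier_sections[OF opU] by blast
      have sub: "V0 \<subseteq> \<Union>\<V>" using V0 by blast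
      have "sec V0 m = sec V0 (\<mu> V0)" using t(2) V0 m res_sec[OF opU op[OF V0(1)] sub] \<mu>(2) by auto
      then have "m = \<mu> V0" using sec_inj[OF op[OF V0(1)] V0(2)] M_mono[OF opU op[OF V0(1)] sub] m(1) \<mu>(1)[OF V0(1)]
        by (auto dest: inj_onD)
      then show ?thesis using m by simp
    qed
    ultimately show ?thesis using mU carrier_sections[OF opU] by blast
  qed
qed

definition stalk_values :: "'p \<Rightarrow> 'l set" where
  "stalk_values x = {m. \<exists>U. openin (space_top X) U \<and> x \<in> U \<and> m \<in> M U}"

definition germ_of :: "'p \<Rightarrow> 'l \<Rightarrow> ('p set \<times> 's) set" where
  "germ_of x m = {(V, sec V m) | V. openin (space_top X) V \<and> x \<in> V \<and> m \<in> M V}"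

text \<open>Sections that agree on a smaller neighbourhood have the same value there, so a germ
  remembers its value and nothing else.\<close>

lemma germ_sec:
  assumes "openin (space_top X) U" "x \<in> U" "m \<in> M U"
  shows "germ X x U (sec U m) = germ_of x m"
proof -
  have "((U, sec U m), (V, t)) \<in> germ_rel X x \<longleftrightarrow> openin (space_top X) V \<and> x \<in> V \<and> m \<in> M V \<and> t = sec V m" for V t
  proof
    assume "((U, sec U m), (V, t)) \<in> germ_rel X x"
    then obtain W where V: "openin (space_top X) V" "x \<in> V" "t \<in> carrier (sections X V)"
      and W: "openin (space_top X) W" "x \<in> W" "W \<subseteq> U \<inter> V" "res X U W (sec U m) = res X V W t"
      unfolding germ_rel_def by auto
    obtain m' where m': "m' \<in> M V" "t = sec V m'" using V carrier_sections by blast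
    have WU: "W \<subseteq> U" "W \<subseteq> V" using W by auto
    have "sec W m = sec W m'"
      using W(4) res_sec[OF assms(1) W(1) WU(1) assms(3)] res_sec[OF V(1) W(1) WU(2) m'(1)] m'(2) by simp
    moreover have "W \<noteq> {}" using W by blast
    moreover have "m \<in> M W" "m' \<in> M W" using M_mono assms V m' W WU by blast+
    ultimately have "m = m'" using sec_inj[OF W(1)] by (auto dest: inj_onD)
    then show "openin (space_top X) V \<and> x \<in> V \<and> m \<in> M V \<and> t = sec V m" using V m' by blast
  next
    assume V: "openin (space_top X) V \<and> x \<in> V \<and> m \<in> M V \<and> t = sec V m"
    then have "openin (space_top X) (U \<inter> V)" using assms by blast
    then show "((U, sec U m), (V, t)) \<in> germ_rel X x"
      unfolding germ_rel_def using assms V carrier_sections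
      by (auto intro!: exI[of _ "U \<inter> V"] simp: res_sec)
  qed
  then show ?thesis unfolding germ_def germ_of_def by auto
qed

lemma germ_of_inj:
  assumes "m \<in> stalk_values x" "germ_of x m = germ_of x m'"
  shows "m = m'"
proof -
  obtain U where U: "openin (space_top X) U" "x \<in> U" "m \<in> M U" using assms(1) unfolding stalk_values_def by blast
  then have "(U, sec U m) \<in> germ_of x m'" using assms(2) unfolding germ_of_def by blast
  then have "m' \<in> M U" "sec U m = sec U m'" unfolding germ_of_def by auto
  then show ?thesis using sec_inj[OF U(1)] U by (auto dest: inj_onD)
qed

lemma carrier_stalk: "carrier (stalk X x) = germ_of x ` stalk_values x"
  unfolding stalk_def stalk_values_def using germ_sec carrier_sections by fastforce

lemma stalk_values_mult: "m \<in> stalk_values x \<Longrightarrow> m' \<in> stalk_values x \<Longrightarrow> m * m' \<in> stalk_values x"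
proof -
  assume "m \<in> stalk_values x" "m' \<in> stalk_values x"
  then obtain U V where *: "openin (space_top X) U" "x \<in> U" "m \<in> M U" "openin (space_top X) V" "x \<in> V" "m' \<in> M V"
    unfolding stalk_values_def by blast
  then have "openin (space_top X) (U \<inter> V)" by blast
  moreover from this have "m * m' \<in> M (U \<inter> V)"
    using M_mult M_mono[OF *(1) _ _ *(3)] M_mono[OF *(4) _ _ *(6)] by (meson inf_le1 inf_le2)
  ultimately show ?thesis unfolding stalk_values_def using * by blast
qed

lemma stalk_mult:
  assumes "m \<in> stalk_values x" "m' \<in> stalk_values x"
  shows "germ_of x m \<otimes>\<^bsub>stalk X x\<^esub> germ_of x m' = germ_of x (m * m')"
proof -
  have 1: "germ X x (U \<inter> V) (res X U (U \<inter> V) s \<otimes>\<^bsub>sections X (U \<inter> V)\<^esub> res X V (U \<inter> V) t) = germ_of x (m * m')"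
    if "(U, s) \<in> germ_of x m" "(V, t) \<in> germ_of x m'" for U s V t
  proof -
    have *: "openin (space_top X) U" "x \<in> U" "m \<in> M U" "openin (space_top X) V" "x \<in> V" "m' \<in> M V" "s = sec U m" "t = sec V m'"
      using that unfolding germ_of_def by auto
    have o: "openin (space_top X) (U \<inter> V)" using * by blast
    have mm: "m \<in> M (U \<inter> V)" "m' \<in> M (U \<inter> V)" using * M_mono[OF *(1) o] M_mono[OF *(4) o] by auto
    have "res X U (U \<inter> V) s = sec (U \<inter> V) m" "res X V (U \<inter> V) t = sec (U \<inter> V) m'"
      using * res_sec[OF *(1) o] res_sec[OF *(4) o] by auto
    then show ?thesis using mm mult_sections[OF o mm] germ_sec[OF o _ M_mult[OF o mm]] * by simp
  qed
  obtain U s where "(U, s) \<in> germ_of x m" using assms(1) unfolding stalk_values_def germ_of_def by blast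
  moreover obtain V t where "(V, t) \<in> germ_of x m'" using assms(2) unfolding stalk_values_def germ_of_def by blast
  moreover have "germ_of x m \<otimes>\<^bsub>stalk X x\<^esub> germ_of x m' = (\<Union>(U, s)\<in>germ_of x m. \<Union>(V, t)\<in>germ_of x m'. germ X x (U \<inter> V)
        (res X U (U \<inter> V) s \<otimes>\<^bsub>sections X (U \<inter> V)\<^esub> res X V (U \<inter> V) t))"
    unfolding stalk_def by simp
  ultimately show ?thesis using 1 by fastforce
qed

lemma stalk_one: "x \<in> topspace (space_top X) \<Longrightarrow> \<one>\<^bsub>stalk X x\<^esub> = germ_of x 1"
  unfolding stalk_def by (simp add: one_sections germ_sec M_one)

lemma Units_stalk:
  assumes x: "x \<in> topspace (space_top X)"
  shows "Units (stalk X x) = germ_of x ` {m \<in> stalk_values x. \<exists>m'\<in>stalk_values x. m * m' = 1}"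
proof -
  have "germ_of x m \<in> Units (stalk X x) \<longleftrightarrow> (\<exists>m'\<in>stalk_values x. m * m' = 1)" if m: "m \<in> stalk_values x" for m
  proof -
    have "germ_of x m \<in> Units (stalk X x) \<longleftrightarrow> (\<exists>m'\<in>stalk_values x. germ_of x (m' * m) = germ_of x 1 \<and> germ_of x (m * m') = germ_of x 1)"
      unfolding Units_def carrier_stalk using m by (auto simp: stalk_mult stalk_one[OF x])
    also have "\<dots> \<longleftrightarrow> (\<exists>m'\<in>stalk_values x. m * m' = 1)"
      using m by (metis germ_of_inj mult.commute stalk_values_mult)
    finally show ?thesis .
  qed
  note iff = this
  show ?thesis
  proof (intro equalityI subsetI)
    fix C assume C: "C \<in> Units (stalk X x)"
    then have "C \<in> carrier (stalk X x)" unfolding Units_def by blast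
    then obtain m where "m \<in> stalk_values x" "C = germ_of x m" unfolding carrier_stalk by blast
    then show "C \<in> germ_of x ` {m \<in> stalk_values x. \<exists>m'\<in>stalk_values x. m * m' = 1}" using C iff by blast
  next
    fix C assume "C \<in> germ_of x ` {m \<in> stalk_values x. \<exists>m'\<in>stalk_values x. m * m' = 1}"
    then show "C \<in> Units (stalk X x)" using iff by blast
  qed
qed

end

text \<open>The map on sections is a single map \<open>\<theta>\<close> on values. Multiplicativity
  is asked over nonempty open sets only, since over the empty set every element stands for the same
  section. The last premise is locality of the stalk maps: if \<open>\<theta> m\<close> becomes
  invertible at \<open>x\<close>, then \<open>m\<close> is invertible near its image.\<close>

lemma constant_sections_morphism:
  fixes X :: "('p, 's) mspace" and Y :: "('q, 't) mspace"
  assumes X: "constant_sections X M sec g" and Y: "constant_sections Y M' sec' g'"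
    and cont: "continuous_map (space_top X) (space_top Y) (pt h)"
    and \<theta>: "\<theta> 1 = 1" "\<theta> 0 = 0" "\<And>V m m'. openin (space_top Y) V \<Longrightarrow> V \<noteq> {} \<Longrightarrow> m \<in> M' V \<Longrightarrow> m' \<in> M' V \<Longrightarrow> \<theta> (m * m') = \<theta> m * \<theta> m'"
    and \<theta>M: "\<And>V m. openin (space_top Y) V \<Longrightarrow> V \<noteq> {} \<Longrightarrow> m \<in> M' V \<Longrightarrow> \<theta> m \<in> M (pre X h V)"
    and pull: "\<And>V m. openin (space_top Y) V \<Longrightarrow> m \<in> M' V \<Longrightarrow> pull h V (sec' V m) = sec (pre X h V) (\<theta> m)"
    and local: "\<And>x V m m'. openin (space_top Y) V \<Longrightarrow> x \<in> topspace (space_top X) \<Longrightarrow> pt h x \<in> V \<Longrightarrow> m \<in> M' V \<Longrightarrow>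
      m' \<in> constant_sections.stalk_values X M x \<Longrightarrow> \<theta> m * m' = 1 \<Longrightarrow>
      \<exists>W m''. openin (space_top Y) W \<and> pt h x \<in> W \<and> m'' \<in> M' W \<and> m * m'' = 1"
  shows "monoidal_morphism X Y h"
proof -
  interpret X: constant_sections X M sec g by fact
  interpret Y: constant_sections Y M' sec' g' by fact
  have op: "openin (space_top X) (pre X h V)" if "openin (space_top Y) V" for V
    unfolding pre_def using cont that by (rule openin_continuous_map_preimage)
  have pull': "pull h V (sec' V m) \<in> carrier (sections X (pre X h V))" if V: "openin (space_top Y) V" "m \<in> M' V" for V m
  proof (cases "V = {}")
    case True
    then have e: "pre X h V = {}" unfolding pre_def by blast
    show ?thesis using pull[OF V] X.carrier_sections[OF op[OF V(1)]] X.sec_empty[of "\<theta> m" 1] X.M_one[OF op[OF V(1)]] unfolding e by force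
  next
    case False
    then show ?thesis using pull[OF V] X.carrier_sections[OF op[OF V(1)]] \<theta>M[OF V(1) False V(2)] by blast
  qed
  have stalkM: "\<theta> m \<in> X.stalk_values x" if xm: "x \<in> topspace (space_top X)" "m \<in> Y.stalk_values (pt h x)" for x m
  proof -
    obtain V where V: "openin (space_top Y) V" "pt h x \<in> V" "m \<in> M' V" using xm(2) unfolding Y.stalk_values_def by blast
    then have "\<theta> m \<in> M (pre X h V)" using \<theta>M by blast
    moreover have "x \<in> pre X h V" unfolding pre_def using V xm(1) by blast
    ultimately show ?thesis unfolding X.stalk_values_def using op[OF V(1)] by blast
  qed
  have smap: "stalk_map X h x (Y.germ_of (pt h x) m) = X.germ_of x (\<theta> m)"
    if x: "x \<in> topspace (space_top X)" and m: "m \<in> Y.stalk_values (pt h x)" for x m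
  proof -
    have "germ X x (pre X h V) (pull h V t) = X.germ_of x (\<theta> m)" if "(V, t) \<in> Y.germ_of (pt h x) m" for V t
    proof -
      have V: "openin (space_top Y) V" "pt h x \<in> V" "m \<in> M' V" "t = sec' V m" using that unfolding Y.germ_of_def by auto
      then have "\<theta> m \<in> M (pre X h V)" "x \<in> pre X h V" using \<theta>M x unfolding pre_def by auto
      then show ?thesis using V pull[OF V(1,3)] X.germ_sec[OF op[OF V(1)]] by simp
    qed
    moreover have "Y.germ_of (pt h x) m \<noteq> {}" using m unfolding Y.stalk_values_def Y.germ_of_def by blast
    ultimately show ?thesis unfolding stalk_map_def by fastforce
  qed
  show ?thesis
  proof (intro monoidal_morphism.intro X.monoidal_space Y.monoidal_space monoidal_morphism_axioms.intro)
    show "continuous_map (space_top X) (space_top Y) (pt h)" by (rule cont)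
    fix V assume V: "openin (space_top Y) V"
    show "pull h V \<in> pm_hom (sections Y V) (sections X (pre X h V))"
    proof (cases "V = {}")
      case True
      then have e: "pre X h V = {}" unfolding pre_def by blast
      have o: "openin (space_top X) {}" by simp
      have all: "pull h V (sec' V m) = sec {} 1" if "m \<in> M' V" for m
        using pull[OF V that] X.sec_empty unfolding e by simp
      show ?thesis unfolding pm_hom_def hom_def
        using pull' Y.M_mult[OF V] Y.M_one[OF V] Y.M_zero[OF V] X.M_one[OF o] X.sec_empty all
        by (auto simp: Y.carrier_sections[OF V] Y.mult_sections[OF V] Y.one_sections[OF V] Y.zero_sections[OF V]
          e X.carrier_sections[OF o] X.mult_sections[OF o] X.one_sections[OF o] X.zero_sections[OF o])
    next
      case False
      note o = op[OF V]
      show ?thesis unfolding pm_hom_def hom_def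
        using Y.M_mult[OF V] Y.M_one[OF V] Y.M_zero[OF V] \<theta>M[OF V False] \<theta>(3)[OF V False] \<theta>(1,2)
        by (auto simp: Y.carrier_sections[OF V] Y.mult_sections[OF V] Y.one_sections[OF V] Y.zero_sections[OF V]
          X.carrier_sections[OF o] X.mult_sections[OF o] X.one_sections[OF o] X.zero_sections[OF o] pull[OF V])
    qed
    fix W t assume W: "openin (space_top Y) W" "W \<subseteq> V" and t: "t \<in> carrier (sections Y V)"
    obtain m where m: "m \<in> M' V" "t = sec' V m" using t Y.carrier_sections[OF V] by blast
    have sub: "pre X h W \<subseteq> pre X h V" using W unfolding pre_def by blast
    have mW: "m \<in> M' W" using Y.M_mono[OF V W m(1)] .
    have "res X (pre X h V) (pre X h W) (sec (pre X h V) (\<theta> m)) = sec (pre X h W) (\<theta> m)"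
    proof (cases "V = {}")
      case True
      then have e: "pre X h V = {}" "pre X h W = {}" using sub unfolding pre_def by blast+
      have o: "openin (space_top X) {}" by simp
      have "sec {} (\<theta> m) = sec {} 1" by (rule X.sec_empty)
      then show ?thesis unfolding e using X.res_sec[OF o o _ X.M_one[OF o]] by simp
    next
      case False
      then show ?thesis by (intro X.res_sec[OF op[OF V] op[OF W(1)] sub] \<theta>M V m)
    qed
    then show "pull h W (res Y V W t) = res X (pre X h V) (pre X h W) (pull h V t)"
      unfolding m(2) using Y.res_sec[OF V W m(1)] pull[OF V m(1)] pull[OF W(1) mW] by simp
  next
    fix x assume x: "x \<in> topspace (space_top X)"
    then have y: "pt h x \<in> topspace (space_top Y)" using cont by (auto simp: continuous_map_def)
    show "{C \<in> carrier (stalk Y (pt h x)). stalk_map X h x C \<in> Units (stalk X x)} = Units (stalk Y (pt h x))"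
    proof (intro equalityI subsetI)
      fix C assume "C \<in> {C \<in> carrier (stalk Y (pt h x)). stalk_map X h x C \<in> Units (stalk X x)}"
      then obtain m where m: "m \<in> Y.stalk_values (pt h x)" "C = Y.germ_of (pt h x) m"
        and u: "X.germ_of x (\<theta> m) \<in> Units (stalk X x)"
        using smap[OF x] unfolding Y.carrier_stalk by auto
      then obtain n n' where n: "X.germ_of x (\<theta> m) = X.germ_of x n" "n \<in> X.stalk_values x" "n' \<in> X.stalk_values x" "n * n' = 1"
        unfolding X.Units_stalk[OF x] by blast
      have "\<theta> m = n" using X.germ_of_inj[OF stalkM[OF x m(1)] n(1)] .
      then have "\<exists>m''\<in>Y.stalk_values (pt h x). m * m'' = 1"
        using local[OF _ x _ _ n(3)] m(1) n(4) unfolding Y.stalk_values_def by blast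
      then show "C \<in> Units (stalk Y (pt h x))" unfolding Y.Units_stalk[OF y] using m by blast
    next
      fix C assume "C \<in> Units (stalk Y (pt h x))"
      then obtain m m' where m: "m \<in> Y.stalk_values (pt h x)" "m' \<in> Y.stalk_values (pt h x)" "m * m' = 1" "C = Y.germ_of (pt h x) m"
        unfolding Y.Units_stalk[OF y] by blast
      obtain V V' where V: "openin (space_top Y) V" "pt h x \<in> V" "m \<in> M' V" "openin (space_top Y) V'" "pt h x \<in> V'" "m' \<in> M' V'"
        using m(1,2) unfolding Y.stalk_values_def by blast
      have o: "openin (space_top Y) (V \<inter> V')" using V by blast
      have "m \<in> M' (V \<inter> V')" "m' \<in> M' (V \<inter> V')" using Y.M_mono[OF V(1) o] Y.M_mono[OF V(4) o] V by auto
      then have "\<theta> (m * m') = \<theta> m * \<theta> m'" using \<theta>(3)[OF o] V by blast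
      then have "\<theta> m * \<theta> m' = 1" using m(3) \<theta>(1) by simp
      then have "X.germ_of x (\<theta> m) \<in> Units (stalk X x)"
        unfolding X.Units_stalk[OF x] using stalkM[OF x] m by blast
      then show "C \<in> {C \<in> carrier (stalk Y (pt h x)). stalk_map X h x C \<in> Units (stalk X x)}"
        unfolding Y.carrier_stalk using m smap[OF x m(1)] by auto
    qed
  qed
qed

section \<open>The projective line over \<open>\<bbbF>\<^sub>1\<close>\<close>

lemma openin_compact_spec:
  "openin (space_top compact_spec) U \<longleftrightarrow>
     U = {} \<or> U \<subseteq> places \<and> trivial_place \<in> U \<and> finite (places - U :: 'k::field place set)"
  by (simp add: compact_spec_def topology_inverse'[OF istopology_compact])

lemma absolute_value_trivial: "absolute_value (\<lambda>x::'k::field. if x = 0 then 0 else 1)"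
  unfolding absolute_value_def by auto

lemma trivial_place_in: "trivial_place \<in> places"
  unfolding trivial_place_def places_def using absolute_value_trivial by (intro quotientI) simp

lemma trivial_place_mem: "(\<lambda>x::'k::field_char_0. if x = 0 then 0 else 1 :: real) \<in> trivial_place"
  unfolding trivial_place_def by (rule in_class[OF absolute_value_trivial])

lemma place_ring_trivial: "place_ring (trivial_place :: 'k::field_char_0 place) = UNIV"
  and place_ideal_trivial: "place_ideal (trivial_place :: 'k::field_char_0 place) = {0}"
  by (auto simp: place_ring_iff[OF trivial_place_in trivial_place_mem]
      place_ideal_iff[OF trivial_place_in trivial_place_mem] split: if_splits)

lemma topspace_compact_spec: "topspace (space_top compact_spec) = (places :: 'k::field place set)"
proof -
  have "openin (space_top compact_spec) (places :: 'k place set)"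
    unfolding openin_compact_spec using trivial_place_in by auto
  moreover have "U \<subseteq> places" if "openin (space_top compact_spec) U" for U :: "'k place set"
    using that unfolding openin_compact_spec by auto
  ultimately show ?thesis by (meson openin_subset openin_topspace subset_antisym)
qed

locale place =
  fixes \<aa> :: "'k::field_char_0 place"
  assumes place: "\<aa> \<in> places"
begin

definition v :: "'k \<Rightarrow> real" where "v = (SOME v. v \<in> \<aa>)"

lemma v_in: "v \<in> \<aa>" unfolding v_def using places_nonempty[OF place] by (rule someI_ex)

sublocale abs_value v using places_absolute_value[OF place v_in] by unfold_locales

lemma ring_iff: "x \<in> place_ring \<aa> \<longleftrightarrow> v x \<le> 1" by (rule place_ring_iff[OF place v_in])
lemma ideal_iff: "x \<in> place_ideal \<aa> \<longleftrightarrow> v x < 1" by (rule place_ideal_iff[OF place v_in])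
lemma na_iff: "\<aa> \<in> na_places \<longleftrightarrow> nonarchimedean v" by (rule na_places_iff[OF place v_in])

lemma ring_mult: "x \<in> place_ring \<aa> \<Longrightarrow> y \<in> place_ring \<aa> \<Longrightarrow> x * y \<in> place_ring \<aa>"
  unfolding ring_iff mult by (simp add: mult_le_one)

lemma ring_one: "1 \<in> place_ring \<aa>" and ring_zero: "0 \<in> place_ring \<aa>"
  unfolding ring_iff by auto

end

text \<open>For \<open>U = {}\<close> the set of values is the whole field, and the section map
  collapses it to the single section \<open>0\<close> of the terminal monoid.\<close>

interpretation compact_spec: constant_sections
  "compact_spec :: ('k::field_char_0 place, 'k) mspace" "\<lambda>U. {x. \<forall>\<aa>\<in>U. x \<in> place_ring \<aa>}"
  "\<lambda>U m. if U = {} then 0 else m" trivial_place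
proof
  fix U V :: "'k place set" and m m' :: 'k
  let ?M = "\<lambda>U. {x::'k. \<forall>\<aa>\<in>U. x \<in> place_ring \<aa>}"
  assume U: "openin (space_top compact_spec) U"
  have pl: "place \<aa>" if "\<aa> \<in> U" for \<aa>
    using U that unfolding openin_compact_spec by unfold_locales auto
  show "U \<noteq> {} \<Longrightarrow> trivial_place \<in> U" using U unfolding openin_compact_spec by auto
  show "1 \<in> ?M U" "0 \<in> ?M U"
    using place.ring_one[OF pl] place.ring_zero[OF pl] by auto
  show mm: "m \<in> ?M U \<Longrightarrow> m' \<in> ?M U \<Longrightarrow> m * m' \<in> ?M U" using place.ring_mult[OF pl] by auto
  show "carrier (sections compact_spec U) = (\<lambda>m. if U = {} then 0 else m) ` ?M U"
    unfolding compact_spec_def sub_pm_def mult_pm_def sub_ring_def by auto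
  show "m \<in> ?M U \<Longrightarrow> m' \<in> ?M U \<Longrightarrow> (if U = {} then 0 else m) \<otimes>\<^bsub>sections compact_spec U\<^esub> (if U = {} then 0 else m') = (if U = {} then 0 else m * m')"
    unfolding compact_spec_def sub_pm_def mult_pm_def sub_ring_def by auto
  show "\<one>\<^bsub>sections compact_spec U\<^esub> = (if U = {} then 0 else 1 :: 'k)"
    "pzero (sections compact_spec U) = (if U = {} then 0 else 0 :: 'k)"
    unfolding compact_spec_def sub_pm_def mult_pm_def sub_ring_def by auto
  show "openin (space_top compact_spec) V \<Longrightarrow> V \<subseteq> U \<Longrightarrow> m \<in> ?M U \<Longrightarrow> m \<in> ?M V" by auto
  show "V \<subseteq> U \<Longrightarrow> res compact_spec U V (if U = {} then 0 else m) = (if V = {} then 0 else m)"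
    unfolding compact_spec_def by auto
qed (auto simp: inj_on_def)

lemma sub_pm_simps [simp]:
  "carrier (sub_pm S) = S" "x \<otimes>\<^bsub>sub_pm S\<^esub> y = x * y" "\<one>\<^bsub>sub_pm S\<^esub> = 1" "pzero (sub_pm S) = 0"
  by (auto simp: sub_pm_def mult_pm_def sub_ring_def)

section \<open>Evaluation of polynomials and the coordinate monoids\<close>

lemma eval_at_0 [simp]: "eval_at x 0 = 0"
  and eval_at_pCons [simp]: "eval_at x (pCons a p) = of_int a + x * eval_at x p"
  by (auto simp: eval_at_def map_poly_pCons)

lemma eval_at_1 [simp]: "eval_at x 1 = 1"
  using eval_at_pCons[of x 1 0] by (simp flip: one_pCons)

lemma eval_at_add [simp]: "eval_at x (p + q) = eval_at x p + eval_at x q"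
proof -
  have "map_poly of_int (p + q) = (map_poly of_int p + map_poly of_int q :: 'a poly)"
    by (simp add: poly_eq_iff coeff_map_poly)
  then show ?thesis by (simp add: eval_at_def)
qed

lemma eval_at_mult [simp]: "eval_at x (p * q) = eval_at x p * eval_at x q"
proof -
  have "map_poly of_int (p * q) = (map_poly of_int p * map_poly of_int q :: 'a poly)"
    by (simp add: poly_eq_iff coeff_map_poly coeff_mult)
  then show ?thesis by (simp add: eval_at_def)
qed

lemma eval_at_power [simp]: "eval_at x (p ^ n) = eval_at x p ^ n"
  by (induction n) auto

lemma of_int_fract: "of_int a = Fract (of_int a :: 'a::idom) 1"
proof -
  have nat: "of_nat n = Fract (of_nat n :: 'a) 1" for n
    by (induction n) (auto simp: One_fract_def Zero_fract_def)
  show ?thesis by (cases a rule: int_cases2) (simp_all add: nat)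
qed

lemma eval_at_Tvar: "eval_at Tvar p = Fract p 1"
proof (induction p)
  case (pCons a p)
  have "Fract (pCons a p) 1 = Fract [:a:] 1 + Fract [:0, 1:] 1 * Fract p 1" by simp
  moreover have "Fract [:a:] 1 = of_int a" using of_int_fract[of a, where 'a = "int poly"] by (simp add: of_int_poly)
  ultimately show ?case using pCons by (simp add: Tvar_def)
qed (simp add: Zero_fract_def)

lemma eval_at_Tvar_inj: "eval_at Tvar p = eval_at Tvar q \<longleftrightarrow> p = q"
  unfolding eval_at_Tvar by (simp add: eq_fract)

lemma Tvar_nonzero: "Tvar \<noteq> 0"
  unfolding Tvar_def Zero_fract_def by (simp add: eq_fract)

lemma X_power_inj: "[:0, 1:] ^ m = ([:0, 1:] ^ n :: int poly) \<longleftrightarrow> m = n"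
  by (metis degree_linear_power)

lemma Tvar_power_inj: "Tvar ^ m = Tvar ^ n \<longleftrightarrow> m = n"
  using eval_at_Tvar_inj[of "[:0, 1:] ^ m" "[:0, 1:] ^ n"] X_power_inj by simp

lemma Tvar_powi_eq_1: "Tvar powi k = 1 \<longleftrightarrow> k = 0"
proof -
  have nat: "Tvar ^ n = 1 \<longleftrightarrow> n = 0" for n using Tvar_power_inj[of n 0] by simp
  show ?thesis
  proof (cases k rule: int_cases2)
    case (nonneg n)
    then show ?thesis using nat by simp
  next
    case (nonpos n)
    then show ?thesis using nat by (simp add: power_int_minus)
  qed
qed

lemma Tvar_powi_inj: "Tvar powi k = Tvar powi l \<longleftrightarrow> k = l"
proof
  assume "Tvar powi k = Tvar powi l"
  then have "Tvar powi (k - l) = 1" using Tvar_nonzero by (simp add: power_int_diff)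
  then show "k = l" using Tvar_powi_eq_1 by auto
qed simp

lemma carrier_F1_X: "carrier F1_X = insert 0 (range (\<lambda>n. [:0, 1:] ^ n))"
  and F1_X_simps [simp]: "x \<otimes>\<^bsub>F1_X\<^esub> y = x * y" "\<one>\<^bsub>F1_X\<^esub> = 1" "pzero F1_X = 0"
  by (auto simp: F1_X_def)

lemma carrier_F1_T: "carrier F1_T = insert 0 (range (\<lambda>k. Tvar powi k))"
  and F1_T_simps [simp]: "x \<otimes>\<^bsub>F1_T\<^esub> y = x * y" "\<one>\<^bsub>F1_T\<^esub> = 1" "pzero F1_T = 0"
  by (auto simp: F1_T_def)

lemma F1_X_cases: "a \<in> carrier F1_X \<Longrightarrow> (a = 0 \<Longrightarrow> thesis) \<Longrightarrow> (\<And>n. a = [:0, 1:] ^ n \<Longrightarrow> thesis) \<Longrightarrow> thesis"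
  unfolding carrier_F1_X by auto

lemma F1_X_mem [simp]: "0 \<in> carrier F1_X" "[:0, 1:] ^ n \<in> carrier F1_X" "1 \<in> carrier F1_X" "[:0, 1:] \<in> carrier F1_X"
proof -
  show pow: "[:0, 1:] ^ n \<in> carrier F1_X" for n unfolding carrier_F1_X by blast
  show "0 \<in> carrier F1_X" unfolding carrier_F1_X by blast
  show "1 \<in> carrier F1_X" "[:0, 1:] \<in> carrier F1_X" using pow[of 0] pow[of 1] by simp_all
qed

lemma F1_X_mult: "a \<in> carrier F1_X \<Longrightarrow> b \<in> carrier F1_X \<Longrightarrow> a * b \<in> carrier F1_X"
  by (elim F1_X_cases) (auto simp flip: power_add)

lemma pointed_monoid_F1_X: "pointed_monoid F1_X"
  by unfold_locales (auto simp: F1_X_mult mult_ac)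

lemma F1_T_cases: "a \<in> carrier F1_T \<Longrightarrow> (a = 0 \<Longrightarrow> thesis) \<Longrightarrow> (\<And>k. a = Tvar powi k \<Longrightarrow> thesis) \<Longrightarrow> thesis"
  unfolding carrier_F1_T by blast

lemma F1_T_mult: "a \<in> carrier F1_T \<Longrightarrow> b \<in> carrier F1_T \<Longrightarrow> a * b \<in> carrier F1_T"
proof -
  assume ab: "a \<in> carrier F1_T" "b \<in> carrier F1_T"
  have 0: "0 \<in> carrier F1_T" unfolding carrier_F1_T by blast
  have 1: "Tvar powi k * Tvar powi l \<in> carrier F1_T" for k l
    unfolding carrier_F1_T using power_int_add[of Tvar k l] Tvar_nonzero by (metis insertCI rangeI)
  show ?thesis
    by (rule F1_T_cases[OF ab(1)]; rule F1_T_cases[OF ab(2)]) (simp_all only: 0 1 mult_zero_left mult_zero_right)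
qed

lemma F1_T_mem: "0 \<in> carrier F1_T" "1 \<in> carrier F1_T" "Tvar powi k \<in> carrier F1_T"
  unfolding carrier_F1_T using rangeI[of "\<lambda>k. Tvar powi k" 0] by auto

lemma pointed_monoid_F1_T: "pointed_monoid F1_T"
  by unfold_locales (auto simp: F1_T_mult F1_T_mem mult_ac)

abbreviation "ev1 \<equiv> eval_at Tvar"
abbreviation "ev2 \<equiv> eval_at (inverse Tvar)"

lemma T_in_F1_T: "a \<in> carrier F1_X \<Longrightarrow> ev1 a \<in> carrier F1_T" "a \<in> carrier F1_X \<Longrightarrow> ev2 a \<in> carrier F1_T"
proof -
  have "Tvar ^ n \<in> carrier F1_T" "inverse Tvar ^ n \<in> carrier F1_T" for n
    using F1_T_mem(3)[of "int n"] F1_T_mem(3)[of "- int n"] by (auto simp: power_int_minus power_inverse)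
  then show "a \<in> carrier F1_X \<Longrightarrow> ev1 a \<in> carrier F1_T" "a \<in> carrier F1_X \<Longrightarrow> ev2 a \<in> carrier F1_T"
    using F1_T_mem by (auto elim!: F1_X_cases)
qed

lemma T2_inj: "inj_on ev2 (carrier F1_X)"
proof (rule inj_onI)
  fix a b assume "a \<in> carrier F1_X" "b \<in> carrier F1_X" "ev2 a = ev2 b"
  then show "a = b"
    using Tvar_nonzero Tvar_power_inj by (elim F1_X_cases) (auto simp: power_inverse)
qed

lemma T_zero_iff: "a \<in> carrier F1_X \<Longrightarrow> ev1 a = 0 \<longleftrightarrow> a = 0" "a \<in> carrier F1_X \<Longrightarrow> ev2 a = 0 \<longleftrightarrow> a = 0"
  using eval_at_Tvar_inj[of a 0] Tvar_nonzero by (auto elim!: F1_X_cases)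

text \<open>The ideal generated by the variable: \<open>0\<close> and all its positive
  powers.\<close>

definition F1_max :: "int poly set" where "F1_max = carrier F1_X - {1}"

lemma prime_pideal_F1_X: "{P. prime_pideal F1_X P} = {{0}, F1_max}"
proof (intro equalityI subsetI)
  fix P assume "P \<in> {P. prime_pideal F1_X P}"
  then have P: "P \<subseteq> carrier F1_X" "0 \<in> P" "1 \<notin> P" "\<And>a x. a \<in> carrier F1_X \<Longrightarrow> x \<in> P \<Longrightarrow> a * x \<in> P"
    "\<And>a b. a \<in> carrier F1_X \<Longrightarrow> b \<in> carrier F1_X \<Longrightarrow> a * b \<in> P \<Longrightarrow> a \<in> P \<or> b \<in> P"
    unfolding prime_pideal_def by auto
  show "P \<in> {{0}, F1_max}"
  proof (cases "[:0, 1:] \<in> P")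
    case True
    have "[:0, 1:] ^ Suc n \<in> P" for n using P(4)[OF F1_X_mem(2)[of n] True] by (simp add: mult.commute)
    then have "[:0, 1:] ^ n \<in> P" if "n \<noteq> 0" for n using that by (cases n) auto
    then have "x \<in> P" if "x \<in> F1_max" for x
      using that P(2) unfolding F1_max_def by (metis Diff_iff F1_X_cases power_0 singletonI)
    then have "F1_max \<subseteq> P" by blast
    then show ?thesis using P unfolding F1_max_def by auto
  next
    case False
    have "[:0, 1:] ^ n \<notin> P" for n
    proof (induction n)
      case (Suc n)
      then show ?case using P(5)[of "[:0, 1:]" "[:0, 1:] ^ n"] False by auto
    qed (use P in simp)
    then have "P = {0}" using P(1,2) by (auto elim!: F1_X_cases)
    then show ?thesis by simp
  qed
next
  fix P :: "int poly set" assume "P \<in> {{0}, F1_max}"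
  moreover have "prime_pideal F1_X {0}" unfolding prime_pideal_def by auto
  moreover have "prime_pideal F1_X F1_max"
    unfolding prime_pideal_def F1_max_def
  proof (intro conjI ballI impI)
    fix a x :: "int poly" assume ax: "a \<in> carrier F1_X" "x \<in> carrier F1_X - {1}"
    have "a * x \<noteq> 1"
    proof
      assume e: "a * x = 1"
      then have "a \<noteq> 0" "x \<noteq> 0" by auto
      then obtain m n where mn: "a = [:0, 1:] ^ m" "x = [:0, 1:] ^ n" using ax by (metis DiffD1 F1_X_cases)
      then have "[:0, 1:] ^ (m + n) = ([:0, 1:] ^ 0 :: int poly)" using e by (simp only: power_add power_0)
      then have "n = 0" unfolding X_power_inj by simp
      then show False using ax mn by simp
    qed
    then show "a \<otimes>\<^bsub>F1_X\<^esub> x \<in> carrier F1_X - {1}" using ax F1_X_mult by auto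
  qed auto
  ultimately show "P \<in> {P. prime_pideal F1_X P}" by auto
qed

lemma F1_max_simps: "0 \<in> F1_max" "[:0, 1:] ^ n \<in> F1_max \<longleftrightarrow> n \<noteq> 0" "F1_max \<noteq> {0}" "1 \<notin> F1_max" "carrier F1_X - F1_max = {1}"
proof -
  show *: "[:0, 1:] ^ n \<in> F1_max \<longleftrightarrow> n \<noteq> 0" for n unfolding F1_max_def using X_power_inj[of n 0] by auto
  show "F1_max \<noteq> {0}"
  proof
    assume e: "F1_max = {0}"
    show False using *[of 1] unfolding e by simp
  qed
qed (auto simp: F1_max_def)

lemma prime_pideal_F1_T: "{P. prime_pideal F1_T P} = {{0}}"
proof (intro equalityI subsetI)
  fix P assume "P \<in> {P. prime_pideal F1_T P}"
  then have P: "P \<subseteq> carrier F1_T" "0 \<in> P" "1 \<notin> P" "\<And>a x. a \<in> carrier F1_T \<Longrightarrow> x \<in> P \<Longrightarrow> a * x \<in> P"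
    unfolding prime_pideal_def by auto
  have "Tvar powi k \<notin> P" for k
  proof
    assume "Tvar powi k \<in> P"
    then have "Tvar powi (- k) * Tvar powi k \<in> P" using P(4) F1_T_mem by blast
    then show False using P(3) Tvar_nonzero by (simp flip: power_int_add)
  qed
  then show "P \<in> {{0}}" using P(1,2) unfolding carrier_F1_T by auto
next
  fix P :: "int poly fract set" assume "P \<in> {{0}}"
  then show "P \<in> {P. prime_pideal F1_T P}" unfolding prime_pideal_def using F1_T_mem by auto
qed

text \<open>The same spectrum is embedded twice, with the variable sent to \<open>T\<close> and to
  its inverse; thus sections on both charts of the projective line take values in one field and can
  be compared.\<close>

interpretation S1: embedded_spectrum F1_X ev1 "{P. prime_pideal F1_X P}" "{0}"
proof (intro embedded_spectrum.intro field_embedding.intro embedded_spectrum_axioms.intro)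
  show "comm_monoid F1_X" using pointed_monoid_F1_X pointed_monoid.axioms by blast
  show "inj_on ev1 (carrier F1_X)" using eval_at_Tvar_inj by (auto simp: inj_on_def)
  fix P assume P: "P \<in> {P. prime_pideal F1_X P}"
  then show "{0} \<inter> carrier F1_X \<subseteq> P" unfolding prime_pideal_def by auto
  have fe: "field_embedding F1_X ev1"
    by (unfold_locales) (use \<open>inj_on ev1 (carrier F1_X)\<close> in \<open>auto simp: F1_X_mult mult_ac\<close>)
  show "field_embedding.eprime F1_X ev1 P"
    unfolding field_embedding.eprime_def[OF fe] using P T_zero_iff unfolding prime_pideal_def by auto
qed (auto simp: prime_pideal_F1_X)

interpretation S2: embedded_spectrum F1_X ev2 "{P. prime_pideal F1_X P}" "{0}"
proof (intro embedded_spectrum.intro field_embedding.intro embedded_spectrum_axioms.intro)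
  show "inj_on ev2 (carrier F1_X)" by (rule T2_inj)
  fix P assume P: "P \<in> {P. prime_pideal F1_X P}"
  have fe: "field_embedding F1_X ev2"
    by (unfold_locales) (use T2_inj in \<open>auto simp: F1_X_mult mult_ac\<close>)
  show "field_embedding.eprime F1_X ev2 P"
    unfolding field_embedding.eprime_def[OF fe] using P T_zero_iff unfolding prime_pideal_def by auto
qed (use S1.comm_monoid_A S1.generic in auto)

interpretation S12: embedded_spectrum F1_T id "{P. prime_pideal F1_T P}" "{0}"
proof (intro embedded_spectrum.intro field_embedding.intro embedded_spectrum_axioms.intro)
  show cm: "comm_monoid F1_T" using pointed_monoid_F1_T pointed_monoid.axioms by blast
  have fe: "field_embedding F1_T id"
    using cm by (auto simp: field_embedding_def)
  fix P assume P: "P \<in> {P. prime_pideal F1_T P}"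
  then show "field_embedding.eprime F1_T id P"
    unfolding field_embedding.eprime_def[OF fe] unfolding prime_pideal_def by auto
qed (auto simp: prime_pideal_F1_T)

text \<open>As both embeddings are injective, a zigzag of identifications returns after two steps,
  so a class has at most two elements.\<close>

lemma glue_class_Inl:
  fixes j1 :: "'x \<Rightarrow> 'p" and j2 :: "'x \<Rightarrow> 'q"
  assumes "inj_on j1 (topspace T)" "inj_on j2 (topspace T)"
  shows "glue_class T j1 j2 (Inl y) = insert (Inl y) {Inr (j2 x) | x. x \<in> topspace T \<and> j1 x = y}"
    and "glue_class T j1 j2 (Inr z) = insert (Inr z) {Inl (j1 x) | x. x \<in> topspace T \<and> j2 x = z}"
proof -
  define R :: "(('p + 'q) \<times> ('p + 'q)) set" where "R = {(Inl (j1 x), Inr (j2 x)) | x. x \<in> topspace T}"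
  have cl: "glue_class T j1 j2 w = (R \<union> R\<inverse>)\<^sup>* `` {w}" for w unfolding glue_class_def R_def Let_def ..
  have *: "(R \<union> R\<inverse>)\<^sup>* `` {w} = S" if "w \<in> S" "\<And>a. a \<in> S \<Longrightarrow> (w, a) \<in> (R \<union> R\<inverse>)\<^sup>*" "\<And>a b. a \<in> S \<Longrightarrow> (a, b) \<in> R \<union> R\<inverse> \<Longrightarrow> b \<in> S" for w S
  proof (intro equalityI subsetI)
    fix a assume "a \<in> (R \<union> R\<inverse>)\<^sup>* `` {w}"
    then have "(w, a) \<in> (R \<union> R\<inverse>)\<^sup>*" by simp
    then show "a \<in> S" by (induction rule: rtrancl_induct) (use that in blast)+
  qed (use that in blast)
  show "glue_class T j1 j2 (Inl y) = insert (Inl y) {Inr (j2 x) | x. x \<in> topspace T \<and> j1 x = y}"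
    unfolding cl
  proof (rule *)
    fix a assume "a \<in> insert (Inl y) {Inr (j2 x) | x. x \<in> topspace T \<and> j1 x = y}"
    then have "a = Inl y \<or> (Inl y, a) \<in> R \<union> R\<inverse>" unfolding R_def by auto
    then show "(Inl y, a) \<in> (R \<union> R\<inverse>)\<^sup>*" by blast
    show "b \<in> insert (Inl y) {Inr (j2 x) | x. x \<in> topspace T \<and> j1 x = y}"
      if "(a, b) \<in> R \<union> R\<inverse>" for b
      using \<open>a \<in> insert _ _\<close> that assms unfolding R_def by (auto dest: inj_onD)
  qed simp
  show "glue_class T j1 j2 (Inr z) = insert (Inr z) {Inl (j1 x) | x. x \<in> topspace T \<and> j2 x = z}"
    unfolding cl
  proof (rule *)
    fix a assume "a \<in> insert (Inr z) {Inl (j1 x) | x. x \<in> topspace T \<and> j2 x = z}"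
    then have "a = Inr z \<or> (Inr z, a) \<in> R \<union> R\<inverse>" unfolding R_def by auto
    then show "(Inr z, a) \<in> (R \<union> R\<inverse>)\<^sup>*" by blast
    show "b \<in> insert (Inr z) {Inl (j1 x) | x. x \<in> topspace T \<and> j2 x = z}"
      if "(a, b) \<in> R \<union> R\<inverse>" for b
      using \<open>a \<in> insert _ _\<close> that assms unfolding R_def by (auto dest: inj_onD)
  qed simp
qed

lemma glue_class_eq:
  fixes j1 :: "'x \<Rightarrow> 'p" and j2 :: "'x \<Rightarrow> 'q"
  shows "x \<in> topspace T \<Longrightarrow> glue_class T j1 j2 (Inl (j1 x)) = glue_class T j1 j2 (Inr (j2 x))"
proof -
  define R :: "(('p + 'q) \<times> ('p + 'q)) set" where "R = {(Inl (j1 x), Inr (j2 x)) | x. x \<in> topspace T}"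
  have cl: "glue_class T j1 j2 w = (R \<union> R\<inverse>)\<^sup>* `` {w}" for w unfolding glue_class_def R_def Let_def ..
  assume "x \<in> topspace T"
  then have "(Inl (j1 x), Inr (j2 x)) \<in> (R \<union> R\<inverse>)\<^sup>*" "(Inr (j2 x), Inl (j1 x)) \<in> (R \<union> R\<inverse>)\<^sup>*"
    unfolding R_def by blast+
  then show ?thesis unfolding cl by (auto intro: rtrancl_trans)
qed

text \<open>Compatible maps are constant on a class, so the representative picked by
  \<open>SOME\<close> has no influence.\<close>

lemma glue_desc_pt_class:
  fixes j1 :: "'x \<Rightarrow> 'p" and j2 :: "'x \<Rightarrow> 'q"
  assumes "\<And>x. x \<in> topspace T \<Longrightarrow> g1 (j1 x) = g2 (j2 x)"
  shows "glue_desc_pt g1 g2 (glue_class T j1 j2 w) = case_sum g1 g2 w"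
proof -
  define R :: "(('p + 'q) \<times> ('p + 'q)) set" where "R = {(Inl (j1 x), Inr (j2 x)) | x. x \<in> topspace T}"
  have cl: "glue_class T j1 j2 w = (R \<union> R\<inverse>)\<^sup>* `` {w}" unfolding glue_class_def R_def Let_def ..
  have "case_sum g1 g2 a = case_sum g1 g2 w" if "a \<in> glue_class T j1 j2 w" for a
  proof -
    have "(w, a) \<in> (R \<union> R\<inverse>)\<^sup>*" using that unfolding cl by simp
    then show ?thesis
      by (induction rule: rtrancl_induct) (auto simp: R_def assms)
  qed
  moreover have "(SOME a. a \<in> glue_class T j1 j2 w) \<in> glue_class T j1 j2 w"
    by (rule someI[of _ w]) (simp add: cl)
  ultimately show ?thesis unfolding glue_desc_pt_def by blast
qed

lemma openin_glue_top:
  "openin (glue_top U1 U2 T j1 j2) W \<longleftrightarrow>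
     W \<subseteq> glue_class T j1 j2 ` (Inl ` topspace U1 \<union> Inr ` topspace U2) \<and>
     openin U1 {x \<in> topspace U1. glue_class T j1 j2 (Inl x) \<in> W} \<and>
     openin U2 {y \<in> topspace U2. glue_class T j1 j2 (Inr y) \<in> W}"
  by (simp add: glue_top_def topology_inverse'[OF istopology_glue])

lemma topspace_glue_top:
  "topspace (glue_top U1 U2 T j1 j2) = glue_class T j1 j2 ` (Inl ` topspace U1 \<union> Inr ` topspace U2)"
proof -
  let ?S = "glue_class T j1 j2 ` (Inl ` topspace U1 \<union> Inr ` topspace U2)"
  have "{x \<in> topspace U1. glue_class T j1 j2 (Inl x) \<in> ?S} = topspace U1"
    "{x \<in> topspace U2. glue_class T j1 j2 (Inr x) \<in> ?S} = topspace U2" by blast+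
  then have "openin (glue_top U1 U2 T j1 j2) ?S" unfolding openin_glue_top by simp
  moreover have "U \<subseteq> ?S" if "openin (glue_top U1 U2 T j1 j2) U" for U using that unfolding openin_glue_top by blast
  ultimately show ?thesis by (meson openin_subset openin_topspace subset_antisym)
qed

section \<open>Points, open sets and sections of the projective line\<close>

lemma topspace_MSpec: "topspace (space_top (MSpec F1_X)) = {{0}, F1_max}" "topspace F1_overlap = {{0}}"
  using S1.topspace_eq S12.topspace_eq prime_pideal_F1_X prime_pideal_F1_T by (auto simp: MSpec_def)

lemma contr_overlap: "pt (F1_emb Tvar) {0} = {0}" "pt (F1_emb (inverse Tvar)) {0} = {0}"
  using T_zero_iff by (auto simp: spec_map_def Let_def)

abbreviation "F1_class \<equiv> glue_class F1_overlap (pt (F1_emb Tvar)) (pt (F1_emb (inverse Tvar)))"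

definition F1_generic :: p1_point where "F1_generic = F1_class (Inl {0})"
definition F1_zero :: p1_point where "F1_zero = F1_class (Inl F1_max)"
definition F1_infinity :: p1_point where "F1_infinity = F1_class (Inr F1_max)"

lemma F1_class_eqs:
  "F1_class (Inl {0}) = {Inl {0}, Inr {0}}" "F1_class (Inr {0}) = {Inl {0}, Inr {0}}"
  "F1_class (Inl F1_max) = {Inl F1_max}" "F1_class (Inr F1_max) = {Inr F1_max}"
  using F1_max_simps(3)
  by (subst glue_class_Inl; force simp: topspace_MSpec contr_overlap)+

lemma F1_points:
  "F1_class (Inr {0}) = F1_generic" "F1_generic \<noteq> F1_zero" "F1_generic \<noteq> F1_infinity" "F1_zero \<noteq> F1_infinity"
  using F1_max_simps(3) unfolding F1_generic_def F1_zero_def F1_infinity_def F1_class_eqs by auto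

abbreviation "F1_in1 \<equiv> glue_in1 F1_overlap (F1_emb Tvar) (F1_emb (inverse Tvar))"
abbreviation "F1_in2 \<equiv> glue_in2 F1_overlap (F1_emb Tvar) (F1_emb (inverse Tvar))"

definition chart1 :: "p1_point set \<Rightarrow> int poly set set" where "chart1 V = pre (MSpec F1_X) F1_in1 V"
definition chart2 :: "p1_point set \<Rightarrow> int poly set set" where "chart2 V = pre (MSpec F1_X) F1_in2 V"

lemma chart_iff:
  "P \<in> chart1 V \<longleftrightarrow> P = {0} \<and> F1_generic \<in> V \<or> P = F1_max \<and> F1_zero \<in> V"
  "P \<in> chart2 V \<longleftrightarrow> P = {0} \<and> F1_generic \<in> V \<or> P = F1_max \<and> F1_infinity \<in> V"
  unfolding chart1_def chart2_def pre_def topspace_MSpec glue_in1_def glue_in2_def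
  by (auto simp: F1_generic_def F1_zero_def F1_infinity_def F1_points(1)[unfolded F1_generic_def])

lemma openin_P1_F1:
  "openin (space_top P1_F1) V \<longleftrightarrow> V \<subseteq> {F1_generic, F1_zero, F1_infinity} \<and>
     openin (spec_top F1_X {P. prime_pideal F1_X P}) (chart1 V) \<and> openin (spec_top F1_X {P. prime_pideal F1_X P}) (chart2 V)"
  unfolding P1_F1_def glue_mspace_def chart1_def chart2_def pre_def glue_in1_def glue_in2_def
  using F1_points(1)
  by (simp add: openin_glue_top topspace_MSpec F1_generic_def F1_zero_def F1_infinity_def) (auto simp: MSpec_def)

lemma topspace_P1_F1: "topspace (space_top P1_F1) = {F1_generic, F1_zero, F1_infinity}"
  using F1_points(1)
  by (auto simp: P1_F1_def glue_mspace_def topspace_glue_top topspace_MSpec F1_generic_def F1_zero_def F1_infinity_def)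

lemma generic_in_open: "openin (space_top P1_F1) V \<Longrightarrow> V \<noteq> {} \<Longrightarrow> F1_generic \<in> V"
proof -
  assume V: "openin (space_top P1_F1) V" "V \<noteq> {}"
  then have "chart1 V \<noteq> {} \<or> chart2 V \<noteq> {}" using chart_iff unfolding openin_P1_F1 by blast
  then have "{0} \<in> chart1 V \<or> {0} \<in> chart2 V"
    using V(1) S1.generic_in unfolding openin_P1_F1 by blast
  then show ?thesis using F1_max_simps(3) by (auto simp: chart_iff)
qed

definition F1_sec :: "p1_point set \<Rightarrow> int poly fract \<Rightarrow> p1_section" where
  "F1_sec V m = ((\<lambda>P\<in>chart1 V. fsec F1_X ev1 P m), (\<lambda>P\<in>chart2 V. fsec F1_X ev2 P m))"

definition F1_vals :: "p1_point set \<Rightarrow> int poly fract set" where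
  "F1_vals V = {m. (\<forall>P\<in>chart1 V. fsec F1_X ev1 P m \<noteq> {}) \<and> (\<forall>P\<in>chart2 V. fsec F1_X ev2 P m \<noteq> {})}"

lemma fsec_generic1: "fsec F1_X ev1 {0} m \<noteq> {} \<longleftrightarrow> m \<in> carrier F1_T"
  and fsec_generic2: "fsec F1_X ev2 {0} m \<noteq> {} \<longleftrightarrow> m \<in> carrier F1_T"
proof -
  have e: "{0} \<in> {P. prime_pideal F1_X P}" by (simp add: prime_pideal_F1_X)
  have quot: "a / b \<in> carrier F1_T" if "a \<in> carrier F1_T" "b \<in> carrier F1_T" for a b
    by (rule F1_T_cases[OF that(1)]; rule F1_T_cases[OF that(2)])
      (simp_all add: F1_T_mem Tvar_nonzero flip: power_int_diff)
  have pow: "Tvar powi k = Tvar ^ nat k / Tvar ^ nat (- k)" for k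
    by (simp add: power_int_def power_inverse divide_inverse)
  show "fsec F1_X ev1 {0} m \<noteq> {} \<longleftrightarrow> m \<in> carrier F1_T"
    unfolding S1.fsec_nonempty_iff[OF S1.pts_eprime[OF e]]
  proof
    show "m \<in> carrier F1_T" if "\<exists>a\<in>carrier F1_X. \<exists>s\<in>carrier F1_X - {0}. m = ev1 a / ev1 s"
      using that T_in_F1_T quot by blast
    assume "m \<in> carrier F1_T"
    then show "\<exists>a\<in>carrier F1_X. \<exists>s\<in>carrier F1_X - {0}. m = ev1 a / ev1 s"
    proof (cases rule: F1_T_cases[consumes 1])
      case 1
      then show ?thesis by (intro bexI[of _ 0] bexI[of _ 1]) auto
    next
      case (2 k)
      then show ?thesis unfolding pow[of k]
        by (intro bexI[of _ "[:0, 1:] ^ nat k"] bexI[of _ "[:0, 1:] ^ nat (- k)"]) auto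
    qed
  qed
  show "fsec F1_X ev2 {0} m \<noteq> {} \<longleftrightarrow> m \<in> carrier F1_T"
    unfolding S2.fsec_nonempty_iff[OF S2.pts_eprime[OF e]]
  proof
    show "m \<in> carrier F1_T" if "\<exists>a\<in>carrier F1_X. \<exists>s\<in>carrier F1_X - {0}. m = ev2 a / ev2 s"
      using that T_in_F1_T quot by blast
    assume "m \<in> carrier F1_T"
    then show "\<exists>a\<in>carrier F1_X. \<exists>s\<in>carrier F1_X - {0}. m = ev2 a / ev2 s"
    proof (cases rule: F1_T_cases[consumes 1])
      case 1
      then show ?thesis by (intro bexI[of _ 0] bexI[of _ 1]) auto
    next
      case (2 k)
      then show ?thesis unfolding pow[of k]
        by (intro bexI[of _ "[:0, 1:] ^ nat (- k)"] bexI[of _ "[:0, 1:] ^ nat k"]) (auto simp: field_simps)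
    qed
  qed
qed

lemma fsec_closed1: "fsec F1_X ev1 F1_max m \<noteq> {} \<longleftrightarrow> m = 0 \<or> (\<exists>n. m = Tvar ^ n)"
  and fsec_closed2: "fsec F1_X ev2 F1_max m \<noteq> {} \<longleftrightarrow> m = 0 \<or> (\<exists>n. m = inverse Tvar ^ n)"
proof -
  have e: "F1_max \<in> {P. prime_pideal F1_X P}" by (simp add: prime_pideal_F1_X)
  show "fsec F1_X ev1 F1_max m \<noteq> {} \<longleftrightarrow> m = 0 \<or> (\<exists>n. m = Tvar ^ n)"
    unfolding S1.fsec_nonempty_iff[OF S1.pts_eprime[OF e]] F1_max_simps(5) by (auto simp: carrier_F1_X)
  show "fsec F1_X ev2 F1_max m \<noteq> {} \<longleftrightarrow> m = 0 \<or> (\<exists>n. m = inverse Tvar ^ n)"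
    unfolding S2.fsec_nonempty_iff[OF S2.pts_eprime[OF e]] F1_max_simps(5) by (auto simp: carrier_F1_X)
qed

lemma F1_vals_generic: "F1_generic \<in> V \<Longrightarrow> F1_vals V \<subseteq> carrier F1_T"
  unfolding F1_vals_def using fsec_generic1 chart_iff by blast

lemma loc_map_F1_T:
  "fsec F1_X ev1 {0} m \<noteq> {} \<Longrightarrow> loc_map F1_T ev1 {0} (fsec F1_X ev1 {0} m) = fsec F1_T id {0} m"
  "fsec F1_X ev2 {0} m \<noteq> {} \<Longrightarrow> loc_map F1_T ev2 {0} (fsec F1_X ev2 {0} m) = fsec F1_T id {0} m"
proof -
  have e: "{0} \<in> {P. prime_pideal F1_T P}" by (simp add: prime_pideal_F1_T)
  have "ev1 a \<in> carrier F1_T \<and> ev1 t \<in> carrier F1_T - {0} \<and> id (ev1 a) = m * id (ev1 t)" if "(a, t) \<in> fsec F1_X ev1 {0} m" for a t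
    using that T_in_F1_T(1) T_zero_iff(1) unfolding fsec_def id_def by blast
  from loc_map_fsec[OF S12.field_embedding_axioms S12.pts_eprime[OF e] _ this]
  show "fsec F1_X ev1 {0} m \<noteq> {} \<Longrightarrow> loc_map F1_T ev1 {0} (fsec F1_X ev1 {0} m) = fsec F1_T id {0} m" .
  have "ev2 a \<in> carrier F1_T \<and> ev2 t \<in> carrier F1_T - {0} \<and> id (ev2 a) = m * id (ev2 t)" if "(a, t) \<in> fsec F1_X ev2 {0} m" for a t
    using that T_in_F1_T(2) T_zero_iff(2) unfolding fsec_def id_def by blast
  from loc_map_fsec[OF S12.field_embedding_axioms S12.pts_eprime[OF e] _ this]
  show "fsec F1_X ev2 {0} m \<noteq> {} \<Longrightarrow> loc_map F1_T ev2 {0} (fsec F1_X ev2 {0} m) = fsec F1_T id {0} m" .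
qed

text \<open>On each chart a section is a value by \<open>frac_sections_eq\<close>; the gluing
  condition forces the two values to coincide, because a nonempty open set contains the generic
  point of the overlap.\<close>

interpretation P1_F1: constant_sections P1_F1 F1_vals F1_sec F1_generic
proof (rule constant_sections.intro)
  let ?A = "{P. prime_pideal F1_X P}"
  have ep1: "S1.eprime P" and ep2: "S2.eprime P" if "P \<in> chart1 V \<or> P \<in> chart2 V" for P V
  proof -
    have "P \<in> ?A" using that unfolding prime_pideal_F1_X chart_iff by blast
    then show "S1.eprime P" "S2.eprime P" using S1.pts_eprime S2.pts_eprime by auto
  qed
  show gen: "F1_generic \<in> V" if "openin (space_top P1_F1) V" "V \<noteq> {}" for V
    using that by (rule generic_in_open)
  fix U V :: "p1_point set" and m m'
  show "F1_sec {} m = F1_sec {} m'" unfolding F1_sec_def by (auto simp: chart_iff)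
  show "m \<in> F1_vals (\<Union>\<V>)" if vals: "\<And>V. V \<in> \<V> \<Longrightarrow> V \<noteq> {} \<Longrightarrow> m \<in> F1_vals V" for \<V>
  proof -
    have "\<exists>V\<in>\<V>. P \<in> chart1 V" if "P \<in> chart1 (\<Union>\<V>)" for P using that unfolding chart_iff by blast
    moreover have "\<exists>V\<in>\<V>. P \<in> chart2 V" if "P \<in> chart2 (\<Union>\<V>)" for P using that unfolding chart_iff by blast
    moreover have "V \<noteq> {}" if "P \<in> chart1 V \<or> P \<in> chart2 V" for P V using that unfolding chart_iff by blast
    ultimately show ?thesis using vals unfolding F1_vals_def mem_Collect_eq by metis
  qed
  assume U: "openin (space_top P1_F1) U"
  show "1 \<in> F1_vals U" "0 \<in> F1_vals U"
  proof -
    have one: "\<exists>n. 1 = Tvar ^ n" "\<exists>n. 1 = inverse Tvar ^ n" by (rule exI[of _ 0], simp)+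
    have n1: "fsec F1_X ev1 P 1 \<noteq> {}" "fsec F1_X ev1 P 0 \<noteq> {}" if "P \<in> {{0}, F1_max}" for P
      using that fsec_generic1 fsec_closed1 F1_T_mem(1,2) one by blast+
    have n2: "fsec F1_X ev2 P 1 \<noteq> {}" "fsec F1_X ev2 P 0 \<noteq> {}" if "P \<in> {{0}, F1_max}" for P
      using that fsec_generic2 fsec_closed2 F1_T_mem(1,2) one by blast+
    have c: "P \<in> {{0}, F1_max}" if "P \<in> chart1 U \<or> P \<in> chart2 U" for P using that unfolding chart_iff by auto
    show "1 \<in> F1_vals U" unfolding F1_vals_def using n1(1)[OF c] n2(1)[OF c] by blast
    show "0 \<in> F1_vals U" unfolding F1_vals_def using n1(2)[OF c] n2(2)[OF c] by blast
  qed
  show mm: "m * m' \<in> F1_vals U" if "m \<in> F1_vals U" "m' \<in> F1_vals U"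
  proof -
    have "fsec F1_X ev1 P (m * m') \<noteq> {}" if "P \<in> chart1 U" for P
      using S1.fsec_mult_nonempty[OF ep1, of P U m m'] \<open>m \<in> _\<close> \<open>m' \<in> _\<close> that unfolding F1_vals_def by blast
    moreover have "fsec F1_X ev2 P (m * m') \<noteq> {}" if "P \<in> chart2 U" for P
      using S2.fsec_mult_nonempty[OF ep2, of P U m m'] \<open>m \<in> _\<close> \<open>m' \<in> _\<close> that unfolding F1_vals_def by blast
    ultimately show ?thesis unfolding F1_vals_def by simp
  qed
  have mono: "chart1 V \<subseteq> chart1 U" "chart2 V \<subseteq> chart2 U" if "V \<subseteq> U"
    using that unfolding chart_iff subset_iff by blast+
  show "openin (space_top P1_F1) V \<Longrightarrow> V \<subseteq> U \<Longrightarrow> m \<in> F1_vals U \<Longrightarrow> m \<in> F1_vals V"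
    unfolding F1_vals_def using mono by blast
  show "inj_on (F1_sec U) (F1_vals U)" if "U \<noteq> {}"
  proof (rule inj_onI)
    fix m m' assume m: "m \<in> F1_vals U" "m' \<in> F1_vals U" "F1_sec U m = F1_sec U m'"
    have g: "{0} \<in> chart1 U" using gen[OF U that] chart_iff by blast
    have "fsec F1_X ev1 {0} m = fsec F1_X ev1 {0} m'" 
      using arg_cong[OF m(3), of "\<lambda>z. fst z {0}"] g unfolding F1_sec_def by simp
    then show "m = m'" using S1.fsec_inj[OF ep1] m(1) g unfolding F1_vals_def by blast
  qed
  have car: "carrier (sections (MSpec F1_X) W) = frac_sections F1_X ?A W" for W unfolding MSpec_def by simp
  have c1: "openin (spec_top F1_X ?A) (chart1 U)" and c2: "openin (spec_top F1_X ?A) (chart2 U)"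
    using U unfolding openin_P1_F1 by auto
  have pull1: "pull (F1_emb Tvar) W s = (\<lambda>Q\<in>{Q. Q = {0} \<and> {0} \<in> W}. loc_map F1_T ev1 Q (s {0}))" for W s
    using contr_overlap(1) unfolding spec_map_def Let_def topspace_MSpec
    by (auto simp: restrict_def fun_eq_iff)
  have pull2: "pull (F1_emb (inverse Tvar)) W s = (\<lambda>Q\<in>{Q. Q = {0} \<and> {0} \<in> W}. loc_map F1_T ev2 Q (s {0}))" for W s
    using contr_overlap(2) unfolding spec_map_def Let_def topspace_MSpec
    by (auto simp: restrict_def fun_eq_iff)
  show "carrier (sections P1_F1 U) = F1_sec U ` F1_vals U"
  proof (intro equalityI subsetI)
    fix z assume "z \<in> carrier (sections P1_F1 U)"
    then have "z \<in> glue_sections (MSpec F1_X) (MSpec F1_X) F1_overlap (F1_emb Tvar) (F1_emb (inverse Tvar)) U"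
      unfolding P1_F1_def glue_mspace_def by (simp add: Let_def)
    then obtain s t where z: "z = (s, t)" "s \<in> frac_sections F1_X ?A (chart1 U)" "t \<in> frac_sections F1_X ?A (chart2 U)"
      "pull (F1_emb Tvar) (chart1 U) s = pull (F1_emb (inverse Tvar)) (chart2 U) t"
      unfolding glue_sections_def Let_def car chart1_def chart2_def by auto
    obtain m where m: "s = (\<lambda>P\<in>chart1 U. fsec F1_X ev1 P m)" "\<And>P. P \<in> chart1 U \<Longrightarrow> fsec F1_X ev1 P m \<noteq> {}"
      using z(2) unfolding S1.frac_sections_eq[OF c1] by blast
    obtain n where n: "t = (\<lambda>P\<in>chart2 U. fsec F1_X ev2 P n)" "\<And>P. P \<in> chart2 U \<Longrightarrow> fsec F1_X ev2 P n \<noteq> {}"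
      using z(3) unfolding S2.frac_sections_eq[OF c2] by blast
    show "z \<in> F1_sec U ` F1_vals U"
    proof (cases "U = {}")
      case True
      then have "chart1 U = {}" "chart2 U = {}" using chart_iff by auto
      then show ?thesis unfolding z(1) m(1) n(1) F1_sec_def F1_vals_def by (auto simp: restrict_def)
    next
      case False
      then have g: "{0} \<in> chart1 U" "{0} \<in> chart2 U" using gen[OF U] chart_iff by auto
      have e: "{0} \<in> {P. prime_pideal F1_T P}" by (simp add: prime_pideal_F1_T)
      \<comment> \<open>The gluing condition read at the generic point of the overlap, where both
        pullbacks are expressed by values in the field of \<open>T\<close>.\<close>
      have "loc_map F1_T ev1 {0} (s {0}) = loc_map F1_T ev2 {0} (t {0})"
        using fun_cong[OF z(4), of "{0}"] g unfolding pull1 pull2 by simp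
      then have "fsec F1_T id {0} m = fsec F1_T id {0} n"
        unfolding m(1) n(1) using g loc_map_F1_T m(2) n(2) by simp
      moreover have "fsec F1_T id {0} m \<noteq> {}"
        using m(2)[OF g(1)] unfolding fsec_generic1 S12.fsec_nonempty_iff[OF S12.pts_eprime[OF e]]
        using F1_T_mem by (intro bexI[of _ m] bexI[of _ 1]) auto
      ultimately have "m = n" using S12.fsec_inj[OF S12.pts_eprime[OF e]] by blast
      then have "m \<in> F1_vals U" "z = F1_sec U m" using m n z unfolding F1_vals_def F1_sec_def by auto
      then show ?thesis by blast
    qed
  next
    fix z assume "z \<in> F1_sec U ` F1_vals U"
    then obtain m where m: "m \<in> F1_vals U" "z = F1_sec U m" by blast
    define s t where "s = (\<lambda>P\<in>chart1 U. fsec F1_X ev1 P m)" and "t = (\<lambda>P\<in>chart2 U. fsec F1_X ev2 P m)"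
    have z: "z = (s, t)" unfolding m(2) F1_sec_def s_def t_def ..
    have st: "s \<in> frac_sections F1_X ?A (chart1 U)" "t \<in> frac_sections F1_X ?A (chart2 U)"
      unfolding S1.frac_sections_eq[OF c1] S2.frac_sections_eq[OF c2] s_def t_def
      using m(1) unfolding F1_vals_def by blast+
    have iff: "{0} \<in> chart1 U \<longleftrightarrow> {0} \<in> chart2 U" using chart_iff F1_max_simps(3) by auto
    have "pull (F1_emb Tvar) (chart1 U) s = pull (F1_emb (inverse Tvar)) (chart2 U) t"
    proof -
      have "loc_map F1_T ev1 {0} (s {0}) = loc_map F1_T ev2 {0} (t {0})" if "{0} \<in> chart1 U"
        using loc_map_F1_T m(1) that iff unfolding s_def t_def F1_vals_def by auto
      then show ?thesis unfolding pull1 pull2 using iff by (auto simp: restrict_def fun_eq_iff)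
    qed
    then have "z \<in> glue_sections (MSpec F1_X) (MSpec F1_X) F1_overlap (F1_emb Tvar) (F1_emb (inverse Tvar)) U"
      unfolding glue_sections_def Let_def car z using st unfolding chart1_def chart2_def by simp
    then show "z \<in> carrier (sections P1_F1 U)" unfolding P1_F1_def glue_mspace_def by (simp add: Let_def)
  qed
  show "F1_sec U m \<otimes>\<^bsub>sections P1_F1 U\<^esub> F1_sec U m' = F1_sec U (m * m')" if "m \<in> F1_vals U" "m' \<in> F1_vals U"
  proof -
    have "F1_sec U m \<otimes>\<^bsub>sections P1_F1 U\<^esub> F1_sec U m' =
      ((\<lambda>P\<in>chart1 U. frac_mult F1_X (carrier F1_X - P) (fsec F1_X ev1 P m) (fsec F1_X ev1 P m')),
       (\<lambda>P\<in>chart2 U. frac_mult F1_X (carrier F1_X - P) (fsec F1_X ev2 P m) (fsec F1_X ev2 P m')))"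
      unfolding P1_F1_def glue_mspace_def F1_sec_def chart1_def chart2_def MSpec_def loc_pm_def
      by (auto simp: Let_def DirProd_def fun_eq_iff)
    also have "\<dots> = F1_sec U (m * m')"
    proof -
      have "frac_mult F1_X (carrier F1_X - P) (fsec F1_X ev1 P m) (fsec F1_X ev1 P m') = fsec F1_X ev1 P (m * m')" if "P \<in> chart1 U" for P
        using S1.frac_mult_fsec[OF ep1, of P U m m'] \<open>m \<in> _\<close> \<open>m' \<in> _\<close> that unfolding F1_vals_def by blast
      moreover have "frac_mult F1_X (carrier F1_X - P) (fsec F1_X ev2 P m) (fsec F1_X ev2 P m') = fsec F1_X ev2 P (m * m')" if "P \<in> chart2 U" for P
        using S2.frac_mult_fsec[OF ep2, of P U m m'] \<open>m \<in> _\<close> \<open>m' \<in> _\<close> that unfolding F1_vals_def by blast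
      ultimately show ?thesis unfolding F1_sec_def by (intro arg_cong2[of _ _ _ _ Pair] restrict_ext)
    qed
    finally show ?thesis .
  qed
  have "\<one>\<^bsub>sections P1_F1 U\<^esub> = ((\<lambda>P\<in>chart1 U. fraction F1_X (carrier F1_X - P) 1 \<one>\<^bsub>F1_X\<^esub>),
      (\<lambda>P\<in>chart2 U. fraction F1_X (carrier F1_X - P) 1 \<one>\<^bsub>F1_X\<^esub>))"
    unfolding P1_F1_def glue_mspace_def chart1_def chart2_def MSpec_def loc_pm_def
    by (simp add: Let_def DirProd_def)
  also have "\<dots> = F1_sec U 1"
    unfolding F1_sec_def
    using S1.fraction_one[OF ep1, of _ U 1] S2.fraction_one[OF ep2, of _ U 1]
    by (intro arg_cong2[of _ _ _ _ Pair] restrict_ext) (simp_all only: F1_X_mem F1_X_simps eval_at_1 eval_at_0 simp_thms)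
  finally show "\<one>\<^bsub>sections P1_F1 U\<^esub> = F1_sec U 1" .
  have "pzero (sections P1_F1 U) = ((\<lambda>P\<in>chart1 U. fraction F1_X (carrier F1_X - P) 0 \<one>\<^bsub>F1_X\<^esub>),
      (\<lambda>P\<in>chart2 U. fraction F1_X (carrier F1_X - P) 0 \<one>\<^bsub>F1_X\<^esub>))"
    unfolding P1_F1_def glue_mspace_def chart1_def chart2_def MSpec_def loc_pm_def
    by (simp add: Let_def DirProd_def)
  also have "\<dots> = F1_sec U 0"
    unfolding F1_sec_def
    using S1.fraction_one[OF ep1, of _ U 0] S2.fraction_one[OF ep2, of _ U 0]
    by (intro arg_cong2[of _ _ _ _ Pair] restrict_ext) (simp_all only: F1_X_mem F1_X_simps eval_at_1 eval_at_0 simp_thms)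
  finally show "pzero (sections P1_F1 U) = F1_sec U 0" .
  show "res P1_F1 U V (F1_sec U m) = F1_sec V m" if "V \<subseteq> U"
  proof -
    have "res (MSpec F1_X) W W' s = restrict s W'" for W W' s by (simp add: MSpec_def)
    then have "res P1_F1 U V z = (restrict (fst z) (chart1 V), restrict (snd z) (chart2 V))" for z
      by (simp add: P1_F1_def glue_mspace_def glue_res_def map_prod_def split_def chart1_def chart2_def)
    then show ?thesis using mono[OF that] by (simp add: F1_sec_def Int_absorb1)
  qed
qed

section \<open>The morphism to the projective line\<close>

text \<open>The homomorphism \<open>T \<mapsto> f\<close> on
  \<open>\<bbbF>\<^sub>1[T\<^sup>\<plusminus>]\<close>; it has this meaning on
  \<open>carrier F1_T\<close>. The target is any field, so that \<open>f = inverse Tvar\<close>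
  gives the exchange of the two charts.\<close>

definition T_eval :: "'k::field \<Rightarrow> int poly fract \<Rightarrow> 'k" where
  "T_eval f m = (if m = 0 then 0 else f powi (THE k. m = Tvar powi k))"

lemma T_eval_0 [simp]: "T_eval f 0 = 0" by (simp add: T_eval_def)

lemma T_eval_powi: "T_eval f (Tvar powi k) = f powi k"
  using Tvar_nonzero by (simp add: T_eval_def Tvar_powi_inj)

lemma T_eval_power: "T_eval f (Tvar ^ n) = f ^ n" "T_eval f (inverse Tvar ^ n) = inverse f ^ n"
  using T_eval_powi[of f "int n"] T_eval_powi[of f "- int n"] by (auto simp: power_int_minus power_inverse)

lemma T_eval_1 [simp]: "T_eval f 1 = 1" using T_eval_powi[of f 0] by simp

lemma T_eval_mult:
  assumes "f \<noteq> 0" "m \<in> carrier F1_T" "m' \<in> carrier F1_T"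
  shows "T_eval f (m * m') = T_eval f m * T_eval f m'"
proof (rule F1_T_cases[OF assms(2)]; rule F1_T_cases[OF assms(3)])
  fix k l assume "m = Tvar powi k" "m' = Tvar powi l"
  then show ?thesis using assms(1) Tvar_nonzero T_eval_powi[of f "k + l"]
    by (simp add: power_int_add T_eval_powi)
qed auto

text \<open>On the second chart the variable has value \<open>T\<close> inverse, so evaluating
  numerator and denominator at \<open>1 / f\<close> realizes \<open>T \<mapsto> f\<close> on
  values.\<close>

lemma T_eval_fsec2:
  assumes "f \<noteq> 0" "(a, t) \<in> fsec F1_X ev2 P m" "0 \<in> P"
  shows "eval_at (inverse f) a = T_eval f m * eval_at (inverse f) t"
proof -
  have at: "a \<in> carrier F1_X" "t \<in> carrier F1_X" "t \<noteq> 0" "ev2 a = m * ev2 t" using assms(2,3) unfolding fsec_def by auto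
  obtain j where j: "t = [:0, 1:] ^ j" using at(2,3) by (elim F1_X_cases) auto
  then have m: "m = ev2 a * Tvar ^ j" using at(4) Tvar_nonzero by (simp add: power_inverse field_simps)
  show ?thesis
  proof (rule F1_X_cases[OF at(1)])
    assume "a = 0"
    then show ?thesis using m by simp
  next
    fix i assume i: "a = [:0, 1:] ^ i"
    then have "m = Tvar powi (int j - int i)" using m Tvar_nonzero by (simp add: power_int_diff power_inverse field_simps)
    then show ?thesis using assms(1) by (simp add: T_eval_powi i j power_int_diff power_inverse field_simps)
  qed
qed

definition psi_pt :: "'k::field_char_0 \<Rightarrow> 'k place \<Rightarrow> p1_point" where
  "psi_pt f \<aa> = (if f \<notin> place_ring \<aa> then F1_infinity else if f \<in> place_ideal \<aa> then F1_zero else F1_generic)"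

text \<open>The value of a section is recovered by \<open>THE\<close>, which is unambiguous over
  nonempty \<open>V\<close>; over \<open>V = {}\<close> the result must be the unique section
  \<open>0\<close>.\<close>

definition psi :: "'k::field_char_0 \<Rightarrow> ('k place, 'k, p1_point, p1_section) space_map" where
  "psi f = \<lparr>pt = psi_pt f,
     pull = (\<lambda>V s. if V = {} then 0 else T_eval f (THE m. m \<in> F1_vals V \<and> s = F1_sec V m))\<rparr>"

lemma psi_pull:
  assumes "openin (space_top P1_F1) V" "m \<in> F1_vals V"
  shows "pull (psi f) V (F1_sec V m) = (if V = {} then 0 else T_eval f m)"
proof (cases "V = {}")
  case False
  have "(THE m'. m' \<in> F1_vals V \<and> F1_sec V m = F1_sec V m') = m"
    using P1_F1.sec_inj[OF assms(1) False] assms(2) by (intro the_equality) (auto dest: inj_onD)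
  then show ?thesis using False by (simp add: psi_def)
qed (simp add: psi_def)

locale nonexceptional = number_field_context K for K :: "'k::field_char_0 itself" +
  fixes f :: 'k
  assumes f_nonzero: "f \<noteq> 0"
    and f_nonexceptional: "absolute_value v \<Longrightarrow> \<not> nonarchimedean v \<Longrightarrow> v f \<noteq> 1"
begin

text \<open>A root of unity has value \<open>1\<close> everywhere, which is excluded at an
  archimedean absolute value, and one exists. This makes \<open>T \<mapsto> f\<close>
  injective.\<close>

lemma not_root_of_unity: "f ^ n = 1 \<longleftrightarrow> n = 0"
proof
  assume fn: "f ^ n = 1"
  obtain v :: "'k \<Rightarrow> real" where v: "absolute_value v" "\<not> nonarchimedean v" using archimedean_exists by blast
  interpret abs_value v using v by unfold_locales
  have "v f ^ n = 1" using fn by (simp flip: power)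
  moreover have "v f \<noteq> 1" using f_nonexceptional v by blast
  ultimately show "n = 0" using power_eq_1_iff[of "v f" n] by auto
qed simp

lemma powi_eq_1: "f powi k = 1 \<longleftrightarrow> k = 0"
  by (cases k rule: int_cases2) (auto simp: power_int_minus not_root_of_unity)

lemma T_eval_inj: "m \<in> carrier F1_T \<Longrightarrow> m' \<in> carrier F1_T \<Longrightarrow> T_eval f m = T_eval f m' \<Longrightarrow> m = m'"
proof -
  assume m: "m \<in> carrier F1_T" "m' \<in> carrier F1_T" and e: "T_eval f m = T_eval f m'"
  show ?thesis
  proof (rule F1_T_cases[OF m(1)]; rule F1_T_cases[OF m(2)])
    fix k l assume kl: "m = Tvar powi k" "m' = Tvar powi l"
    then have "f powi (k - l) = 1" using e f_nonzero by (simp add: T_eval_powi power_int_diff)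
    then show ?thesis using kl powi_eq_1 by simp
  qed (use e f_nonzero in \<open>auto simp: T_eval_powi\<close>)
qed

lemma psi_continuous: "continuous_map (space_top compact_spec) (space_top P1_F1) (psi_pt f)"
  unfolding continuous_map_def topspace_compact_spec topspace_P1_F1
proof (intro conjI allI impI)
  show "psi_pt f \<in> places \<rightarrow> {F1_generic, F1_zero, F1_infinity}" unfolding psi_pt_def by auto
  fix V assume V: "openin (space_top P1_F1) V"
  show "openin (space_top compact_spec) {\<aa> \<in> places. psi_pt f \<aa> \<in> V}"
  proof (cases "V = {}")
    case False
    then have g: "F1_generic \<in> V" using generic_in_open V by blast
    have "places - {\<aa> \<in> places. psi_pt f \<aa> \<in> V} \<subseteq> {\<aa> \<in> places. \<not> (f \<in> place_ring \<aa> \<and> f \<notin> place_ideal \<aa>)}"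
      using g unfolding psi_pt_def by auto
    then have "finite (places - {\<aa> \<in> places. psi_pt f \<aa> \<in> V})"
      using finite_places_nonunit[OF f_nonzero] finite_subset by blast
    moreover have "psi_pt f trivial_place = F1_generic"
      unfolding psi_pt_def place_ring_trivial place_ideal_trivial using f_nonzero by auto
    ultimately show ?thesis unfolding openin_compact_spec using g trivial_place_in by auto
  qed simp
qed

text \<open>Regularity at the image point bounds the exponent on the correct side: nonnegative where
  \<open>f\<close> is small, nonpositive where it is large, arbitrary where it has value
  \<open>1\<close>.\<close>

lemma T_eval_place_ring:
  assumes V: "openin (space_top P1_F1) V" "m \<in> F1_vals V" and a: "\<aa> \<in> places" "psi_pt f \<aa> \<in> V"
  shows "T_eval f m \<in> place_ring \<aa>"
proof -
  interpret place \<aa> using a(1) by unfold_locales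
  have g: "F1_generic \<in> V" using generic_in_open V(1) a(2) by blast
  then have mT: "m \<in> carrier F1_T" using F1_vals_generic V(2) by blast
  consider "v f > 1" | "v f < 1" | "v f = 1" by linarith
  then show ?thesis
  proof cases
    case 1
    then have "F1_infinity \<in> V" using a(2) unfolding psi_pt_def ring_iff by simp
    then have "fsec F1_X ev2 F1_max m \<noteq> {}" using V(2) chart_iff unfolding F1_vals_def by blast
    then consider "m = 0" | n where "m = inverse Tvar ^ n" unfolding fsec_closed2 by blast
    then show ?thesis unfolding ring_iff
      using 1 by cases (auto simp: T_eval_power power inverse intro!: power_le_one inverse_le_1_iff[THEN iffD2])
  next
    case 2
    then have "F1_zero \<in> V" using a(2) unfolding psi_pt_def ring_iff ideal_iff by simp
    then have "fsec F1_X ev1 F1_max m \<noteq> {}" using V(2) chart_iff unfolding F1_vals_def by blast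
    then consider "m = 0" | n where "m = Tvar ^ n" unfolding fsec_closed1 by blast
    then show ?thesis unfolding ring_iff
      using 2 by cases (auto simp: T_eval_power power intro!: power_le_one)
  next
    case 3
    then show ?thesis unfolding ring_iff
      by (rule_tac F1_T_cases[OF mT]) (auto simp: T_eval_powi powi)
  qed
qed

lemma chart_generic: "chart1 {F1_generic} = {{0}}" "chart2 {F1_generic} = {{0}}"
proof -
  have "P \<in> chart1 {F1_generic} \<longleftrightarrow> P = {0}" "P \<in> chart2 {F1_generic} \<longleftrightarrow> P = {0}" for P
    unfolding chart_iff singleton_iff using F1_points by metis+
  then show "chart1 {F1_generic} = {{0}}" "chart2 {F1_generic} = {{0}}" by blast+
qed

lemma openin_generic: "openin (space_top P1_F1) {F1_generic}"
proof -
  have "{P \<in> {P. prime_pideal F1_X P}. [:0, 1:] \<notin> P} = {{0}}"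
    unfolding prime_pideal_F1_X using F1_max_simps(2)[of 1] by auto
  then show ?thesis
    unfolding openin_P1_F1 chart_generic using openin_spec_top_basic[OF F1_X_mem(4), of "{P. prime_pideal F1_X P}"] by auto
qed

lemma psi_morphism: "monoidal_morphism compact_spec P1_F1 (psi f)"
proof (rule constant_sections_morphism[OF compact_spec.constant_sections_axioms P1_F1.constant_sections_axioms, where \<theta> = "T_eval f"])
  show "continuous_map (space_top compact_spec) (space_top P1_F1) (pt (psi f))"
    using psi_continuous by (simp add: psi_def)
  have pre: "\<aa> \<in> pre compact_spec (psi f) V \<longleftrightarrow> \<aa> \<in> places \<and> psi_pt f \<aa> \<in> V" for \<aa> V
    unfolding pre_def topspace_compact_spec by (simp add: psi_def)
  fix V assume V: "openin (space_top P1_F1) V"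
  show "T_eval f (m * m') = T_eval f m * T_eval f m'" if "V \<noteq> {}" "m \<in> F1_vals V" "m' \<in> F1_vals V" for m m'
    using F1_vals_generic[OF generic_in_open[OF V that(1)]] that f_nonzero by (intro T_eval_mult) auto
  show "T_eval f m \<in> {x. \<forall>\<aa>\<in>pre compact_spec (psi f) V. x \<in> place_ring \<aa>}" if "V \<noteq> {}" "m \<in> F1_vals V" for m
    using T_eval_place_ring[OF V that(2)] pre by blast
  show "pull (psi f) V (F1_sec V m) = (if pre compact_spec (psi f) V = {} then 0 else T_eval f m)" if "m \<in> F1_vals V" for m
  proof (cases "V = {}")
    case True
    then have "pre compact_spec (psi f) V = {}" using pre by blast
    then show ?thesis using psi_pull[OF V that] True by simp
  next
    case False
    have "psi_pt f trivial_place = F1_generic"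
      unfolding psi_pt_def place_ring_trivial place_ideal_trivial using f_nonzero by auto
    then have "trivial_place \<in> pre compact_spec (psi f) V"
      using pre generic_in_open[OF V False] trivial_place_in by auto
    then show ?thesis using psi_pull[OF V that] False by auto
  qed
  fix \<aa> m m'
  assume \<aa>: "\<aa> \<in> topspace (space_top (compact_spec :: ('k place, 'k) mspace))" "pt (psi f) \<aa> \<in> V" and m: "m \<in> F1_vals V"
    and m': "m' \<in> compact_spec.stalk_values \<aa>" and 1: "T_eval f m * m' = 1"
  have a: "\<aa> \<in> places" "psi_pt f \<aa> \<in> V" using \<aa> unfolding topspace_compact_spec by (auto simp: psi_def)
  interpret place \<aa> using a(1) by unfold_locales
  have g: "F1_generic \<in> V" using generic_in_open V(1) a(2) by blast
  then have mT: "m \<in> carrier F1_T" using F1_vals_generic m by blast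
  have "m' \<in> place_ring \<aa>" using m' unfolding compact_spec.stalk_values_def by blast
  then have "v m' \<le> 1" using ring_iff by blast
  moreover have "v (T_eval f m) \<le> 1" using T_eval_place_ring[OF V m a] ring_iff by blast
  moreover have "v (T_eval f m) * v m' = 1" using 1 by (simp flip: mult)
  ultimately have v1: "v (T_eval f m) = 1"
    by (metis antisym mult.right_neutral mult_left_mono nonneg)
  have m0: "m \<noteq> 0" using v1 by auto
  \<comment> \<open>At a closed point \<open>m\<close> is a power of \<open>T\<close> with exponent
    of fixed sign, and value \<open>1\<close> forces exponent \<open>0\<close>, so
    \<open>m = 1\<close>. At the generic point any power of \<open>T\<close> is invertible on the
    open set \<open>{F1_generic}\<close>.\<close>
  consider "v f > 1" | "v f < 1" | "v f = 1" by linarith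
  then show "\<exists>W m''. openin (space_top P1_F1) W \<and> pt (psi f) \<aa> \<in> W \<and> m'' \<in> F1_vals W \<and> m * m'' = 1"
  proof cases
    case 1
    then have "F1_infinity \<in> V" using a(2) unfolding psi_pt_def ring_iff by simp
    then have "fsec F1_X ev2 F1_max m \<noteq> {}" using m chart_iff unfolding F1_vals_def by blast
    then obtain n where n: "m = inverse Tvar ^ n" unfolding fsec_closed2 using m0 by blast
    then have "inverse (v f) ^ n = 1" using v1 by (simp add: T_eval_power power inverse)
    then have "n = 0" using 1 power_eq_1_iff[of "inverse (v f)" n] by auto
    then show ?thesis using n V \<aa>(2) P1_F1.M_one[OF V] by (intro exI[of _ V] exI[of _ 1]) auto
  next
    case 2
    then have "F1_zero \<in> V" using a(2) unfolding psi_pt_def ring_iff ideal_iff by simp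
    then have "fsec F1_X ev1 F1_max m \<noteq> {}" using m chart_iff unfolding F1_vals_def by blast
    then obtain n where n: "m = Tvar ^ n" unfolding fsec_closed1 using m0 by blast
    then have "v f ^ n = 1" using v1 by (simp add: T_eval_power power)
    then have "n = 0" using 2 power_eq_1_iff[of "v f" n] by auto
    then show ?thesis using n V \<aa>(2) P1_F1.M_one[OF V] by (intro exI[of _ V] exI[of _ 1]) auto
  next
    case 3
    then have "psi_pt f \<aa> = F1_generic" unfolding psi_pt_def ring_iff ideal_iff by simp
    moreover obtain k where k: "m = Tvar powi k" using mT m0 by (elim F1_T_cases) auto
    have "fsec F1_X ev1 {0} (Tvar powi (- k)) \<noteq> {}" "fsec F1_X ev2 {0} (Tvar powi (- k)) \<noteq> {}"
      unfolding fsec_generic1 fsec_generic2 by (rule F1_T_mem)+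
    then have "Tvar powi (- k) \<in> F1_vals {F1_generic}"
      unfolding F1_vals_def chart_generic by simp
    moreover have "m * Tvar powi (- k) = 1" unfolding k using Tvar_nonzero by (simp flip: power_int_add)
    ultimately show ?thesis using openin_generic
      by (intro exI[of _ "{F1_generic}"] exI[of _ "Tvar powi (- k)"]) (auto simp: psi_def)
  qed
qed auto

end

section \<open>Kernel congruences and their residue monoids\<close>

definition kernel_cong :: "('a, 'e) monoid_scheme \<Rightarrow> ('a \<Rightarrow> 'b) \<Rightarrow> ('a \<times> 'a) set" where
  "kernel_cong A h = {(x, y). x \<in> carrier A \<and> y \<in> carrier A \<and> h x = h y}"

lemma equiv_kernel_cong: "equiv (carrier A) (kernel_cong A h)"
  by (rule equivI) (auto simp: kernel_cong_def refl_on_def sym_def trans_def)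

lemma UN_UN_const: "A \<noteq> {} \<Longrightarrow> B \<noteq> {} \<Longrightarrow> (\<And>a b. a \<in> A \<Longrightarrow> b \<in> B \<Longrightarrow> f a b = K) \<Longrightarrow> (\<Union>a\<in>A. \<Union>b\<in>B. f a b) = K"
  by fastforce

text \<open>The setting of the first isomorphism theorem for pointed monoids; \<open>bar\<close>
  will be the induced embedding of the quotient into \<open>N\<close>.\<close>

locale kernel_quotient = A: pointed_monoid A + N: pointed_monoid N
  for A :: "'a pmonoid" and N :: "'b pmonoid" +
  fixes h :: "'a \<Rightarrow> 'b"
  assumes h: "h \<in> pm_hom A N"
begin

lemma h_closed: "x \<in> carrier A \<Longrightarrow> h x \<in> carrier N" and h_mult: "x \<in> carrier A \<Longrightarrow> y \<in> carrier A \<Longrightarrow> h (x \<otimes>\<^bsub>A\<^esub> y) = h x \<otimes>\<^bsub>N\<^esub> h y"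
  and h_one: "h \<one>\<^bsub>A\<^esub> = \<one>\<^bsub>N\<^esub>" and h_zero: "h (pzero A) = pzero N"
  using h unfolding pm_hom_def hom_def by auto

abbreviation "c \<equiv> kernel_cong A h"
abbreviation "B \<equiv> quot_pm A c"

lemma congruence_c: "congruence A c"
  unfolding congruence_def using equiv_kernel_cong[of A h] by (auto simp: kernel_cong_def h_mult)

lemma class_eq_iff: "x \<in> carrier A \<Longrightarrow> y \<in> carrier A \<Longrightarrow> c `` {x} = c `` {y} \<longleftrightarrow> h x = h y"
  unfolding kernel_cong_def by auto

definition bar :: "'a set \<Rightarrow> 'b" where "bar X = the_elem (h ` X)"

lemma bar_class: "x \<in> carrier A \<Longrightarrow> bar (c `` {x}) = h x"
proof -
  assume x: "x \<in> carrier A"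
  have "h ` (c `` {x}) = {h x}" unfolding kernel_cong_def using x by force
  then show ?thesis unfolding bar_def by simp
qed

lemma carrier_B: "carrier B = (\<lambda>x. c `` {x}) ` carrier A"
  unfolding quot_pm_def quotient_def by auto

lemma one_B: "\<one>\<^bsub>B\<^esub> = c `` {\<one>\<^bsub>A\<^esub>}" and zero_B: "pzero B = c `` {pzero A}"
  unfolding quot_pm_def by auto

lemma mult_B:
  assumes "x \<in> carrier A" "y \<in> carrier A"
  shows "c `` {x} \<otimes>\<^bsub>B\<^esub> c `` {y} = c `` {x \<otimes>\<^bsub>A\<^esub> y}"
proof -
  have "c `` {x' \<otimes>\<^bsub>A\<^esub> y'} = c `` {x \<otimes>\<^bsub>A\<^esub> y}" if "x' \<in> c `` {x}" "y' \<in> c `` {y}" for x' y'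
    using that assms by (subst class_eq_iff) (auto simp: kernel_cong_def h_mult)
  moreover have "c `` {x} \<noteq> {}" "c `` {y} \<noteq> {}" using assms by (auto simp: kernel_cong_def)
  ultimately show ?thesis unfolding quot_pm_def by (simp add: UN_UN_const)
qed

lemma pointed_monoid_B: "pointed_monoid B"
proof (intro pointed_monoid.intro comm_monoidI pointed_monoid_axioms.intro)
  show "\<one>\<^bsub>B\<^esub> \<in> carrier B" "pzero B \<in> carrier B" unfolding carrier_B one_B zero_B using A.pzero_closed by auto
  fix X assume "X \<in> carrier B"
  then obtain x where x: "x \<in> carrier A" "X = c `` {x}" unfolding carrier_B by blast
  show "\<one>\<^bsub>B\<^esub> \<otimes>\<^bsub>B\<^esub> X = X" unfolding one_B x(2) using x(1) by (simp add: mult_B)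
  show "pzero B \<otimes>\<^bsub>B\<^esub> X = pzero B" unfolding zero_B x(2) using x(1) A.pzero_closed by (simp add: mult_B A.pzero_absorbing)
  fix Y assume "Y \<in> carrier B"
  then obtain y where y: "y \<in> carrier A" "Y = c `` {y}" unfolding carrier_B by blast
  show "X \<otimes>\<^bsub>B\<^esub> Y \<in> carrier B" unfolding x(2) y(2) mult_B[OF x(1) y(1)] unfolding carrier_B using x y by blast
  show "X \<otimes>\<^bsub>B\<^esub> Y = Y \<otimes>\<^bsub>B\<^esub> X" unfolding x(2) y(2) using x(1) y(1) by (simp add: mult_B A.m_comm)
  fix Z assume "Z \<in> carrier B"
  then obtain z where z: "z \<in> carrier A" "Z = c `` {z}" unfolding carrier_B by blast
  show "X \<otimes>\<^bsub>B\<^esub> Y \<otimes>\<^bsub>B\<^esub> Z = X \<otimes>\<^bsub>B\<^esub> (Y \<otimes>\<^bsub>B\<^esub> Z)"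
    unfolding x(2) y(2) z(2) using x(1) y(1) z(1) by (simp add: mult_B A.m_assoc)
qed

lemma bar_hom: "bar \<in> pm_hom B N"
  unfolding pm_hom_def hom_def
  by (auto simp: carrier_B one_B zero_B bar_class mult_B h_closed h_mult h_one h_zero A.pzero_closed)

lemma bar_inj: "inj_on bar (carrier B)"
proof (rule inj_onI)
  fix X Y assume "X \<in> carrier B" "Y \<in> carrier B" and e: "bar X = bar Y"
  then obtain x y where "x \<in> carrier A" "y \<in> carrier A" "X = c `` {x}" "Y = c `` {y}" unfolding carrier_B by blast
  then show "X = Y" using e class_eq_iff bar_class by metis
qed

end

text \<open>\<open>pm_domain\<close> fixes a list type for the elements of the field. Lists over any
  type can be told apart by length, so this type accommodates every countable field.\<close>

lemma inj_countable_list: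
  assumes "countable C"
  shows "\<exists>i :: 'c \<Rightarrow> 'a list. inj_on i C"
proof (intro exI)
  show "inj_on (\<lambda>x. replicate (to_nat_on C x) undefined :: 'a list) C"
    using inj_on_to_nat_on[OF assms] by (auto simp: inj_on_def dest: arg_cong[of _ _ length])
qed

text \<open>The quotient by a kernel embeds in \<open>L\<close>, and \<open>L\<close> is transported
  along an injection to the type that \<open>pm_domain\<close> prescribes.\<close>

lemma kernel_cong_SCong:
  fixes A :: "'a pmonoid" and L :: "'c ring"
  assumes A: "pointed_monoid A" and L: "field L" "countable (carrier L)" and h: "h \<in> pm_hom A (mult_pm L)"
  shows "kernel_cong A h \<in> SCong A"
proof -
  interpret L: field L by fact
  have N: "pointed_monoid (mult_pm L)"
    by (intro pointed_monoid.intro comm_monoidI pointed_monoid_axioms.intro)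
      (auto simp: mult_pm_def intro: L.m_assoc L.m_comm)
  interpret kernel_quotient A "mult_pm L" h
    using A N h by (auto simp: kernel_quotient_def kernel_quotient_axioms_def)
  obtain i :: "'c \<Rightarrow> 'a set list" where i: "inj_on i (carrier L)" using inj_countable_list[OF L(2)] by blast
  define L' where "L' = image_ring i L"
  have L': "field L'" unfolding L'_def by (rule L.inj_imp_image_ring_is_field[OF i])
  have iso: "i \<in> ring_iso L L'" unfolding L'_def by (rule inj_imp_image_ring_iso[OF i])
  then have ih: "i \<in> ring_hom L L'" by (auto simp: ring_iso_def)
  have i0: "i \<zero>\<^bsub>L\<^esub> = \<zero>\<^bsub>L'\<^esub>" using ring_hom_zero[OF ih] L' L.ring_axioms field.axioms domain.axioms cring.axioms by blast
  have "i \<circ> bar \<in> pm_hom B (mult_pm L')"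
    using bar_hom ih i0 ring_hom_closed[OF ih] ring_hom_mult[OF ih] ring_hom_one[OF ih]
    unfolding pm_hom_def hom_def mult_pm_def by (auto dest: funcset_mem)
  moreover have "inj_on (i \<circ> bar) (carrier B)"
    using bar_inj bar_hom i by (intro comp_inj_on) (auto simp: pm_hom_def hom_def mult_pm_def intro: inj_on_subset)
  ultimately have "pm_domain B" unfolding pm_domain_def using L' by blast
  then show ?thesis unfolding SCong_def using congruence_c by blast
qed

lemma SCong_one_zero: "d \<in> SCong A \<Longrightarrow> pointed_monoid A \<Longrightarrow> (\<one>\<^bsub>A\<^esub>, pzero A) \<notin> d"
proof
  assume d: "d \<in> SCong A" and A: "pointed_monoid A" and 10: "(\<one>\<^bsub>A\<^esub>, pzero A) \<in> d"
  obtain L :: "'a set list ring" and h where L: "field L" and h: "h \<in> pm_hom (quot_pm A d) (mult_pm L)"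
    using d unfolding SCong_def pm_domain_def by blast
  interpret L: field L by fact
  have "equiv (carrier A) d" using d unfolding SCong_def congruence_def by blast
  then have "d `` {\<one>\<^bsub>A\<^esub>} = d `` {pzero A}" using 10 by (rule equiv_class_eq)
  then have "h (\<one>\<^bsub>quot_pm A d\<^esub>) = h (pzero (quot_pm A d))" unfolding quot_pm_def by simp
  moreover have "h \<one>\<^bsub>quot_pm A d\<^esub> = \<one>\<^bsub>L\<^esub>" "h (pzero (quot_pm A d)) = \<zero>\<^bsub>L\<^esub>"
    using h unfolding pm_hom_def mult_pm_def by auto
  ultimately show False using L.one_not_zero by metis
qed

text \<open>The basic open set of the pair \<open>(1, 0)\<close> is everything, because
  \<open>1\<close> and \<open>0\<close> differ in a domain.\<close>

lemma topspace_SCong_top: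
  assumes "pointed_monoid A"
  shows "topspace (SCong_top A) = SCong A"
proof -
  interpret pointed_monoid A by fact
  have "c \<in> \<Union>{{c \<in> SCong A. (a, b) \<notin> c} |a b. a \<in> carrier A \<and> b \<in> carrier A}" if c: "c \<in> SCong A" for c
    using SCong_one_zero[OF c assms] c one_closed pzero_closed by blast
  then show ?thesis unfolding SCong_top_def topology_generated_by_topspace by blast
qed

text \<open>The values are zero or units, so the nonzero classes of \<open>B\<close> are exactly
  those sent to units and can be inverted in \<open>N\<close>. \<open>N\<close> is just a pointed
  monoid, as required by the residue monoids of archimedean places.\<close>

locale unit_kernel_quotient = kernel_quotient A N h for A N h +
  assumes unit_or_zero: "x \<in> carrier A \<Longrightarrow> h x = pzero N \<or> h x \<in> Units N"
    and zero_not_unit: "pzero N \<notin> Units N"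
begin

interpretation B: pointed_monoid B by (rule pointed_monoid_B)

abbreviation "S \<equiv> carrier B - {pzero B}"

lemma bar_simps: "X \<in> carrier B \<Longrightarrow> bar X \<in> carrier N" "X \<in> carrier B \<Longrightarrow> Y \<in> carrier B \<Longrightarrow> bar (X \<otimes>\<^bsub>B\<^esub> Y) = bar X \<otimes>\<^bsub>N\<^esub> bar Y"
  "bar \<one>\<^bsub>B\<^esub> = \<one>\<^bsub>N\<^esub>" "bar (pzero B) = pzero N"
  using bar_hom unfolding pm_hom_def hom_def by auto

lemma bar_zero_iff: "X \<in> carrier B \<Longrightarrow> bar X = pzero N \<longleftrightarrow> X = pzero B"
  using bar_inj bar_simps(4) B.pzero_closed by (metis inj_onD)

lemma bar_S: "Y \<in> carrier B \<Longrightarrow> Y \<in> S \<longleftrightarrow> bar Y \<in> Units N"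
proof -
  assume Y: "Y \<in> carrier B"
  then obtain y where y: "y \<in> carrier A" "bar Y = h y" unfolding carrier_B using bar_class by auto
  show ?thesis using unit_or_zero[OF y(1)] zero_not_unit bar_zero_iff[OF Y] Y unfolding y(2) by auto
qed

lemma S_one: "\<one>\<^bsub>B\<^esub> \<in> S" using bar_S[of "\<one>\<^bsub>B\<^esub>"] bar_simps(3) by simp

lemma S_mult: "X \<in> S \<Longrightarrow> Y \<in> S \<Longrightarrow> X \<otimes>\<^bsub>B\<^esub> Y \<in> S"
  using bar_S[of X] bar_S[of Y] bar_S[of "X \<otimes>\<^bsub>B\<^esub> Y"] bar_simps(2)[of X Y] N.Units_m_closed by auto

lemma fraction_B:
  assumes "X \<in> carrier B" "Y \<in> S"
  shows "fraction B S X Y = {(X', Y'). X' \<in> carrier B \<and> Y' \<in> S \<and> bar X \<otimes>\<^bsub>N\<^esub> bar Y' = bar X' \<otimes>\<^bsub>N\<^esub> bar Y}"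
  using assms bar_S bar_inj bar_hom unfolding pm_hom_def
  by (intro fraction_eq) (auto intro: B.comm_monoid_axioms N.comm_monoid_axioms)

definition value_of :: "('a set \<times> 'a set) set \<Rightarrow> 'b" where
  "value_of z = (THE w. \<exists>X Y. (X, Y) \<in> z \<and> w = bar X \<otimes>\<^bsub>N\<^esub> inv\<^bsub>N\<^esub> (bar Y))"

lemma units_div_eq:
  assumes "x \<in> carrier N" "x' \<in> carrier N" "y \<in> Units N" "y' \<in> Units N"
  shows "x \<otimes>\<^bsub>N\<^esub> y' = x' \<otimes>\<^bsub>N\<^esub> y \<longleftrightarrow> x \<otimes>\<^bsub>N\<^esub> inv\<^bsub>N\<^esub> y = x' \<otimes>\<^bsub>N\<^esub> inv\<^bsub>N\<^esub> y'"
proof -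
  have c: "y \<in> carrier N" "y' \<in> carrier N" "inv\<^bsub>N\<^esub> y \<in> carrier N" "inv\<^bsub>N\<^esub> y' \<in> carrier N" using assms by auto
  have 1: "x \<otimes>\<^bsub>N\<^esub> y' \<otimes>\<^bsub>N\<^esub> (inv\<^bsub>N\<^esub> y \<otimes>\<^bsub>N\<^esub> inv\<^bsub>N\<^esub> y') = x \<otimes>\<^bsub>N\<^esub> inv\<^bsub>N\<^esub> y"
    "x' \<otimes>\<^bsub>N\<^esub> y \<otimes>\<^bsub>N\<^esub> (inv\<^bsub>N\<^esub> y \<otimes>\<^bsub>N\<^esub> inv\<^bsub>N\<^esub> y') = x' \<otimes>\<^bsub>N\<^esub> inv\<^bsub>N\<^esub> y'"
    using c assms by (metis (no_types, lifting) N.Units_r_inv N.m_assoc N.m_closed N.m_comm N.r_one)+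
  have 2: "x \<otimes>\<^bsub>N\<^esub> inv\<^bsub>N\<^esub> y \<otimes>\<^bsub>N\<^esub> (y \<otimes>\<^bsub>N\<^esub> y') = x \<otimes>\<^bsub>N\<^esub> y'"
    "x' \<otimes>\<^bsub>N\<^esub> inv\<^bsub>N\<^esub> y' \<otimes>\<^bsub>N\<^esub> (y \<otimes>\<^bsub>N\<^esub> y') = x' \<otimes>\<^bsub>N\<^esub> y"
    using c assms by (metis (no_types, lifting) N.Units_l_inv N.m_assoc N.m_closed N.m_comm N.r_one)+
  show ?thesis using 1 2 by metis
qed

lemma value_of_fraction:
  assumes "X \<in> carrier B" "Y \<in> S"
  shows "value_of (fraction B S X Y) = bar X \<otimes>\<^bsub>N\<^esub> inv\<^bsub>N\<^esub> (bar Y)"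
  unfolding value_of_def
proof (rule the_equality)
  show "\<exists>X' Y'. (X', Y') \<in> fraction B S X Y \<and> bar X \<otimes>\<^bsub>N\<^esub> inv\<^bsub>N\<^esub> bar Y = bar X' \<otimes>\<^bsub>N\<^esub> inv\<^bsub>N\<^esub> bar Y'"
    using assms fraction_B by blast
  fix w assume "\<exists>X' Y'. (X', Y') \<in> fraction B S X Y \<and> w = bar X' \<otimes>\<^bsub>N\<^esub> inv\<^bsub>N\<^esub> bar Y'"
  then show "w = bar X \<otimes>\<^bsub>N\<^esub> inv\<^bsub>N\<^esub> bar Y"
    using assms bar_S bar_simps(1) units_div_eq unfolding fraction_B[OF assms] by (smt (verit) DiffD1 case_prodD mem_Collect_eq)
qed

lemma fraction_B_eq_iff:
  assumes "X \<in> carrier B" "Y \<in> S" "X' \<in> carrier B" "Y' \<in> S"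
  shows "fraction B S X Y = fraction B S X' Y' \<longleftrightarrow> bar X \<otimes>\<^bsub>N\<^esub> inv\<^bsub>N\<^esub> (bar Y) = bar X' \<otimes>\<^bsub>N\<^esub> inv\<^bsub>N\<^esub> (bar Y')"
proof
  assume "fraction B S X Y = fraction B S X' Y'"
  then show "bar X \<otimes>\<^bsub>N\<^esub> inv\<^bsub>N\<^esub> (bar Y) = bar X' \<otimes>\<^bsub>N\<^esub> inv\<^bsub>N\<^esub> (bar Y')"
    using value_of_fraction assms by metis
next
  assume e: "bar X \<otimes>\<^bsub>N\<^esub> inv\<^bsub>N\<^esub> (bar Y) = bar X' \<otimes>\<^bsub>N\<^esub> inv\<^bsub>N\<^esub> (bar Y')"
  have char: "fraction B S X Y = {(X1, Y1). X1 \<in> carrier B \<and> Y1 \<in> S \<and> bar X \<otimes>\<^bsub>N\<^esub> inv\<^bsub>N\<^esub> (bar Y) = bar X1 \<otimes>\<^bsub>N\<^esub> inv\<^bsub>N\<^esub> (bar Y1)}"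
    if "X \<in> carrier B" "Y \<in> S" for X Y
  proof -
    have "bar X \<otimes>\<^bsub>N\<^esub> bar Y1 = bar X1 \<otimes>\<^bsub>N\<^esub> bar Y \<longleftrightarrow> bar X \<otimes>\<^bsub>N\<^esub> inv\<^bsub>N\<^esub> (bar Y) = bar X1 \<otimes>\<^bsub>N\<^esub> inv\<^bsub>N\<^esub> (bar Y1)"
      if "X1 \<in> carrier B" "Y1 \<in> S" for X1 Y1
      using bar_S bar_simps(1) that \<open>X \<in> carrier B\<close> \<open>Y \<in> S\<close> by (intro units_div_eq) blast+
    then show ?thesis unfolding fraction_B[OF that] by blast
  qed
  show "fraction B S X Y = fraction B S X' Y'" unfolding char[OF assms(1,2)] char[OF assms(3,4)] e ..
qed

lemma carrier_cong_residue: "carrier (cong_residue A c) = {fraction B S X Y | X Y. X \<in> carrier B \<and> Y \<in> S}"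
  unfolding cong_residue_def Let_def loc_pm_def quotient_def fraction_def by auto

lemma one_cong_residue: "\<one>\<^bsub>cong_residue A c\<^esub> = fraction B S \<one>\<^bsub>B\<^esub> \<one>\<^bsub>B\<^esub>"
  and zero_cong_residue: "pzero (cong_residue A c) = fraction B S (pzero B) \<one>\<^bsub>B\<^esub>"
  unfolding cong_residue_def Let_def loc_pm_def by auto

lemma bar_fraction_mult:
  assumes "X \<in> carrier B" "Y \<in> S" "X' \<in> carrier B" "Y' \<in> S"
  shows "bar (X \<otimes>\<^bsub>B\<^esub> X') \<otimes>\<^bsub>N\<^esub> inv\<^bsub>N\<^esub> bar (Y \<otimes>\<^bsub>B\<^esub> Y') = (bar X \<otimes>\<^bsub>N\<^esub> inv\<^bsub>N\<^esub> bar Y) \<otimes>\<^bsub>N\<^esub> (bar X' \<otimes>\<^bsub>N\<^esub> inv\<^bsub>N\<^esub> bar Y')"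
proof -
  have u: "bar Y \<in> Units N" "bar Y' \<in> Units N" using bar_S assms by (metis DiffD1)+
  have c: "bar X \<in> carrier N" "bar X' \<in> carrier N" "bar Y \<in> carrier N" "bar Y' \<in> carrier N"
    "inv\<^bsub>N\<^esub> bar Y \<in> carrier N" "inv\<^bsub>N\<^esub> bar Y' \<in> carrier N" using bar_simps(1) assms u by auto
  have "bar Y \<otimes>\<^bsub>N\<^esub> bar Y' \<otimes>\<^bsub>N\<^esub> (inv\<^bsub>N\<^esub> bar Y \<otimes>\<^bsub>N\<^esub> inv\<^bsub>N\<^esub> bar Y')
      = (bar Y \<otimes>\<^bsub>N\<^esub> inv\<^bsub>N\<^esub> bar Y) \<otimes>\<^bsub>N\<^esub> (bar Y' \<otimes>\<^bsub>N\<^esub> inv\<^bsub>N\<^esub> bar Y')"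
    using c by (simp add: N.m_ac)
  also have "\<dots> = \<one>\<^bsub>N\<^esub>" using u by simp
  finally have "inv\<^bsub>N\<^esub> (bar Y \<otimes>\<^bsub>N\<^esub> bar Y') = inv\<^bsub>N\<^esub> bar Y \<otimes>\<^bsub>N\<^esub> inv\<^bsub>N\<^esub> bar Y'"
    using c by (intro N.comm_inv_char) auto
  moreover have "bar (X \<otimes>\<^bsub>B\<^esub> X') = bar X \<otimes>\<^bsub>N\<^esub> bar X'" "bar (Y \<otimes>\<^bsub>B\<^esub> Y') = bar Y \<otimes>\<^bsub>N\<^esub> bar Y'"
    using bar_simps(2) assms by auto
  ultimately show ?thesis using c by (simp add: N.m_ac)
qed

lemma mult_cong_residue:
  assumes "X \<in> carrier B" "Y \<in> S" "X' \<in> carrier B" "Y' \<in> S"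
  shows "fraction B S X Y \<otimes>\<^bsub>cong_residue A c\<^esub> fraction B S X' Y' = fraction B S (X \<otimes>\<^bsub>B\<^esub> X') (Y \<otimes>\<^bsub>B\<^esub> Y')"
proof -
  have "fraction B S (X1 \<otimes>\<^bsub>B\<^esub> X1') (Y1 \<otimes>\<^bsub>B\<^esub> Y1') = fraction B S (X \<otimes>\<^bsub>B\<^esub> X') (Y \<otimes>\<^bsub>B\<^esub> Y')"
    if in1: "(X1, Y1) \<in> fraction B S X Y" "(X1', Y1') \<in> fraction B S X' Y'" for X1 Y1 X1' Y1'
  proof -
    have c: "X1 \<in> carrier B" "Y1 \<in> S" "X1' \<in> carrier B" "Y1' \<in> S"
      using in1 unfolding fraction_B[OF assms(1,2)] fraction_B[OF assms(3,4)] by auto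
    have "bar X \<otimes>\<^bsub>N\<^esub> bar Y1 = bar X1 \<otimes>\<^bsub>N\<^esub> bar Y" "bar X' \<otimes>\<^bsub>N\<^esub> bar Y1' = bar X1' \<otimes>\<^bsub>N\<^esub> bar Y'"
      using in1 unfolding fraction_B[OF assms(1,2)] fraction_B[OF assms(3,4)] by auto
    then have "bar X \<otimes>\<^bsub>N\<^esub> inv\<^bsub>N\<^esub> bar Y = bar X1 \<otimes>\<^bsub>N\<^esub> inv\<^bsub>N\<^esub> bar Y1"
      "bar X' \<otimes>\<^bsub>N\<^esub> inv\<^bsub>N\<^esub> bar Y' = bar X1' \<otimes>\<^bsub>N\<^esub> inv\<^bsub>N\<^esub> bar Y1'"
      using units_div_eq c assms bar_simps(1) bar_S by (metis DiffD1)+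
    moreover have "X1 \<otimes>\<^bsub>B\<^esub> X1' \<in> carrier B" "X \<otimes>\<^bsub>B\<^esub> X' \<in> carrier B" "Y1 \<otimes>\<^bsub>B\<^esub> Y1' \<in> S" "Y \<otimes>\<^bsub>B\<^esub> Y' \<in> S"
      using c assms S_mult B.m_closed by auto
    ultimately show ?thesis using c assms by (subst fraction_B_eq_iff) (simp_all add: bar_fraction_mult del: Diff_iff)
  qed
  moreover have "fraction B S X Y \<noteq> {}" "fraction B S X' Y' \<noteq> {}"
    using fraction_B assms by blast+
  moreover have "fraction B S X Y \<otimes>\<^bsub>cong_residue A c\<^esub> fraction B S X' Y' = frac_mult B S (fraction B S X Y) (fraction B S X' Y')"
    unfolding cong_residue_def Let_def loc_pm_def by simp
  ultimately show ?thesis unfolding frac_mult_def split_def by (simp add: UN_UN_const)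
qed

lemma value_of_hom: "value_of \<in> pm_hom (cong_residue A c) N"
proof -
  have key: "value_of (fraction B S X Y \<otimes>\<^bsub>cong_residue A c\<^esub> fraction B S X' Y') = value_of (fraction B S X Y) \<otimes>\<^bsub>N\<^esub> value_of (fraction B S X' Y')"
    if "X \<in> carrier B" "Y \<in> S" "X' \<in> carrier B" "Y' \<in> S" for X Y X' Y'
    using that S_mult B.m_closed
    by (simp add: mult_cong_residue value_of_fraction bar_fraction_mult del: Diff_iff)
  have "value_of (fraction B S X Y) \<in> carrier N" if "X \<in> carrier B" "Y \<in> S" for X Y
    using that bar_S[of Y] bar_simps(1) by (simp add: value_of_fraction del: Diff_iff) blast
  moreover have "value_of \<one>\<^bsub>cong_residue A c\<^esub> = \<one>\<^bsub>N\<^esub>" "value_of (pzero (cong_residue A c)) = pzero N"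
    using S_one N.pzero_closed unfolding one_cong_residue zero_cong_residue
    by (simp_all add: value_of_fraction B.pzero_closed bar_simps del: Diff_iff)
  ultimately show ?thesis unfolding pm_hom_def hom_def using key
    by (auto simp: carrier_cong_residue simp del: Diff_iff) blast+
qed

lemma value_of_inj: "inj_on value_of (carrier (cong_residue A c))"
proof (rule inj_onI)
  fix z z' assume z: "z \<in> carrier (cong_residue A c)" "z' \<in> carrier (cong_residue A c)" "value_of z = value_of z'"
  then obtain X Y X' Y' where *: "z = fraction B S X Y" "z' = fraction B S X' Y'"
    "X \<in> carrier B" "Y \<in> S" "X' \<in> carrier B" "Y' \<in> S"
    unfolding carrier_cong_residue by blast
  then show "z = z'" using z(3) value_of_fraction fraction_B_eq_iff by simp
qed

lemma cong_residue_fraction: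
  assumes "z \<in> carrier (cong_residue A c)"
  obtains x y where "x \<in> carrier A" "y \<in> carrier A" "h y \<in> Units N" "z = fraction B S (c `` {x}) (c `` {y})"
proof -
  obtain X Y where z: "z = fraction B S X Y" "X \<in> carrier B" "Y \<in> S" using assms unfolding carrier_cong_residue by blast
  then obtain x y where "x \<in> carrier A" "y \<in> carrier A" "X = c `` {x}" "Y = c `` {y}" unfolding carrier_B by blast
  then show ?thesis using that z bar_S bar_class by (metis DiffD1)
qed

lemma class_in_B: "x \<in> carrier A \<Longrightarrow> c `` {x} \<in> carrier B" unfolding carrier_B by blast
lemma class_in_S: "x \<in> carrier A \<Longrightarrow> h x \<in> Units N \<Longrightarrow> c `` {x} \<in> S"
  using bar_S class_in_B bar_class by metis

definition of_elem :: "'a \<Rightarrow> ('a set \<times> 'a set) set" where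
  "of_elem x = fraction B S (c `` {x}) \<one>\<^bsub>B\<^esub>"

lemma of_elem_closed: "x \<in> carrier A \<Longrightarrow> of_elem x \<in> carrier (cong_residue A c)"
  unfolding of_elem_def carrier_cong_residue using class_in_B S_one by blast

lemma of_elem_mult: "x \<in> carrier A \<Longrightarrow> y \<in> carrier A \<Longrightarrow> of_elem (x \<otimes>\<^bsub>A\<^esub> y) = of_elem x \<otimes>\<^bsub>cong_residue A c\<^esub> of_elem y"
  unfolding of_elem_def using class_in_B S_one by (simp add: mult_cong_residue mult_B del: Diff_iff)

lemma of_elem_one: "of_elem \<one>\<^bsub>A\<^esub> = \<one>\<^bsub>cong_residue A c\<^esub>"
  and of_elem_zero: "of_elem (pzero A) = pzero (cong_residue A c)"
  unfolding of_elem_def one_cong_residue zero_cong_residue one_B zero_B by auto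

lemma value_of_elem: "x \<in> carrier A \<Longrightarrow> value_of (of_elem x) = h x"
  unfolding of_elem_def using class_in_B S_one by (simp add: value_of_fraction bar_class bar_simps(3) h_closed del: Diff_iff)

lemma fraction_times_denominator:
  assumes "x \<in> carrier A" "y \<in> carrier A" "h y \<in> Units N"
  shows "fraction B S (c `` {x}) (c `` {y}) \<otimes>\<^bsub>cong_residue A c\<^esub> of_elem y = of_elem x"
proof -
  note in_B = class_in_B[OF assms(1)] class_in_B[OF assms(2)] and in_S = class_in_S[OF assms(2,3)]
  have "fraction B S (c `` {x}) (c `` {y}) \<otimes>\<^bsub>cong_residue A c\<^esub> of_elem y
      = fraction B S (c `` {x} \<otimes>\<^bsub>B\<^esub> c `` {y}) (c `` {y} \<otimes>\<^bsub>B\<^esub> \<one>\<^bsub>B\<^esub>)"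
    unfolding of_elem_def by (rule mult_cong_residue[OF in_B(1) in_S in_B(2) S_one])
  also have "\<dots> = fraction B S (c `` {x}) \<one>\<^bsub>B\<^esub>"
    using in_B in_S S_one assms h_closed
    by (subst fraction_B_eq_iff) (auto simp: bar_simps bar_class N.m_assoc simp del: Diff_iff)
  finally show ?thesis unfolding of_elem_def .
qed

text \<open>A homomorphism on fractions is determined by its values on \<open>A\<close>: multiply by
  the denominator and cancel its image, which is a unit.\<close>

lemma hom_cong_residue_eqI:
  assumes g: "g \<in> pm_hom (cong_residue A c) N" "g' \<in> pm_hom (cong_residue A c) N"
    and eq: "\<And>x. x \<in> carrier A \<Longrightarrow> g (of_elem x) = g' (of_elem x)"
    and unit: "\<And>y. y \<in> carrier A \<Longrightarrow> h y \<in> Units N \<Longrightarrow> g (of_elem y) \<in> Units N"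
    and z: "z \<in> carrier (cong_residue A c)"
  shows "g z = g' z"
proof -
  obtain x y where xy: "x \<in> carrier A" "y \<in> carrier A" "h y \<in> Units N" "z = fraction B S (c `` {x}) (c `` {y})"
    by (rule cong_residue_fraction[OF z])
  have zy: "z \<otimes>\<^bsub>cong_residue A c\<^esub> of_elem y = of_elem x"
    unfolding xy(4) by (rule fraction_times_denominator[OF xy(1-3)])
  have m: "g (z \<otimes>\<^bsub>cong_residue A c\<^esub> of_elem y) = g z \<otimes>\<^bsub>N\<^esub> g (of_elem y)"
    "g' (z \<otimes>\<^bsub>cong_residue A c\<^esub> of_elem y) = g' z \<otimes>\<^bsub>N\<^esub> g' (of_elem y)"
    using g z of_elem_closed[OF xy(2)] unfolding pm_hom_def hom_def by auto
  have cl: "g z \<in> carrier N" "g' z \<in> carrier N" using g z unfolding pm_hom_def hom_def by auto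
  have "g (of_elem y) \<otimes>\<^bsub>N\<^esub> g z = g (of_elem y) \<otimes>\<^bsub>N\<^esub> g' z"
    using m eq[OF xy(1)] eq[OF xy(2)] cl N.Units_closed[OF unit[OF xy(2,3)]] unfolding zy by (simp add: N.m_comm)
  then show ?thesis using unit[OF xy(2,3)] cl by simp
qed

end

section \<open>Residue monoids of places\<close>

context place
begin

lemma place_cong_equiv: "equiv (place_ring \<aa>) (place_cong \<aa>)"
proof (rule equivI)
  show "place_cong \<aa> \<subseteq> place_ring \<aa> \<times> place_ring \<aa>" unfolding place_cong_def by auto
  show "refl_on (place_ring \<aa>) (place_cong \<aa>)"
    by (rule refl_onI) (auto simp: place_cong_def ideal_iff)
  have "x - y \<in> place_ideal \<aa> \<Longrightarrow> y - x \<in> place_ideal \<aa>" for x y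
    using uminus[of "x - y"] unfolding ideal_iff by simp
  then show "sym (place_cong \<aa>)" by (intro symI) (auto simp: place_cong_def)
  have "x - z \<in> place_ideal \<aa>" if "x - y \<in> place_ideal \<aa>" "y - z \<in> place_ideal \<aa>" "\<aa> \<in> na_places" for x y z
  proof -
    have "v (x - y + (y - z)) \<le> max (v (x - y)) (v (y - z))" using that(3) unfolding na_iff nonarchimedean_def by blast
    then show ?thesis using that(1,2) unfolding ideal_iff by auto
  qed
  note tr = this
  show "trans (place_cong \<aa>)"
  proof (rule transI)
    fix x y z assume "(x, y) \<in> place_cong \<aa>" "(y, z) \<in> place_cong \<aa>"
    then show "(x, z) \<in> place_cong \<aa>"
      using tr[of x y z] by (cases "\<aa> \<in> na_places") (auto simp: place_cong_def)
  qed
qed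

lemma ideal_mult: "x \<in> place_ideal \<aa> \<Longrightarrow> y \<in> place_ring \<aa> \<Longrightarrow> x * y \<in> place_ideal \<aa>"
  "x \<in> place_ring \<aa> \<Longrightarrow> y \<in> place_ideal \<aa> \<Longrightarrow> x * y \<in> place_ideal \<aa>"
  unfolding ideal_iff ring_iff mult
  by (metis le_less_trans mult_left_le nonneg, metis le_less_trans mult_left_le_one_le nonneg)

lemma ideal_sub_ring: "x \<in> place_ideal \<aa> \<Longrightarrow> x \<in> place_ring \<aa>"
  unfolding ideal_iff ring_iff by simp

lemma place_cong_mult_left:
  assumes "(x, x') \<in> place_cong \<aa>" "y \<in> place_ring \<aa>"
  shows "(x * y, x' * y) \<in> place_cong \<aa>"
  using assms ideal_mult ring_mult by (auto simp: place_cong_def simp flip: left_diff_distrib)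

lemma residue_eq_iff: "x \<in> place_ring \<aa> \<Longrightarrow> y \<in> place_ring \<aa> \<Longrightarrow> residue \<aa> x = residue \<aa> y \<longleftrightarrow> (x, y) \<in> place_cong \<aa>"
  unfolding residue_def using eq_equiv_class_iff[OF place_cong_equiv] by blast

lemma residue_eq_0_iff: "x \<in> place_ring \<aa> \<Longrightarrow> residue \<aa> x = residue \<aa> 0 \<longleftrightarrow> x \<in> place_ideal \<aa>"
  by (auto simp: residue_eq_iff ring_zero place_cong_def ideal_iff)

lemma residue_mult_cong:
  assumes "x \<in> place_ring \<aa>" "y \<in> place_ring \<aa>" "x' \<in> residue \<aa> x" "y' \<in> residue \<aa> y"
  shows "residue \<aa> (x' * y') = residue \<aa> (x * y)"
proof -
  have c: "(x, x') \<in> place_cong \<aa>" "(y, y') \<in> place_cong \<aa>" using assms unfolding residue_def by auto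
  then have r: "x' \<in> place_ring \<aa>" "y' \<in> place_ring \<aa>" unfolding place_cong_def by auto
  have "(x * y, x' * y) \<in> place_cong \<aa>" "(y * x', y' * x') \<in> place_cong \<aa>"
    using c r assms place_cong_mult_left by auto
  then have "(x * y, x' * y') \<in> place_cong \<aa>"
    using place_cong_equiv unfolding equiv_def by (metis mult.commute transD)
  then have "residue \<aa> (x * y) = residue \<aa> (x' * y')" using assms r ring_mult by (simp add: residue_eq_iff)
  then show ?thesis by simp
qed

lemma carrier_kappa: "carrier (place_kappa \<aa>) = residue \<aa> ` place_ring \<aa>"
  unfolding place_kappa_def quot_pm_def quotient_def residue_def by auto

lemma one_kappa: "\<one>\<^bsub>place_kappa \<aa>\<^esub> = residue \<aa> 1" and zero_kappa: "pzero (place_kappa \<aa>) = residue \<aa> 0"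
  unfolding place_kappa_def quot_pm_def residue_def by auto

lemma residue_self: "x \<in> place_ring \<aa> \<Longrightarrow> x \<in> residue \<aa> x"
  unfolding residue_def by (rule equiv_class_self[OF place_cong_equiv])

lemma mult_kappa:
  assumes "x \<in> place_ring \<aa>" "y \<in> place_ring \<aa>"
  shows "residue \<aa> x \<otimes>\<^bsub>place_kappa \<aa>\<^esub> residue \<aa> y = residue \<aa> (x * y)"
proof -
  have "residue \<aa> x \<otimes>\<^bsub>place_kappa \<aa>\<^esub> residue \<aa> y = (\<Union>x'\<in>residue \<aa> x. \<Union>y'\<in>residue \<aa> y. residue \<aa> (x' * y'))"
    unfolding place_kappa_def quot_pm_def residue_def by simp
  also have "\<dots> = residue \<aa> (x * y)"
  proof (rule UN_UN_const)
    show "residue \<aa> x \<noteq> {}" "residue \<aa> y \<noteq> {}"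
      using residue_self[OF assms(1)] residue_self[OF assms(2)] by blast+
  qed (rule residue_mult_cong[OF assms])
  finally show ?thesis .
qed

lemma pointed_monoid_kappa: "pointed_monoid (place_kappa \<aa>)"
  by (intro pointed_monoid.intro comm_monoidI pointed_monoid_axioms.intro)
    (auto simp: carrier_kappa one_kappa zero_kappa mult_kappa ring_one ring_zero ring_mult mult_ac)

lemma residue_unit:
  assumes "v x = 1"
  shows "residue \<aa> x \<in> Units (place_kappa \<aa>)"
proof -
  have x: "x \<in> place_ring \<aa>" "inverse x \<in> place_ring \<aa>" "x \<noteq> 0" using assms unfolding ring_iff inverse by auto
  then show ?thesis unfolding Units_def carrier_kappa one_kappa
    by (auto intro!: bexI[of _ "inverse x"] simp: mult_kappa)
qed

lemma zero_not_unit_kappa: "pzero (place_kappa \<aa>) \<notin> Units (place_kappa \<aa>)"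
proof
  assume "pzero (place_kappa \<aa>) \<in> Units (place_kappa \<aa>)"
  then obtain x where "x \<in> place_ring \<aa>" "residue \<aa> x \<otimes>\<^bsub>place_kappa \<aa>\<^esub> residue \<aa> 0 = residue \<aa> 1"
    unfolding Units_def carrier_kappa one_kappa zero_kappa by auto
  then have "residue \<aa> 1 = residue \<aa> 0" by (simp add: mult_kappa ring_zero)
  then show False using residue_eq_0_iff[OF ring_one] unfolding ideal_iff by simp
qed

lemma residue_in_kappa: "x \<in> place_ring \<aa> \<Longrightarrow> residue \<aa> x \<in> carrier (place_kappa \<aa>)"
  unfolding carrier_kappa by blast

lemma eval_at_place_ring: "g \<in> place_ring \<aa> \<Longrightarrow> x \<in> carrier F1_X \<Longrightarrow> eval_at g x \<in> place_ring \<aa>"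
  by (elim F1_X_cases) (auto simp: ring_iff power intro: power_le_one)

definition eval_residue :: "'k \<Rightarrow> int poly \<Rightarrow> 'k set" where
  "eval_residue g x = residue \<aa> (eval_at g x)"

lemma eval_residue_power: "eval_residue g ([:0, 1:] ^ n) = residue \<aa> (g ^ n)" and eval_residue_0: "eval_residue g 0 = residue \<aa> 0"
  and eval_residue_1: "eval_residue g 1 = residue \<aa> 1"
  unfolding eval_residue_def by auto

text \<open>Elements of value \<open>1\<close> become units in the residue monoid and elements of
  smaller value become zero, at archimedean places as well.\<close>

lemma unit_kernel_quotient_eval:
  assumes g: "g \<in> place_ring \<aa>"
  shows "unit_kernel_quotient F1_X (place_kappa \<aa>) (eval_residue g)"
proof (intro unit_kernel_quotient.intro kernel_quotient.intro kernel_quotient_axioms.intro unit_kernel_quotient_axioms.intro)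
  show "eval_residue g \<in> pm_hom F1_X (place_kappa \<aa>)"
    unfolding pm_hom_def hom_def using g eval_at_place_ring[OF g]
    by (auto simp: eval_residue_def residue_in_kappa one_kappa zero_kappa mult_kappa)
  fix x assume x: "x \<in> carrier F1_X"
  show "eval_residue g x = pzero (place_kappa \<aa>) \<or> eval_residue g x \<in> Units (place_kappa \<aa>)"
  proof (cases "v (eval_at g x) = 1")
    case True
    then show ?thesis using residue_unit unfolding eval_residue_def by blast
  next
    case False
    have r: "eval_at g x \<in> place_ring \<aa>" by (rule eval_at_place_ring[OF g x])
    then have "eval_at g x \<in> place_ideal \<aa>" using False unfolding ideal_iff ring_iff by simp
    then show ?thesis using residue_eq_0_iff[OF r] unfolding eval_residue_def zero_kappa by blast
  qed
qed (use pointed_monoid_F1_X pointed_monoid_kappa zero_not_unit_kappa in auto)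

end

definition place_congruence :: "'k::field_char_0 place \<Rightarrow> 'k \<Rightarrow> (int poly \<times> int poly) set" where
  "place_congruence \<aa> g = kernel_cong F1_X (\<lambda>x. residue \<aa> (eval_at g x))"

context number_field_context
begin

text \<open>Makes residue fields countable, hence small enough for the type of fields that
  \<open>pm_domain\<close> admits.\<close>

lemma countable_K: "countable (UNIV :: 'k set)"
proof -
  obtain B :: "'k set" where B: "finite B" "qvs.span B = UNIV"
    using number_field unfolding number_field_def by blast
  have "countable (qvs.span B')" if "finite B'" for B' :: "'k set"
    using that
  proof (induction B' rule: finite_induct)
    case (insert b B')
    have "qvs.span (insert b B') \<subseteq> (\<lambda>(q, x). of_rat q * b + x) ` (UNIV \<times> qvs.span B')"
    proof
      fix x assume "x \<in> qvs.span (insert b B')"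
      then obtain q where "x - of_rat q * b \<in> qvs.span B'" unfolding qvs.span_insert by blast
      then show "x \<in> (\<lambda>(q, x). of_rat q * b + x) ` (UNIV \<times> qvs.span B')"
        by (intro image_eqI[of _ _ "(q, x - of_rat q * b)"]) auto
    qed
    moreover have "countable ((\<lambda>(q, x). of_rat q * b + x) ` (UNIV \<times> qvs.span B'))"
      using insert by (intro countable_image countable_SIGMA) auto
    ultimately show ?case by (rule countable_subset)
  qed simp
  then show ?thesis using B by metis
qed

text \<open>The residue field of a non-archimedean place, as a field in the sense of \<open>HOL-Algebra\<close>; its
  elements are the residue classes.\<close>

lemma residue_field:
  assumes a: "\<aa> \<in> (na_places :: 'k place set)"
  obtains L :: "'k set ring" where "field L" "countable (carrier L)"
    "carrier L = carrier (place_kappa \<aa>)" "\<one>\<^bsub>L\<^esub> = \<one>\<^bsub>place_kappa \<aa>\<^esub>" "\<zero>\<^bsub>L\<^esub> = pzero (place_kappa \<aa>)"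
    "\<And>x y. x \<in> carrier L \<Longrightarrow> y \<in> carrier L \<Longrightarrow> x \<otimes>\<^bsub>L\<^esub> y = x \<otimes>\<^bsub>place_kappa \<aa>\<^esub> y"
proof -
  have pl: "\<aa> \<in> places" using a unfolding na_places_def by simp
  interpret place \<aa> using pl by unfold_locales
  have nv: "nonarchimedean v" using a na_iff by blast
  define R I where "R = sub_ring (place_ring \<aa>)" and "I = place_ideal \<aa>"
  have diff: "x - y \<in> place_ring \<aa>" if "x \<in> place_ring \<aa>" "y \<in> place_ring \<aa>" for x y
    using nv[unfolded nonarchimedean_def, rule_format, of x "- y"] that unfolding ring_iff by simp
  interpret S: subring_set "place_ring \<aa>"
    by unfold_locales (auto simp: ring_one ring_mult diff)
  interpret R: cring R unfolding R_def by (rule S.cring_sub_ring)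
  have Idiff: "x + y \<in> I" if "x \<in> I" "y \<in> I" for x y
    using nv[unfolded nonarchimedean_def, rule_format, of x y] that unfolding I_def ideal_iff by simp
  have pI: "primeideal I R"
    unfolding R_def S.primeideal_sub_ring_iff
  proof (intro conjI ballI impI)
    fix x y assume "x \<in> place_ring \<aa>" "y \<in> place_ring \<aa>" "x * y \<in> I"
    then show "x \<in> I \<or> y \<in> I" unfolding I_def ideal_iff ring_iff mult
      by (metis antisym_conv2 mult.right_neutral order.irrefl)
  qed (auto simp: I_def ideal_sub_ring ideal_mult Idiff[unfolded I_def], simp_all add: ideal_iff)
  then interpret pI: primeideal I R .
  define L where "L = R Quot I"
  have coset: "I +>\<^bsub>R\<^esub> x = residue \<aa> x" if x: "x \<in> place_ring \<aa>" for x
  proof -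
    have "I +>\<^bsub>R\<^esub> x = (\<lambda>i. i + x) ` I" unfolding a_r_coset_def' R_def by auto
    also have "\<dots> = {y. y - x \<in> I}"
      by (auto simp: image_iff) (metis diff_add_cancel)
    also have "\<dots> = residue \<aa> x"
    proof (intro equalityI subsetI)
      fix y assume "y \<in> {y. y - x \<in> I}"
      then have y: "y - x \<in> I" by simp
      then have "y - x + x \<in> place_ring \<aa>" using x ideal_sub_ring S.add_mem unfolding I_def by blast
      moreover have "x - y \<in> I" using y uminus[of "y - x"] unfolding I_def ideal_iff by simp
      ultimately show "y \<in> residue \<aa> x" using x a unfolding residue_def place_cong_def I_def by simp
    next
      fix y assume "y \<in> residue \<aa> x"
      then have "x - y \<in> I" using a unfolding residue_def place_cong_def I_def by auto
      then show "y \<in> {y. y - x \<in> I}" using uminus[of "x - y"] unfolding I_def ideal_iff by simp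
    qed
    finally show ?thesis .
  qed
  have carL: "carrier L = residue \<aa> ` place_ring \<aa>"
    unfolding L_def FactRing_def A_RCOSETS_def' using coset by (auto simp: R_def)
  have multL: "residue \<aa> x \<otimes>\<^bsub>L\<^esub> residue \<aa> y = residue \<aa> (x * y)" if "x \<in> place_ring \<aa>" "y \<in> place_ring \<aa>" for x y
  proof -
    have "(I +>\<^bsub>R\<^esub> x) \<otimes>\<^bsub>L\<^esub> (I +>\<^bsub>R\<^esub> y) = I +>\<^bsub>R\<^esub> (x \<otimes>\<^bsub>R\<^esub> y)"
      unfolding L_def FactRing_def using pI.rcoset_mult_add[of x y] that by (simp add: R_def)
    then show ?thesis using coset that ring_mult by (simp add: R_def)
  qed
  have oneL: "\<one>\<^bsub>L\<^esub> = residue \<aa> 1" unfolding L_def FactRing_def using coset[OF ring_one] by (simp add: R_def)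
  have zeroL: "\<zero>\<^bsub>L\<^esub> = residue \<aa> 0"
  proof -
    have "I +>\<^bsub>R\<^esub> 0 = I" unfolding a_r_coset_def' R_def by auto
    then show ?thesis unfolding L_def FactRing_def using coset[OF ring_zero] by simp
  qed
  have "domain L" unfolding L_def by (rule pI.quotient_is_domain)
  then interpret L: domain L .
  have "field L"
  proof (rule L.cring_fieldI2)
    show "\<zero>\<^bsub>L\<^esub> \<noteq> \<one>\<^bsub>L\<^esub>" using L.one_not_zero by metis
    fix X assume "X \<in> carrier L" "X \<noteq> \<zero>\<^bsub>L\<^esub>"
    then obtain x where x: "x \<in> place_ring \<aa>" "X = residue \<aa> x" "x \<notin> place_ideal \<aa>"
      unfolding carL zeroL using residue_eq_0_iff by blast
    then have "v x = 1" "x \<noteq> 0" unfolding ring_iff ideal_iff by auto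
    then have i: "inverse x \<in> place_ring \<aa>" "x * inverse x = 1" unfolding ring_iff inverse by auto
    then show "\<exists>b\<in>carrier L. X \<otimes>\<^bsub>L\<^esub> b = \<one>\<^bsub>L\<^esub>"
      unfolding carL oneL x(2) using multL[OF x(1) i(1)] by auto
  qed
  moreover have "countable (carrier L)"
    unfolding carL using countable_K by (meson countable_image countable_subset subset_UNIV)
  moreover have "x \<otimes>\<^bsub>L\<^esub> y = x \<otimes>\<^bsub>place_kappa \<aa>\<^esub> y" if "x \<in> carrier L" "y \<in> carrier L" for x y
    using that multL mult_kappa unfolding carL by auto
  ultimately show ?thesis
    using that carL carrier_kappa oneL one_kappa zeroL zero_kappa by metis
qed

end

section \<open>The map to the strong congruence space\<close>

text \<open>A sufficiently high or low power of \<open>T\<close> moves both elements into a given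
  chart; it is a unit on the overlap.\<close>

lemma F1_T_common_multiple:
  assumes "x \<in> carrier F1_T" "y \<in> carrier F1_T"
  shows "\<exists>u\<in>carrier F1_T. \<exists>u'\<in>carrier F1_T. u' * u = 1 \<and> (\<exists>a\<in>carrier F1_X. \<exists>b\<in>carrier F1_X. u * x = ev1 a \<and> u * y = ev1 b)"
    and "\<exists>u\<in>carrier F1_T. \<exists>u'\<in>carrier F1_T. u' * u = 1 \<and> (\<exists>a\<in>carrier F1_X. \<exists>b\<in>carrier F1_X. u * x = ev2 a \<and> u * y = ev2 b)"
proof -
  have ex: "\<exists>k. x = 0 \<or> x = Tvar powi k" if "x \<in> carrier F1_T" for x
    using that by (elim F1_T_cases) auto
  obtain k where k: "x = 0 \<or> x = Tvar powi k" using ex[OF assms(1)] by blast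
  obtain l where l: "y = 0 \<or> y = Tvar powi l" using ex[OF assms(2)] by blast
  define n where "n = \<bar>k\<bar> + \<bar>l\<bar>"
  have 1: "\<exists>a\<in>carrier F1_X. Tvar powi n * x = ev1 a" if "x = 0 \<or> x = Tvar powi k" "n + k \<ge> 0" for x k
  proof (cases "x = 0")
    case False
    then have "Tvar powi n * x = Tvar powi (n + k)" using that Tvar_nonzero by (simp add: power_int_add)
    also have "\<dots> = ev1 ([:0, 1:] ^ nat (n + k))" using that(2) by (simp add: power_int_def)
    finally show ?thesis using F1_X_mem by blast
  qed (intro bexI[of _ 0], auto)
  have 2: "\<exists>a\<in>carrier F1_X. Tvar powi (- n) * x = ev2 a" if "x = 0 \<or> x = Tvar powi k" "k - n \<le> 0" for x k
  proof (cases "x = 0")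
    case False
    then have "Tvar powi (- n) * x = Tvar powi (- (n - k))" using that Tvar_nonzero by (simp flip: power_int_add)
    also have "\<dots> = inverse Tvar powi (n - k)" by (simp only: power_int_minus power_int_inverse)
    also have "\<dots> = ev2 ([:0, 1:] ^ nat (n - k))" using that(2) by (simp add: power_int_def)
    finally show ?thesis using F1_X_mem by blast
  qed (intro bexI[of _ 0], auto)
  have inv: "Tvar powi (- m) * Tvar powi m = 1" for m using Tvar_nonzero by (simp flip: power_int_add)
  show "\<exists>u\<in>carrier F1_T. \<exists>u'\<in>carrier F1_T. u' * u = 1 \<and> (\<exists>a\<in>carrier F1_X. \<exists>b\<in>carrier F1_X. u * x = ev1 a \<and> u * y = ev1 b)"
  proof (rule bexI[of _ "Tvar powi n"], rule bexI[of _ "Tvar powi (- n)"])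
    have "0 \<le> n + k" "0 \<le> n + l" unfolding n_def by linarith+
    then show "Tvar powi (- n) * Tvar powi n = 1 \<and> (\<exists>a\<in>carrier F1_X. \<exists>b\<in>carrier F1_X. Tvar powi n * x = ev1 a \<and> Tvar powi n * y = ev1 b)"
      using 1[OF k] 1[OF l] inv by blast
  qed (rule F1_T_mem)+
  show "\<exists>u\<in>carrier F1_T. \<exists>u'\<in>carrier F1_T. u' * u = 1 \<and> (\<exists>a\<in>carrier F1_X. \<exists>b\<in>carrier F1_X. u * x = ev2 a \<and> u * y = ev2 b)"
  proof (rule bexI[of _ "Tvar powi (- n)"], rule bexI[of _ "Tvar powi n"])
    have "k - n \<le> 0" "l - n \<le> 0" unfolding n_def by linarith+
    moreover have "Tvar powi n * Tvar powi (- n) = 1" using inv[of n] by (simp only: mult.commute)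
    ultimately show "Tvar powi n * Tvar powi (- n) = 1 \<and> (\<exists>a\<in>carrier F1_X. \<exists>b\<in>carrier F1_X. Tvar powi (- n) * x = ev2 a \<and> Tvar powi (- n) * y = ev2 b)"
      using 2[OF k] 2[OF l] by blast
  qed (rule F1_T_mem)+
qed

lemma congruence_mult_left: "congruence A d \<Longrightarrow> u \<in> carrier A \<Longrightarrow> (x, y) \<in> d \<Longrightarrow> (u \<otimes>\<^bsub>A\<^esub> x, u \<otimes>\<^bsub>A\<^esub> y) \<in> d"
proof -
  assume d: "congruence A d" and u: "u \<in> carrier A" and xy: "(x, y) \<in> d"
  have "(u, u) \<in> d" using d u unfolding congruence_def equiv_def refl_on_def by blast
  then show ?thesis using d xy unfolding congruence_def by fast
qed

lemma congruence_carrier: "congruence A d \<Longrightarrow> (x, y) \<in> d \<Longrightarrow> x \<in> carrier A \<and> y \<in> carrier A"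
  unfolding congruence_def using equiv_type by blast

text \<open>Multiply a related pair into the chart by a unit, transfer it there and multiply back.
  So a congruence on the overlap is determined by its restriction to either chart, which makes the
  gluing maps of the strong congruence space injective.\<close>

lemma F1_T_congruence_subset:
  assumes d: "congruence F1_T d" "congruence F1_T d'"
    and ev: "pullback_cong F1_X ev1 d \<subseteq> pullback_cong F1_X ev1 d' \<or> pullback_cong F1_X ev2 d \<subseteq> pullback_cong F1_X ev2 d'"
  shows "d \<subseteq> d'"
proof
  fix z assume z: "z \<in> d"
  obtain x y where xy: "z = (x, y)" by (cases z)
  then have c: "x \<in> carrier F1_T" "y \<in> carrier F1_T" using congruence_carrier[OF d(1)] z by auto
  have "\<exists>u\<in>carrier F1_T. \<exists>u'\<in>carrier F1_T. u' * u = 1 \<and> (u * x, u * y) \<in> d'"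
    using ev
  proof
    assume ev: "pullback_cong F1_X ev1 d \<subseteq> pullback_cong F1_X ev1 d'"
    obtain u u' a b where u: "u \<in> carrier F1_T" "u' \<in> carrier F1_T" "u' * u = 1" "a \<in> carrier F1_X" "b \<in> carrier F1_X"
      "u * x = ev1 a" "u * y = ev1 b" using F1_T_common_multiple(1)[OF c] by blast
    have "(ev1 a, ev1 b) \<in> d" using congruence_mult_left[OF d(1) u(1), of x y] z xy u by simp
    then have "(ev1 a, ev1 b) \<in> d'" using ev u unfolding pullback_cong_def by blast
    then show ?thesis using u by metis
  next
    assume ev: "pullback_cong F1_X ev2 d \<subseteq> pullback_cong F1_X ev2 d'"
    obtain u u' a b where u: "u \<in> carrier F1_T" "u' \<in> carrier F1_T" "u' * u = 1" "a \<in> carrier F1_X" "b \<in> carrier F1_X"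
      "u * x = ev2 a" "u * y = ev2 b" using F1_T_common_multiple(2)[OF c] by blast
    have "(ev2 a, ev2 b) \<in> d" using congruence_mult_left[OF d(1) u(1), of x y] z xy u by simp
    then have "(ev2 a, ev2 b) \<in> d'" using ev u unfolding pullback_cong_def by blast
    then show ?thesis using u by metis
  qed
  then obtain u u' where u: "u' \<in> carrier F1_T" "u' * u = 1" "(u * x, u * y) \<in> d'" by blast
  have "u' * (u * x) = x" "u' * (u * y) = y" using u(2) by (simp_all flip: mult.assoc)
  then have "(x, y) \<in> d'" using congruence_mult_left[OF d(2) u(1,3)] by (simp only: F1_T_simps)
  then show "z \<in> d'" unfolding xy .
qed

lemma pullback_cong_inj:
  "inj_on (pullback_cong F1_X ev1) (topspace (SCong_top F1_T))"
  "inj_on (pullback_cong F1_X ev2) (topspace (SCong_top F1_T))"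
  unfolding topspace_SCong_top[OF pointed_monoid_F1_T]
  by (intro inj_onI subset_antisym F1_T_congruence_subset; simp add: SCong_def)+

lemma sc_class_Inl: "sc_class (Inl c) = insert (Inl c) {Inr (pullback_cong F1_X ev2 d) | d. d \<in> SCong F1_T \<and> pullback_cong F1_X ev1 d = c}"
  and sc_class_Inr: "sc_class (Inr c) = insert (Inr c) {Inl (pullback_cong F1_X ev1 d) | d. d \<in> SCong F1_T \<and> pullback_cong F1_X ev2 d = c}"
  using glue_class_Inl[OF pullback_cong_inj] unfolding topspace_SCong_top[OF pointed_monoid_F1_T] by blast+

text \<open>Powers of \<open>T\<close> are units on the overlap, and relating one of them to
  \<open>0\<close> would relate \<open>1\<close> to \<open>0\<close>.\<close>

lemma null_ideal_pullback:
  assumes d: "d \<in> SCong F1_T"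
  shows "null_ideal F1_X (pullback_cong F1_X ev1 d) = {0}" "null_ideal F1_X (pullback_cong F1_X ev2 d) = {0}"
proof -
  have cong: "congruence F1_T d" using d unfolding SCong_def by blast
  have "(Tvar powi k, 0) \<notin> d" for k
  proof
    assume k0: "(Tvar powi k, 0) \<in> d"
    have "(Tvar powi (- k) * Tvar powi k, Tvar powi (- k) * 0) \<in> d"
      using congruence_mult_left[OF cong F1_T_mem(3)[of "- k"] k0] by (simp only: F1_T_simps)
    then have "(1, 0) \<in> d" using Tvar_nonzero by (simp flip: power_int_add)
    then show False using SCong_one_zero[OF d pointed_monoid_F1_T] by simp
  qed
  from this[of "int n" for n] this[of "- int n" for n]
  have n: "(Tvar ^ n, 0) \<notin> d" "(inverse Tvar ^ n, 0) \<notin> d" for n by (auto simp: power_int_minus power_inverse)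
  have "(0, 0) \<in> d" using cong F1_T_mem(1) unfolding congruence_def equiv_def refl_on_def by blast
  then show "null_ideal F1_X (pullback_cong F1_X ev1 d) = {0}" "null_ideal F1_X (pullback_cong F1_X ev2 d) = {0}"
    using n unfolding null_ideal_def pullback_cong_def by (auto elim!: F1_X_cases)
qed

lemma sc_pi_class: "sc_pi (sc_class w) = case_sum (\<lambda>c. F1_class (Inl (null_ideal F1_X c))) (\<lambda>c. F1_class (Inr (null_ideal F1_X c))) w"
  unfolding sc_pi_def glue_in1_def glue_in2_def space_map.simps
proof (rule glue_desc_pt_class)
  fix d assume "d \<in> topspace (SCong_top F1_T)"
  then have "d \<in> SCong F1_T" using topspace_SCong_top[OF pointed_monoid_F1_T] by blast
  then show "F1_class (Inl (null_ideal F1_X (pullback_cong F1_X ev1 d))) = F1_class (Inr (null_ideal F1_X (pullback_cong F1_X ev2 d)))"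
    by (simp add: null_ideal_pullback F1_class_eqs)
qed

text \<open>The congruence generated by \<open>X \<sim> 0\<close>, see
  \<open>gen_congruence_X_0\<close>; its quotient is \<open>\<bbbF>\<^sub>1\<close>. This closed
  form is easier to compare with kernels.\<close>

definition collapse :: "(int poly \<times> int poly) set" where
  "collapse = {(x, y). x \<in> carrier F1_X \<and> y \<in> carrier F1_X \<and> (x = 1 \<longleftrightarrow> y = 1)}"

lemma null_ideal_collapse: "null_ideal F1_X collapse = F1_max"
  unfolding null_ideal_def collapse_def F1_max_def by auto

lemma T_eval_ev: "f \<noteq> 0 \<Longrightarrow> x \<in> carrier F1_X \<Longrightarrow> T_eval f (ev1 x) = eval_at f x"
  "f \<noteq> 0 \<Longrightarrow> x \<in> carrier F1_X \<Longrightarrow> T_eval f (ev2 x) = eval_at (inverse f) x"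
  by (auto elim!: F1_X_cases simp: T_eval_power)

context place
begin

lemma place_congruence_iff:
  assumes "g \<in> place_ring \<aa>"
  shows "(x, y) \<in> place_congruence \<aa> g \<longleftrightarrow> x \<in> carrier F1_X \<and> y \<in> carrier F1_X \<and> (eval_at g x, eval_at g y) \<in> place_cong \<aa>"
  unfolding place_congruence_def kernel_cong_def using eval_at_place_ring[OF assms] residue_eq_iff by auto

text \<open>All positive powers of \<open>g\<close> lie in the ideal of the place and are identified
  with \<open>0\<close> under either form of \<open>place_cong\<close>, while \<open>1\<close> is
  not. This is how the archimedean places are handled.\<close>

lemma place_congruence_small:
  assumes "v g < 1"
  shows "place_congruence \<aa> g = collapse"
proof -
  have g: "g \<in> place_ring \<aa>" using assms unfolding ring_iff by simp
  have small: "eval_at g x \<in> place_ideal \<aa> \<longleftrightarrow> x \<noteq> 1" if x: "x \<in> carrier F1_X" for x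
  proof (rule F1_X_cases[OF x])
    assume "x = 0" then show ?thesis by (simp add: ideal_iff)
  next
    fix n assume n: "x = [:0, 1:] ^ n"
    then have "x = 1 \<longleftrightarrow> n = 0" using X_power_inj[of n 0] by simp
    moreover have "v g ^ n < 1 \<longleftrightarrow> n \<noteq> 0"
    proof (cases n)
      case (Suc m)
      have "v g * v g ^ m \<le> v g * 1" using assms by (intro mult_left_mono power_le_one) auto
      then show ?thesis using assms Suc by simp
    qed simp
    ultimately show ?thesis unfolding n by (simp add: ideal_iff power)
  qed
  have "(eval_at g x, eval_at g y) \<in> place_cong \<aa> \<longleftrightarrow> (x = 1 \<longleftrightarrow> y = 1)" if xy: "x \<in> carrier F1_X" "y \<in> carrier F1_X" for x y
  proof -
    have r: "eval_at g x \<in> place_ring \<aa>" "eval_at g y \<in> place_ring \<aa>" using eval_at_place_ring[OF g] xy by auto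
    have z: "(u, 0) \<in> place_cong \<aa> \<longleftrightarrow> u \<in> place_ideal \<aa>" if "u \<in> place_ring \<aa>" for u
      using residue_eq_0_iff[OF that] residue_eq_iff[OF that ring_zero] by blast
    have res: "residue \<aa> (eval_at g x) = residue \<aa> 0 \<longleftrightarrow> x \<noteq> 1" if "x \<in> carrier F1_X" for x
      using residue_eq_0_iff eval_at_place_ring[OF g that] small[OF that] by blast
    show ?thesis unfolding residue_eq_iff[OF r, symmetric]
      using res[OF xy(1)] res[OF xy(2)] by (cases "x = 1"; cases "y = 1") auto
  qed
  then show ?thesis unfolding collapse_def using place_congruence_iff[OF g] by auto
qed

end

context number_field_context
begin

lemma kernel_residue_SCong:
  assumes a: "\<aa> \<in> (na_places :: 'k place set)" and A: "pointed_monoid A" and h: "h \<in> pm_hom A (place_kappa \<aa>)"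
  shows "kernel_cong A h \<in> SCong A"
proof -
  obtain L :: "'k set ring" where L: "field L" "countable (carrier L)"
    "carrier L = carrier (place_kappa \<aa>)" "\<one>\<^bsub>L\<^esub> = \<one>\<^bsub>place_kappa \<aa>\<^esub>" "\<zero>\<^bsub>L\<^esub> = pzero (place_kappa \<aa>)"
    "\<And>x y. x \<in> carrier L \<Longrightarrow> y \<in> carrier L \<Longrightarrow> x \<otimes>\<^bsub>L\<^esub> y = x \<otimes>\<^bsub>place_kappa \<aa>\<^esub> y"
    by (rule residue_field[OF a]) blast
  have "h \<in> pm_hom A (mult_pm L)"
    using h L(6) unfolding pm_hom_def hom_def mult_pm_def by (auto simp: L(3-5) dest: funcset_mem)
  then show ?thesis by (rule kernel_cong_SCong[OF A L(1,2)])
qed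

lemma trivial_place_na: "trivial_place \<in> (na_places :: 'k place set)"
  unfolding na_places_iff[OF trivial_place_in trivial_place_mem] nonarchimedean_def by auto

text \<open>\<open>collapse\<close> is the kernel of \<open>X \<mapsto> 0\<close> with values in
  \<open>K\<close>, the residue field of the trivial place, so its quotient embeds in a
  field.\<close>

lemma collapse_SCong: "collapse \<in> SCong F1_X"
proof -
  interpret place "trivial_place :: 'k place" using trivial_place_in by unfold_locales
  have "v 0 < 1" by simp
  then have "collapse = place_congruence (trivial_place :: 'k place) 0" using place_congruence_small by blast
  also have "\<dots> \<in> SCong F1_X"
    using unit_kernel_quotient_eval[OF ring_zero]
    unfolding place_congruence_def eval_residue_def unit_kernel_quotient_def kernel_quotient_def kernel_quotient_axioms_def
    by (intro kernel_residue_SCong[OF trivial_place_na pointed_monoid_F1_X]) auto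
  finally show ?thesis .
qed

end

context nonexceptional
begin

definition f_check :: "'k place \<Rightarrow> sc_point" where
  "f_check \<aa> = (if f \<in> place_ring \<aa> then sc_class (Inl (place_congruence \<aa> f)) else sc_class (Inr (place_congruence \<aa> (inverse f))))"

lemma archimedean_not_1: "place \<aa> \<Longrightarrow> \<aa> \<notin> na_places \<Longrightarrow> place.v \<aa> f \<noteq> (1::real)" for \<aa> :: "'k place"
  using f_nonexceptional place.na_iff abs_value.absolute_value place.v_in place.place places_absolute_value by metis

text \<open>For \<open>v g < 1\<close> the congruence is \<open>collapse\<close>. Otherwise
  \<open>f\<close> has value \<open>1\<close>, so the place is non-archimedean and its residue
  monoid is a field.\<close>

lemma place_congruence_SCong:
  assumes a: "\<aa> \<in> (places :: 'k place set)" and g: "g \<in> place_ring \<aa>" "g = f \<or> g = inverse f"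
  shows "place_congruence \<aa> g \<in> SCong F1_X"
proof -
  interpret place \<aa> using a by unfold_locales
  show ?thesis
  proof (cases "v g < 1")
    case True
    then show ?thesis using place_congruence_small collapse_SCong by simp
  next
    case False
    then have "v g = 1" using g(1) unfolding ring_iff by simp
    then have "v f = 1" using g(2) by (auto simp: inverse)
    then have "\<aa> \<in> na_places" using archimedean_not_1[OF place_axioms] by blast
    then show ?thesis
      using unit_kernel_quotient_eval[OF g(1)]
      unfolding place_congruence_def eval_residue_def unit_kernel_quotient_def kernel_quotient_def kernel_quotient_axioms_def
      by (intro kernel_residue_SCong pointed_monoid_F1_X) auto
  qed
qed

text \<open>Where \<open>f\<close> has value \<open>1\<close> the point lies on both charts: the
  kernel of \<open>T \<mapsto> f\<close> on the overlap restricts to both kernels.\<close>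

lemma overlap_congruence:
  assumes a: "\<aa> \<in> (places :: 'k place set)" and f: "f \<in> place_ring \<aa>" "f \<notin> place_ideal \<aa>"
  obtains d where "d \<in> SCong F1_T" "pullback_cong F1_X ev1 d = place_congruence \<aa> f"
    "pullback_cong F1_X ev2 d = place_congruence \<aa> (inverse f)"
proof -
  interpret place \<aa> using a by unfold_locales
  have v1: "v f = 1" using f unfolding ring_iff ideal_iff by simp
  then have na: "\<aa> \<in> na_places" using archimedean_not_1[OF place_axioms] by blast
  have ring: "T_eval f m \<in> place_ring \<aa>" if "m \<in> carrier F1_T" for m
    by (rule F1_T_cases[OF that]) (auto simp: ring_iff T_eval_powi powi v1)
  define h where "h = (\<lambda>m. residue \<aa> (T_eval f m))"
  have "h \<in> pm_hom F1_T (place_kappa \<aa>)"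
    unfolding pm_hom_def hom_def h_def using ring T_eval_mult[OF f_nonzero]
    by (auto simp: residue_in_kappa one_kappa zero_kappa mult_kappa)
  then have "kernel_cong F1_T h \<in> SCong F1_T" by (rule kernel_residue_SCong[OF na pointed_monoid_F1_T])
  moreover have "pullback_cong F1_X ev1 (kernel_cong F1_T h) = place_congruence \<aa> f"
    unfolding pullback_cong_def kernel_cong_def place_congruence_def h_def
    using T_in_F1_T T_eval_ev[OF f_nonzero] by auto
  moreover have "pullback_cong F1_X ev2 (kernel_cong F1_T h) = place_congruence \<aa> (inverse f)"
    unfolding pullback_cong_def kernel_cong_def place_congruence_def h_def
    using T_in_F1_T T_eval_ev[OF f_nonzero] by auto
  ultimately show ?thesis using that by blast
qed

lemma inverse_in_ideal: "\<aa> \<in> places \<Longrightarrow> f \<notin> place_ring \<aa> \<Longrightarrow> inverse f \<in> place_ideal \<aa>"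
proof -
  assume "\<aa> \<in> places"
  then interpret place \<aa> by unfold_locales
  show "f \<notin> place_ring \<aa> \<Longrightarrow> inverse f \<in> place_ideal \<aa>"
    unfolding ring_iff ideal_iff inverse by (auto simp: inverse_less_1_iff)
qed

lemma sc_pi_f_check:
  assumes a: "\<aa> \<in> places"
  shows "sc_pi (f_check \<aa>) = psi_pt f \<aa>"
proof -
  interpret place \<aa> using a by unfold_locales
  consider "f \<notin> place_ring \<aa>" | "f \<in> place_ideal \<aa>" "f \<in> place_ring \<aa>" | "f \<in> place_ring \<aa>" "f \<notin> place_ideal \<aa>" by blast
  then show ?thesis
  proof cases
    case 1
    then have "place_congruence \<aa> (inverse f) = collapse"
      using place_congruence_small inverse_in_ideal[OF a] ideal_iff by blast
    then show ?thesis using 1 unfolding f_check_def psi_pt_def by (simp add: sc_pi_class null_ideal_collapse F1_infinity_def)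
  next
    case 2
    then have "place_congruence \<aa> f = collapse" using place_congruence_small ideal_iff by blast
    then show ?thesis using 2 unfolding f_check_def psi_pt_def by (simp add: sc_pi_class null_ideal_collapse F1_zero_def)
  next
    case 3
    obtain d where "d \<in> SCong F1_T" "pullback_cong F1_X ev1 d = place_congruence \<aa> f" by (rule overlap_congruence[OF a 3])
    then have "null_ideal F1_X (place_congruence \<aa> f) = {0}" using null_ideal_pullback by metis
    then show ?thesis using 3 unfolding f_check_def psi_pt_def by (simp add: sc_pi_class F1_generic_def)
  qed
qed

lemma eval_at_f_inj: "x \<in> carrier F1_X \<Longrightarrow> y \<in> carrier F1_X \<Longrightarrow> eval_at f x = eval_at f y \<Longrightarrow> x = y"
  using T_eval_inj[of "ev1 x" "ev1 y"] T_in_F1_T T_eval_ev[OF f_nonzero] eval_at_Tvar_inj by metis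

lemma place_cong_trivial: "place_cong (trivial_place :: 'k place) = Id"
  unfolding place_cong_def using trivial_place_na by (auto simp: place_ring_trivial place_ideal_trivial)

lemma place_congruence_trivial: "place_congruence trivial_place f = Id_on (carrier F1_X)"
proof -
  interpret place "trivial_place :: 'k place" using trivial_place_in by unfold_locales
  have "f \<in> place_ring trivial_place" by (simp add: place_ring_trivial)
  then show ?thesis using place_congruence_iff[of f] eval_at_f_inj by (auto simp: place_cong_trivial Id_on_iff)
qed

text \<open>Induction over the generation of the topology. For a basic set given by \<open>x\<close>
  and \<open>y\<close>, an exceptional place is one where \<open>eval_at f x - eval_at f y\<close>
  reduces to \<open>0\<close>. This difference is nonzero because \<open>f\<close> is no root of
  unity, so there are only finitely many such places.\<close>

lemma SCong_open_generic:
  assumes "openin (SCong_top F1_X) W" "W \<noteq> {}"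
  shows "Id_on (carrier F1_X) \<in> W \<and>
    finite {\<aa> \<in> places. f \<in> place_ring \<aa> \<and> f \<notin> place_ideal \<aa> \<and> place_congruence \<aa> f \<notin> W}"
proof -
  let ?G = "Id_on (carrier F1_X)" and ?F = "\<lambda>W. {\<aa> \<in> places. f \<in> place_ring \<aa> \<and> f \<notin> place_ideal \<aa> \<and> place_congruence \<aa> f \<notin> W}"
  have "generate_topology_on {{c \<in> SCong F1_X. (a, b) \<notin> c} |a b. a \<in> carrier F1_X \<and> b \<in> carrier F1_X} W"
    using assms(1) unfolding SCong_top_def openin_topology_generated_by_iff .
  then show ?thesis using assms(2)
  proof (induction rule: generate_topology_on.induct)
    case (Int W W')
    then have "finite (?F W \<union> ?F W')" "?G \<in> W \<inter> W'" by auto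
    moreover have "?F (W \<inter> W') \<subseteq> ?F W \<union> ?F W'" by blast
    ultimately show ?case using finite_subset by blast
  next
    case (UN \<K>)
    then obtain W where W: "W \<in> \<K>" "W \<noteq> {}" by blast
    then have "finite (?F W)" "?G \<in> W" using UN by auto
    moreover have "?F (\<Union>\<K>) \<subseteq> ?F W" using W by blast
    ultimately show ?case using finite_subset W by blast
  next
    case (Basis W)
    then obtain x y where xy: "W = {c \<in> SCong F1_X. (x, y) \<notin> c}" "x \<in> carrier F1_X" "y \<in> carrier F1_X" by blast
    obtain c where "c \<in> SCong F1_X" "(x, y) \<notin> c" using Basis xy by blast
    then have ne: "x \<noteq> y" using xy unfolding SCong_def congruence_def equiv_def refl_on_def by blast
    have "?G \<in> SCong F1_X"
      using place_congruence_SCong[OF trivial_place_in, of f] place_congruence_trivial by (simp add: place_ring_trivial)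
    then have G: "?G \<in> W" using ne unfolding xy by auto
    define z where "z = eval_at f x - eval_at f y"
    have z: "z \<noteq> 0" unfolding z_def using eval_at_f_inj[OF xy(2,3)] ne by auto
    have "?F W \<subseteq> {\<aa> \<in> places. \<not> (z \<in> place_ring \<aa> \<and> z \<notin> place_ideal \<aa>)}"
    proof
      fix \<aa> assume "\<aa> \<in> ?F W"
      then have a: "\<aa> \<in> places" "f \<in> place_ring \<aa>" "f \<notin> place_ideal \<aa>" "place_congruence \<aa> f \<notin> W" by auto
      interpret place \<aa> using a(1) by unfold_locales
      have "v f = 1" using a unfolding ring_iff ideal_iff by simp
      then have na: "\<aa> \<in> na_places" using archimedean_not_1[OF place_axioms] by blast
      have "(x, y) \<in> place_congruence \<aa> f" using a place_congruence_SCong[OF a(1,2)] unfolding xy by blast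
      then have "z \<in> place_ideal \<aa>" using place_congruence_iff[OF a(2)] na unfolding place_cong_def z_def by auto
      then show "\<aa> \<in> {\<aa> \<in> places. \<not> (z \<in> place_ring \<aa> \<and> z \<notin> place_ideal \<aa>)}" using a by blast
    qed
    then show ?case using G finite_places_nonunit[OF z] finite_subset by blast
  qed simp
qed

lemma f_check_continuous: "continuous_map (space_top (compact_spec :: ('k place, 'k) mspace)) SCong_P1 f_check"
  unfolding continuous_map_def topspace_compact_spec
proof (intro conjI allI impI)
  have top: "topspace SCong_P1 = sc_class ` (Inl ` SCong F1_X \<union> Inr ` SCong F1_X)"
    unfolding SCong_P1_def topspace_glue_top topspace_SCong_top[OF pointed_monoid_F1_X] ..
  show "f_check \<in> places \<rightarrow> topspace SCong_P1"
  proof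
    fix \<aa> :: "'k place" assume a: "\<aa> \<in> places"
    interpret place \<aa> using a by unfold_locales
    show "f_check \<aa> \<in> topspace SCong_P1"
      unfolding top f_check_def using place_congruence_SCong[OF a] inverse_in_ideal[OF a] ideal_sub_ring by auto
  qed
  fix W assume W: "openin SCong_P1 W"
  define W1 where "W1 = {c \<in> SCong F1_X. sc_class (Inl c) \<in> W}"
  have o: "W \<subseteq> topspace SCong_P1" "openin (SCong_top F1_X) W1" "openin (SCong_top F1_X) {c \<in> SCong F1_X. sc_class (Inr c) \<in> W}"
    using W openin_subset[OF W] unfolding SCong_P1_def openin_glue_top W1_def
    by (auto simp: topspace_SCong_top[OF pointed_monoid_F1_X])
  show "openin (space_top compact_spec) {\<aa> \<in> places. f_check \<aa> \<in> W}"
  proof (cases "W = {}")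
    case False
    have triv: "f \<in> place_ring trivial_place" "f \<notin> place_ideal trivial_place"
      using f_nonzero by (auto simp: place_ring_trivial place_ideal_trivial)
    have "W1 \<noteq> {}"
    proof -
      \<comment> \<open>A nonempty open part of the second chart contains the trivial congruence,
        which the overlap identifies with that of the first chart. Hence every nonempty
        \<open>W\<close> meets the first chart.\<close>
      have "Id_on (carrier F1_X) \<in> W1" if W2: "{c \<in> SCong F1_X. sc_class (Inr c) \<in> W} \<noteq> {}"
      proof -
        obtain d where d: "d \<in> SCong F1_T" "pullback_cong F1_X ev1 d = place_congruence trivial_place f"
          "pullback_cong F1_X ev2 d = place_congruence trivial_place (inverse f)"
          by (rule overlap_congruence[OF trivial_place_in triv])
        interpret place "trivial_place :: 'k place" using trivial_place_in by unfold_locales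
        have if_inj: "eval_at (inverse f) x = eval_at (inverse f) y \<Longrightarrow> x = y" if "x \<in> carrier F1_X" "y \<in> carrier F1_X" for x y
          using T_eval_inj[of "ev2 x" "ev2 y"] T_in_F1_T T_eval_ev[OF f_nonzero] T2_inj that by (metis inj_onD)
        have "inverse f \<in> place_ring trivial_place" by (simp add: place_ring_trivial)
        then have "place_congruence trivial_place (inverse f) = Id_on (carrier F1_X)"
          using place_congruence_iff[of "inverse f"] if_inj by (auto simp: place_cong_trivial Id_on_iff)
        then have "sc_class (Inr (Id_on (carrier F1_X))) = sc_class (Inl (Id_on (carrier F1_X)))"
          using glue_class_eq[of d "SCong_top F1_T" "pullback_cong F1_X ev1" "pullback_cong F1_X ev2"] d
          by (simp add: topspace_SCong_top[OF pointed_monoid_F1_T] place_congruence_trivial)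
        then show ?thesis using SCong_open_generic[OF o(3) W2] unfolding W1_def by auto
      qed
      moreover obtain w where w: "w \<in> W" using False by blast
      moreover have "w \<in> sc_class ` (Inl ` SCong F1_X \<union> Inr ` SCong F1_X)" using w o(1) unfolding top by blast
      ultimately show ?thesis unfolding W1_def by blast
    qed
    then have G: "Id_on (carrier F1_X) \<in> W1"
      "finite {\<aa> \<in> places. f \<in> place_ring \<aa> \<and> f \<notin> place_ideal \<aa> \<and> place_congruence \<aa> f \<notin> W1}"
      using SCong_open_generic[OF o(2)] by auto
    \<comment> \<open>The possible exceptions are the places where \<open>f\<close> is not a unit
      and those where the congruence misses the first chart of \<open>W\<close>; both sets are
      finite.\<close>
    have "places - {\<aa> \<in> places. f_check \<aa> \<in> W} \<subseteq> {\<aa> \<in> places. \<not> (f \<in> place_ring \<aa> \<and> f \<notin> place_ideal \<aa>)} \<union>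
      {\<aa> \<in> places. f \<in> place_ring \<aa> \<and> f \<notin> place_ideal \<aa> \<and> place_congruence \<aa> f \<notin> W1}"
      unfolding W1_def f_check_def by auto
    then have "finite (places - {\<aa> \<in> places. f_check \<aa> \<in> W})"
      using finite_places_nonunit[OF f_nonzero] G(2) finite_subset by (metis (no_types, lifting) finite_UnI)
    moreover have "f_check trivial_place \<in> W"
      unfolding f_check_def using triv G(1) by (simp add: place_congruence_trivial W1_def)
    ultimately show ?thesis unfolding openin_compact_spec using trivial_place_in by auto
  qed simp
qed

end

section \<open>The closed points and the comparison with \<open>f_tilde\<close>\<close>

lemma congruence_refl: "congruence A c \<Longrightarrow> x \<in> carrier A \<Longrightarrow> (x, x) \<in> c"
  and congruence_sym: "congruence A c \<Longrightarrow> (x, y) \<in> c \<Longrightarrow> (y, x) \<in> c"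
  and congruence_trans: "congruence A c \<Longrightarrow> (x, y) \<in> c \<Longrightarrow> (y, z) \<in> c \<Longrightarrow> (x, z) \<in> c"
  unfolding congruence_def equiv_def refl_on_def sym_def trans_def by blast+

lemma gen_congruence_sym: "gen_congruence A a b = gen_congruence A b a"
  unfolding gen_congruence_def using congruence_sym by (metis (no_types, lifting))

lemma gen_congruence_X_power:
  assumes c: "congruence F1_X c" "([:0, 1:] ^ n, 1) \<in> c" "n dvd j - i" "i \<le> j"
  shows "([:0, 1:] ^ j, [:0, 1:] ^ i) \<in> c"
proof -
  obtain q where q: "j - i = n * q" using c(3) by blast
  have "([:0, 1:] ^ (n * q), 1) \<in> c" for q
  proof (induction q)
    case (Suc q)
    have "([:0, 1:] ^ n * [:0, 1:] ^ (n * q), [:0, 1:] ^ n * 1) \<in> c"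
      using congruence_mult_left[OF c(1) F1_X_mem(2)[of n] Suc] by (simp only: F1_X_simps)
    then have "([:0, 1:] ^ n * [:0, 1:] ^ (n * q), 1) \<in> c" using congruence_trans[OF c(1) _ c(2)] by simp
    then show ?case by (simp add: power_add)
  qed (use congruence_refl[OF c(1) F1_X_mem(3)] in simp)
  then have "([:0, 1:] ^ i * [:0, 1:] ^ (n * q), [:0, 1:] ^ i * 1) \<in> c"
    using congruence_mult_left[OF c(1) F1_X_mem(2)[of i]] by (metis F1_X_simps(1))
  moreover have "j = i + n * q" using q c(4) by simp
  ultimately show ?thesis by (simp add: power_add)
qed

context unit_kernel_quotient
begin

lemma cong_residue_mult_closed:
  assumes "z \<in> carrier (cong_residue A c)" "z' \<in> carrier (cong_residue A c)"
  shows "z \<otimes>\<^bsub>cong_residue A c\<^esub> z' \<in> carrier (cong_residue A c)"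
proof -
  interpret B: pointed_monoid B by (rule pointed_monoid_B)
  obtain X Y X' Y' where *: "z = fraction B S X Y" "z' = fraction B S X' Y'"
    "X \<in> carrier B" "Y \<in> S" "X' \<in> carrier B" "Y' \<in> S"
    using assms unfolding carrier_cong_residue by blast
  show ?thesis unfolding *(1,2) mult_cong_residue[OF *(3-6)]
    using B.m_closed[OF *(3,5)] S_mult[OF *(4,6)] unfolding carrier_cong_residue by blast
qed

lemma cong_residue_one_closed: "\<one>\<^bsub>cong_residue A c\<^esub> \<in> carrier (cong_residue A c)"
  and cong_residue_zero_closed: "pzero (cong_residue A c) \<in> carrier (cong_residue A c)"
  using of_elem_closed[OF A.one_closed] of_elem_closed[OF A.pzero_closed] by (simp_all add: of_elem_one of_elem_zero)

end

context number_field_context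
begin

lemma gen_congruence_X_0: "gen_congruence F1_X [:0, 1:] 0 = collapse"
proof
  have X1: "[:0, 1:] \<noteq> (1 :: int poly)" using X_power_inj[of 1 0] by simp
  have "congruence F1_X collapse" using collapse_SCong unfolding SCong_def by blast
  moreover have "([:0, 1:], 0) \<in> collapse" unfolding collapse_def using X1 by auto
  ultimately show "gen_congruence F1_X [:0, 1:] 0 \<subseteq> collapse" unfolding gen_congruence_def by blast
  have "(x, y) \<in> c" if xy: "(x, y) \<in> collapse" and c: "congruence F1_X c" "([:0, 1:], 0) \<in> c" for x y c
  proof -
    have zero: "(x, 0) \<in> c" if x: "x \<in> carrier F1_X" "x \<noteq> 1" for x
    proof (rule F1_X_cases[OF x(1)])
      fix n assume n: "x = [:0, 1:] ^ n"
      then obtain m where m: "n = Suc m" using x(2) by (cases n) auto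
      have "([:0, 1:] ^ m * [:0, 1:], [:0, 1:] ^ m * 0) \<in> c"
        using congruence_mult_left[OF c(1) F1_X_mem(2)[of m] c(2)] by (simp only: F1_X_simps)
      then show ?thesis unfolding n m by (simp only: power_Suc2 mult_zero_right)
    qed (use congruence_refl[OF c(1) F1_X_mem(1)] in simp)
    show ?thesis
    proof (cases "x = 1")
      case True
      then show ?thesis using xy congruence_refl[OF c(1) F1_X_mem(3)] unfolding collapse_def by auto
    next
      case False
      then have "(x, 0) \<in> c" "(y, 0) \<in> c" using xy zero unfolding collapse_def by auto
      then show ?thesis using congruence_sym[OF c(1)] congruence_trans[OF c(1)] by blast
    qed
  qed
  then show "collapse \<subseteq> gen_congruence F1_X [:0, 1:] 0" unfolding gen_congruence_def by auto
qed

lemma sc_zero_eq: "sc_zero = sc_class (Inl collapse)" and sc_infinity_eq: "sc_infinity = sc_class (Inr collapse)"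
  unfolding sc_zero_def sc_infinity_def using gen_congruence_X_0 gen_congruence_sym by metis+

end

context place
begin

lemma residue_power_eq_1_iff:
  assumes "v g = 1"
  shows "residue \<aa> (g ^ m) = residue \<aa> 1 \<longleftrightarrow> group.ord (units_of (place_kappa \<aa>)) (residue \<aa> g) dvd m"
proof -
  interpret N: pointed_monoid "place_kappa \<aa>" by (rule pointed_monoid_kappa)
  interpret G: Group.group "units_of (place_kappa \<aa>)" by (rule N.units_group)
  have r: "residue \<aa> g \<in> carrier (units_of (place_kappa \<aa>))" unfolding units_of_carrier using residue_unit[OF assms] .
  have gp: "g ^ k \<in> place_ring \<aa>" for k using assms unfolding ring_iff power by simp
  have "residue \<aa> g [^]\<^bsub>units_of (place_kappa \<aa>)\<^esub> k = residue \<aa> (g ^ k)" for k :: nat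
  proof (induction k)
    case (Suc k)
    then show ?case using gp[of k] gp[of 1] by (simp add: units_of_mult mult_kappa mult.commute)
  qed (simp add: units_of_one one_kappa)
  then show ?thesis using G.pow_eq_id[OF r, of m] by (simp add: units_of_one one_kappa)
qed

lemma residue_power_eq_iff:
  assumes "v g = 1" "i \<le> j"
  shows "residue \<aa> (g ^ j) = residue \<aa> (g ^ i) \<longleftrightarrow> group.ord (units_of (place_kappa \<aa>)) (residue \<aa> g) dvd j - i"
proof -
  have gp: "g ^ k \<in> place_ring \<aa>" "inverse g ^ k \<in> place_ring \<aa>" for k using assms unfolding ring_iff power inverse by auto
  have g0: "g \<noteq> 0" using assms by auto
  have e: "g ^ j = g ^ (j - i) * g ^ i" using assms(2) by (simp flip: power_add)
  have "(g ^ j, g ^ i) \<in> place_cong \<aa> \<longleftrightarrow> (g ^ (j - i), 1) \<in> place_cong \<aa>"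
  proof
    assume "(g ^ j, g ^ i) \<in> place_cong \<aa>"
    then have "(g ^ j * inverse g ^ i, g ^ i * inverse g ^ i) \<in> place_cong \<aa>" using place_cong_mult_left gp by blast
    then show "(g ^ (j - i), 1) \<in> place_cong \<aa>" unfolding e using g0 by (simp add: power_inverse mult.assoc)
  next
    assume "(g ^ (j - i), 1) \<in> place_cong \<aa>"
    then show "(g ^ j, g ^ i) \<in> place_cong \<aa>" unfolding e using place_cong_mult_left gp(1)[of i] by fastforce
  qed
  then show ?thesis using residue_power_eq_1_iff[OF assms(1), of "j - i"] residue_eq_iff gp(1) ring_one by simp
qed

text \<open>Two powers of \<open>g\<close> have equal residues exactly if their exponents agree
  modulo the order, and no power reduces to \<open>0\<close>. The argument includes order
  \<open>0\<close>, the convention for infinite order, where the generating relation is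
  \<open>1 \<sim> 1\<close>.\<close>

lemma gen_congruence_root:
  assumes v1: "v g = 1"
  shows "gen_congruence F1_X ([:0, 1:] ^ group.ord (units_of (place_kappa \<aa>)) (residue \<aa> g)) 1 = place_congruence \<aa> g"
    (is "gen_congruence F1_X ([:0, 1:] ^ ?n) 1 = _")
proof
  have g: "g \<in> place_ring \<aa>" using v1 unfolding ring_iff by simp
  interpret unit_kernel_quotient F1_X "place_kappa \<aa>" "eval_residue g" by (rule unit_kernel_quotient_eval[OF g])
  have pc: "place_congruence \<aa> g = kernel_cong F1_X (eval_residue g)" unfolding place_congruence_def eval_residue_def ..
  have "([:0, 1:] ^ ?n, 1) \<in> kernel_cong F1_X (eval_residue g)"
    using residue_power_eq_1_iff[OF v1, of ?n] unfolding kernel_cong_def by (auto simp: eval_residue_power eval_residue_1)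
  then show "gen_congruence F1_X ([:0, 1:] ^ ?n) 1 \<subseteq> place_congruence \<aa> g"
    unfolding gen_congruence_def pc using congruence_c by blast
  have "(x, y) \<in> c'" if xy: "(x, y) \<in> place_congruence \<aa> g" and c': "congruence F1_X c'" "([:0, 1:] ^ ?n, 1) \<in> c'" for x y c'
  proof -
    have car: "x \<in> carrier F1_X" "y \<in> carrier F1_X" and e: "residue \<aa> (eval_at g x) = residue \<aa> (eval_at g y)"
      using xy unfolding place_congruence_def kernel_cong_def by auto
    have nz: "residue \<aa> (g ^ k) \<noteq> residue \<aa> 0" for k
      using residue_eq_0_iff[of "g ^ k"] v1 unfolding ring_iff ideal_iff power by simp
    show ?thesis
    proof (rule F1_X_cases[OF car(1)]; rule F1_X_cases[OF car(2)])
      fix i j assume ij: "x = [:0, 1:] ^ i" "y = [:0, 1:] ^ j"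
      then have r: "residue \<aa> (g ^ i) = residue \<aa> (g ^ j)" using e by simp
      show ?thesis
      proof (cases "i \<le> j")
        case True
        then have "?n dvd j - i" using residue_power_eq_iff[OF v1 True] r by simp
        then show ?thesis unfolding ij using gen_congruence_X_power[OF c'] True congruence_sym[OF c'(1)] by blast
      next
        case False
        then have "?n dvd i - j" using residue_power_eq_iff[OF v1, of j i] r by simp
        then show ?thesis unfolding ij using gen_congruence_X_power[OF c'] False by simp
      qed
    next
      show ?thesis if "x = 0" "y = 0" using that congruence_refl[OF c'(1) F1_X_mem(1)] by simp
    qed (use e nz in auto)
  qed
  then show "place_congruence \<aa> g \<subseteq> gen_congruence F1_X ([:0, 1:] ^ ?n) 1" unfolding gen_congruence_def by auto
qed

end

context integer_prime
begin

lemma prime_place_na: "prime_place P \<in> na_places"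
  and place_ring_prime: "place_ring (prime_place P) = loc_integers P"
  and place_ideal_prime: "place_ideal (prime_place P) = loc_ideal P"
proof -
  have "prime_place P \<in> na_places \<and> place_ring (prime_place P) = loc_integers P \<and> place_ideal (prime_place P) = loc_ideal P"
  proof (cases "P = {0}")
    case True
    have "x \<in> loc_integers P" for x
      unfolding loc_integers_def True using as_fraction[of x] by blast
    moreover have "loc_ideal P = {0}" unfolding loc_ideal_def using one_notin by (auto simp: True intro!: exI[of _ 1])
    ultimately show ?thesis unfolding prime_place_def using True
      by (simp add: place_ring_trivial place_ideal_trivial trivial_place_na) blast
  next
    case False
    then interpret nonzero_integer_prime K P by unfold_locales
    have pl: "prime_place P \<in> places" "prime_abs \<in> prime_place P"
      unfolding prime_place_eq using places_class[OF prime_abs_absolute_value] in_class[OF prime_abs_absolute_value] by auto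
    show ?thesis
      using place_ring_iff[OF pl] place_ideal_iff[OF pl] na_places_iff[OF pl] prime_abs_nonarchimedean
        prime_abs_le_1 prime_abs_less_1 by blast
  qed
  then show "prime_place P \<in> na_places" "place_ring (prime_place P) = loc_integers P"
    "place_ideal (prime_place P) = loc_ideal P" by auto
qed

lemma prime_place_in: "prime_place P \<in> places" using prime_place_na unfolding na_places_def by simp

end

context nonexceptional
begin

lemma f_check_prime:
  assumes "primeideal P ring_of_integers"
  shows "f_check (prime_place P) = f_tilde f P"
proof -
  interpret P: integer_prime K P by (intro integer_prime.intro integer_prime_axioms.intro number_field_context_axioms assms)
  interpret place "prime_place P" using P.prime_place_in by unfold_locales
  show ?thesis
  proof (cases "P = {0}")
    case True
    then have e: "prime_place P = trivial_place" by (simp add: prime_place_def)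
    show ?thesis unfolding f_check_def f_tilde_def e using True
      by (simp add: place_ring_trivial place_congruence_trivial sc_generic_def)
  next
    case False
    interpret P: nonzero_integer_prime K P using False by unfold_locales
    have nn: "val P f \<ge> 0 \<longleftrightarrow> f \<in> place_ring (prime_place P)" and pp: "val P f > 0 \<longleftrightarrow> f \<in> place_ideal (prime_place P)"
      using P.val_nonneg_iff[OF f_nonzero] P.val_pos_iff[OF f_nonzero] P.place_ring_prime P.place_ideal_prime by auto
    consider "val P f > 0" | "val P f < 0" | "val P f = 0" by linarith
    then show ?thesis
    proof cases
      case 1
      then have "f \<in> place_ring (prime_place P)" "v f < 1" using nn pp ideal_iff by auto
      then show ?thesis using 1 False place_congruence_small unfolding f_check_def f_tilde_def by (simp add: sc_zero_eq)
    next
      case 2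
      then have "f \<notin> place_ring (prime_place P)" using nn by simp
      moreover from this have "v (inverse f) < 1" using inverse_in_ideal[OF P.prime_place_in] ideal_iff by blast
      ultimately show ?thesis using 2 False place_congruence_small unfolding f_check_def f_tilde_def by (simp add: sc_infinity_eq)
    next
      case 3
      then have "f \<in> place_ring (prime_place P)" "f \<notin> place_ideal (prime_place P)" using nn pp by auto
      moreover from this have "v f = 1" unfolding ring_iff ideal_iff by simp
      ultimately show ?thesis using 3 False gen_congruence_root unfolding f_check_def f_tilde_def by (simp add: sc_root_def)
    qed
  qed
qed

section \<open>Maps of residue monoids\<close>

definition chart_coordinate :: "'k place \<Rightarrow> 'k" where
  "chart_coordinate \<aa> = (if f \<in> place_ring \<aa> then f else inverse f)"

lemma chart_coordinate_ring: "\<aa> \<in> places \<Longrightarrow> chart_coordinate \<aa> \<in> place_ring \<aa>"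
proof -
  assume a: "\<aa> \<in> places"
  interpret place \<aa> using a by unfold_locales
  show ?thesis unfolding chart_coordinate_def using inverse_in_ideal[OF a] ideal_sub_ring by auto
qed

lemma f_check_the_Inl:
  assumes "\<aa> \<in> places" "f \<in> place_ring \<aa>"
  shows "Inl (place_congruence \<aa> f) \<in> f_check \<aa>" "(THE c. Inl c \<in> f_check \<aa>) = place_congruence \<aa> f"
  using assms unfolding f_check_def sc_class_Inl by auto

text \<open>When \<open>f\<close> is outside the place ring the congruence is
  \<open>collapse\<close> on the second chart. It has no representative on the first: congruences
  pulled back from the overlap have null ideal \<open>{0}\<close>, and that of
  \<open>collapse\<close> is \<open>F1_max\<close>. So both branches of \<open>sc_kappa\<close> use
  the chart of \<open>chart_coordinate\<close>.\<close>

lemma sc_kappa_f_check: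
  assumes a: "\<aa> \<in> places"
  shows "sc_kappa (f_check \<aa>) = cong_residue F1_X (place_congruence \<aa> (chart_coordinate \<aa>))"
proof (cases "f \<in> place_ring \<aa>")
  case True
  then show ?thesis using f_check_the_Inl[OF a True] unfolding sc_kappa_def chart_coordinate_def by auto
next
  case False
  interpret place \<aa> using a by unfold_locales
  have c: "place_congruence \<aa> (inverse f) = collapse"
    using place_congruence_small inverse_in_ideal[OF a False] ideal_iff by blast
  have "pullback_cong F1_X ev2 d \<noteq> collapse" if "d \<in> SCong F1_T" for d
    using null_ideal_pullback(2)[OF that] null_ideal_collapse F1_max_simps(3) by metis
  then have e: "f_check \<aa> = {Inr collapse}"
    unfolding f_check_def sc_class_Inr c using False by auto
  show ?thesis unfolding sc_kappa_def e chart_coordinate_def using False c by simp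
qed

definition f_kappa :: "'k place \<Rightarrow> (int poly set \<times> int poly set) set \<Rightarrow> 'k set" where
  "f_kappa \<aa> = unit_kernel_quotient.value_of (place_kappa \<aa>) (place.eval_residue \<aa> (chart_coordinate \<aa>))"

lemma unit_kernel_quotient_chart:
  assumes "\<aa> \<in> places"
  shows "unit_kernel_quotient F1_X (place_kappa \<aa>) (place.eval_residue \<aa> (chart_coordinate \<aa>))"
    and "place_congruence \<aa> (chart_coordinate \<aa>) = kernel_cong F1_X (place.eval_residue \<aa> (chart_coordinate \<aa>))"
proof -
  interpret place \<aa> using assms by unfold_locales
  show "unit_kernel_quotient F1_X (place_kappa \<aa>) (eval_residue (chart_coordinate \<aa>))"
    by (rule unit_kernel_quotient_eval[OF chart_coordinate_ring[OF assms]])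
  show "place_congruence \<aa> (chart_coordinate \<aa>) = kernel_cong F1_X (eval_residue (chart_coordinate \<aa>))"
    unfolding place_congruence_def eval_residue_def ..
qed

lemma f_kappa_hom: "\<aa> \<in> places \<Longrightarrow> f_kappa \<aa> \<in> pm_hom (sc_kappa (f_check \<aa>)) (place_kappa \<aa>)"
  and f_kappa_inj: "\<aa> \<in> places \<Longrightarrow> inj_on (f_kappa \<aa>) (carrier (sc_kappa (f_check \<aa>)))"
  using unit_kernel_quotient.value_of_hom[OF unit_kernel_quotient_chart(1)]
    unit_kernel_quotient.value_of_inj[OF unit_kernel_quotient_chart(1)]
  by (auto simp: f_kappa_def sc_kappa_f_check unit_kernel_quotient_chart(2))

text \<open>The only element of the chart with a unit as value is \<open>1\<close>, so fractions
  have trivial denominators and the values are \<open>0\<close> and \<open>1\<close>; injectivity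
  decides which fraction has value zero.\<close>

lemma f_kappa_small:
  assumes a: "\<aa> \<in> places" and small: "chart_coordinate \<aa> \<in> place_ideal \<aa>" and z: "z \<in> carrier (sc_kappa (f_check \<aa>))"
  shows "f_kappa \<aa> z = (if z = pzero (sc_kappa (f_check \<aa>)) then pzero (place_kappa \<aa>) else \<one>\<^bsub>place_kappa \<aa>\<^esub>)"
proof -
  interpret place \<aa> using a by unfold_locales
  interpret unit_kernel_quotient F1_X "place_kappa \<aa>" "eval_residue (chart_coordinate \<aa>)"
    by (rule unit_kernel_quotient_chart(1)[OF a])
  note sk = sc_kappa_f_check[OF a, unfolded unit_kernel_quotient_chart(2)[OF a]]
  have val: "eval_residue (chart_coordinate \<aa>) x = (if x = 1 then \<one>\<^bsub>place_kappa \<aa>\<^esub> else pzero (place_kappa \<aa>))" if x: "x \<in> carrier F1_X" for x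
  proof -
    have "(x, 0) \<in> place_congruence \<aa> (chart_coordinate \<aa>) \<longleftrightarrow> x \<noteq> 1"
      using place_congruence_small small x unfolding ideal_iff collapse_def by auto
    then have "eval_residue (chart_coordinate \<aa>) x = residue \<aa> 0 \<longleftrightarrow> x \<noteq> 1"
      using x unfolding unit_kernel_quotient_chart(2)[OF a] kernel_cong_def by (simp add: eval_residue_0)
    then show ?thesis by (auto simp: zero_kappa one_kappa eval_residue_1)
  qed
  obtain x y where xy: "x \<in> carrier F1_X" "y \<in> carrier F1_X" "eval_residue (chart_coordinate \<aa>) y \<in> Units (place_kappa \<aa>)"
    "z = fraction B S (c `` {x}) (c `` {y})" using cong_residue_fraction z unfolding sk by metis
  have "y = 1" using val[OF xy(2)] xy(3) zero_not_unit by (auto split: if_splits)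
  then have "value_of z = eval_residue (chart_coordinate \<aa>) x"
    using value_of_elem[OF xy(1)] one_B unfolding xy(4) of_elem_def by (simp del: Diff_iff)
  then have "f_kappa \<aa> z = \<one>\<^bsub>place_kappa \<aa>\<^esub> \<or> f_kappa \<aa> z = pzero (place_kappa \<aa>)"
    unfolding f_kappa_def using val[OF xy(1)] by auto
  moreover have "f_kappa \<aa> z = pzero (place_kappa \<aa>) \<longleftrightarrow> z = pzero (sc_kappa (f_check \<aa>))"
  proof -
    have zero: "f_kappa \<aa> (pzero (sc_kappa (f_check \<aa>))) = pzero (place_kappa \<aa>)"
      using f_kappa_hom[OF a] unfolding pm_hom_def by blast
    moreover have "pzero (sc_kappa (f_check \<aa>)) \<in> carrier (sc_kappa (f_check \<aa>))"
      unfolding sk using of_elem_closed[of 0] of_elem_zero by simp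
    ultimately show ?thesis using f_kappa_inj[OF a] z by (metis inj_onD)
  qed
  ultimately show ?thesis by auto
qed

text \<open>\<open>T\<close> generates the residue monoid up to fractions. This supplies the
  uniqueness required by the \<open>THE\<close> in \<open>f_tilde_map\<close>.\<close>

lemma f_kappa_unique:
  assumes a: "\<aa> \<in> places" and f: "f \<in> place_ring \<aa>" and k: "k \<in> pm_hom (sc_kappa (f_check \<aa>)) (place_kappa \<aa>)"
    "k (sc_T (f_check \<aa>)) = residue \<aa> f" and z: "z \<in> carrier (sc_kappa (f_check \<aa>))"
  shows "f_kappa \<aa> z = k z"
proof -
  interpret place \<aa> using a by unfold_locales
  interpret unit_kernel_quotient F1_X "place_kappa \<aa>" "eval_residue (chart_coordinate \<aa>)"
    by (rule unit_kernel_quotient_chart(1)[OF a])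
  note sk = sc_kappa_f_check[OF a, unfolded unit_kernel_quotient_chart(2)[OF a]]
  have cf: "chart_coordinate \<aa> = f" using f by (simp add: chart_coordinate_def)
  have sT: "sc_T (f_check \<aa>) = of_elem [:0, 1:]"
    unfolding sc_T_def Let_def f_check_the_Inl(2)[OF a f] of_elem_def
    using unit_kernel_quotient_chart(2)[OF a] unfolding cf by simp
  have k': "k \<in> pm_hom (cong_residue F1_X c) (place_kappa \<aa>)" using k(1) unfolding sk .
  have eq: "value_of (of_elem x) = k (of_elem x)" if x: "x \<in> carrier F1_X" for x
  proof (rule F1_X_cases[OF x])
    assume "x = 0"
    then show ?thesis using value_of_hom k' of_elem_zero unfolding pm_hom_def by auto
  next
    have "value_of (of_elem ([:0, 1:] ^ n)) = k (of_elem ([:0, 1:] ^ n))" for n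
    proof (induction n)
      case 0
      then show ?case using value_of_hom k' of_elem_one unfolding pm_hom_def by simp
    next
      case (Suc n)
      have "of_elem ([:0, 1:] ^ Suc n) = of_elem [:0, 1:] \<otimes>\<^bsub>cong_residue F1_X c\<^esub> of_elem ([:0, 1:] ^ n)"
        using of_elem_mult[of "[:0, 1:]" "[:0, 1:] ^ n"] by (simp only: F1_X_mem F1_X_simps power_Suc)
      moreover have "value_of (of_elem [:0, 1:]) = k (of_elem [:0, 1:])"
        using value_of_elem[of "[:0, 1:]"] k(2) unfolding sT cf by (simp add: eval_residue_def)
      ultimately show ?case using Suc value_of_hom k' of_elem_closed[OF F1_X_mem(2)[of n]] of_elem_closed[OF F1_X_mem(4)]
        unfolding pm_hom_def hom_def by (simp del: power_Suc)
    qed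
    then show "x = [:0, 1:] ^ n \<Longrightarrow> ?thesis" for n by simp
  qed
  have "value_of z = k z"
    using z value_of_elem unfolding sk by (intro hom_cong_residue_eqI[OF value_of_hom k' eq]) auto
  then show ?thesis unfolding f_kappa_def .
qed

lemma f_kappa_T:
  assumes a: "\<aa> \<in> places" and f: "f \<in> place_ring \<aa>"
  shows "f_kappa \<aa> (sc_T (f_check \<aa>)) = residue \<aa> f" "sc_T (f_check \<aa>) \<in> carrier (sc_kappa (f_check \<aa>))"
proof -
  interpret place \<aa> using a by unfold_locales
  interpret unit_kernel_quotient F1_X "place_kappa \<aa>" "eval_residue (chart_coordinate \<aa>)"
    by (rule unit_kernel_quotient_chart(1)[OF a])
  note sk = sc_kappa_f_check[OF a, unfolded unit_kernel_quotient_chart(2)[OF a]]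
  have cf: "chart_coordinate \<aa> = f" using f by (simp add: chart_coordinate_def)
  have sT: "sc_T (f_check \<aa>) = of_elem [:0, 1:]"
    unfolding sc_T_def Let_def f_check_the_Inl(2)[OF a f] of_elem_def
    using unit_kernel_quotient_chart(2)[OF a] unfolding cf by simp
  show "f_kappa \<aa> (sc_T (f_check \<aa>)) = residue \<aa> f"
    unfolding sT f_kappa_def using value_of_elem[of "[:0, 1:]"] by (simp add: eval_residue_def cf)
  show "sc_T (f_check \<aa>) \<in> carrier (sc_kappa (f_check \<aa>))" unfolding sT sk by (rule of_elem_closed) simp
qed

lemma f_kappa_prime:
  assumes P: "primeideal P ring_of_integers" and z: "z \<in> carrier (sc_kappa (f_check (prime_place P)))"
  shows "f_kappa (prime_place P) z = f_tilde_map f P z"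
proof -
  interpret P: integer_prime K P by (intro integer_prime.intro integer_prime_axioms.intro number_field_context_axioms P)
  define \<aa> where "\<aa> = prime_place P"
  have a: "\<aa> \<in> places" unfolding \<aa>_def by (rule P.prime_place_in)
  interpret place \<aa> using a by unfold_locales
  have ft: "f_tilde f P = f_check \<aa>" unfolding \<aa>_def using f_check_prime[OF P] by simp
  note z = z[folded \<aa>_def]
  have pi: "sc_pi sc_zero = F1_zero" "sc_pi sc_infinity = F1_infinity"
    unfolding sc_zero_eq sc_infinity_eq sc_pi_class by (auto simp: null_ideal_collapse F1_zero_def F1_infinity_def)
  \<comment> \<open>\<open>f_tilde_map\<close> branches on the point, \<open>f_kappa_small\<close>
    on the place. The projection \<open>sc_pi\<close> tells \<open>sc_zero\<close> and
    \<open>sc_infinity\<close> from the points above the generic one.\<close>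
  have iff: "f_check \<aa> \<in> {sc_zero, sc_infinity} \<longleftrightarrow> chart_coordinate \<aa> \<in> place_ideal \<aa>"
  proof
    assume "f_check \<aa> \<in> {sc_zero, sc_infinity}"
    then have "psi_pt f \<aa> \<in> {F1_zero, F1_infinity}" using pi sc_pi_f_check[OF a] by auto
    then have "f \<notin> place_ring \<aa> \<or> f \<in> place_ideal \<aa>" unfolding psi_pt_def using F1_points by (auto split: if_splits)
    then show "chart_coordinate \<aa> \<in> place_ideal \<aa>"
      unfolding chart_coordinate_def using inverse_in_ideal[OF a] ideal_sub_ring by auto
  next
    assume "chart_coordinate \<aa> \<in> place_ideal \<aa>"
    then have "place_congruence \<aa> (chart_coordinate \<aa>) = collapse" using place_congruence_small ideal_iff by blast
    then show "f_check \<aa> \<in> {sc_zero, sc_infinity}"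
      unfolding f_check_def chart_coordinate_def sc_zero_eq sc_infinity_eq by (auto split: if_splits)
  qed
  show ?thesis
  proof (cases "chart_coordinate \<aa> \<in> place_ideal \<aa>")
    case True
    then show ?thesis unfolding f_tilde_map_def Let_def ft \<aa>_def[symmetric]
      using iff f_kappa_small[OF a True z] z by simp
  next
    case False
    then have f: "f \<in> place_ring \<aa>" using inverse_in_ideal[OF a] unfolding chart_coordinate_def by (auto split: if_splits)
    let ?A = "sc_kappa (f_check \<aa>)" and ?B = "place_kappa \<aa>"
    interpret unit_kernel_quotient F1_X "place_kappa \<aa>" "eval_residue (chart_coordinate \<aa>)"
      by (rule unit_kernel_quotient_chart(1)[OF a])
    note sk = sc_kappa_f_check[OF a, unfolded unit_kernel_quotient_chart(2)[OF a]]
    \<comment> \<open>The \<open>THE\<close> in \<open>f_tilde_map\<close> ranges over extensional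
      maps, so \<open>f_kappa\<close> has to be restricted to the carrier first.\<close>
    have restr: "restrict (f_kappa \<aa>) (carrier ?A) \<in> pm_hom ?A ?B"
      using f_kappa_hom[OF a] cong_residue_mult_closed cong_residue_one_closed cong_residue_zero_closed
      unfolding pm_hom_def hom_def sk by auto
    have "(THE h. h \<in> pm_hom ?A ?B \<and> h \<in> extensional (carrier ?A) \<and> h (sc_T (f_check \<aa>)) = residue \<aa> f)
        = restrict (f_kappa \<aa>) (carrier ?A)"
    proof (rule the_equality)
      show "restrict (f_kappa \<aa>) (carrier ?A) \<in> pm_hom ?A ?B \<and> restrict (f_kappa \<aa>) (carrier ?A) \<in> extensional (carrier ?A) \<and>
          restrict (f_kappa \<aa>) (carrier ?A) (sc_T (f_check \<aa>)) = residue \<aa> f"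
        using restr f_kappa_T[OF a f] by simp
      fix h assume h: "h \<in> pm_hom ?A ?B \<and> h \<in> extensional (carrier ?A) \<and> h (sc_T (f_check \<aa>)) = residue \<aa> f"
      then show "h = restrict (f_kappa \<aa>) (carrier ?A)"
        using f_kappa_unique[OF a f] by (intro extensionalityI[of _ "carrier ?A"]) auto
    qed
    then show ?thesis unfolding f_tilde_map_def Let_def ft \<aa>_def[symmetric]
      using iff False z by simp
  qed
qed

end

section \<open>Comparison with the projective line over \<open>\<int>\<close>\<close>

text \<open>Serves the ring of integers, the integral polynomials and the rings
  \<open>integers_adjoin t\<close> alike; the zero ideal is the generic point.\<close>

lemma embedded_spectrum_sub_ring:
  fixes S :: "'a::idom set" and e :: "'a \<Rightarrow> 'l::field"
  assumes S: "subring_set S" and e: "\<And>a b. e (a * b) = e a * e b" "e 1 = 1" "inj e"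
  shows "embedded_spectrum (sub_ring S) e {P. primeideal P (sub_ring S)} {0}"
proof -
  interpret subring_set S by (rule S)
  interpret R: cring "sub_ring S" by (rule cring_sub_ring)
  have fe: "field_embedding (sub_ring S) e"
    using e R.comm_monoid_axioms inj_on_subset[OF e(3)] by (intro field_embedding.intro) auto
  have "e 0 * e 0 = e 0 * e 1" using e(1)[of 0 0] e(2) by simp
  moreover have "e 0 \<noteq> e 1" using e(3) by (metis injD zero_neq_one)
  ultimately have "e 0 = 0" using mult_cancel_left by blast
  then have e0: "e a = 0 \<longleftrightarrow> a = 0" for a using e(3) by (metis injD)
  show ?thesis
  proof (intro embedded_spectrum.intro embedded_spectrum_axioms.intro fe)
    show "{0} \<in> {P. primeideal P (sub_ring S)}"
      unfolding mem_Collect_eq primeideal_sub_ring_iff using zero_mem by auto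
    fix P assume P: "P \<in> {P. primeideal P (sub_ring S)}"
    show "field_embedding.eprime (sub_ring S) e P"
      unfolding field_embedding.eprime_def[OF fe] using P e0 unfolding primeideal_sub_ring_iff by auto
    show "{0} \<inter> carrier (sub_ring S) \<subseteq> P" using P unfolding primeideal_sub_ring_iff by auto
  qed
qed

lemma primeideal_contraction:
  assumes S: "subring_set S" and S': "subring_set S'" and Q: "primeideal Q (sub_ring S')"
    and h: "\<And>a. a \<in> S \<Longrightarrow> h a \<in> S'" "h 1 = 1" "h 0 = 0" "\<And>a b. h (a * b) = h a * h b" "\<And>a b. h (a + b) = h a + h b"
  shows "primeideal {a \<in> S. h a \<in> Q} (sub_ring S)"
proof -
  interpret S: subring_set S by (rule S)
  interpret S': subring_set S' by (rule S')
  show ?thesis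
    using Q h S.zero_mem S.add_mem S.mult_mem
    unfolding S.primeideal_sub_ring_iff S'.primeideal_sub_ring_iff by auto
qed

interpretation UNIV_ring: subring_set "UNIV :: 'a::comm_ring_1 set" by unfold_locales auto

interpretation O: embedded_spectrum "ring_of_integers :: 'k::field_char_0 ring" id "{P. primeideal P ring_of_integers}" "{0}"
  unfolding ring_of_integers_def by (rule embedded_spectrum_sub_ring) (auto intro: integers.subring_set_axioms)

interpretation Z_X: embedded_spectrum Z_X ev1 "{P. primeideal P Z_X}" "{0}"
  unfolding Z_X_def using eval_at_Tvar_inj
  by (intro embedded_spectrum_sub_ring) (auto intro: UNIV_ring.subring_set_axioms simp: inj_on_def)

lemma carrier_Z_X [simp]: "carrier Z_X = UNIV" by (simp add: Z_X_def)

lemma carrier_ring_of_integers [simp]: "carrier ring_of_integers = integers" by (simp add: ring_of_integers_def)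

definition adjoin :: "'k::field_char_0 \<Rightarrow> 'k set" where
  "adjoin t = {Polynomial.poly q t |q. \<forall>i. algebraic_int (Polynomial.coeff q i)}"

lemma integers_adjoin_sub_ring: "integers_adjoin t = sub_ring (adjoin t)"
  unfolding integers_adjoin_def adjoin_def ..

lemma carrier_integers_adjoin [simp]: "carrier (integers_adjoin t) = adjoin t"
  by (simp add: integers_adjoin_sub_ring)

lemma algebraic_int_sum: "(\<And>i. i \<in> A \<Longrightarrow> algebraic_int (g i :: 'k::field_char_0)) \<Longrightarrow> algebraic_int (sum g A)"
  by (induction A rule: infinite_finite_induct) (auto intro: algebraic_int_plus)

lemma adjoin_subring: "subring_set (adjoin (t :: 'k::field_char_0))"
  unfolding adjoin_def
proof
  let ?A = "{Polynomial.poly q t |q. \<forall>i. algebraic_int (Polynomial.coeff q i)}"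
  show "1 \<in> ?A" by (intro CollectI exI[of _ 1]) (auto simp: coeff_1)
  fix a b assume "a \<in> ?A" "b \<in> ?A"
  then obtain p q where pq: "a = Polynomial.poly p t" "b = Polynomial.poly q t"
    "\<And>i. algebraic_int (Polynomial.coeff p i)" "\<And>i. algebraic_int (Polynomial.coeff q i)" by blast
  show "a - b \<in> ?A"
    using pq by (intro CollectI exI[of _ "p - q"]) (auto intro: algebraic_int_diff)
  show "a * b \<in> ?A"
    using pq by (intro CollectI exI[of _ "p * q"]) (auto simp: coeff_mult intro!: algebraic_int_sum algebraic_int_times)
qed

lemma integral_adjoin: "algebraic_int a \<Longrightarrow> a \<in> adjoin t"
  unfolding adjoin_def by (intro CollectI exI[of _ "[:a:]"]) (auto simp: coeff_pCons split: nat.splits)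

lemma self_adjoin: "(t :: 'k::field_char_0) \<in> adjoin t"
  unfolding adjoin_def by (intro CollectI exI[of _ "[:0, 1:]"]) (auto simp: coeff_pCons split: nat.splits)

lemma eval_adjoin: "eval_at t p \<in> adjoin (t :: 'k::field_char_0)"
  unfolding eval_at_def adjoin_def by (intro CollectI exI[of _ "map_poly of_int p"]) (auto simp: coeff_map_poly)

lemma adjoin_subset:
  assumes "\<And>a. algebraic_int a \<Longrightarrow> a \<in> S" "\<And>x y. x \<in> S \<Longrightarrow> y \<in> S \<Longrightarrow> x + y \<in> S"
    "\<And>x y. x \<in> S \<Longrightarrow> y \<in> S \<Longrightarrow> x * y \<in> S" "t \<in> S"
  shows "adjoin t \<subseteq> S"
proof -
  have "Polynomial.poly q t \<in> S" if "\<And>i. algebraic_int (Polynomial.coeff q i)" for q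
    using that
  proof (induction q)
    case 0
    then show ?case using assms(1)[of 0] by simp
  next
    case (pCons a q)
    have "algebraic_int a" using pCons.prems[of 0] by simp
    moreover have "algebraic_int (Polynomial.coeff q i)" for i using pCons.prems[of "Suc i"] by simp
    ultimately show ?case using pCons.IH assms by simp
  qed
  then show ?thesis unfolding adjoin_def by blast
qed

lemma embedded_spectrum_adjoin:
  "embedded_spectrum (integers_adjoin (t :: 'k::field_char_0)) id {P. primeideal P (integers_adjoin t)} {0}"
  unfolding integers_adjoin_sub_ring by (rule embedded_spectrum_sub_ring) (auto intro: adjoin_subring)

lemmas primeideal_adjoin_iff = subring_set.primeideal_sub_ring_iff[OF adjoin_subring, folded integers_adjoin_sub_ring]

lemma notin_place_ring_iff:
  assumes "\<aa> \<in> places" "(g::'k::field_char_0) \<noteq> 0"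
  shows "g \<notin> place_ring \<aa> \<longleftrightarrow> inverse g \<in> place_ideal \<aa>"
proof -
  interpret place \<aa> using assms(1) by unfold_locales
  have "v g > 0" using assms(2) nonneg[of g] by (simp add: less_le)
  then show ?thesis unfolding ring_iff ideal_iff inverse by (auto simp: inverse_less_1_iff not_le)
qed

context integer_prime
begin

sublocale pl: place "prime_place P" using prime_place_in by unfold_locales

lemma loc_integers_iff: "x \<in> loc_integers P \<longleftrightarrow> pl.v x \<le> 1"
  and loc_ideal_iff: "x \<in> loc_ideal P \<longleftrightarrow> pl.v x < 1"
  using pl.ring_iff pl.ideal_iff unfolding place_ring_prime place_ideal_prime by auto

lemma loc_nonarchimedean: "pl.v (x + y) \<le> max (pl.v x) (pl.v y)"
  using prime_place_na pl.na_iff unfolding nonarchimedean_def by blast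

lemma adjoin_loc_integers: "g \<in> loc_integers P \<Longrightarrow> adjoin g \<subseteq> loc_integers P"
  by (rule adjoin_subset) (auto intro: loc_integers_integral loc_integers_add loc_integers_mult)

text \<open>For \<open>g\<close> in the localization at \<open>P\<close>, the unique prime of
  \<open>integers_adjoin g\<close> above \<open>P\<close>.\<close>

definition extension :: "'k \<Rightarrow> 'k set" where
  "extension g = adjoin g \<inter> loc_ideal P"

lemma extension_prime:
  assumes "g \<in> loc_integers P"
  shows "primeideal (extension g) (integers_adjoin g)" "{a. algebraic_int a \<and> a \<in> extension g} = P"
proof -
  interpret R: subring_set "adjoin g" by (rule adjoin_subring)
  have int: "pl.v x \<le> 1" if "x \<in> adjoin g" for x using adjoin_loc_integers[OF assms] that loc_integers_iff by blast
  have "pl.v (x + y) < 1" if "pl.v x < 1" "pl.v y < 1" for x y using loc_nonarchimedean[of x y] that by simp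
  moreover have "pl.v (x * y) < 1" if "x \<in> adjoin g" "pl.v y < 1" for x y
    using int[OF that(1)] that(2) pl.nonneg[of x] pl.nonneg[of y] unfolding pl.mult by (metis le_less_trans mult_left_le_one_le)
  moreover have "pl.v x < 1 \<or> pl.v y < 1" if "x \<in> adjoin g" "y \<in> adjoin g" "pl.v (x * y) < 1" for x y
  proof (rule ccontr)
    assume "\<not> ?thesis"
    then have "pl.v x = 1" "pl.v y = 1" using int[OF that(1)] int[OF that(2)] by auto
    then show False using that(3) by (simp add: pl.mult)
  qed
  ultimately show "primeideal (extension g) (integers_adjoin g)"
    unfolding primeideal_adjoin_iff extension_def
    using R.zero_mem R.add_mem R.mult_mem by (auto simp: loc_ideal_iff)
  show "{a. algebraic_int a \<and> a \<in> extension g} = P"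
    using loc_ideal_integral by (auto simp: extension_def intro: integral_adjoin integral)
qed

text \<open>The image of \<open>P\<close> in the spectrum of the integral polynomials under
  \<open>X \<mapsto> g\<close>.\<close>

definition chart_point :: "'k \<Rightarrow> int poly set" where
  "chart_point g = {p. eval_at g p \<in> loc_ideal P}"

lemma chart_point_extension: "chart_point g = {p. eval_at g p \<in> extension g}"
  unfolding chart_point_def extension_def using eval_adjoin[of g] by auto

lemma chart_point_prime: "g \<in> loc_integers P \<Longrightarrow> primeideal (chart_point g) Z_X"
  using primeideal_contraction[OF UNIV_ring.subring_set_axioms adjoin_subring, of "extension g" g "eval_at g"]
    extension_prime(1)[of g] eval_adjoin[of g]
  unfolding chart_point_extension Z_X_def integers_adjoin_sub_ring by simp

lemma chart_point_F1:
  assumes "g \<in> loc_integers P" "g \<noteq> 0"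
  shows "{a \<in> carrier F1_X. a \<in> chart_point g} = (if g \<in> loc_ideal P then F1_max else {0})"
proof -
  have "eval_at g ([:0, 1:] ^ n) \<in> loc_ideal P \<longleftrightarrow> n \<noteq> 0 \<and> g \<in> loc_ideal P" for n
  proof (cases "pl.v g < 1")
    case True
    then show ?thesis unfolding loc_ideal_iff using power_less_one_iff[OF pl.nonneg, of g n] by (simp add: pl.power)
  next
    case False
    then show ?thesis unfolding loc_ideal_iff using assms loc_integers_iff by (simp add: pl.power)
  qed
  moreover have "0 \<in> loc_ideal P" unfolding loc_ideal_iff by simp
  ultimately have *: "a \<in> carrier F1_X \<Longrightarrow> a \<in> chart_point g \<longleftrightarrow> (if g \<in> loc_ideal P then a \<in> F1_max else a = 0)" for a
    unfolding chart_point_def mem_Collect_eq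
    by (elim F1_X_cases) (auto simp: F1_max_simps simp del: eval_at_power)
  show ?thesis using * F1_max_simps(1) unfolding F1_max_def by auto
qed

end

context number_field_context
begin

lemma integer_primeI: "primeideal P ring_of_integers \<Longrightarrow> integer_prime K P"
  by (intro integer_prime.intro integer_prime_axioms.intro number_field_context_axioms)

text \<open>If \<open>g\<close> were not in the localization at \<open>P\<close>, then
  \<open>1 / g = a / b\<close> with \<open>a\<close> in \<open>P\<close>, and
  \<open>b = g * a\<close> would lie in \<open>Q\<close>, which is impossible. Hence
  \<open>integers_adjoin g\<close> is contained in the localization, and an element
  \<open>a / b\<close> lies in \<open>Q\<close> exactly if \<open>a\<close> lies in
  \<open>P\<close>.\<close>

lemma adjoin_contraction:
  assumes g: "g \<noteq> (0::'k)" and Q: "primeideal Q (integers_adjoin g)"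
  defines "P \<equiv> {a. algebraic_int a \<and> a \<in> Q}"
  shows "primeideal P ring_of_integers" "g \<in> loc_integers P" "Q = integer_prime.extension P g"
proof -
  show prP: "primeideal P ring_of_integers"
    using primeideal_contraction[OF integers.subring_set_axioms adjoin_subring Q[unfolded integers_adjoin_sub_ring], of id]
    unfolding P_def ring_of_integers_def by (simp add: integral_adjoin)
  interpret integer_prime K P by (rule integer_primeI[OF prP])
  note Q' = Q[unfolded primeideal_adjoin_iff]
  have mQ: "x * y \<in> Q" if "x \<in> adjoin g" "y \<in> Q" for x y using Q' that by blast
  have pQ: "x \<in> Q \<or> y \<in> Q" if "x \<in> adjoin g" "y \<in> adjoin g" "x * y \<in> Q" for x y using Q' that by blast
  show gP: "g \<in> loc_integers P"
  proof (rule ccontr)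
    assume "g \<notin> loc_integers P"
    then have "inverse g \<in> loc_ideal P"
      using notin_place_ring_iff[OF prime_place_in g] unfolding place_ring_prime place_ideal_prime by simp
    then obtain a b where ab: "inverse g = a / b" "a \<in> P" "algebraic_int b" "b \<notin> P" unfolding loc_ideal_def by blast
    then have "g * a = b" using g notin_nonzero[of b] by (auto simp: field_simps)
    moreover have "g * a \<in> Q" using ab(2) unfolding P_def by (intro mQ self_adjoin) simp
    ultimately show False using ab unfolding P_def by simp
  qed
  have "x \<in> Q \<longleftrightarrow> x \<in> loc_ideal P" if x: "x \<in> adjoin g" for x
  proof -
    have "x \<in> loc_integers P" using adjoin_loc_integers[OF gP] x by blast
    then obtain a b where ab: "x = a / b" "algebraic_int a" "algebraic_int b" "b \<notin> P" unfolding loc_integers_def by blast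
    have xb: "x * b = a" using ab notin_nonzero[of b] by simp
    have bQ: "b \<in> adjoin g" "b \<notin> Q" using ab integral_adjoin unfolding P_def by blast+
    have "x \<in> Q \<longleftrightarrow> a \<in> P"
      using mQ[OF bQ(1), of x] pQ[OF x bQ(1)] bQ(2) ab(2) xb unfolding P_def by (auto simp: mult.commute)
    also have "\<dots> \<longleftrightarrow> x \<in> loc_ideal P"
    proof
      assume "a \<in> P"
      then show "x \<in> loc_ideal P" unfolding loc_ideal_def using ab by blast
    next
      assume "x \<in> loc_ideal P"
      then have "pl.v x < 1" unfolding loc_ideal_iff .
      moreover have "pl.v b \<le> 1" using loc_integers_integral[OF ab(3)] loc_integers_iff by blast
      ultimately have "pl.v a < 1" unfolding xb[symmetric] pl.mult
        by (metis le_less_trans mult_left_le pl.nonneg)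
      then show "a \<in> P" using loc_ideal_integral[OF ab(2)] loc_ideal_iff by blast
    qed
    finally show ?thesis .
  qed
  moreover have "Q \<subseteq> adjoin g" using Q' by blast
  ultimately show "Q = extension g" unfolding extension_def by blast
qed

text \<open>\<open>g\<close> is regular at \<open>P\<close> exactly if one of its denominators
  \<open>b\<close> avoids \<open>P\<close>, so the set is a union of basic open sets.\<close>

lemma openin_loc_integers:
  "openin (spec_top ring_of_integers {P. primeideal P ring_of_integers}) {P. primeideal P ring_of_integers \<and> (g::'k) \<in> loc_integers P}"
proof -
  have "{P. primeideal P ring_of_integers \<and> g \<in> loc_integers P}
    = (\<Union>b\<in>{b. algebraic_int b \<and> algebraic_int (g * b) \<and> b \<noteq> 0}. {P \<in> {P. primeideal P ring_of_integers}. b \<notin> P})" (is "?l = ?r")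
  proof (intro equalityI subsetI)
    fix P assume "P \<in> ?l"
    then have P: "primeideal P ring_of_integers" "g \<in> loc_integers P" by auto
    interpret integer_prime K P by (rule integer_primeI[OF P(1)])
    obtain a b where "g = a / b" "algebraic_int a" "algebraic_int b" "b \<notin> P" using P(2) unfolding loc_integers_def by blast
    then show "P \<in> ?r" using P(1) notin_nonzero[of b] by (auto intro!: bexI[of _ b])
  next
    fix P assume "P \<in> ?r"
    then obtain b where b: "algebraic_int b" "algebraic_int (g * b)" "b \<noteq> 0" "b \<notin> P" "primeideal P ring_of_integers" by blast
    have "g = (g * b) / b" using b(3) by simp
    then show "P \<in> ?l" using b unfolding loc_integers_def by blast
  qed
  moreover have "openin (spec_top ring_of_integers {P. primeideal P ring_of_integers}) ?r"
    by (intro openin_Union; elim imageE) (auto intro!: openin_spec_top_basic[of _ ring_of_integers "{P. primeideal P ring_of_integers}", simplified])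
  ultimately show ?thesis by simp
qed

end

section \<open>The morphisms \<open>p_map\<close> and \<open>phi\<close> on points and
  sections\<close>

abbreviation "Z_class \<equiv> glue_class Z_overlap (pt (Z_emb Tvar)) (pt (Z_emb (inverse Tvar)))"
abbreviation "Z_in1 \<equiv> glue_in1 Z_overlap (Z_emb Tvar) (Z_emb (inverse Tvar))"
abbreviation "Z_in2 \<equiv> glue_in2 Z_overlap (Z_emb Tvar) (Z_emb (inverse Tvar))"

definition F1_contr :: "int poly set \<Rightarrow> int poly set" where
  "F1_contr Q = {a \<in> carrier F1_X. a \<in> Q}"

lemma topspace_Spec_Z_X: "topspace (space_top (Spec Z_X)) = {Q. primeideal Q Z_X}"
  using Z_X.topspace_eq by (simp add: Spec_def)

lemma topspace_Spec_integers: "topspace (space_top (Spec ring_of_integers)) = {P. primeideal P ring_of_integers}"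
  using O.topspace_eq by (simp add: Spec_def)

lemma topspace_Spec_adjoin: "topspace (space_top (Spec (integers_adjoin g))) = {Q. primeideal Q (integers_adjoin g)}"
  using embedded_spectrum.topspace_eq[OF embedded_spectrum_adjoin] by (simp add: Spec_def)

lemma prime_pideal_F1_contr:
  assumes "primeideal Q Z_X"
  shows "prime_pideal F1_X (F1_contr Q)"
  using assms F1_X_mult unfolding Z_X_def UNIV_ring.primeideal_sub_ring_iff prime_pideal_def F1_contr_def by auto

lemma contr_chart_iff:
  assumes "primeideal Q Z_X"
  shows "F1_contr Q \<in> chart1 V \<longleftrightarrow> F1_class (Inl (F1_contr Q)) \<in> V" "F1_contr Q \<in> chart2 V \<longleftrightarrow> F1_class (Inr (F1_contr Q)) \<in> V"
proof -
  have "F1_contr Q \<in> topspace (space_top (MSpec F1_X))"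
    using prime_pideal_F1_contr[OF assms] prime_pideal_F1_X unfolding topspace_MSpec by blast
  then show "F1_contr Q \<in> chart1 V \<longleftrightarrow> F1_class (Inl (F1_contr Q)) \<in> V" "F1_contr Q \<in> chart2 V \<longleftrightarrow> F1_class (Inr (F1_contr Q)) \<in> V"
    unfolding chart1_def chart2_def pre_def glue_in1_def glue_in2_def by simp_all
qed

lemma prime_Z_T_contr:
  assumes "primeideal Q Z_T"
  shows "F1_contr {p. ev1 p \<in> Q} = {0}" "F1_contr {p. ev2 p \<in> Q} = {0}"
proof -
  interpret primeideal Q Z_T by (rule assms)
  have one: "1 \<notin> Q" using one_imp_carrier I_notcarr by (auto simp: Z_T_def)
  have zero: "0 \<in> Q" using additive_subgroup.zero_closed[OF is_additive_subgroup] by (simp add: Z_T_def)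
  have "1 / Tvar ^ n \<in> carrier Z_T" "Tvar ^ n \<in> carrier Z_T" for n
    unfolding Z_T_def sub_ring_simps mem_Collect_eq using eval_at_1[of Tvar] eval_at_power[of Tvar "[:0, 1:]" n]
    by (metis, intro exI[of _ "[:0, 1:] ^ n"] exI[of _ 0]) simp
  then have "Tvar ^ n \<in> Q \<Longrightarrow> 1 / Tvar ^ n * Tvar ^ n \<in> Q" "1 / Tvar ^ n \<in> Q \<Longrightarrow> Tvar ^ n * (1 / Tvar ^ n) \<in> Q" for n
    using I_l_closed[of "Tvar ^ n" "1 / Tvar ^ n"] I_l_closed[of "1 / Tvar ^ n" "Tvar ^ n"] by (auto simp: Z_T_def)
  then have "Tvar ^ n \<notin> Q" "inverse Tvar ^ n \<notin> Q" for n
    using one Tvar_nonzero by (auto simp: power_inverse divide_inverse)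
  then show "F1_contr {p. ev1 p \<in> Q} = {0}" "F1_contr {p. ev2 p \<in> Q} = {0}"
    unfolding F1_contr_def using zero by (auto elim!: F1_X_cases)
qed

lemma pt_p_map: "pt p_map (Z_class w) = case_sum (\<lambda>Q. F1_class (Inl (F1_contr Q))) (\<lambda>Q. F1_class (Inr (F1_contr Q))) w"
proof -
  have "primeideal x Z_T" if "x \<in> topspace Z_overlap" for x
    using that unfolding Spec_def spec_top_def topology_generated_by_topspace by auto
  then have "F1_class (Inl (F1_contr (pt (Z_emb Tvar) x))) = F1_class (Inr (F1_contr (pt (Z_emb (inverse Tvar)) x)))"
    if "x \<in> topspace Z_overlap" for x
    using prime_Z_T_contr[of x] that F1_points(1) unfolding F1_generic_def by (simp add: spec_map_def)
  note * = glue_desc_pt_class[where ?T = Z_overlap and ?j1.0 = "pt (Z_emb Tvar)" and ?j2.0 = "pt (Z_emb (inverse Tvar))"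
      and ?g1.0 = "\<lambda>Q. F1_class (Inl (F1_contr Q))" and ?g2.0 = "\<lambda>Q. F1_class (Inr (F1_contr Q))", OF this, of w]
  have "pt p_map = glue_desc_pt (\<lambda>Q. F1_class (Inl (F1_contr Q))) (\<lambda>Q. F1_class (Inr (F1_contr Q)))"
    unfolding p_map_def glue_desc_def comp_map_def glue_in1_def glue_in2_def spec_map_def Let_def F1_contr_def
    by (simp add: comp_def)
  then show ?thesis using * by simp
qed

text \<open>Both charts are embedded by \<open>ev1\<close>, which on the second chart replaces the value \<open>T\<close> by \<open>T\<^sup>-\<^sup>1\<close>.\<close>

lemma pull_p_map:
  fixes m :: "int poly fract"
  assumes m: "m \<in> F1_vals V"
  defines "D1 \<equiv> {Q. primeideal Q Z_X \<and> F1_contr Q \<in> chart1 V}" and "D2 \<equiv> {Q. primeideal Q Z_X \<and> F1_contr Q \<in> chart2 V}"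
  shows "pull p_map V (F1_sec V m) = (\<lambda>Q\<in>D1. fsec Z_X ev1 Q m, \<lambda>Q\<in>D2. fsec Z_X ev1 Q (T_eval (inverse Tvar) m))"
    and "Q \<in> D1 \<Longrightarrow> fsec Z_X ev1 Q m \<noteq> {}" "Q \<in> D2 \<Longrightarrow> fsec Z_X ev1 Q (T_eval (inverse Tvar) m) \<noteq> {}"
proof -
  have z1: "ev1 a = m * ev1 t \<and> t \<notin> Q" if "(a, t) \<in> fsec F1_X ev1 (F1_contr Q) m" for a t Q
    using that unfolding fsec_def F1_contr_def by auto
  have z2: "ev1 a = T_eval (inverse Tvar) m * ev1 t \<and> t \<notin> Q" if "Q \<in> D2" "(a, t) \<in> fsec F1_X ev2 (F1_contr Q) m" for a t Q
  proof -
    have "0 \<in> F1_contr Q" using that(1) prime_pideal_F1_contr unfolding D2_def prime_pideal_def by auto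
    then have "ev1 a = T_eval (inverse Tvar) m * ev1 t"
      using T_eval_fsec2[of "inverse Tvar" a t "F1_contr Q" m] that(2) Tvar_nonzero by simp
    then show ?thesis using that(2) unfolding fsec_def F1_contr_def by auto
  qed
  have n1: "fsec F1_X ev1 (F1_contr Q) m \<noteq> {}" if "Q \<in> D1" for Q using that m unfolding F1_vals_def D1_def by blast
  have n2: "fsec F1_X ev2 (F1_contr Q) m \<noteq> {}" if "Q \<in> D2" for Q using that m unfolding F1_vals_def D2_def by blast
  have l1: "loc_map Z_X id Q (fsec F1_X ev1 (F1_contr Q) m) = fsec Z_X ev1 Q m" if "Q \<in> D1" for Q
    using z1 that n1[OF that] by (intro loc_map_fsec[OF Z_X.field_embedding_axioms Z_X.pts_eprime]) (auto simp: D1_def)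
  have l2: "loc_map Z_X id Q (fsec F1_X ev2 (F1_contr Q) m) = fsec Z_X ev1 Q (T_eval (inverse Tvar) m)" if "Q \<in> D2" for Q
    using z2 that n2[OF that] by (intro loc_map_fsec[OF Z_X.field_embedding_axioms Z_X.pts_eprime]) (auto simp: D2_def)
  have in12: "pull F1_in1 V u = fst u" "pull F1_in2 V u = snd u" for u
    by (simp_all add: glue_in1_def glue_in2_def)
  have sp: "pull (spec_map F1_X Z_X (space_top (Spec Z_X)) id) W s
    = (\<lambda>Q\<in>{Q. primeideal Q Z_X \<and> F1_contr Q \<in> W}. loc_map Z_X id Q (s (F1_contr Q)))" for W s
    by (simp add: spec_map_def Let_def topspace_Spec_Z_X F1_contr_def)
  have "pull p_map V (F1_sec V m) = (\<lambda>Q\<in>D1. loc_map Z_X id Q (fst (F1_sec V m) (F1_contr Q)), \<lambda>Q\<in>D2. loc_map Z_X id Q (snd (F1_sec V m) (F1_contr Q)))"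
    unfolding p_map_def Let_def glue_desc_def D1_def D2_def
    by (simp add: comp_map_def in12 sp flip: chart1_def chart2_def)
  also have "\<dots> = (\<lambda>Q\<in>D1. loc_map Z_X id Q (fsec F1_X ev1 (F1_contr Q) m), \<lambda>Q\<in>D2. loc_map Z_X id Q (fsec F1_X ev2 (F1_contr Q) m))"
    unfolding F1_sec_def D1_def D2_def by (auto simp: fun_eq_iff restrict_def)
  finally show "pull p_map V (F1_sec V m) = (\<lambda>Q\<in>D1. fsec Z_X ev1 Q m, \<lambda>Q\<in>D2. fsec Z_X ev1 Q (T_eval (inverse Tvar) m))"
    using l1 l2 by (simp cong: restrict_cong)
  have "(a, t) \<in> fsec Z_X ev1 Q m" if "(a, t) \<in> fsec F1_X ev1 (F1_contr Q) m" for a t Q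
    using z1[OF that] unfolding fsec_def by simp
  then show "Q \<in> D1 \<Longrightarrow> fsec Z_X ev1 Q m \<noteq> {}" using n1 by fastforce
  have "(a, t) \<in> fsec Z_X ev1 Q (T_eval (inverse Tvar) m)" if "Q \<in> D2" "(a, t) \<in> fsec F1_X ev2 (F1_contr Q) m" for a t Q
    using z2[OF that] unfolding fsec_def by simp
  then show "Q \<in> D2 \<Longrightarrow> fsec Z_X ev1 Q (T_eval (inverse Tvar) m) \<noteq> {}" using n2 by fastforce
qed

text \<open>After a negative power of \<open>T\<close> is moved to the other side, the hypothesis is
  an identity of integral polynomials and can be evaluated at \<open>g\<close>.\<close>

lemma T_eval_eval_at:
  assumes "g \<noteq> 0" "m \<in> carrier F1_T" "ev1 a = m * ev1 t"
  shows "eval_at g a = T_eval g m * eval_at g t"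
proof (rule F1_T_cases[OF assms(2)])
  assume "m = 0"
  then show ?thesis using assms(3) eval_at_Tvar_inj[of a 0] by simp
next
  fix k assume k: "m = Tvar powi k"
  show ?thesis
  proof (cases k rule: int_cases2)
    case (nonneg n)
    then have "ev1 a = ev1 ([:0, 1:] ^ n * t)" using assms(3) unfolding k by simp
    then have "a = [:0, 1:] ^ n * t" unfolding eval_at_Tvar_inj .
    then show ?thesis unfolding k T_eval_powi nonneg by simp
  next
    case (nonpos n)
    then have "ev1 ([:0, 1:] ^ n * a) = ev1 t" using assms(3) Tvar_nonzero unfolding k by (simp add: power_int_minus field_simps)
    then have "[:0, 1:] ^ n * a = t" unfolding eval_at_Tvar_inj .
    then have "g ^ n * eval_at g a = eval_at g t" by auto
    then show ?thesis unfolding k T_eval_powi nonpos using assms(1) by (simp add: power_int_minus field_simps)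
  qed
qed

lemma pull_chart:
  fixes g :: "'k::field_char_0"
  assumes g: "g \<noteq> 0" and m: "m \<in> carrier F1_T" and ne: "\<And>R. R \<in> D \<Longrightarrow> fsec Z_X ev1 R m \<noteq> {}"
  shows "pull (spec_map Z_X (integers_adjoin g) (space_top (Spec (integers_adjoin g))) (eval_at g)) D (\<lambda>R\<in>D. fsec Z_X ev1 R m)
    = (\<lambda>Q\<in>{Q. primeideal Q (integers_adjoin g) \<and> {p. eval_at g p \<in> Q} \<in> D}. fsec (integers_adjoin g) id Q (T_eval g m))"
proof -
  interpret A: embedded_spectrum "integers_adjoin g" id "{P. primeideal P (integers_adjoin g)}" "{0}"
    by (rule embedded_spectrum_adjoin)
  have "loc_map (integers_adjoin g) (eval_at g) Q (fsec Z_X ev1 {p. eval_at g p \<in> Q} m) = fsec (integers_adjoin g) id Q (T_eval g m)"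
    if Q: "primeideal Q (integers_adjoin g)" "{p. eval_at g p \<in> Q} \<in> D" for Q
  proof (rule loc_map_fsec[OF A.field_embedding_axioms A.pts_eprime ne[OF Q(2)]])
    fix a t assume "(a, t) \<in> fsec Z_X ev1 {p. eval_at g p \<in> Q} m"
    then have "ev1 a = m * ev1 t" "eval_at g t \<notin> Q" unfolding fsec_def by auto
    then show "eval_at g a \<in> carrier (integers_adjoin g) \<and> eval_at g t \<in> carrier (integers_adjoin g) - Q \<and> id (eval_at g a) = T_eval g m * id (eval_at g t)"
      using T_eval_eval_at[OF g m] eval_adjoin by auto
  qed (use Q in simp)
  then show ?thesis unfolding spec_map_def Let_def topspace_Spec_adjoin by (auto simp: fun_eq_iff restrict_def)
qed

lemma pull_contraction:
  fixes g :: "'k::field_char_0"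
  assumes ne: "\<And>P. P \<in> U \<Longrightarrow> fsec ring_of_integers id P x \<noteq> {}"
  shows "pull (spec_map ring_of_integers (integers_adjoin g) (space_top (Spec (integers_adjoin g))) id) U (\<lambda>P\<in>U. fsec ring_of_integers id P x)
    = (\<lambda>Q\<in>{Q. primeideal Q (integers_adjoin g) \<and> {a. algebraic_int a \<and> a \<in> Q} \<in> U}. fsec (integers_adjoin g) id Q x)"
    and "{a. algebraic_int a \<and> a \<in> Q} \<in> U \<Longrightarrow> fsec (integers_adjoin g) id Q x \<noteq> {}"
proof -
  interpret A: embedded_spectrum "integers_adjoin g" id "{P. primeideal P (integers_adjoin g)}" "{0}"
    by (rule embedded_spectrum_adjoin)
  have *: "a \<in> adjoin g \<and> t \<in> adjoin g - Q \<and> a = x * t" if "(a, t) \<in> fsec ring_of_integers id {a. algebraic_int a \<and> a \<in> Q} x" for a t Q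
    using that integral_adjoin unfolding fsec_def by auto
  have "loc_map (integers_adjoin g) id Q (fsec ring_of_integers id {a. algebraic_int a \<and> a \<in> Q} x) = fsec (integers_adjoin g) id Q x"
    if Q: "primeideal Q (integers_adjoin g)" "{a. algebraic_int a \<and> a \<in> Q} \<in> U" for Q
    using * by (intro loc_map_fsec[OF A.field_embedding_axioms A.pts_eprime ne[OF Q(2)]]) (use Q in auto)
  then show "pull (spec_map ring_of_integers (integers_adjoin g) (space_top (Spec (integers_adjoin g))) id) U (\<lambda>P\<in>U. fsec ring_of_integers id P x)
    = (\<lambda>Q\<in>{Q. primeideal Q (integers_adjoin g) \<and> {a. algebraic_int a \<and> a \<in> Q} \<in> U}. fsec (integers_adjoin g) id Q x)"
    unfolding spec_map_def Let_def topspace_Spec_adjoin by (auto simp: fun_eq_iff restrict_def)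
  assume "{a. algebraic_int a \<and> a \<in> Q} \<in> U"
  from ne[OF this] obtain a t where "(a, t) \<in> fsec ring_of_integers id {a. algebraic_int a \<and> a \<in> Q} x" by auto
  from *[OF this] have "(a, t) \<in> fsec (integers_adjoin g) id Q x" unfolding fsec_def by auto
  then show "fsec (integers_adjoin g) id Q x \<noteq> {}" by blast
qed

lemma pull_cover_desc:
  "pull (cover_desc X X1 c1 X2 c2 g1 g2) W t =
     (let U = {x \<in> topspace (space_top X). pt (cover_desc X X1 c1 X2 c2 g1 g2) x \<in> W} in
      THE s. s \<in> carrier (sections X U) \<and> pull c1 U s = pull g1 W t \<and> pull c2 U s = pull g2 W t)"
  by (simp add: cover_desc_def Let_def)

lemma space_top_Spec: "space_top (Spec R) = spec_top R {P. primeideal P R}" by (simp add: Spec_def)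

context number_field_context
begin

text \<open>\<open>cover_desc\<close> selects preimages with \<open>inv_into\<close>; contraction is
  injective, so the selected prime is \<open>extension\<close>.\<close>

lemma contraction_image:
  assumes "g \<noteq> (0::'k)"
  defines "c \<equiv> spec_map ring_of_integers (integers_adjoin g) (space_top (Spec (integers_adjoin g))) id"
  shows "pt c Q = {a. algebraic_int a \<and> a \<in> Q}"
    and "pt c ` topspace (space_top (Spec (integers_adjoin g))) = {P. primeideal P ring_of_integers \<and> g \<in> loc_integers P}"
    and "primeideal P ring_of_integers \<Longrightarrow> g \<in> loc_integers P \<Longrightarrow>
      inv_into (topspace (space_top (Spec (integers_adjoin g)))) (pt c) P = integer_prime.extension P g"
proof -
  show pt: "pt c Q = {a. algebraic_int a \<and> a \<in> Q}" for Q unfolding c_def spec_map_def by simp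
  note ext = integer_prime.extension_prime[OF integer_primeI]
  show "pt c ` topspace (space_top (Spec (integers_adjoin g))) = {P. primeideal P ring_of_integers \<and> g \<in> loc_integers P}"
  proof (intro equalityI subsetI)
    fix P assume "P \<in> pt c ` topspace (space_top (Spec (integers_adjoin g)))"
    then show "P \<in> {P. primeideal P ring_of_integers \<and> g \<in> loc_integers P}"
      unfolding topspace_Spec_adjoin using adjoin_contraction(1,2)[OF assms(1)] by (auto simp: pt)
  next
    fix P assume "P \<in> {P. primeideal P ring_of_integers \<and> g \<in> loc_integers P}"
    then show "P \<in> pt c ` topspace (space_top (Spec (integers_adjoin g)))"
      unfolding topspace_Spec_adjoin using ext[of P g] by (intro image_eqI[of _ _ "integer_prime.extension P g"]) (auto simp: pt)
  qed
  assume P: "primeideal P ring_of_integers" "g \<in> loc_integers P"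
  have "inj_on (pt c) (topspace (space_top (Spec (integers_adjoin g))))"
    unfolding topspace_Spec_adjoin inj_on_def pt using adjoin_contraction(3)[OF assms(1)] by (metis mem_Collect_eq)
  from inv_into_f_f[OF this, of "integer_prime.extension P g"]
  show "inv_into (topspace (space_top (Spec (integers_adjoin g)))) (pt c) P = integer_prime.extension P g"
    using ext[OF P] unfolding topspace_Spec_adjoin pt by simp
qed

end

context nonexceptional
begin

lemma prime_psi_pt:
  assumes "primeideal P ring_of_integers"
  shows "f \<in> loc_integers P \<Longrightarrow> psi_pt f (prime_place P) = F1_class (Inl (F1_contr (integer_prime.chart_point P f)))"
    and "inverse f \<in> loc_integers P \<Longrightarrow> psi_pt f (prime_place P) = F1_class (Inr (F1_contr (integer_prime.chart_point P (inverse f))))"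
    and "f \<notin> loc_integers P \<longleftrightarrow> inverse f \<in> loc_ideal P"
    and "inverse f \<notin> loc_integers P \<longleftrightarrow> f \<in> loc_ideal P"
proof -
  interpret integer_prime K P by (rule integer_primeI[OF assms])
  show n1: "f \<notin> loc_integers P \<longleftrightarrow> inverse f \<in> loc_ideal P"
    using notin_place_ring_iff[OF prime_place_in f_nonzero] unfolding place_ring_prime place_ideal_prime .
  show n2: "inverse f \<notin> loc_integers P \<longleftrightarrow> f \<in> loc_ideal P"
    using notin_place_ring_iff[OF prime_place_in, of "inverse f"] f_nonzero unfolding place_ring_prime place_ideal_prime by simp
  show "psi_pt f (prime_place P) = F1_class (Inl (F1_contr (chart_point f)))" if "f \<in> loc_integers P"
    using that chart_point_F1[OF that f_nonzero] unfolding psi_pt_def place_ring_prime place_ideal_prime F1_contr_def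
    by (simp add: F1_generic_def F1_zero_def)
  show "psi_pt f (prime_place P) = F1_class (Inr (F1_contr (chart_point (inverse f))))" if "inverse f \<in> loc_integers P"
    using that chart_point_F1[OF that] f_nonzero n1 n2 unfolding psi_pt_def place_ring_prime place_ideal_prime F1_contr_def
    by (simp add: F1_points(1) F1_infinity_def)
qed

lemma pt_phi:
  assumes P: "primeideal P ring_of_integers"
  shows "pt (phi f) P = (if f \<in> loc_integers P then Z_class (Inl (integer_prime.chart_point P f))
     else Z_class (Inr (integer_prime.chart_point P (inverse f))))"
proof -
  interpret integer_prime K P by (rule integer_primeI[OF P])
  have "inverse f \<noteq> 0" using f_nonzero by simp
  note c = contraction_image[OF f_nonzero] contraction_image[OF this]
  have 1: "P \<in> pt (spec_map ring_of_integers (integers_adjoin f) (space_top (Spec (integers_adjoin f))) id) ` topspace (space_top (Spec (integers_adjoin f)))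
      \<longleftrightarrow> f \<in> loc_integers P" unfolding c(2) using P by simp
  have 2: "inverse f \<in> loc_integers P" if "f \<notin> loc_integers P" using prime_psi_pt(3)[OF P] that loc_ideal_subset by blast
  have 3: "pt (comp_map (Spec Z_X) Z_in1 (spec_map Z_X (integers_adjoin f) T (eval_at f))) Q = Z_class (Inl {p. eval_at f p \<in> Q})"
    "pt (comp_map (Spec Z_X) Z_in2 (spec_map Z_X (integers_adjoin (inverse f)) T (eval_at (inverse f)))) Q = Z_class (Inr {p. eval_at (inverse f) p \<in> Q})" for T Q
    by (simp_all add: comp_map_def glue_in1_def glue_in2_def spec_map_def)
  have "pt (phi f) P = (if f \<in> loc_integers P then Z_class (Inl {p. eval_at f p \<in> extension f})
     else Z_class (Inr {p. eval_at (inverse f) p \<in> extension (inverse f)}))"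
    unfolding phi_def Let_def cover_desc_def using 1 2 P by (simp add: 3 c(3,6) cong: if_cong)
  then show ?thesis unfolding chart_point_extension .
qed

lemma p_map_phi:
  assumes P: "primeideal P ring_of_integers"
  shows "pt p_map (pt (phi f) P) = psi_pt f (prime_place P)" "pt (phi f) P \<in> topspace (space_top P1_Z)"
proof -
  interpret integer_prime K P by (rule integer_primeI[OF P])
  have i: "inverse f \<in> loc_integers P" if "f \<notin> loc_integers P" using prime_psi_pt(3)[OF P] that loc_ideal_subset by blast
  show "pt p_map (pt (phi f) P) = psi_pt f (prime_place P)"
    unfolding pt_phi[OF P] using prime_psi_pt[OF P] i by (auto simp: pt_p_map)
  show "pt (phi f) P \<in> topspace (space_top P1_Z)"
    unfolding pt_phi[OF P] P1_Z_def glue_rspace_def using chart_point_prime i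
    by (simp add: topspace_glue_top topspace_Spec_Z_X)
qed

definition preimage :: "p1_point set \<Rightarrow> 'k set set" where
  "preimage V = {P. primeideal P ring_of_integers \<and> psi_pt f (prime_place P) \<in> V}"

lemma openin_preimage:
  assumes V: "openin (space_top P1_F1) V"
  shows "openin (space_top (Spec ring_of_integers)) (preimage V)"
proof (cases "V = {}")
  case False
  then have gen: "F1_generic \<in> V" using generic_in_open V by blast
  define X where "X g = {P. primeideal P ring_of_integers \<and> g \<in> loc_integers P}" for g :: 'k
  have op: "openin (space_top (Spec ring_of_integers)) (X g)" for g
    unfolding X_def space_top_Spec by (rule openin_loc_integers)
  \<comment> \<open>The generic point is in \<open>V\<close>, so only membership of the two closed
    points varies. The place of \<open>P\<close> goes to a closed point precisely where
    \<open>f\<close> or its inverse fails to be regular at \<open>P\<close>.\<close>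
  have "P \<in> preimage V \<longleftrightarrow> P \<in> (X f \<inter> X (inverse f)) \<union> (if F1_zero \<in> V then X f else {}) \<union> (if F1_infinity \<in> V then X (inverse f) else {})" for P
  proof (cases "primeideal P ring_of_integers")
    case True
    interpret integer_prime K P by (rule integer_primeI[OF True])
    show ?thesis using True gen prime_psi_pt(3,4)[OF True] loc_ideal_subset
      by (auto simp: preimage_def X_def psi_pt_def place_ring_prime place_ideal_prime)
  qed (auto simp: preimage_def X_def)
  then have "preimage V = (X f \<inter> X (inverse f)) \<union> (if F1_zero \<in> V then X f else {}) \<union> (if F1_infinity \<in> V then X (inverse f) else {})" by blast
  then show ?thesis using op by (auto intro!: openin_Un openin_Int)
qed (simp add: preimage_def)

lemma T_eval_fsec_nonempty:
  assumes V: "openin (space_top P1_F1) V" "m \<in> F1_vals V" and P: "P \<in> preimage V"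
  shows "fsec ring_of_integers id P (T_eval f m) \<noteq> {}"
proof -
  have prP: "primeideal P ring_of_integers" using P unfolding preimage_def by blast
  interpret integer_prime K P by (rule integer_primeI[OF prP])
  have "T_eval f m \<in> loc_integers P"
    using T_eval_place_ring[OF V prime_place_in] P unfolding preimage_def place_ring_prime by blast
  then show ?thesis unfolding loc_integers_def
    using O.fsec_nonempty_iff[OF O.pts_eprime, of P "T_eval f m"] prP by auto
qed

abbreviation "Z_open V \<equiv> pre (forget_add P1_Z) p_map V"

lemma Z_open_class:
  assumes "primeideal R Z_X"
  shows "Z_class (Inl R) \<in> Z_open V \<longleftrightarrow> F1_contr R \<in> chart1 V" "Z_class (Inr R) \<in> Z_open V \<longleftrightarrow> F1_contr R \<in> chart2 V"
  using assms unfolding pre_def forget_add_def P1_Z_def glue_rspace_def contr_chart_iff[OF assms]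
  by (simp_all add: topspace_glue_top topspace_Spec_Z_X pt_p_map)

text \<open>\<open>phi\<close> obtains its section by \<open>THE\<close> from the restrictions to
  the two rings \<open>integers_adjoin f\<close> and \<open>integers_adjoin (inverse f)\<close>. The
  section with value \<open>T_eval f m\<close> has both restrictions, and a section over a nonempty
  set is determined by its value at a single prime.\<close>

lemma pull_phi:
  assumes V: "openin (space_top P1_F1) V" and m: "m \<in> F1_vals V" "m \<in> carrier F1_T"
  shows "pull (phi f) (Z_open V) (pull p_map V (F1_sec V m)) = (\<lambda>P\<in>preimage V. fsec ring_of_integers id P (T_eval f m))"
proof -
  define D1 where "D1 = {Q. primeideal Q Z_X \<and> F1_contr Q \<in> chart1 V}"
  define D2 where "D2 = {Q. primeideal Q Z_X \<and> F1_contr Q \<in> chart2 V}"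
  note pm = pull_p_map[OF m(1), folded D1_def D2_def]
  let ?X = "\<lambda>g::'k. space_top (Spec (integers_adjoin g))"
  let ?c = "\<lambda>g. spec_map ring_of_integers (integers_adjoin g) (?X g) id"
  let ?e = "\<lambda>g. spec_map Z_X (integers_adjoin g) (?X g) (eval_at g)"
  let ?x = "T_eval f m" and ?U = "preimage V"
  have f': "inverse f \<noteq> 0" using f_nonzero by simp
  have pre12: "pre (Spec Z_X) Z_in1 (Z_open V) = D1" "pre (Spec Z_X) Z_in2 (Z_open V) = D2"
    unfolding pre_def[of "Spec Z_X"] topspace_Spec_Z_X D1_def D2_def glue_in1_def glue_in2_def
    using Z_open_class by auto
  \<comment> \<open>On the second chart the value has been rewritten with \<open>T\<close> inverted;
    evaluation at the inverse of \<open>f\<close> cancels this, so both charts yield the same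
    element of \<open>K\<close>.\<close>
  have m': "T_eval (inverse Tvar) m \<in> carrier F1_T" and x': "T_eval (inverse f) (T_eval (inverse Tvar) m) = ?x"
  proof -
    have "T_eval (inverse Tvar) m \<in> carrier F1_T \<and> T_eval (inverse f) (T_eval (inverse Tvar) m) = ?x"
    proof (rule F1_T_cases[OF m(2)])
      fix k assume k: "m = Tvar powi k"
      have 1: "T_eval (inverse Tvar) (Tvar powi k) = Tvar powi (- k)" unfolding T_eval_powi by (simp add: power_int_inverse power_int_minus)
      have 2: "T_eval (inverse f) (Tvar powi (- k)) = T_eval f (Tvar powi k)" unfolding T_eval_powi by (simp add: power_int_inverse power_int_minus)
      show ?thesis unfolding k 1 2 using F1_T_mem(3) by blast
    qed (simp add: F1_T_mem)
    then show "T_eval (inverse Tvar) m \<in> carrier F1_T" "T_eval (inverse f) (T_eval (inverse Tvar) m) = ?x" by auto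
  qed
  \<comment> \<open>Sections are extensional functions, so besides their values the domains must
    agree: pulling \<open>V\<close> back through the polynomial chart or through the integers gives
    the same primes \<open>Q\<close>.\<close>
  have dom1: "{p. eval_at f p \<in> Q} \<in> D1 \<longleftrightarrow> {a. algebraic_int a \<and> a \<in> Q} \<in> ?U" if Q: "primeideal Q (integers_adjoin f)" for Q
  proof -
    let ?P = "{a. algebraic_int a \<and> a \<in> Q}"
    note P = adjoin_contraction[OF f_nonzero Q]
    interpret integer_prime K ?P by (rule integer_primeI[OF P(1)])
    have "{p. eval_at f p \<in> Q} = chart_point f" unfolding chart_point_extension using P(3) by simp
    then show ?thesis using chart_point_prime[OF P(2)] contr_chart_iff(1) prime_psi_pt(1)[OF P(1,2)] P(1)
      unfolding D1_def preimage_def by simp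
  qed
  have dom2: "{p. eval_at (inverse f) p \<in> Q} \<in> D2 \<longleftrightarrow> {a. algebraic_int a \<and> a \<in> Q} \<in> ?U" if Q: "primeideal Q (integers_adjoin (inverse f))" for Q
  proof -
    let ?P = "{a. algebraic_int a \<and> a \<in> Q}"
    note P = adjoin_contraction[OF f' Q]
    interpret integer_prime K ?P by (rule integer_primeI[OF P(1)])
    have "{p. eval_at (inverse f) p \<in> Q} = chart_point (inverse f)" unfolding chart_point_extension using P(3) by simp
    then show ?thesis using chart_point_prime[OF P(2)] contr_chart_iff(2) prime_psi_pt(2)[OF P(1,2)] P(1)
      unfolding D2_def preimage_def by simp
  qed
  define E where "E g = {Q. primeideal Q (integers_adjoin g) \<and> {a. algebraic_int a \<and> a \<in> Q} \<in> ?U}" for g :: 'k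
  have e1: "pull (?e f) D1 (\<lambda>R\<in>D1. fsec Z_X ev1 R m) = (\<lambda>Q\<in>E f. fsec (integers_adjoin f) id Q ?x)"
  proof -
    have "{Q. primeideal Q (integers_adjoin f) \<and> {p. eval_at f p \<in> Q} \<in> D1} = E f" unfolding E_def using dom1 by blast
    then show ?thesis using pull_chart[OF f_nonzero m(2), of D1] pm(2) by simp
  qed
  have e2: "pull (?e (inverse f)) D2 (\<lambda>R\<in>D2. fsec Z_X ev1 R (T_eval (inverse Tvar) m)) = (\<lambda>Q\<in>E (inverse f). fsec (integers_adjoin (inverse f)) id Q ?x)"
  proof -
    have "{Q. primeideal Q (integers_adjoin (inverse f)) \<and> {p. eval_at (inverse f) p \<in> Q} \<in> D2} = E (inverse f)"
      unfolding E_def using dom2 by blast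
    then show ?thesis using pull_chart[OF f' m', of D2] pm(3) x' by simp
  qed
  have U: "openin (spec_top ring_of_integers {P. primeideal P ring_of_integers}) ?U"
    using openin_preimage[OF V] unfolding space_top_Spec .
  have sec: "carrier (sections (Spec ring_of_integers) ?U) = {(\<lambda>P\<in>?U. fsec ring_of_integers id P y) | y. \<forall>P\<in>?U. fsec ring_of_integers id P y \<noteq> {}}"
    unfolding Spec_def using O.frac_sections_eq[OF U] by simp
  have ne: "P \<in> ?U \<Longrightarrow> fsec ring_of_integers id P ?x \<noteq> {}" for P by (rule T_eval_fsec_nonempty[OF V m(1)])
  have "{P \<in> topspace (space_top (Spec ring_of_integers)). pt (phi f) P \<in> Z_open V} = ?U"
    unfolding topspace_Spec_integers preimage_def pre_def forget_add_def using p_map_phi by auto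
  moreover have pull_gen: "pull (phi f) W t = (let U = {x \<in> topspace (space_top (Spec ring_of_integers)). pt (phi f) x \<in> W} in
      THE s. s \<in> carrier (sections (Spec ring_of_integers) U) \<and>
        pull (?c f) U s = pull (comp_map (Spec Z_X) Z_in1 (?e f)) W t \<and>
        pull (?c (inverse f)) U s = pull (comp_map (Spec Z_X) Z_in2 (?e (inverse f))) W t)" for W t
    unfolding phi_def Let_def by (rule pull_cover_desc[unfolded Let_def])
  moreover have in12: "pull Z_in1 W u = fst u" "pull Z_in2 W u = snd u" for W u
    by (simp_all add: glue_in1_def glue_in2_def)
  ultimately have pull: "pull (phi f) (Z_open V) (pull p_map V (F1_sec V m)) =
     (THE s. s \<in> carrier (sections (Spec ring_of_integers) ?U) \<and>
        pull (?c f) ?U s = (\<lambda>Q\<in>E f. fsec (integers_adjoin f) id Q ?x) \<and>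
        pull (?c (inverse f)) ?U s = (\<lambda>Q\<in>E (inverse f). fsec (integers_adjoin (inverse f)) id Q ?x))"
    unfolding pull_gen by (simp add: Let_def comp_map_def in12 pre12 pm(1) e1 e2)
  have pull_c: "pull (?c g) ?U (\<lambda>P\<in>?U. fsec ring_of_integers id P y) = (\<lambda>Q\<in>E g. fsec (integers_adjoin g) id Q y)"
    if "\<And>P. P \<in> ?U \<Longrightarrow> fsec ring_of_integers id P y \<noteq> {}" for g y
    unfolding E_def by (rule pull_contraction(1)[OF that])
  show ?thesis unfolding pull
  proof (rule the_equality)
    show "(\<lambda>P\<in>?U. fsec ring_of_integers id P ?x) \<in> carrier (sections (Spec ring_of_integers) ?U) \<and>
        pull (?c f) ?U (\<lambda>P\<in>?U. fsec ring_of_integers id P ?x) = (\<lambda>Q\<in>E f. fsec (integers_adjoin f) id Q ?x) \<and>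
        pull (?c (inverse f)) ?U (\<lambda>P\<in>?U. fsec ring_of_integers id P ?x) = (\<lambda>Q\<in>E (inverse f). fsec (integers_adjoin (inverse f)) id Q ?x)"
      unfolding sec using pull_c[of ?x] ne by blast
  next
    fix s assume s: "s \<in> carrier (sections (Spec ring_of_integers) ?U) \<and>
        pull (?c f) ?U s = (\<lambda>Q\<in>E f. fsec (integers_adjoin f) id Q ?x) \<and>
        pull (?c (inverse f)) ?U s = (\<lambda>Q\<in>E (inverse f). fsec (integers_adjoin (inverse f)) id Q ?x)"
    then obtain y where y: "s = (\<lambda>P\<in>?U. fsec ring_of_integers id P y)" "\<And>P. P \<in> ?U \<Longrightarrow> fsec ring_of_integers id P y \<noteq> {}"
      unfolding sec by blast
    have eq: "(\<lambda>Q\<in>E g. fsec (integers_adjoin g) id Q y) = (\<lambda>Q\<in>E g. fsec (integers_adjoin g) id Q ?x)" if "g = f \<or> g = inverse f" for g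
      using s that pull_c[OF y(2), of g] unfolding y(1) by auto
    show "s = (\<lambda>P\<in>?U. fsec ring_of_integers id P ?x)"
    proof (cases "?U = {}")
      case False
      then obtain P where P: "P \<in> ?U" by blast
      then have prP: "primeideal P ring_of_integers" unfolding preimage_def by blast
      interpret integer_prime K P by (rule integer_primeI[OF prP])
      \<comment> \<open>Some chart contains a prime above \<open>P\<close>; comparing the two
        sections there determines the value.\<close>
      have "f \<in> loc_integers P \<or> inverse f \<in> loc_integers P" using prime_psi_pt(3)[OF prP] loc_ideal_subset by blast
      then obtain g where g: "g = f \<or> g = inverse f" "g \<in> loc_integers P" by blast
      interpret A: embedded_spectrum "integers_adjoin g" id "{P. primeideal P (integers_adjoin g)}" "{0}"
        by (rule embedded_spectrum_adjoin)
      have Q: "extension g \<in> E g" unfolding E_def using extension_prime[OF g(2)] P by simp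
      then have "fsec (integers_adjoin g) id (extension g) y = fsec (integers_adjoin g) id (extension g) ?x"
        using fun_cong[OF eq[OF g(1)], of "extension g"] by simp
      moreover have "fsec (integers_adjoin g) id (extension g) y \<noteq> {}"
        using pull_contraction(2)[OF y(2)] Q unfolding E_def by blast
      ultimately have "y = ?x"
        using A.fsec_inj[OF A.pts_eprime] extension_prime(1)[OF g(2)] by blast
      then show ?thesis using y(1) by simp
    qed (simp add: y(1) restrict_def)
  qed
qed

lemma restriction_map_eq:
  "map_eq (forget_add (Spec ring_of_integers)) P1_F1
      (comp_map (open_subspace compact_spec na_places)
        (comp_map compact_spec (psi f) (open_incl compact_spec na_places)) na_iso)
      (comp_map (forget_add P1_Z) p_map (phi f))"
  (is "map_eq ?S P1_F1 ?l ?r")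
  unfolding map_eq_def
proof (intro conjI ballI allI impI)
  have ptl: "pt ?l P = psi_pt f (prime_place P)" for P
    by (simp add: comp_map_def na_iso_def open_incl_def psi_def)
  fix P assume "P \<in> topspace (space_top ?S)"
  then have "primeideal P ring_of_integers" by (simp add: forget_add_def topspace_Spec_integers)
  then show "pt ?l P = pt ?r P" unfolding ptl using p_map_phi by (simp add: comp_map_def)
next
  fix V t assume V: "openin (space_top P1_F1) V" and t: "t \<in> carrier (sections P1_F1 V)"
  obtain m0 where m0: "m0 \<in> F1_vals V" "t = F1_sec V m0" using t P1_F1.carrier_sections[OF V] by auto
  obtain m where m: "m \<in> F1_vals V" "m \<in> carrier F1_T" "t = F1_sec V m"
  proof (cases "V = {}")
    case True
    have "chart1 {} = {}" "chart2 {} = {}" using chart_iff by blast+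
    then have "0 \<in> F1_vals V" "t = F1_sec V 0" using m0(2) unfolding True F1_vals_def F1_sec_def by (auto simp: restrict_def)
    then show ?thesis using that F1_T_mem(1) by blast
  next
    case False
    then have "m0 \<in> carrier F1_T" using m0(1) F1_vals_generic[OF generic_in_open[OF V]] by blast
    then show ?thesis using that m0 by blast
  qed
  have "pull ?r V t = (\<lambda>P\<in>preimage V. fsec ring_of_integers id P (T_eval f m))"
    unfolding m(3) using pull_phi[OF V m(1,2)] by (simp add: comp_map_def)
  moreover have "pull ?l V t = (\<lambda>P\<in>preimage V. fsec ring_of_integers id P (T_eval f m))"
  proof -
    let ?W = "pre compact_spec (psi f) V"
    \<comment> \<open>The zeros are the conventions for sections over empty sets. They take effect
      only when no prime lies in \<open>preimage V\<close>, and then both sides are functions on the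
      empty set.\<close>
    let ?y = "if ?W \<inter> na_places = {} then 0 else if V = {} then 0 else T_eval f m"
    let ?U = "pre (open_subspace compact_spec na_places) (comp_map compact_spec (psi f) (open_incl compact_spec na_places)) V"
    have "pull ?l V t = pull na_iso ?U ?y"
      unfolding m(3) comp_map_def open_incl_def by (simp add: psi_pull[OF V m(1)] compact_spec_def)
    moreover have dom: "{P. primeideal P ring_of_integers \<and> prime_place P \<in> ?U} = preimage V"
    proof -
      have "prime_place P \<in> ?U \<longleftrightarrow> psi_pt f (prime_place P) \<in> V" if "primeideal P ring_of_integers" for P
        using integer_prime.prime_place_na[OF integer_primeI[OF that]] integer_prime.prime_place_in[OF integer_primeI[OF that]]
        unfolding pre_def open_subspace_def by (simp add: topspace_compact_spec comp_map_def open_incl_def psi_def)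
      then show ?thesis unfolding preimage_def by blast
    qed
    moreover have y: "?y = T_eval f m" if "P \<in> preimage V" for P
    proof -
      have "prime_place P \<in> ?W \<inter> na_places" "V \<noteq> {}"
        using that integer_prime.prime_place_na[OF integer_primeI, of P] integer_prime.prime_place_in[OF integer_primeI, of P]
        unfolding preimage_def pre_def topspace_compact_spec by (auto simp: psi_def)
      then show ?thesis by auto
    qed
    have "pull na_iso ?U x = (\<lambda>P\<in>preimage V. {(a, b). algebraic_int a \<and> algebraic_int b \<and> b \<notin> P \<and> a = x * b})" for x
      unfolding na_iso_def by (simp only: space_map.simps dom)
    ultimately have "pull ?l V t = (\<lambda>P\<in>preimage V. {(a, b). algebraic_int a \<and> algebraic_int b \<and> b \<notin> P \<and> a = ?y * b})"
      by (simp only:)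
    also have "\<dots> = (\<lambda>P\<in>preimage V. {(a, b). algebraic_int a \<and> algebraic_int b \<and> b \<notin> P \<and> a = T_eval f m * b})"
    proof (cases "preimage V = {}")
      case False
      then have "?y = T_eval f m" using y by blast
      then show ?thesis by (simp only:)
    qed (simp add: restrict_def)
    finally have "pull ?l V t = (\<lambda>P\<in>preimage V. {(a, b). algebraic_int a \<and> algebraic_int b \<and> b \<notin> P \<and> a = T_eval f m * b})" .
    then show ?thesis unfolding fsec_def by simp
  qed
  ultimately show "pull ?l V t = pull ?r V t" by simp
qed

end

theorem theorem5p2:
  fixes f :: "'k::field_char_0"
  assumes "number_field TYPE('k)"
    and "f \<noteq> 0"
    and "\<And>v. absolute_value v \<Longrightarrow> \<not> nonarchimedean v \<Longrightarrow> v f \<noteq> 1"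
  shows "\<exists>\<psi> f_check f_kappa.
    monoidal_morphism (compact_spec :: ('k place, 'k) mspace) P1_F1 \<psi> \<and>
    map_eq (forget_add (Spec ring_of_integers)) P1_F1
      (comp_map (open_subspace compact_spec na_places)
        (comp_map compact_spec \<psi> (open_incl compact_spec na_places)) na_iso)
      (comp_map (forget_add P1_Z) p_map (phi f)) \<and>
    continuous_map (space_top (compact_spec :: ('k place, 'k) mspace)) SCong_P1 f_check \<and>
    (\<forall>\<aa>\<in>places. sc_pi (f_check \<aa>) = pt \<psi> \<aa>) \<and>
    (\<forall>P. primeideal P ring_of_integers \<longrightarrow> f_check (prime_place P) = f_tilde f P) \<and>
    (\<forall>\<aa>\<in>places. f_kappa \<aa> \<in> pm_hom (sc_kappa (f_check \<aa>)) (place_kappa \<aa>) \<and>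
      inj_on (f_kappa \<aa>) (carrier (sc_kappa (f_check \<aa>)))) \<and>
    (\<forall>P. primeideal P ring_of_integers \<longrightarrow>
      (\<forall>z\<in>carrier (sc_kappa (f_check (prime_place P))).
        f_kappa (prime_place P) z = f_tilde_map f P z))"
proof -
  interpret nonexceptional "TYPE('k)" f
    using assms by unfold_locales auto
  have "pt (psi f) = psi_pt f" by (simp add: psi_def)
  then show ?thesis
    using psi_morphism restriction_map_eq f_check_continuous sc_pi_f_check f_check_prime f_kappa_hom f_kappa_inj f_kappa_prime
    by (intro exI[of _ "psi f"] exI[of _ f_check] exI[of _ f_kappa] conjI ballI allI impI) auto
qed

end
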